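(* Let $\Omega\subset\mathbb{R}^n$ be a bounded open set, and let $X=(X_1,\dots,X_m)$ satisfy (LIC) on $\Omega$ and conditions (H1), (H2), (H3). Let $0<c_0\le c_1$, let $\mathcal L_h\in\mathcal E(\Omega,c_0,c_1)$ ($h\in\mathbb{N}$), and let $a^h(x)=[a^h_{ij}(x)]$ be the matrix associated with $\mathcal L_h$, i.e. $\mathcal L_h=\mathrm{div}_X(a^h(x)X)$. Then there exist a symmetric $m\times m$ matrix $a=[a_{ij}(x)]$ with $a_{ij}\in L^\infty(\Omega)$ satisfying $$c_0|\eta|^2\le\langle a(x)\eta,\eta\rangle\le c_1|\eta|^2\quad\text{for a.e. }x\in\Omega\text{ and any }\eta\in\mathbb{R}^m,$$ and an operator $\mathcal L_\infty:=\mathrm{div}_X(a(x)X)\in\mathcal E(\Omega,c_0,c_1)$ such that, for any $g\in L^2(\Omega)$ and $\mu\ge0$, if $u_h$ ($h\in\mathbb{N}$) and $u_\infty$ denote, respectively, the unique solutions to $$\begin{cases}\mu u+\mathcal L_h(u)=g&\text{in }\Omega\\ u\in H^1_{X,0}(\Omega)\end{cases}\qquad\text{and}\qquad\begin{cases}\mu u+\mathcal L_\infty(u)=g&\text{in }\Omega\\ u\in H^1_{X,0}(\Omega)\end{cases}$$ then, up to subsequences, the following convergences hold: $$u_h\to u_\infty\ \text{ strongly in }L^2(\Omega)\qquad\text{and}\qquad a^hXu_h\to aXu_\infty\ \text{ weakly in }L^2(\Omega)^m .$$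
   Context: Vector fields. $X=(X_1,\dots,X_m)$ is a family of first-order operators $X_j(x)=\sum_{i=1}^n c_{ji}(x)\partial_i$, with $X_j$ identified with the vector field $(c_{j1},\dots,c_{jn})$. It is defined and Lipschitz continuous on an open neighborhood $\Omega_0$ of $\overline\Omega$ (coefficients being extended to locally Lipschitz functions on $\mathbb{R}^n$). (LIC) on $\Omega$: there is a set $\mathcal N_X\subset\Omega$, closed in the topology of $\Omega$, with Lebesgue measure $|\mathcal N_X|=0$, such that $X_1(x),\dots,X_m(x)$ are linearly independent vectors of $\mathbb{R}^n$ for every $x\in\Omega\setminus\mathcal N_X$. Carnot–Carathéodory distance: an absolutely continuous curve $\gamma:[0,T]\to\mathbb{R}^n$ is subunit if for a.e. $t$, $\langle\dot\gamma(t),\xi\rangle^2\le\sum_{j=1}^m\langle X_j(\gamma(t)),\xi\rangle^2$ for all $\xi\in\mathbb{R}^n$; $d(x,y)\in[0,\infty]$ is the infimum of the $T\ge 0$ such that some subunit $\gamma:[0,T]\to\mathbb{R}^n$ joins $x$ to $y$ ($\inf\emptyset=\infty$). $B_d(x,r):=\{y\in\Omega_0: d(x,y)<r\}$. (H1) $d(x,y)<\infty$ for all $x,y\in\Omega_0$, so $d$ is a distance on $\Omega_0$, and $d$ is continuous with respect to the usual topology of $\mathbb{R}^n$. (H2) For every compact $K\subset\Omega_0$ there are $r_K>0$, $C_K>0$ with $|B_d(x,2r)|\le C_K|B_d(x,r)|$ for all $x\in K$, $r<r_K$. (H3) There are geometric constants $c,C>0$ such that for every ball $B=B_d(\bar x,r)$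 with $cB:=B_d(\bar x,cr)\subseteq\Omega_0$, every $u\in\mathrm{Lip}(c\overline B)$ and every $x\in\overline B$, $$\Big|u(x)-\frac1{|B|}\int_B u(y)\,dy\Big|\le C\int_{cB}|Xu(y)|\frac{d(x,y)}{|B_d(x,d(x,y))|}\,dy .$$ Sobolev spaces. For $u\in L^1(\Omega)$, $X_ju$ is the distribution $\psi\mapsto-\int_\Omega u\sum_{i=1}^n\partial_i(c_{ji}\psi)\,dx$, $\psi\in C_c^\infty(\Omega)$, and $Xu=(X_1u,\dots,X_mu)$. $W^{1,2}_X(\Omega)=\{u\in L^2(\Omega): X_ju\in L^2(\Omega),\ j=1,\dots,m\}$ with norm $(\int_\Omega|u|^2+\int_\Omega|Xu|^2)^{1/2}$; $H^1_{X,0}(\Omega)=W^{1,2}_{X,0}(\Omega)$ is the closure of $C^1_c(\Omega)\cap W^{1,2}_X(\Omega)$ in $W^{1,2}_X(\Omega)$, and $H^{-1}_X(\Omega)$ is its dual. Operators. $\mathcal E(\Omega)=\mathcal E(\Omega,c_0,c_1)$ is the class of operators $$\mathcal L=\mathrm{div}_X(a(x)X):=\sum_{i,j=1}^mX_j^T\big(a_{ij}(x)X_i\big),\qquad X_j^T\varphi=-\sum_{i=1}^n\partial_i(c_{ji}\varphi)=-(\mathrm{div}(X_j)+X_j)\varphi,$$ where $a=[a_{ij}]$ is a symmetric $m\times m$ matrix with $a_{ij}\in L^\infty(\Omega)$ and $c_0|\eta|^2\le\langle a(x)\eta,\eta\rangle\le c_1|\eta|^2$ for a.e. $x\in\Omega$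 and all $\eta\in\mathbb{R}^m$; the domain of $\mathcal L$ is the set of $u\in W^{1,2}_X(\Omega)$ such that the distribution on the right-hand side belongs to $L^2(\Omega)$. For $\mu\ge0$, $\mu\,\mathrm{Id}+\mathcal L$ is an isomorphism from $H^1_{X,0}(\Omega)$ onto $H^{-1}_X(\Omega)$; the solution $u\in H^1_{X,0}(\Omega)$ of $\mu u+\mathcal L(u)=g$ is characterized by $\int_\Omega(\mu uv+\langle aXu,Xv\rangle)\,dx=\int_\Omega gv\,dx$ for all $v\in H^1_{X,0}(\Omega)$. *)

theory Defs
  imports "HOL-Analysis.Analysis"
begin

text \<open>
  A family of vector fields is a map \<open>X :: 'm \<Rightarrow> real^'n \<Rightarrow> real^'n\<close> with \<open>m = CARD('m)\<close>,
  \<open>n = CARD('n)\<close>; the coefficient \<open>c\<^sub>j\<^sub>i(x)\<close> is \<open>X j x $ i\<close>.  Functions on \<open>\<Omega>\<close> are represented by total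
  functions on \<open>real^'n\<close> whose values outside \<open>\<Omega>\<close> are irrelevant; equality in \<open>L\<^sup>2(\<Omega>)\<close> is
  equality almost everywhere in \<open>\<Omega>\<close>.
\<close>

subsection \<open>Vector fields and the Carnot-Caratheodory distance\<close>

definition lipschitz_fields :: "('m::finite \<Rightarrow> real^'n \<Rightarrow> real^'n) \<Rightarrow> (real^'n) set \<Rightarrow> bool" where
  "lipschitz_fields X \<Omega>0 \<longleftrightarrow>
     (\<forall>j. \<exists>L. L-lipschitz_on \<Omega>0 (X j)) \<and>
     (\<forall>j x. \<exists>\<epsilon>>0. \<exists>L. L-lipschitz_on (ball x \<epsilon>) (X j))"

definition LIC :: "('m::finite \<Rightarrow> real^'n \<Rightarrow> real^'n) \<Rightarrow> (real^'n) set \<Rightarrow> bool" where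
  "LIC X \<Omega> \<longleftrightarrow> (\<exists>N. N \<subseteq> \<Omega> \<and> closedin (top_of_set \<Omega>) N \<and> N \<in> null_sets lebesgue \<and>
     (\<forall>x\<in>\<Omega> - N. inj (\<lambda>j. X j x) \<and> independent (range (\<lambda>j. X j x))))"

definition abs_continuous_curve :: "real \<Rightarrow> (real \<Rightarrow> 'a::real_normed_vector) \<Rightarrow> bool" where
  "abs_continuous_curve T \<gamma> \<longleftrightarrow>
     (\<forall>\<epsilon>>0. \<exists>\<delta>>0. \<forall>P :: (real \<times> real) set.
        finite P \<and> (\<forall>(s,t)\<in>P. 0 \<le> s \<and> s < t \<and> t \<le> T) \<and>
        disjoint_family_on (\<lambda>(s,t). {s<..<t}) P \<and> (\<Sum>(s,t)\<in>P. t - s) < \<delta>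
        \<longrightarrow> (\<Sum>(s,t)\<in>P. norm (\<gamma> t - \<gamma> s)) < \<epsilon>)"

definition subunit :: "('m::finite \<Rightarrow> real^'n \<Rightarrow> real^'n) \<Rightarrow> real \<Rightarrow> (real \<Rightarrow> real^'n) \<Rightarrow> bool" where
  "subunit X T \<gamma> \<longleftrightarrow> abs_continuous_curve T \<gamma> \<and>
     (AE t in lebesgue_on {0..T}. \<exists>v. (\<gamma> has_vector_derivative v) (at t within {0..T}) \<and>
        (\<forall>\<xi>. (v \<bullet> \<xi>)\<^sup>2 \<le> (\<Sum>j\<in>UNIV. (X j (\<gamma> t) \<bullet> \<xi>)\<^sup>2)))"

definition cc_dist :: "('m::finite \<Rightarrow> real^'n \<Rightarrow> real^'n) \<Rightarrow> real^'n \<Rightarrow> real^'n \<Rightarrow> ennreal" where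
  "cc_dist X x y = Inf {ennreal T | T. 0 \<le> T \<and> (\<exists>\<gamma>. subunit X T \<gamma> \<and> \<gamma> 0 = x \<and> \<gamma> T = y)}"

text \<open>\<open>B\<^sub>d(x,r)\<close> is \<open>cc_ball X \<Omega>0 x r\<close>; the ambient set is a parameter.\<close>

definition cc_ball ::
  "('m::finite \<Rightarrow> real^'n \<Rightarrow> real^'n) \<Rightarrow> (real^'n) set \<Rightarrow> real^'n \<Rightarrow> ennreal \<Rightarrow> (real^'n) set" where
  "cc_ball X S x r = {y\<in>S. cc_dist X x y < r}"

definition cc_cball ::
  "('m::finite \<Rightarrow> real^'n \<Rightarrow> real^'n) \<Rightarrow> (real^'n) set \<Rightarrow> real^'n \<Rightarrow> ennreal \<Rightarrow> (real^'n) set" where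
  "cc_cball X S x r = {y\<in>S. cc_dist X x y \<le> r}"

subsection \<open>Test functions and derivatives along the vector fields\<close>

definition partial :: "'n::finite \<Rightarrow> (real^'n \<Rightarrow> real) \<Rightarrow> real^'n \<Rightarrow> real" where
  "partial i f x = deriv (\<lambda>t. f (x + t *\<^sub>R axis i 1)) 0"

text \<open>\<open>C\<^sup>\<infinity>\<close> means that every iterated partial derivative is Frechet differentiable everywhere,
  so that all of them are continuous.\<close>

definition smooth :: "(real^'n \<Rightarrow> real) \<Rightarrow> bool" where
  "smooth f \<longleftrightarrow> (\<forall>is x. foldr partial is f differentiable (at x))"

definition supported_in :: "(real^'n) set \<Rightarrow> (real^'n \<Rightarrow> real) \<Rightarrow> bool" where
  "supported_in S f \<longleftrightarrow> (\<exists>K. compact K \<and> K \<subseteq> S \<and> (\<forall>x. x \<notin> K \<longrightarrow> f x = 0))"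

definition test_functions :: "(real^'n) set \<Rightarrow> (real^'n \<Rightarrow> real) set" where
  "test_functions S = {\<psi>. smooth \<psi> \<and> supported_in S \<psi>}"

definition C1c :: "(real^'n) set \<Rightarrow> (real^'n \<Rightarrow> real) set" where
  "C1c S = {f. (\<forall>x. f differentiable (at x)) \<and>
     (\<forall>i. continuous_on UNIV (partial i f)) \<and> supported_in S f}"

text \<open>The distribution \<open>X\<^sub>j u\<close> on the open set \<open>S\<close> is represented by the locally integrable function \<open>v\<close>.
  As \<open>X j\<close> is only Lipschitz, \<open>\<partial>\<^sub>i(c\<^sub>j\<^sub>i \<psi>)\<close> exists almost everywhere; \<^const>\<open>partial\<close> is unspecified
  on the remaining null set.\<close>

definition is_X_deriv ::
  "('m::finite \<Rightarrow> real^'n \<Rightarrow> real^'n) \<Rightarrow> (real^'n) set \<Rightarrow> 'm \<Rightarrow>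
   (real^'n \<Rightarrow> real) \<Rightarrow> (real^'n \<Rightarrow> real) \<Rightarrow> bool" where
  "is_X_deriv X S j u v \<longleftrightarrow>
     (\<forall>K. compact K \<and> K \<subseteq> S \<longrightarrow> integrable (lebesgue_on K) v) \<and>
     (\<forall>\<psi>\<in>test_functions S.
        (\<integral>x. v x * \<psi> x \<partial>lebesgue_on S) =
        - (\<integral>x. u x * (\<Sum>i\<in>UNIV. partial i (\<lambda>y. X j y $ i * \<psi> y) x) \<partial>lebesgue_on S))"

text \<open>The representing function is unique up to null sets; \<open>Xgrad\<close> picks one for each component.\<close>

definition Xgrad ::
  "('m::finite \<Rightarrow> real^'n \<Rightarrow> real^'n) \<Rightarrow> (real^'n) set \<Rightarrow> (real^'n \<Rightarrow> real) \<Rightarrow> real^'n \<Rightarrow> real^'m" where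
  "Xgrad X S u x = (\<chi> j. (SOME v. is_X_deriv X S j u v) x)"

subsection \<open>Conditions (H1), (H2), (H3)\<close>

definition cond_H1 :: "('m::finite \<Rightarrow> real^'n \<Rightarrow> real^'n) \<Rightarrow> (real^'n) set \<Rightarrow> bool" where
  "cond_H1 X \<Omega>0 \<longleftrightarrow> (\<forall>x\<in>\<Omega>0. \<forall>y\<in>\<Omega>0. cc_dist X x y < \<infinity>) \<and>
     continuous_on (\<Omega>0 \<times> \<Omega>0) (\<lambda>p. cc_dist X (fst p) (snd p))"

definition cond_H2 :: "('m::finite \<Rightarrow> real^'n \<Rightarrow> real^'n) \<Rightarrow> (real^'n) set \<Rightarrow> bool" where
  "cond_H2 X \<Omega>0 \<longleftrightarrow> (\<forall>K. compact K \<and> K \<subseteq> \<Omega>0 \<longrightarrow>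
     (\<exists>rK>0. \<exists>CK>0. \<forall>x\<in>K. \<forall>r. 0 < r \<and> r < rK \<longrightarrow>
        emeasure lebesgue (cc_ball X \<Omega>0 x (ennreal (2 * r)))
          \<le> ennreal CK * emeasure lebesgue (cc_ball X \<Omega>0 x (ennreal r))))"

text \<open>The proviso \<open>cB \<subseteq> \<Omega>0\<close> refers to the full metric ball of \<open>real^'n\<close> (ambient set \<^const>\<open>UNIV\<close>): for balls
  intersected with \<open>\<Omega>0\<close> it would be vacuous.  Under it, \<open>cB\<close> is the same set for both ambient sets.
  The right-hand side is an integral with values in \<open>[0,\<infinity>]\<close>.  Here \<open>v\<close> ranges over the
  representatives of \<open>Xu\<close> on \<open>cB\<close>.\<close>

definition cond_H3 :: "('m::finite \<Rightarrow> real^'n \<Rightarrow> real^'n) \<Rightarrow> (real^'n) set \<Rightarrow> bool" where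
  "cond_H3 X \<Omega>0 \<longleftrightarrow> (\<exists>c>0. \<exists>C>0. \<forall>xb\<in>\<Omega>0. \<forall>r>0.
     cc_ball X UNIV xb (ennreal (c * r)) \<subseteq> \<Omega>0 \<longrightarrow>
     (let B = cc_ball X \<Omega>0 xb (ennreal r); cB = cc_ball X \<Omega>0 xb (ennreal (c * r)) in
      \<forall>(u :: real^'n \<Rightarrow> real) (v :: real^'n \<Rightarrow> real^'m).
        (\<exists>L. L-lipschitz_on (cc_cball X \<Omega>0 xb (ennreal (c * r))) u) \<and>
        (\<forall>j. is_X_deriv X cB j u (\<lambda>y. v y $ j)) \<longrightarrow>
        (\<forall>x\<in>cc_cball X \<Omega>0 xb (ennreal r).
           ennreal \<bar>u x - (\<integral>y. u y \<partial>lebesgue_on B) / measure lebesgue B\<bar>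
           \<le> ennreal C * (\<integral>\<^sup>+y. ennreal (norm (v y)) *
               (cc_dist X x y / emeasure lebesgue (cc_ball X \<Omega>0 x (cc_dist X x y)))
               \<partial>lebesgue_on cB))))"

subsection \<open>Function spaces\<close>

definition L2 :: "(real^'n) set \<Rightarrow> (real^'n \<Rightarrow> 'b::euclidean_space) set" where
  "L2 \<Omega> = {f. f \<in> borel_measurable (lebesgue_on \<Omega>) \<and>
     integrable (lebesgue_on \<Omega>) (\<lambda>x. (norm (f x))\<^sup>2)}"

definition L2_tendsto ::
  "(real^'n) set \<Rightarrow> (nat \<Rightarrow> real^'n \<Rightarrow> 'b::euclidean_space) \<Rightarrow> (real^'n \<Rightarrow> 'b) \<Rightarrow> bool" where
  "L2_tendsto \<Omega> f F \<longleftrightarrow> (\<forall>k. f k \<in> L2 \<Omega>) \<and> F \<in> L2 \<Omega> \<and>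
     (\<lambda>k. sqrt (\<integral>x. (norm (f k x - F x))\<^sup>2 \<partial>lebesgue_on \<Omega>)) \<longlonglongrightarrow> 0"

definition L2_weakly_tendsto ::
  "(real^'n) set \<Rightarrow> (nat \<Rightarrow> real^'n \<Rightarrow> 'b::euclidean_space) \<Rightarrow> (real^'n \<Rightarrow> 'b) \<Rightarrow> bool" where
  "L2_weakly_tendsto \<Omega> f F \<longleftrightarrow> (\<forall>k. f k \<in> L2 \<Omega>) \<and> F \<in> L2 \<Omega> \<and>
     (\<forall>\<Phi>\<in>L2 \<Omega>. (\<lambda>k. \<integral>x. f k x \<bullet> \<Phi> x \<partial>lebesgue_on \<Omega>) \<longlonglongrightarrow> (\<integral>x. F x \<bullet> \<Phi> x \<partial>lebesgue_on \<Omega>))"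

definition W12 ::
  "('m::finite \<Rightarrow> real^'n \<Rightarrow> real^'n) \<Rightarrow> (real^'n) set \<Rightarrow> (real^'n \<Rightarrow> real) set" where
  "W12 X \<Omega> = {u\<in>L2 \<Omega>. \<forall>j. \<exists>v\<in>L2 \<Omega>. is_X_deriv X \<Omega> j u v}"

definition W12_norm ::
  "('m::finite \<Rightarrow> real^'n \<Rightarrow> real^'n) \<Rightarrow> (real^'n) set \<Rightarrow> (real^'n \<Rightarrow> real) \<Rightarrow> real" where
  "W12_norm X \<Omega> u = sqrt ((\<integral>x. \<bar>u x\<bar>\<^sup>2 \<partial>lebesgue_on \<Omega>) + (\<integral>x. (norm (Xgrad X \<Omega> u x))\<^sup>2 \<partial>lebesgue_on \<Omega>))"

definition H10 ::
  "('m::finite \<Rightarrow> real^'n \<Rightarrow> real^'n) \<Rightarrow> (real^'n) set \<Rightarrow> (real^'n \<Rightarrow> real) set" where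
  "H10 X \<Omega> = {u\<in>W12 X \<Omega>. \<forall>\<epsilon>>0. \<exists>\<phi>\<in>C1c \<Omega> \<inter> W12 X \<Omega>. W12_norm X \<Omega> (\<lambda>x. u x - \<phi> x) < \<epsilon>}"

subsection \<open>Operators\<close>

definition elliptic_matrix ::
  "(real^'n) set \<Rightarrow> real \<Rightarrow> real \<Rightarrow> (real^'n \<Rightarrow> real^'m^'m) \<Rightarrow> bool" where
  "elliptic_matrix \<Omega> c0 c1 a \<longleftrightarrow>
     (\<forall>i j. (\<lambda>x. a x $ i $ j) \<in> borel_measurable (lebesgue_on \<Omega>) \<and>
        (\<exists>M. AE x in lebesgue_on \<Omega>. \<bar>a x $ i $ j\<bar> \<le> M)) \<and>
     (AE x in lebesgue_on \<Omega>. transpose (a x) = a x) \<and>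
     (AE x in lebesgue_on \<Omega>. \<forall>\<eta>.
        c0 * (norm \<eta>)\<^sup>2 \<le> (a x *v \<eta>) \<bullet> \<eta> \<and> (a x *v \<eta>) \<bullet> \<eta> \<le> c1 * (norm \<eta>)\<^sup>2)"

text \<open>\<open>X\<^sub>j\<^sup>T \<phi>\<close> for \<open>\<phi> \<in> L\<^sup>2(\<Omega>)\<close> as a functional: on a test function \<open>v\<close> the
  distribution \<open>- \<Sum>\<^sub>i \<partial>\<^sub>i(c\<^sub>j\<^sub>i \<phi>)\<close> has the value \<open>\<integral> \<phi> \<Sum>\<^sub>i c\<^sub>j\<^sub>i \<partial>\<^sub>i v = \<integral> \<phi> X\<^sub>j v\<close>, and the last expression is its
  continuous extension to \<open>v \<in> H\<^sup>1\<^sub>X\<^sub>,\<^sub>0(\<Omega>)\<close>, i.e. the element of \<open>H\<^sup>-\<^sup>1\<^sub>X(\<Omega>)\<close>.\<close>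

definition X_transpose ::
  "('m::finite \<Rightarrow> real^'n \<Rightarrow> real^'n) \<Rightarrow> (real^'n) set \<Rightarrow> 'm \<Rightarrow>
   (real^'n \<Rightarrow> real) \<Rightarrow> (real^'n \<Rightarrow> real) \<Rightarrow> real" where
  "X_transpose X \<Omega> j \<phi> v = (\<integral>x. \<phi> x * Xgrad X \<Omega> v x $ j \<partial>lebesgue_on \<Omega>)"

definition div_X ::
  "('m::finite \<Rightarrow> real^'n \<Rightarrow> real^'n) \<Rightarrow> (real^'n) set \<Rightarrow> (real^'n \<Rightarrow> real^'m^'m) \<Rightarrow>
   (real^'n \<Rightarrow> real) \<Rightarrow> (real^'n \<Rightarrow> real) \<Rightarrow> real" where
  "div_X X \<Omega> a u v =
     (\<Sum>i\<in>UNIV. \<Sum>j\<in>UNIV. X_transpose X \<Omega> j (\<lambda>x. a x $ i $ j * Xgrad X \<Omega> u x $ i) v)"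

definition operator_class ::
  "('m::finite \<Rightarrow> real^'n \<Rightarrow> real^'n) \<Rightarrow> (real^'n) set \<Rightarrow> real \<Rightarrow> real \<Rightarrow>
   ((real^'n \<Rightarrow> real) \<Rightarrow> (real^'n \<Rightarrow> real) \<Rightarrow> real) set" where
  "operator_class X \<Omega> c0 c1 = {div_X X \<Omega> a | a. elliptic_matrix \<Omega> c0 c1 a}"

definition operator_domain ::
  "('m::finite \<Rightarrow> real^'n \<Rightarrow> real^'n) \<Rightarrow> (real^'n) set \<Rightarrow>
   ((real^'n \<Rightarrow> real) \<Rightarrow> (real^'n \<Rightarrow> real) \<Rightarrow> real) \<Rightarrow> (real^'n \<Rightarrow> real) set" where
  "operator_domain X \<Omega> L = {u\<in>W12 X \<Omega>. \<exists>f\<in>L2 \<Omega>. \<forall>\<psi>\<in>test_functions \<Omega>.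
     L u \<psi> = (\<integral>x. f x * \<psi> x \<partial>lebesgue_on \<Omega>)}"

text \<open>\<open>u \<in> H\<^sup>1\<^sub>X\<^sub>,\<^sub>0(\<Omega>)\<close> solves \<open>\<mu> u + L u = g\<close> as an identity in \<open>H\<^sup>-\<^sup>1\<^sub>X(\<Omega>)\<close>.  For \<open>g \<in> L\<^sup>2(\<Omega>)\<close> membership in the
  domain of \<open>L\<close> then follows, since \<open>L u = g - \<mu> u\<close>.\<close>

definition solves ::
  "('m::finite \<Rightarrow> real^'n \<Rightarrow> real^'n) \<Rightarrow> (real^'n) set \<Rightarrow> real \<Rightarrow>
   ((real^'n \<Rightarrow> real) \<Rightarrow> (real^'n \<Rightarrow> real) \<Rightarrow> real) \<Rightarrow>
   (real^'n \<Rightarrow> real) \<Rightarrow> (real^'n \<Rightarrow> real) \<Rightarrow> bool" where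
  "solves X \<Omega> \<mu> L g u \<longleftrightarrow> u \<in> H10 X \<Omega> \<and> u \<in> operator_domain X \<Omega> L \<and>
     (\<forall>v\<in>H10 X \<Omega>. \<mu> * (\<integral>x. u x * v x \<partial>lebesgue_on \<Omega>) + L u v = (\<integral>x. g x * v x \<partial>lebesgue_on \<Omega>))"

end

theory Submission
  imports Defs "HOL-Analysis.Analysis" "HOL-Library.Diagonal_Subsequence"
begin

text \<open>
  Pairs \<open>(u, Xu)\<close> are treated as elements of the Hilbert space \<open>H = L\<^sup>2(\<real>\<^sup>n; \<real> \<times> \<real>\<^sup>m)\<close>, and \<open>H\<^sup>1\<^sub>X\<^sub>,\<^sub>0\<close> as the closed subspace \<open>V\<close>
  generated by the pairs of \<open>C\<^sup>1\<^sub>c\<close> functions.  By (H2) and Schur's test the integral operator in (H3) is bounded on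
  \<open>L\<^sup>2\<close> with a norm proportional to the radius of the ball.  Hence \<open>u\<close> is close in \<open>L\<^sup>2\<close>, uniformly for bounded \<open>Xu\<close>, to its averages over small balls, which
  gives the compactness of \<open>V \<rightarrow> L\<^sup>2\<close>, and by contradiction a Poincare inequality and coercivity on \<open>V\<close>.

  The limit matrix is found by Tartar's method.  Along a subsequence there are correctors, solutions for the operators \<open>\<L>\<^sub>h\<close> that converge
  weakly to prescribed functions \<open>w\<close> and whose fluxes \<open>a\<^sup>hXz\<^sub>h\<close> converge weakly to some \<open>\<tau>\<close>.  The functions \<open>w\<close> are products of cut-offs with \<open>1\<close>
  or a coordinate; where (LIC) holds, the vectors \<open>Xw\<close> span \<open>\<real>\<^sup>m\<close>, so the condition that \<open>a\<close> maps \<open>Xw\<close> to \<open>\<tau>\<close> determines \<open>a\<close>.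
  If \<open>(z, D)\<close> is any pair of weak limits of solutions and fluxes, compensated compactness gives
  \<open>c\<^sub>0|Z|\<^sup>2 \<le> D \<bullet> Z\<close> and \<open>|D|\<^sup>2 \<le> c\<^sub>1 D \<bullet> Z\<close> almost everywhere, where \<open>z = (u, Z)\<close>.
  Applied to linear combinations of \<open>(z, D)\<close> and the correctors, the second inequality forces \<open>D = aZ\<close>: a combination with \<open>Z = 0\<close> at a point has \<open>D = 0\<close> there.
\<close>

section \<open>Hilbert spaces and weak convergence\<close>

text \<open>The fields are only Lipschitz, so \<open>X j y $ i * \<psi> y\<close> in
  \<open>is_X_deriv\<close> has partial derivatives only almost everywhere; integration by parts
  must be proved at that level. Solutions with prescribed weak limits come from the weak limit of
  the inverse operators, which stays coercive and hence is onto. Countably many right-hand sides are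
  involved, so one subsequence serves all data \<open>g\<close> and \<open>\<mu>\<close>. The
  constant 1 occurs among the factors because a cut-off is not constant on its box: the cut-off
  itself is used to cancel its own gradient. The cancelling coefficients depend on the point, so the
  pointwise inequalities are needed off a single null set for all coefficients at once. The upper
  bound is carried as |aZ|^2 <= c1 aZ.Z and not as aZ.Z <= c1 |Z|^2: in the first form the left side
  is weakly lower semicontinuous and the right side converges, so the constant survives the limit.
  This form rests on the symmetry of the matrices.\<close>

lemma quadratic_nonneg_imp_zero:
  fixes a b :: real
  assumes "\<And>t. 0 \<le> 2 * t * a + t\<^sup>2 * b"
  shows "a = 0"
proof (rule ccontr)
  assume "a \<noteq> 0"
  have b: "0 \<le> b" using assms[of 1] assms[of "-1"] by simp
  \<comment> \<open>The increment \<open>b + 1\<close> keeps the test value defined for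
    \<open>b = 0\<close> and still makes the quadratic negative.\<close>
  have "0 \<le> 2 * (- a / (b + 1)) * a + (- a / (b + 1))\<^sup>2 * b" by (rule assms)
  also have "\<dots> = - (a\<^sup>2 * (b + 2)) / (b + 1)\<^sup>2"
    using b by (simp add: divide_simps power2_eq_square) (simp add: algebra_simps)
  also have "\<dots> < 0" using b \<open>a \<noteq> 0\<close>
    by (intro divide_neg_pos) (auto intro!: mult_pos_pos)
  finally show False by simp
qed

text \<open>Minimise |v|^2 - 2 l(v) over \<open>V\<close>. The linear part drops out of the
  parallelogram identity, so minimising sequences are Cauchy, and the first-order condition at the
  minimiser is the representation. As \<open>l\<close> has to be linear on \<open>V\<close> only,
  the lemma yields projections as well as dual vectors of the whole space.\<close>

lemma riesz_closed_subspace: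
  fixes V :: "'a::{real_inner,complete_space} set"
  assumes V: "subspace V" "closed V"
    and add: "\<And>x y. x \<in> V ==> y \<in> V ==> l (x + y) = l x + l y"
    and scale: "\<And>c x. x \<in> V ==> l (c *\<^sub>R x) = c * l x"
    and bd: "\<And>x. x \<in> V ==> \<bar>l x\<bar> \<le> C * norm x"
  obtains f where "f \<in> V" "\<And>v. v \<in> V ==> l v = f \<bullet> v"
proof -
  define J where "J v = v \<bullet> v - 2 * l v" for v
  have lower: "- C\<^sup>2 \<le> J v" if "v \<in> V" for v
  proof -
    have "0 \<le> (norm v - C)\<^sup>2" by simp
    then have "2 * (C * norm v) \<le> norm v * norm v + C\<^sup>2"
      by (simp add: power2_diff power2_eq_square algebra_simps)
    then show ?thesis using bd[OF that] by (simp add: J_def dot_square_norm power2_eq_square)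
  qed
  define m where "m = Inf (J ` V)"
  have bdd: "bdd_below (J ` V)" using lower by (auto intro!: bdd_belowI2)
  have ne: "J ` V \<noteq> {}" using subspace_0[OF V(1)] by auto
  have m_le: "m \<le> J v" if "v \<in> V" for v
    unfolding m_def using that bdd by (auto intro: cInf_lower)
  have "\<exists>v\<in>V. J v < m + 1 / (real k + 1)" for k
    using cInf_lessD[OF ne, of "m + 1 / (real k + 1)"] by (auto simp: m_def)
  then obtain v where v: "\<And>k. v k \<in> V" "\<And>k. J (v k) < m + 1 / (real k + 1)" by metis
  have para: "(norm (x - y))\<^sup>2 = 2 * J x + 2 * J y - 4 * J ((1/2) *\<^sub>R (x + y))" if "x \<in> V" "y \<in> V" for x y
  proof -
    have "l ((1/2) *\<^sub>R (x + y)) = (l x + l y) / 2"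
      using that V(1) scale[of "x + y" "1/2"] by (simp add: add subspace_add)
    then show ?thesis
      by (simp add: J_def power2_norm_eq_inner inner_diff_left inner_diff_right inner_add_left inner_add_right inner_commute[of y x] field_simps)
  qed
  \<comment> \<open>Both values lie within 1/(N+1) of the infimum and the midpoint is not below it,
    so the parallelogram identity leaves 4/(N+1).\<close>
  have dist_v: "(norm (v i - v j))\<^sup>2 \<le> 4 / (real N + 1)" if "N \<le> i" "N \<le> j" for i j N
  proof -
    have "m \<le> J ((1/2) *\<^sub>R (v i + v j))"
      by (intro m_le subspace_scale[OF V(1)] subspace_add[OF V(1)] v)
    moreover have "1 / (real i + 1) \<le> 1 / (real N + 1)" "1 / (real j + 1) \<le> 1 / (real N + 1)"
      using that by (auto intro!: divide_left_mono)
    ultimately show ?thesis using para[OF v(1) v(1), of i j] v(2)[of i] v(2)[of j] by simp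
  qed
  have "Cauchy v"
  proof (rule CauchyI)
    fix e :: real assume "e > 0"
    then obtain N :: nat where "real N > 4 / e\<^sup>2" using reals_Archimedean2 by blast
    then have N: "4 / (real N + 1) < e\<^sup>2"
      using \<open>e > 0\<close> by (simp add: divide_simps) (simp add: algebra_simps add_strict_increasing2)
    have "norm (v i - v j) < e" if "N \<le> i" "N \<le> j" for i j
      using dist_v[OF that] N \<open>e > 0\<close> power2_less_imp_less[of "norm (v i - v j)" e] by force
    then show "\<exists>M. \<forall>i\<ge>M. \<forall>j\<ge>M. norm (v i - v j) < e" by blast
  qed
  then obtain f where f: "v \<longlonglongrightarrow> f" using Cauchy_convergent convergent_def by blast
  have fV: "f \<in> V" using closed_sequentially[OF V(2) _ f] v(1) by blast
  have ldiff: "l (x - y) = l x - l y" if "x \<in> V" "y \<in> V" for x y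
    using add[of x "- y"] scale[of y "-1"] that subspace_neg[OF V(1)] by simp
  have "(\<lambda>k. l (v k) - l f) \<longlonglongrightarrow> 0"
  proof (rule Lim_null_comparison[where g = "\<lambda>k. C * norm (v k - f)"])
    show "\<forall>\<^sub>F k in sequentially. norm (l (v k) - l f) \<le> C * norm (v k - f)"
      using bd[OF subspace_diff[OF V(1) v(1) fV]] by (simp add: ldiff v(1) fV)
    show "(\<lambda>k. C * norm (v k - f)) \<longlonglongrightarrow> 0"
      using f by (auto intro!: tendsto_eq_intros simp: LIM_zero_iff)
  qed
  then have "(\<lambda>k. J (v k)) \<longlonglongrightarrow> J f"
    unfolding J_def using f by (intro tendsto_intros) (auto simp: LIM_zero_iff)
  moreover have "(\<lambda>k. m + 1 / (real k + 1)) \<longlonglongrightarrow> m + 0"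
    by (intro tendsto_intros) (use LIMSEQ_inverse_real_of_nat in \<open>simp add: field_simps\<close>)
  ultimately have Jf: "J f \<le> m"
    using v(2) by (intro LIMSEQ_le[of "\<lambda>k. J (v k)" _ "\<lambda>k. m + 1 / (real k + 1)"]) (auto intro: less_imp_le)
  have "l w = f \<bullet> w" if w: "w \<in> V" for w
  proof -
    \<comment> \<open>This expands J(f) <= J(f + t w), valid for every \<open>t\<close> because
      \<open>f\<close> minimises.\<close>
    have "0 \<le> 2 * t * (f \<bullet> w - l w) + t\<^sup>2 * (w \<bullet> w)" for t
    proof -
      have "f + t *\<^sub>R w \<in> V" by (intro subspace_add subspace_scale V fV w)
      from order.trans[OF Jf m_le[OF this]] show ?thesis
        by (simp add: J_def add scale fV w subspace_scale V inner_commute algebra_simps power2_eq_square)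
    qed
    from quadratic_nonneg_imp_zero[OF this] show ?thesis by simp
  qed
  with fV that show thesis by blast
qed

section \<open>Orthogonal projections and Lax-Milgram\<close>

definition proj_on :: "'a::{real_inner,complete_space} set => 'a => 'a" where
  "proj_on V x = (SOME p. p \<in> V \<and> (\<forall>v\<in>V. (x - p) \<bullet> v = 0))"

context
  fixes V :: "'a::{real_inner,complete_space} set"
  assumes V: "subspace V" "closed V"
begin

lemma proj_on: "proj_on V x \<in> V" "v \<in> V ==> (x - proj_on V x) \<bullet> v = 0"
proof -
  obtain p where "p \<in> V" "\<And>v. v \<in> V ==> x \<bullet> v = p \<bullet> v"
    by (rule riesz_closed_subspace[OF V, of "\<lambda>v. x \<bullet> v" "norm x"])
      (auto simp: inner_right_distrib Cauchy_Schwarz_ineq2)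
  then have "\<exists>p. p \<in> V \<and> (\<forall>v\<in>V. (x - p) \<bullet> v = 0)" by (auto simp: inner_diff_left)
  from someI_ex[OF this, folded proj_on_def]
  show "proj_on V x \<in> V" "v \<in> V ==> (x - proj_on V x) \<bullet> v = 0" by auto
qed

lemma proj_on_inner: "v \<in> V ==> proj_on V x \<bullet> v = x \<bullet> v"
  using proj_on(2)[of v x] by (simp add: inner_diff_left)

text \<open>The inner products with \<open>V\<close> determine the projection, so identities such as
  additivity are proved by testing a candidate.\<close>

lemma proj_on_unique:
  assumes "p \<in> V" "\<And>v. v \<in> V ==> p \<bullet> v = x \<bullet> v" shows "proj_on V x = p"
proof -
  have d: "proj_on V x - p \<in> V" using assms(1) proj_on(1) V(1) by (auto intro: subspace_diff)
  have "(proj_on V x - p) \<bullet> (proj_on V x - p) = 0"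
    using assms(2)[OF d] proj_on_inner[OF d, of x] by (simp add: inner_diff_left)
  then show ?thesis by simp
qed

lemma proj_on_diff: "proj_on V (x - y) = proj_on V x - proj_on V y"
  by (rule proj_on_unique) (auto simp: inner_diff_left proj_on_inner proj_on(1) intro: subspace_diff[OF V(1)])

lemma norm_proj_on: "norm (proj_on V x) \<le> norm x"
proof (cases "proj_on V x = 0")
  case False
  have "norm (proj_on V x) * norm (proj_on V x) = x \<bullet> proj_on V x"
    using proj_on_inner[OF proj_on(1), of x x] by (metis dot_square_norm power2_eq_square)
  also have "\<dots> \<le> norm x * norm (proj_on V x)" by (rule norm_cauchy_schwarz)
  finally show ?thesis using False by simp
qed simp

text \<open>Coercivity is known on \<open>V\<close> only, so the Richardson iteration for
  \<open>T x = f\<close> is projected back to \<open>V\<close>. Expanding the square shows that a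
  step of length \<open>t\<close> contracts squared distances by 1 - 2tc + t^2 D^2, and Banach's
  theorem applies.\<close>

lemma lax_milgram:
  assumes T: "bounded_linear T" and bd: "\<And>x. norm (T x) \<le> C * norm x"
    and c: "0 < c" and coer: "\<And>x. x \<in> V ==> c * (norm x)\<^sup>2 \<le> T x \<bullet> x"
  shows "\<exists>z\<in>V. \<forall>v\<in>V. T z \<bullet> v = f \<bullet> v"
proof -
  interpret T: bounded_linear T by fact
  \<comment> \<open>The maximum makes the bound positive and at least \<open>c\<close>, hence
    \<open>0 \<le> q\<close> below.\<close>
  define D where "D = max C c"
  have D: "c \<le> D" "0 < D" using c by (auto simp: D_def)
  have bdD: "norm (T x) \<le> D * norm x" for x
    using bd[of x] mult_right_mono[of C D "norm x"] by (auto simp: D_def)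
  \<comment> \<open>This step length minimises 1 - 2tc + t^2 D^2; the minimum is
    \<open>q\<close>.\<close>
  define t where "t = c / D\<^sup>2"
  have t: "0 < t" using c D by (simp add: t_def)
  define F where "F x = x - t *\<^sub>R proj_on V (T x - f)" for x
  define q where "q = 1 - c\<^sup>2 / D\<^sup>2"
  have "c\<^sup>2 / D\<^sup>2 \<le> 1" using c D by (simp add: power_mono)
  then have q: "0 \<le> q" "q < 1" using c D by (auto simp: q_def)
  have contr: "dist (F x) (F y) \<le> sqrt q * dist x y" if xy: "x \<in> V" "y \<in> V" for x y
  proof -
    define e where "e = x - y"
    have eV: "e \<in> V" using xy V by (auto simp: e_def intro: subspace_diff)
    have "F x - F y = e - t *\<^sub>R proj_on V (T e)"
      by (simp add: F_def e_def proj_on_diff T.diff algebra_simps)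
    then have "(norm (F x - F y))\<^sup>2 = (e - t *\<^sub>R proj_on V (T e)) \<bullet> (e - t *\<^sub>R proj_on V (T e))"
      by (simp add: power2_norm_eq_inner)
    moreover have "proj_on V (T e) \<bullet> e = T e \<bullet> e" "e \<bullet> proj_on V (T e) = T e \<bullet> e"
      using proj_on_inner[OF eV, of "T e"] by (simp_all add: inner_commute)
    ultimately have "(norm (F x - F y))\<^sup>2 = e \<bullet> e - 2 * t * (T e \<bullet> e) + t\<^sup>2 * (norm (proj_on V (T e)))\<^sup>2"
      by (simp add: power2_norm_eq_inner inner_diff_left inner_diff_right power2_eq_square[of t] algebra_simps)
    also have "\<dots> \<le> e \<bullet> e - 2 * t * (c * (norm e)\<^sup>2) + t\<^sup>2 * (D * norm e)\<^sup>2"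
      using coer[OF eV] t order.trans[OF norm_proj_on[of "T e"] bdD[of e]]
      by (intro add_mono diff_mono mult_left_mono power_mono) auto
    also have "\<dots> = (1 - 2 * t * c + t\<^sup>2 * D\<^sup>2) * (norm e)\<^sup>2"
      by (simp add: power2_norm_eq_inner algebra_simps power_mult_distrib)
    also have "1 - 2 * t * c + t\<^sup>2 * D\<^sup>2 = q"
    proof -
      have "t * c = c\<^sup>2 / D\<^sup>2" "t\<^sup>2 * D\<^sup>2 = c\<^sup>2 / D\<^sup>2"
        using D by (auto simp: t_def power2_eq_square)
      then show ?thesis by (simp add: q_def)
    qed
    finally have "norm (F x - F y) \<le> sqrt (q * (norm e)\<^sup>2)" by (simp add: real_le_rsqrt)
    then show ?thesis by (simp add: real_sqrt_mult dist_norm e_def)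
  qed
  have "\<exists>!x\<in>V. F x = x"
  proof (rule Banach_fix)
    show "complete V" using V(2) by (simp add: complete_eq_closed)
    show "V \<noteq> {}" using subspace_0[OF V(1)] by auto
    show "0 \<le> sqrt q" "sqrt q < 1" using q by auto
    show "F ` V \<subseteq> V" using V by (auto simp: F_def intro!: subspace_diff subspace_scale proj_on)
  qed (use contr in auto)
  then obtain z where z: "z \<in> V" "F z = z" by blast
  then have "proj_on V (T z - f) = 0" using t by (simp add: F_def)
  then have "T z \<bullet> v = f \<bullet> v" if "v \<in> V" for v
    using proj_on_inner[OF that, of "T z - f"] by (simp add: inner_diff_left)
  with z show ?thesis by blast
qed

end

text \<open>The bound on the sequence is part of the notion because every passage to the limit below
  estimates with it.\<close>

definition weakly_tendsto :: "(nat => 'a::real_inner) => 'a => bool" where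
  "weakly_tendsto x l \<longleftrightarrow> bounded (range x) \<and> (\<forall>v. (\<lambda>k. x k \<bullet> v) \<longlonglongrightarrow> l \<bullet> v)"

lemma weakly_tendstoD: "weakly_tendsto x l ==> (\<lambda>k. x k \<bullet> v) \<longlonglongrightarrow> l \<bullet> v"
  by (simp add: weakly_tendsto_def)

lemma weakly_tendsto_bound: "weakly_tendsto x l ==> \<exists>B. \<forall>k. norm (x k) \<le> B"
  by (auto simp: weakly_tendsto_def bounded_iff)

lemma weakly_tendsto_unique: "weakly_tendsto x l ==> weakly_tendsto x l' ==> l = l'"
proof -
  assume "weakly_tendsto x l" "weakly_tendsto x l'"
  then have "l \<bullet> v = l' \<bullet> v" for v by (blast intro: LIMSEQ_unique weakly_tendstoD)
  then have "(l - l') \<bullet> (l - l') = 0" by (simp add: inner_diff_left)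
  then show ?thesis by simp
qed

lemma weakly_tendsto_subseq: "weakly_tendsto x l ==> strict_mono r ==> weakly_tendsto (\<lambda>k. x (r k)) l"
  using LIMSEQ_subseq_LIMSEQ[of "\<lambda>k. x k \<bullet> v" for v]
  by (auto simp: weakly_tendsto_def bounded_iff o_def)

lemma weakly_tendsto_add:
  assumes "weakly_tendsto x l" "weakly_tendsto y m" shows "weakly_tendsto (\<lambda>k. x k + y k) (l + m)"
proof -
  from assms obtain B B' where "\<forall>k. norm (x k) \<le> B" "\<forall>k. norm (y k) \<le> B'" by (metis weakly_tendsto_bound)
  then have "norm (x k + y k) \<le> B + B'" for k by (meson add_mono norm_triangle_le)
  then show ?thesis using assms tendsto_add[of "\<lambda>k. x k \<bullet> v" "l \<bullet> v" sequentially "\<lambda>k. y k \<bullet> v" "m \<bullet> v" for v]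
    by (auto simp: weakly_tendsto_def inner_add_left bounded_iff)
qed

lemma bounded_linear_adjoint:
  fixes T :: "'a::{real_inner,complete_space} => 'b::real_inner"
  assumes "bounded_linear T"
  shows "\<exists>w. \<forall>x. T x \<bullet> v = w \<bullet> x"
proof -
  interpret bounded_linear T by fact
  obtain K where K: "\<And>x. norm (T x) \<le> norm x * K" using bounded by blast
  have "\<bar>T x \<bullet> v\<bar> \<le> (K * norm v) * norm x" for x
    using Cauchy_Schwarz_ineq2[of "T x" v] mult_right_mono[OF K[of x], of "norm v"] by (simp add: ac_simps)
  then show ?thesis
    using riesz_closed_subspace[OF subspace_UNIV closed_UNIV, of "\<lambda>x. T x \<bullet> v"]
    by (metis UNIV_I add inner_add_left inner_scaleR_left scaleR)
qed

lemma weakly_tendsto_bounded_linear: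
  fixes T :: "'a::{real_inner,complete_space} => 'b::real_inner"
  assumes T: "bounded_linear T" and x: "weakly_tendsto x l"
  shows "weakly_tendsto (\<lambda>k. T (x k)) (T l)"
proof -
  have "bounded (T ` range x)" using x T by (intro bounded_linear_image) (auto simp: weakly_tendsto_def)
  moreover have "(\<lambda>k. T (x k) \<bullet> v) \<longlonglongrightarrow> T l \<bullet> v" for v
  proof -
    obtain w where w: "\<And>x. T x \<bullet> v = w \<bullet> x" using bounded_linear_adjoint[OF T, of v] by blast
    show ?thesis unfolding w using weakly_tendstoD[OF x, of w] by (simp add: inner_commute)
  qed
  ultimately show ?thesis by (simp add: weakly_tendsto_def image_image)
qed

text \<open>A weak factor against a strong one: the error is at most the bound of the weak sequence
  times the distance of the strong one from its limit.\<close>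

lemma weakly_tendsto_inner:
  assumes x: "weakly_tendsto x l" and y: "y \<longlonglongrightarrow> m"
  shows "(\<lambda>k. x k \<bullet> y k) \<longlonglongrightarrow> l \<bullet> m"
proof -
  obtain B where B: "\<And>k. norm (x k) \<le> B" using weakly_tendsto_bound[OF x] by blast
  have "(\<lambda>k. x k \<bullet> (y k - m)) \<longlonglongrightarrow> 0"
  proof (rule Lim_null_comparison[where g = "\<lambda>k. B * norm (y k - m)"])
    show "\<forall>\<^sub>F k in sequentially. norm (x k \<bullet> (y k - m)) \<le> B * norm (y k - m)"
      using B by (auto intro!: always_eventually order.trans[OF Cauchy_Schwarz_ineq2] mult_right_mono)
    show "(\<lambda>k. B * norm (y k - m)) \<longlonglongrightarrow> 0"
      using y by (auto intro!: tendsto_eq_intros simp: LIM_zero_iff)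
  qed
  from tendsto_add[OF this weakly_tendstoD[OF x, of m]] show ?thesis by (simp add: inner_diff_right)
qed

text \<open>The component of \<open>l\<close> orthogonal to \<open>V\<close> is invisible to all
  \<open>x k\<close>, hence also to their weak limit.\<close>

lemma weakly_tendsto_closed_subspace:
  fixes V :: "'a::{real_inner,complete_space} set"
  assumes V: "subspace V" "closed V" and x: "weakly_tendsto x l" "\<And>k. x k \<in> V"
  shows "l \<in> V"
proof -
  let ?d = "l - proj_on V l"
  have "x k \<bullet> ?d = 0" for k using proj_on(2)[OF V x(2), of l] by (simp add: inner_commute)
  then have "l \<bullet> ?d = 0" using weakly_tendstoD[OF x(1), of ?d] by (simp add: LIMSEQ_const_iff)
  moreover have "proj_on V l \<bullet> ?d = 0" using proj_on[OF V] by (simp add: inner_commute)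
  ultimately have "?d \<bullet> ?d = 0" by (simp add: inner_diff_left)
  then have "l = proj_on V l" by simp
  then show ?thesis using proj_on(1)[OF V] by metis
qed

text \<open>This reduces convergence for all vectors to convergence for a generating family: split
  any vector by projecting onto this closed subspace. Closedness holds because the uniform bound
  turns an approximation of the vector into an error uniform in \<open>h\<close>.\<close>

lemma convergent_functionals:
  fixes T :: "nat => 'a::real_normed_vector => real"
  assumes lin: "\<And>h. linear (T h)" and bd: "\<And>h x. \<bar>T h x\<bar> \<le> B * norm x"
  shows "subspace {x. convergent (\<lambda>h. T h x)}" "closed {x. convergent (\<lambda>h. T h x)}"
proof -
  show "subspace {x. convergent (\<lambda>h. T h x)}"
    by (auto simp: subspace_def linear_add[OF lin] linear_scale[OF lin] linear_0[OF lin]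
        intro!: convergent_add convergent_mult convergent_const)
  show "closed {x. convergent (\<lambda>h. T h x)}"
    unfolding closed_sequential_limits
  proof safe
    fix x l assume x: "\<forall>n. x n \<in> {x. convergent (\<lambda>h. T h x)}" and l: "x \<longlonglongrightarrow> l"
    have "Cauchy (\<lambda>h. T h l)"
    proof (rule CauchyI)
      fix e :: real assume "0 < e"
      \<comment> \<open>A strictly positive bound, since it is divided by below.\<close>
      define B' where "B' = \<bar>B\<bar> + 1"
      have B': "B' > 0" "\<bar>T h y\<bar> \<le> B' * norm y" for h y
        using order.trans[OF bd[of h y] mult_right_mono[of B B' "norm y"]] by (auto simp: B'_def)
      obtain n where n: "norm (x n - l) < e / (4 * B')"
        using LIMSEQ_D[OF l, of "e / (4 * B')"] \<open>0 < e\<close> B' by auto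
      have close: "\<bar>T h (x n) - T h l\<bar> < e / 4" for h
      proof -
        have "\<bar>T h (x n) - T h l\<bar> \<le> B' * norm (x n - l)"
          using B'(2)[of h "x n - l"] by (simp add: linear_diff[OF lin])
        also have "\<dots> < B' * (e / (4 * B'))" using n B' by (intro mult_strict_left_mono) auto
        finally show ?thesis using B' by simp
      qed
      have "Cauchy (\<lambda>h. T h (x n))" using x by (simp add: convergent_Cauchy)
      then obtain M where M: "\<And>i j. M \<le> i ==> M \<le> j ==> norm (T i (x n) - T j (x n)) < e / 2"
        using \<open>0 < e\<close> by (metis CauchyD half_gt_zero)
      have "norm (T i l - T j l) < e" if "M \<le> i" "M \<le> j" for i j
        using M[OF that] close[of i] close[of j] by (simp only: real_norm_def)
      then show "\<exists>M. \<forall>i\<ge>M. \<forall>j\<ge>M. norm (T i l - T j l) < e" by blast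
    qed
    then show "convergent (\<lambda>h. T h l)" by (simp add: Cauchy_convergent)
  qed
qed

lemma weak_limit_exists:
  fixes x :: "nat => 'a::{real_inner,complete_space}"
  assumes B: "\<And>k. norm (x k) \<le> B" and conv: "\<And>v. convergent (\<lambda>k. x k \<bullet> v)"
  shows "\<exists>l. weakly_tendsto x l"
proof -
  define l where "l v = lim (\<lambda>k. x k \<bullet> v)" for v
  have l: "(\<lambda>k. x k \<bullet> v) \<longlonglongrightarrow> l v" for v using conv[of v] by (simp add: l_def convergent_LIMSEQ_iff)
  have bd: "\<bar>l v\<bar> \<le> B * norm v" for v
  proof (rule LIMSEQ_le_const2[OF tendsto_rabs[OF l]])
    show "\<exists>N. \<forall>n\<ge>N. \<bar>x n \<bullet> v\<bar> \<le> B * norm v"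
      using B by (auto intro!: order.trans[OF Cauchy_Schwarz_ineq2] mult_right_mono)
  qed
  have "l (v + w) = l v + l w" for v w
    using tendsto_add[OF l[of v] l[of w]] l[of "v + w"] by (auto simp: inner_add_right intro: LIMSEQ_unique)
  moreover have "l (c *\<^sub>R v) = c * l v" for c v
    using tendsto_mult[OF tendsto_const l, of c v] l[of "c *\<^sub>R v"] by (auto intro: LIMSEQ_unique)
  ultimately obtain f where "\<And>v. l v = f \<bullet> v"
    using riesz_closed_subspace[OF subspace_UNIV closed_UNIV, of l B] bd by (metis UNIV_I)
  then show ?thesis using l B by (auto simp: weakly_tendsto_def bounded_iff)
qed

lemma bounded_real_diagonal:
  fixes a :: "nat => nat => real"
  assumes "\<And>k h. \<bar>a k h\<bar> \<le> B k"
  obtains s where "strict_mono s" "\<And>k. convergent (\<lambda>h. a k (s h))"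
proof -
  interpret subseqs "\<lambda>k s. convergent (\<lambda>h. a k (s h))"
  proof
    fix n and s :: "nat => nat" assume "strict_mono s"
    have "bounded (range (\<lambda>h. a n (s h)))" using assms[of n] by (auto simp: bounded_iff)
    then obtain l r where "strict_mono r" "((\<lambda>h. a n (s h)) \<circ> r) \<longlonglongrightarrow> l"
      using bounded_imp_convergent_subsequence by blast
    then show "\<exists>r'. strict_mono r' \<and> convergent (\<lambda>h. a n ((s \<circ> r') h))"
      by (auto simp: o_def convergent_def)
  qed
  have "convergent (\<lambda>h. a k (diagseq h))" for k
  proof -
    \<comment> \<open>The diagonal sequence refines the \<open>k\<close>-th extraction only from
      index \<open>k + 1\<close> on; the initial segment is then discarded.\<close>
    have "convergent (\<lambda>h. a k ((diagseq \<circ> ((+) (Suc k))) h))"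
      by (rule diagseq_holds) (auto simp: o_def dest: convergent_subseq_convergent)
    then have "convergent (\<lambda>h. a k (diagseq (h + Suc k)))" by (simp add: o_def add.commute)
    then show ?thesis by (subst (asm) convergent_ignore_initial_segment)
  qed
  then show thesis using that subseq_diagseq by blast
qed

text \<open>It suffices to test with the vectors \<open>x i j\<close> themselves, which are
  countably many: whatever is orthogonal to all of them has zero inner products along every
  sequence. Thus one subsequence serves all sequences, in any Hilbert space.\<close>

lemma weak_compactness_diagonal:
  fixes x :: "nat => nat => 'a::{real_inner,complete_space}"
  assumes B: "\<And>k h. norm (x k h) \<le> B k"
  obtains s where "strict_mono s" "\<And>k. \<exists>l. weakly_tendsto (\<lambda>h. x k (s h)) l"
proof -
  \<comment> \<open>The index \<open>p\<close> codes the triple \<open>(k, i, j)\<close>.\<close>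
  define a where "a p h = (case prod_decode p of (k, q) => case prod_decode q of (i, j) => x k h \<bullet> x i j)" for p h
  define C where "C p = (case prod_decode p of (k, q) => case prod_decode q of (i, j) => B k * norm (x i j))" for p
  have "\<bar>a p h\<bar> \<le> C p" for p h
    using B by (auto simp: a_def C_def split: prod.split intro!: order.trans[OF Cauchy_Schwarz_ineq2] mult_right_mono)
  from bounded_real_diagonal[of a C, OF this] obtain s where s: "strict_mono s" "\<And>p. convergent (\<lambda>h. a p (s h))" by blast
  have conv: "convergent (\<lambda>h. x k (s h) \<bullet> x i j)" for k i j
    using s(2)[of "prod_encode (k, prod_encode (i, j))"] by (simp add: a_def)
  have "\<exists>l. weakly_tendsto (\<lambda>h. x k (s h)) l" for k
  proof (rule weak_limit_exists)
    show "norm (x k (s h)) \<le> B k" for h by (rule B)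
    fix v
    let ?Y = "{v. convergent (\<lambda>h. x k (s h) \<bullet> v)}"
    have lin: "linear (\<lambda>v. x k (s h) \<bullet> v)" for h by (intro linearI) (simp_all add: inner_add_right)
    have bdd: "\<bar>x k (s h) \<bullet> v\<bar> \<le> B k * norm v" for h v
      using Cauchy_Schwarz_ineq2[of "x k (s h)" v] mult_right_mono[OF B[of k "s h"], of "norm v"] by simp
    note Y = convergent_functionals[of "\<lambda>h v. x k (s h) \<bullet> v" "B k", OF lin bdd]
    \<comment> \<open>All \<open>x k (s h)\<close> belong to the subspace on which convergence
      holds, so only the projection of \<open>v\<close> to it is seen.\<close>
    have "x k (s h) \<bullet> (v - proj_on ?Y v) = 0" for h
      using proj_on(2)[OF Y, of "x k (s h)" v] conv by (simp add: inner_commute)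
    then have "(\<lambda>h. x k (s h) \<bullet> v) = (\<lambda>h. x k (s h) \<bullet> proj_on ?Y v)" by (simp add: inner_diff_right)
    then show "convergent (\<lambda>h. x k (s h) \<bullet> v)" using proj_on(1)[OF Y, of v] by simp
  qed
  with s(1) that show thesis by blast
qed

lemma weak_compactness:
  fixes x :: "nat => 'a::{real_inner,complete_space}"
  assumes "\<And>h. norm (x h) \<le> B"
  obtains s l where "strict_mono s" "weakly_tendsto (\<lambda>h. x (s h)) l"
  using weak_compactness_diagonal[of "\<lambda>_. x" "\<lambda>_. B"] assms by metis

text \<open>If the whole sequence failed against some \<open>v\<close>, a subsequence would stay
  away from the limit; weak compactness extracts from it a weakly convergent one, whose limit is
  \<open>l\<close> by assumption.\<close>

lemma weakly_tendsto_from_subsequences: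
  fixes x :: "nat => 'a::{real_inner,complete_space}"
  assumes B: "\<And>h. norm (x h) \<le> B"
    and sub: "\<And>r l'. strict_mono r ==> weakly_tendsto (\<lambda>h. x (r h)) l' ==> l' = l"
  shows "weakly_tendsto x l"
proof -
  have "(\<lambda>h. x h \<bullet> v) \<longlonglongrightarrow> l \<bullet> v" for v
  proof (rule ccontr)
    assume "\<not> (\<lambda>h. x h \<bullet> v) \<longlonglongrightarrow> l \<bullet> v"
    then obtain e where e: "e > 0" "\<exists>\<^sub>\<infinity>h. e \<le> dist (x h \<bullet> v) (l \<bullet> v)"
      by (auto simp: tendsto_iff not_eventually cofinite_eq_sequentially[symmetric] frequently_cofinite INFM_iff_infinite not_less)
    define r where "r = enumerate {h. e \<le> dist (x h \<bullet> v) (l \<bullet> v)}"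
    have inf: "infinite {h. e \<le> dist (x h \<bullet> v) (l \<bullet> v)}" using e(2) by (simp add: INFM_iff_infinite)
    have r: "strict_mono r" unfolding r_def using inf by (rule strict_mono_enumerate)
    have far: "e \<le> dist (x (r h) \<bullet> v) (l \<bullet> v)" for h
      using enumerate_in_set[OF inf, of h] by (simp add: r_def)
    obtain t l' where t: "strict_mono t" "weakly_tendsto (\<lambda>h. x (r (t h))) l'"
      using weak_compactness[of "\<lambda>h. x (r h)" B] B by blast
    have "strict_mono (\<lambda>h. r (t h))" using strict_mono_o[OF r t(1)] by (simp add: o_def)
    then have "l' = l" using t(2) by (rule sub)
    then have "(\<lambda>h. dist (x (r (t h)) \<bullet> v) (l \<bullet> v)) \<longlonglongrightarrow> 0"
      using tendsto_dist[OF weakly_tendstoD[OF t(2), of v] tendsto_const, of "l \<bullet> v"] by simp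
    then have "e \<le> 0" using far by (intro LIMSEQ_le_const) auto
    with e show False by simp
  qed
  then show ?thesis using B by (auto simp: weakly_tendsto_def bounded_iff)
qed

text \<open>The inverses \<open>S\<^sub>h\<close> of \<open>A\<^sub>h\<close> on \<open>V\<close> converge weakly along a subsequence to an operator which is again coercive,
  hence onto: every \<open>w \<in> V\<close> is the weak limit of solutions with a fixed right-hand side.\<close>

lemma coercive_correctors:
  fixes V :: "'a::{real_inner,complete_space} set" and A :: "nat => 'a => 'a" and e w :: "nat => 'a"
  assumes V: "subspace V" "closed V" and A: "\<And>h. bounded_linear (A h)"
    and bd: "\<And>h x. norm (A h x) \<le> C * norm x"
    and c: "0 < c" and coer: "\<And>h x. x \<in> V ==> c * (norm x)\<^sup>2 \<le> A h x \<bullet> x"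
    and total: "\<And>v. (\<And>k. v \<bullet> e k = 0) ==> v = 0"
    and w: "\<And>k. w k \<in> V"
  obtains s f z D where "strict_mono s" "\<And>k h. z k h \<in> V" "\<And>k h v. v \<in> V ==> A (s h) (z k h) \<bullet> v = f k \<bullet> v"
    "\<And>k. weakly_tendsto (z k) (w k)" "\<And>k. weakly_tendsto (\<lambda>h. A (s h) (z k h)) (D k)"
proof -
  have linA: "linear (A h)" for h using A[of h] by (simp add: bounded_linear.linear)
  have "\<exists>z\<in>V. \<forall>v\<in>V. A h z \<bullet> v = f \<bullet> v" for h f
    by (rule lax_milgram[OF V A bd c coer])
  then obtain S where S: "\<And>h f. S h f \<in> V" "\<And>h f v. v \<in> V ==> A h (S h f) \<bullet> v = f \<bullet> v" by metis
  have uniq: "S h f = z" if z: "z \<in> V" "\<And>v. v \<in> V ==> A h z \<bullet> v = f \<bullet> v" for h f z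
  proof -
    let ?d = "S h f - z"
    have d: "?d \<in> V" using S(1) z(1) by (intro subspace_diff V)
    have "c * (norm ?d)\<^sup>2 \<le> A h ?d \<bullet> ?d" by (rule coer[OF d])
    also have "\<dots> = 0" using S(2)[OF d, of h f] z(2)[OF d] by (simp add: linear_diff[OF linA] inner_diff_left)
    finally show ?thesis using c by (simp add: mult_le_0_iff power2_eq_square)
  qed
  have S_add: "S h (f + g) = S h f + S h g" for h f g
    by (rule uniq) (auto simp: linear_add[OF linA] inner_add_left S intro: subspace_add[OF V(1)])
  have S_scale: "S h (r *\<^sub>R f) = r *\<^sub>R S h f" for h f r
    by (rule uniq) (auto simp: linear_scale[OF linA] S intro: subspace_scale[OF V(1)])
  have S_bd: "norm (S h f) \<le> norm f / c" for h f
  proof (cases "S h f = 0")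
    case False
    have "c * (norm (S h f))\<^sup>2 \<le> A h (S h f) \<bullet> S h f" by (rule coer[OF S(1)])
    also have "\<dots> = f \<bullet> S h f" by (rule S(2)[OF S(1)])
    also have "\<dots> \<le> norm f * norm (S h f)" by (rule norm_cauchy_schwarz)
    finally have "c * norm (S h f) \<le> norm f" using False by (simp add: power2_eq_square)
    then show ?thesis using c by (simp add: field_simps)
  qed (use c in auto)
  define D where "D = max C c"
  have D: "0 < D" using c by (auto simp: D_def)
  have bdD: "norm (A h x) \<le> D * norm x" for h x
    using bd[of h x] mult_right_mono[of C D "norm x"] by (auto simp: D_def)
  \<comment> \<open>Testing the equation for \<open>S h f\<close> with \<open>f\<close> gives |f| <=
    D |S h f|, and f . S h f = A h (S h f) . S h f >= c |S h f|^2. The constant is independent of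
    \<open>h\<close> and so passes to the weak limit \<open>R\<close>.\<close>
  have S_coer: "c / D\<^sup>2 * (norm f)\<^sup>2 \<le> S h f \<bullet> f" if f: "f \<in> V" for h f
  proof -
    have "norm f * norm f = A h (S h f) \<bullet> f" using S(2)[OF f, of h f] by (simp add: norm_eq_sqrt_inner)
    also have "\<dots> \<le> norm (A h (S h f)) * norm f" by (rule norm_cauchy_schwarz)
    also have "\<dots> \<le> (D * norm (S h f)) * norm f" by (intro mult_right_mono bdD) auto
    finally have "norm f \<le> D * norm (S h f)" by (cases "f = 0") (use D in auto)
    then have "(norm f)\<^sup>2 \<le> (D * norm (S h f))\<^sup>2" by (intro power_mono) auto
    then have "c / D\<^sup>2 * (norm f)\<^sup>2 \<le> c / D\<^sup>2 * (D * norm (S h f))\<^sup>2" using c D by (intro mult_left_mono) auto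
    also have "\<dots> = c * (norm (S h f))\<^sup>2" using D by (simp add: power_mult_distrib)
    also have "\<dots> \<le> A h (S h f) \<bullet> S h f" by (rule coer[OF S(1)])
    also have "\<dots> = f \<bullet> S h f" by (rule S(2)[OF S(1)])
    also have "\<dots> = S h f \<bullet> f" by (rule inner_commute)
    finally show ?thesis .
  qed
  obtain s0 where s0: "strict_mono s0" "\<And>k. \<exists>l. weakly_tendsto (\<lambda>h. S (s0 h) (e k)) l"
    using weak_compactness_diagonal[of "\<lambda>k h. S h (e k)" "\<lambda>k. norm (e k) / c"] S_bd by metis
  \<comment> \<open>The extraction gives convergence for \<open>f = e k\<close>; the good
    \<open>f\<close> form a closed subspace, and a vector orthogonal to all \<open>e k\<close>
    vanishes.\<close>
  have conv: "convergent (\<lambda>h. S (s0 h) f \<bullet> v)" for f v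
  proof -
    let ?Y = "{f. convergent (\<lambda>h. S (s0 h) f \<bullet> v)}"
    have lin: "linear (\<lambda>f. S (s0 h) f \<bullet> v)" for h by (intro linearI) (simp_all add: S_add S_scale inner_add_left)
    have bdd: "\<bar>S (s0 h) f \<bullet> v\<bar> \<le> norm v / c * norm f" for h f
      using Cauchy_Schwarz_ineq2[of "S (s0 h) f" v] mult_right_mono[OF S_bd[of "s0 h" f], of "norm v"] by (simp add: mult.commute)
    note Y = convergent_functionals[of "\<lambda>h f. S (s0 h) f \<bullet> v" "norm v / c", OF lin bdd]
    have "e k \<in> ?Y" for k using s0(2)[of k] by (auto simp: weakly_tendsto_def convergent_def)
    then have "(f - proj_on ?Y f) \<bullet> e k = 0" for k using proj_on(2)[OF Y] by blast
    then have "f = proj_on ?Y f" using total by fastforce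
    then show ?thesis using proj_on(1)[OF Y, of f] by simp
  qed
  have "\<exists>l. weakly_tendsto (\<lambda>h. S (s0 h) f) l" for f
    by (rule weak_limit_exists[OF S_bd conv])
  then obtain R where R: "\<And>f. weakly_tendsto (\<lambda>h. S (s0 h) f) (R f)" by metis
  have RV: "R f \<in> V" for f by (rule weakly_tendsto_closed_subspace[OF V R S(1)])
  have R_bd: "norm (R f) \<le> norm f * (1 / c)" for f
  proof -
    have "norm (R f) * norm (R f) \<le> norm f / c * norm (R f)"
      unfolding norm_eq_sqrt_inner[of "R f"] real_sqrt_mult_self
    proof (rule LIMSEQ_le_const2)
      show "(\<lambda>h. S (s0 h) f \<bullet> R f) \<longlonglongrightarrow> \<bar>R f \<bullet> R f\<bar>" using weakly_tendstoD[OF R] by simp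
      show "\<exists>N. \<forall>n\<ge>N. S (s0 n) f \<bullet> R f \<le> norm f / c * sqrt (R f \<bullet> R f)"
        unfolding norm_eq_sqrt_inner[of "R f", symmetric]
        using order.trans[OF norm_cauchy_schwarz mult_right_mono[OF S_bd norm_ge_zero]] by blast
    qed
    then have "norm (R f) * norm (R f) \<le> (norm f / c) * norm (R f)" by simp
    then have "norm (R f) \<le> norm f / c" if "R f \<noteq> 0" using that mult_right_le_imp_le by (metis zero_less_norm_iff)
    then show ?thesis by (cases "R f = 0") (use c in auto)
  qed
  have R_lin: "bounded_linear R"
  proof (rule bounded_linear_intro[OF _ _ R_bd])
    show "R (x + y) = R x + R y" for x y
      using weakly_tendsto_add[OF R[of x] R[of y]] R[of "x + y"] by (auto simp: S_add intro: weakly_tendsto_unique)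
    show "R (r *\<^sub>R x) = r *\<^sub>R R x" for r x
      using weakly_tendsto_bounded_linear[OF bounded_linear_scaleR_right R[of x], of r] R[of "r *\<^sub>R x"]
      by (auto simp: S_scale intro: weakly_tendsto_unique)
  qed
  have R_coer: "c / D\<^sup>2 * (norm f)\<^sup>2 \<le> R f \<bullet> f" if "f \<in> V" for f
    by (rule LIMSEQ_le_const[OF weakly_tendstoD[OF R]]) (use S_coer[OF that] in auto)
  \<comment> \<open>Lax-Milgram for \<open>R\<close> gives equality with \<open>x\<close> only when
    tested on \<open>V\<close>, but \<open>R f - x\<close> lies in \<open>V\<close> itself.\<close>
  have "\<exists>f. R f = x" if x: "x \<in> V" for x
  proof -
    have "\<exists>f\<in>V. \<forall>v\<in>V. R f \<bullet> v = x \<bullet> v"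
      by (rule lax_milgram[OF V R_lin _ _ R_coer, of "1/c"]) (use R_bd c D in \<open>auto simp: mult.commute\<close>)
    then obtain f where f: "\<And>v. v \<in> V ==> R f \<bullet> v = x \<bullet> v" by blast
    have "(R f - x) \<bullet> (R f - x) = 0"
      using f[OF subspace_diff[OF V(1) RV x, of f]] by (simp add: inner_diff_left)
    then show ?thesis by auto
  qed
  then have "\<forall>k. \<exists>f. R f = w k" using w by blast
  then obtain f where f: "\<And>k. R (f k) = w k" by metis
  \<comment> \<open>A second extraction makes the images under \<open>A\<close> converge too; they
    are bounded by D |f k| / c.\<close>
  obtain s1 where s1: "strict_mono s1"
     "\<And>k. \<exists>l. weakly_tendsto (\<lambda>h. A (s0 (s1 h)) (S (s0 (s1 h)) (f k))) l"
  proof (rule weak_compactness_diagonal[of "\<lambda>k h. A (s0 h) (S (s0 h) (f k))" "\<lambda>k. D * (norm (f k) / c)"])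
    show "norm (A (s0 h) (S (s0 h) (f k))) \<le> D * (norm (f k) / c)" for k h
      using bdD D S_bd by (meson mult_left_mono order.trans less_imp_le)
  qed (use that in blast)
  then obtain F where F: "\<And>k. weakly_tendsto (\<lambda>h. A (s0 (s1 h)) (S (s0 (s1 h)) (f k))) (F k)" by metis
  show thesis
  proof (rule that[of "\<lambda>h. s0 (s1 h)" "\<lambda>k h. S (s0 (s1 h)) (f k)" f F])
    show "strict_mono (\<lambda>h. s0 (s1 h))" using strict_mono_o[OF s0(1) s1(1)] by (simp add: o_def)
    show "weakly_tendsto (\<lambda>h. S (s0 (s1 h)) (f k)) (w k)" for k
      using weakly_tendsto_subseq[OF R[of "f k"] s1(1)] f by simp
  qed (use S F in auto)
qed

section \<open>The Hilbert space of square integrable functions\<close>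

lemma enn2real_leD: "enn2real a \<le> enn2real b ==> a < \<infinity> ==> b < \<infinity> ==> a \<le> b"
  using ennreal_leI[of "enn2real a" "enn2real b"] by simp

text \<open>Compare the measures with densities the negative and the positive part of the function.
  The assumption orders them on open sets, outer regularity of the finite one extends this to Borel
  sets, and on the set of negativity the positive part has measure zero.\<close>

lemma nonneg_open_integrals_imp_AE:
  fixes F :: "'a::euclidean_space => real"
  assumes F: "integrable lebesgue F"
    and nonneg: "\<And>U. open U ==> 0 \<le> (\<integral>x. indicator U x * F x \<partial>lebesgue)"
  shows "AE x in lebesgue. 0 \<le> F x"
proof -
  have "F \<in> borel_measurable (completion lborel)" using F by auto
  \<comment> \<open>Outer regularity is applied to a Borel measure, so \<open>F\<close> is first
    replaced by a Borel function that agrees with it almost everywhere.\<close>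
  from completion_ex_borel_measurable_real[OF this] obtain G where
    G[measurable]: "G \<in> borel_measurable lborel" and ae: "AE x in lborel. F x = G x" by blast
  have ae': "AE x in lebesgue. F x = G x" using ae by (rule AE_completion)
  have "integrable lebesgue G"
    using F measurable_completion[OF G] ae' by (rule integrable_cong_AE_imp)
  then have int_G: "integrable lborel G" using integrable_completion[OF G] by simp
  define N where "N = density lborel (\<lambda>x. ennreal (- G x))"
  define P where "P = density lborel (\<lambda>x. ennreal (G x))"
  have fin: "(\<integral>\<^sup>+x. ennreal (\<bar>G x\<bar>) \<partial>lborel) < \<infinity>" using int_G by (auto simp: integrable_iff_bounded)
  have finP: "emeasure P (space P) \<noteq> \<infinity>"
  proof -
    have "(\<integral>\<^sup>+x. ennreal (G x) \<partial>lborel) \<le> (\<integral>\<^sup>+x. ennreal \<bar>G x\<bar> \<partial>lborel)"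
      by (intro nn_integral_mono ennreal_leI) simp
    then show ?thesis using fin by (auto simp: P_def emeasure_density top_unique)
  qed
  have NP: "emeasure N U \<le> emeasure P U" if U: "open U" for U
  proof -
    have [measurable]: "U \<in> sets borel" using U by simp
    let ?G = "\<lambda>x. indicator U x * G x"
    have intU: "integrable lborel ?G" using integrable_real_mult_indicator[of U lborel G] int_G by (simp add: mult.commute)
    have "0 \<le> (\<integral>x. indicator U x * F x \<partial>lebesgue)" by (rule nonneg[OF U])
    also have "\<dots> = (\<integral>x. ?G x \<partial>lebesgue)"
    proof (rule integral_cong_AE)
      have "U \<in> sets lebesgue" by simp
      then show "(\<lambda>x. indicator U x * F x) \<in> borel_measurable lebesgue"
        using F by (intro borel_measurable_times borel_measurable_indicator) auto
      show "?G \<in> borel_measurable lebesgue" by (rule measurable_completion) simp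
      show "AE x in lebesgue. indicator U x * F x = indicator U x * G x" using ae' by eventually_elim simp
    qed
    also have "\<dots> = (\<integral>x. ?G x \<partial>lborel)" by (rule integral_completion) simp
    also have "\<dots> = enn2real (\<integral>\<^sup>+x. ennreal (?G x) \<partial>lborel) - enn2real (\<integral>\<^sup>+x. ennreal (- ?G x) \<partial>lborel)"
      by (rule real_lebesgue_integral_def[OF intU])
    finally have "enn2real (\<integral>\<^sup>+x. ennreal (- ?G x) \<partial>lborel) \<le> enn2real (\<integral>\<^sup>+x. ennreal (?G x) \<partial>lborel)" by simp
    moreover have "(\<integral>\<^sup>+x. ennreal (- ?G x) \<partial>lborel) < \<infinity>"
      by (rule le_less_trans[OF nn_integral_mono fin]) (intro ennreal_leI, auto simp: indicator_def)
    moreover have "(\<integral>\<^sup>+x. ennreal (?G x) \<partial>lborel) < \<infinity>"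
      by (rule le_less_trans[OF nn_integral_mono fin]) (intro ennreal_leI, auto simp: indicator_def)
    ultimately have "(\<integral>\<^sup>+x. ennreal (- ?G x) \<partial>lborel) \<le> (\<integral>\<^sup>+x. ennreal (?G x) \<partial>lborel)"
      by (rule enn2real_leD)
    moreover have "ennreal (- ?G x) = ennreal (- G x) * indicator U x" "ennreal (?G x) = ennreal (G x) * indicator U x" for x
      by (auto simp: indicator_def)
    ultimately show ?thesis by (simp add: N_def P_def emeasure_density)
  qed
  \<comment> \<open>The set on which \<open>P\<close> vanishes by construction; approximating it
    from outside by open sets carries \<open>NP\<close> over to it.\<close>
  let ?B = "{x. G x < 0}"
  have B[measurable]: "?B \<in> sets borel" by measurable
  have "emeasure N ?B \<le> emeasure P ?B"
  proof -
    have "emeasure P ?B = (INF U \<in> {U. ?B \<subseteq> U \<and> open U}. emeasure P U)"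
      by (rule outer_regular[OF _ finP]) (auto simp: P_def)
    moreover have "emeasure N ?B \<le> (INF U \<in> {U. ?B \<subseteq> U \<and> open U}. emeasure P U)"
    proof (rule INF_greatest)
      fix U assume U: "U \<in> {U. ?B \<subseteq> U \<and> open U}"
      have "emeasure N ?B \<le> emeasure N U" using U by (intro emeasure_mono) (auto simp: N_def)
      then show "emeasure N ?B \<le> emeasure P U" using NP[of U] U by auto
    qed
    ultimately show ?thesis by simp
  qed
  moreover have "emeasure P ?B = 0"
    by (auto simp: P_def emeasure_density nn_integral_0_iff_AE indicator_def ennreal_neg)
  ultimately have "emeasure N ?B = 0" by simp
  then have "AE x in lborel. ennreal (- G x) * indicator ?B x = 0"
    by (simp add: N_def emeasure_density nn_integral_0_iff_AE)
  then have "AE x in lborel. 0 \<le> G x"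
  proof eventually_elim
    case (elim x)
    then show ?case by (cases "G x < 0") auto
  qed
  then have "AE x in lebesgue. 0 \<le> G x" by (rule AE_completion)
  with ae' show ?thesis by eventually_elim simp
qed

lemma zero_open_integrals_imp_AE:
  fixes F :: "'a::euclidean_space => real"
  assumes F: "integrable lebesgue F"
    and zero: "\<And>U. open U ==> (\<integral>x. indicator U x * F x \<partial>lebesgue) = 0"
  shows "AE x in lebesgue. F x = 0"
proof -
  have "AE x in lebesgue. 0 \<le> F x" by (rule nonneg_open_integrals_imp_AE[OF F]) (simp add: zero)
  moreover have "AE x in lebesgue. 0 \<le> - F x" by (rule nonneg_open_integrals_imp_AE) (use F in \<open>auto simp: zero\<close>)
  ultimately show ?thesis by eventually_elim simp
qed

section \<open>The Hilbert space of classes of square integrable functions\<close>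

definition sq_int :: "('a::euclidean_space => 'b::euclidean_space) => bool" where
  "sq_int f \<longleftrightarrow> f \<in> borel_measurable lebesgue \<and> integrable lebesgue (\<lambda>x. (norm (f x))\<^sup>2)"

lemma sq_intD: "sq_int f ==> f \<in> borel_measurable lebesgue" "sq_int f ==> integrable lebesgue (\<lambda>x. (norm (f x))\<^sup>2)"
  by (auto simp: sq_int_def)

lemma sq_int_bound:
  assumes "sq_int f" "g \<in> borel_measurable lebesgue" "AE x in lebesgue. norm (g x) \<le> C * norm (f x)"
  shows "sq_int g"
  unfolding sq_int_def
proof
  show "integrable lebesgue (\<lambda>x. (norm (g x))\<^sup>2)"
  proof (rule Bochner_Integration.integrable_bound[of lebesgue "\<lambda>x. C\<^sup>2 * (norm (f x))\<^sup>2"])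
    show "AE x in lebesgue. norm ((norm (g x))\<^sup>2) \<le> norm (C\<^sup>2 * (norm (f x))\<^sup>2)"
      using assms(3)
    proof eventually_elim
      case (elim x)
      then have "(norm (g x))\<^sup>2 \<le> (C * norm (f x))\<^sup>2" by (intro power_mono) auto
      then show ?case by (simp add: power_mult_distrib)
    qed
  qed (use assms in \<open>auto simp: sq_int_def\<close>)
qed fact

lemma sq_int_0 [simp]: "sq_int (\<lambda>_. 0)" by (simp add: sq_int_def)

lemma sq_int_cong_AE:
  assumes "sq_int f" "AE x in lebesgue. f x = g x" "g \<in> borel_measurable lebesgue" shows "sq_int g"
  by (rule sq_int_bound[OF assms(1,3), of 1]) (use assms(2) in eventually_elim, simp)

lemma sq_int_add:
  assumes "sq_int f" "sq_int g" shows "sq_int (\<lambda>x. f x + g x)"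
  unfolding sq_int_def
proof
  show "integrable lebesgue (\<lambda>x. (norm (f x + g x))\<^sup>2)"
  proof (rule Bochner_Integration.integrable_bound[of lebesgue "\<lambda>x. 2 * (norm (f x))\<^sup>2 + 2 * (norm (g x))\<^sup>2"])
    have "(norm (a + b))\<^sup>2 \<le> 2 * (norm a)\<^sup>2 + 2 * (norm b)\<^sup>2" for a b :: 'b
    proof -
      have "0 \<le> (norm (a - b))\<^sup>2" by simp
      then show ?thesis by (simp add: power2_norm_eq_inner inner_diff_left inner_diff_right inner_add_left inner_add_right)
    qed
    then show "AE x in lebesgue. norm ((norm (f x + g x))\<^sup>2) \<le> norm (2 * (norm (f x))\<^sup>2 + 2 * (norm (g x))\<^sup>2)"
      by simp
  qed (use assms in \<open>auto simp: sq_int_def\<close>)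
qed (use assms in \<open>auto simp: sq_int_def\<close>)

lemma sq_int_scaleR: "sq_int f ==> sq_int (\<lambda>x. c *\<^sub>R f x)"
  by (rule sq_int_bound[where C = "\<bar>c\<bar>"]) (auto simp: sq_int_def)

lemma integrable_inner_sq_int:
  assumes "sq_int f" "sq_int g" shows "integrable lebesgue (\<lambda>x. f x \<bullet> g x)"
proof (rule Bochner_Integration.integrable_bound[of lebesgue "\<lambda>x. (norm (f x))\<^sup>2 + (norm (g x))\<^sup>2"])
  have "\<bar>a \<bullet> b\<bar> \<le> (norm a)\<^sup>2 + (norm b)\<^sup>2" for a b :: 'b
  proof -
    have "0 \<le> (norm a - norm b)\<^sup>2" by simp
    then have "2 * (norm a * norm b) \<le> (norm a)\<^sup>2 + (norm b)\<^sup>2" by (simp add: power2_diff)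
    moreover have "0 \<le> norm a * norm b" by simp
    ultimately have "norm a * norm b \<le> (norm a)\<^sup>2 + (norm b)\<^sup>2" by linarith
    then show ?thesis using Cauchy_Schwarz_ineq2[of a b] by simp
  qed
  then show "AE x in lebesgue. norm (f x \<bullet> g x) \<le> norm ((norm (f x))\<^sup>2 + (norm (g x))\<^sup>2)" by simp
qed (use assms in \<open>auto simp: sq_int_def\<close>)

\<comment> \<open>The classes form a type, so that the inner product and completeness become class
  instances and the abstract results above apply. The relation is partial: only square integrable
  functions represent a class.\<close>
quotient_type (overloaded) ('a, 'b) l2 = "'a::euclidean_space => 'b::euclidean_space" / partial:
  "\<lambda>f g. sq_int f \<and> sq_int g \<and> (AE x in lebesgue. f x = g x)"
  by (rule part_equivpI)
    (auto intro!: exI[of _ "\<lambda>_. 0"] symI transpI simp: symp_def transp_def elim: AE_mp eventually_elim2)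

definition l2_of :: "('a::euclidean_space => 'b::euclidean_space) => ('a, 'b) l2" where
  "l2_of f = abs_l2 f"

definition fn :: "('a::euclidean_space, 'b::euclidean_space) l2 => 'a => 'b" where
  "fn = rep_l2"

lemma sq_int_fn [simp]: "sq_int (fn a)"
  using Quotient3_rep_reflp[OF Quotient3_l2, of a] by (simp add: fn_def)

lemma measurable_fn [measurable]: "fn a \<in> borel_measurable lebesgue"
  using sq_int_fn sq_intD by blast

lemma l2_of_fn [simp]: "l2_of (fn a) = a"
  by (simp add: l2_of_def fn_def Quotient3_abs_rep[OF Quotient3_l2])

lemma fn_l2_of: "sq_int f ==> AE x in lebesgue. fn (l2_of f) x = f x"
  using Quotient3_rep_abs[OF Quotient3_l2, of f] by (simp add: l2_of_def fn_def)

lemma l2_of_eq: "sq_int f ==> sq_int g ==> l2_of f = l2_of g \<longleftrightarrow> (AE x in lebesgue. f x = g x)"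
  using Quotient3_rel[OF Quotient3_l2, of f g] by (auto simp: l2_of_def)

lemma l2_eqI: "(AE x in lebesgue. fn a x = fn b x) ==> a = b"
  using l2_of_eq[of "fn a" "fn b"] by simp

instantiation l2 :: (euclidean_space, euclidean_space) real_inner
begin

definition "0 = l2_of (\<lambda>_. 0)"
definition "a + b = l2_of (\<lambda>x. fn a x + fn b x)"
definition "- a = l2_of (\<lambda>x. - fn a x)"
definition "a - b = a + (- (b::('a,'b) l2))"
definition "r *\<^sub>R a = l2_of (\<lambda>x. r *\<^sub>R fn a x)"
definition "a \<bullet> b = (\<integral>x. fn a x \<bullet> fn b x \<partial>lebesgue)"
definition "norm (a :: ('a, 'b) l2) = sqrt (a \<bullet> a)"
definition "sgn (a :: ('a, 'b) l2) = inverse (norm a) *\<^sub>R a"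
definition "dist (a :: ('a, 'b) l2) b = norm (a - b)"
definition [code del]: "(uniformity :: (('a, 'b) l2 \<times> ('a, 'b) l2) filter) = (INF e\<in>{0 <..}. principal {(x, y). dist x y < e})"
definition [code del]: "open (U :: ('a, 'b) l2 set) \<longleftrightarrow> (\<forall>x\<in>U. eventually (\<lambda>(x', y). x' = x \<longrightarrow> y \<in> U) uniformity)"

lemma fn_0': "AE x in lebesgue. fn (0 :: ('a, 'b) l2) x = 0" unfolding zero_l2_def by (rule fn_l2_of) simp
lemma fn_add': "AE x in lebesgue. fn (a + b :: ('a, 'b) l2) x = fn a x + fn b x"
  unfolding plus_l2_def by (rule fn_l2_of) (simp add: sq_int_add)
lemma fn_scaleR': "AE x in lebesgue. fn (r *\<^sub>R a :: ('a, 'b) l2) x = r *\<^sub>R fn a x"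
  unfolding scaleR_l2_def by (rule fn_l2_of) (simp add: sq_int_scaleR)
lemma fn_minus': "AE x in lebesgue. fn (- a :: ('a, 'b) l2) x = - fn a x"
  unfolding uminus_l2_def by (rule fn_l2_of) (use sq_int_scaleR[of "fn a" "-1"] in simp)

instance
proof
  fix a b c :: "('a, 'b) l2" and r s :: real
  show "a + b + c = a + (b + c)"
    by (rule l2_eqI) (use fn_add'[of "a + b" c] fn_add'[of a b] fn_add'[of a "b + c"] fn_add'[of b c] in eventually_elim, simp)
  show "a + b = b + a"
    by (rule l2_eqI) (use fn_add'[of a b] fn_add'[of b a] in eventually_elim, simp)
  show "0 + a = a"
    by (rule l2_eqI) (use fn_add'[of 0 a] fn_0' in eventually_elim, simp)
  show "- a + a = 0"
    by (rule l2_eqI) (use fn_add'[of "- a" a] fn_0' fn_minus'[of a] in eventually_elim, simp)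
  show "a - b = a + - b" by (simp add: minus_l2_def)
  show "r *\<^sub>R (a + b) = r *\<^sub>R a + r *\<^sub>R b"
    by (rule l2_eqI) (use fn_add'[of a b] fn_scaleR'[of r "a + b"] fn_scaleR'[of r a] fn_scaleR'[of r b]
        fn_add'[of "r *\<^sub>R a" "r *\<^sub>R b"] in eventually_elim, simp add: scaleR_add_right)
  show "(r + s) *\<^sub>R a = r *\<^sub>R a + s *\<^sub>R a"
    by (rule l2_eqI) (use fn_scaleR'[of "r + s" a] fn_scaleR'[of r a] fn_scaleR'[of s a]
        fn_add'[of "r *\<^sub>R a" "s *\<^sub>R a"] in eventually_elim, simp add: scaleR_add_left)
  show "r *\<^sub>R s *\<^sub>R a = (r * s) *\<^sub>R a"
    by (rule l2_eqI) (use fn_scaleR'[of r "s *\<^sub>R a"] fn_scaleR'[of s a] fn_scaleR'[of "r * s" a] in eventually_elim, simp)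
  show "1 *\<^sub>R a = a"
    by (rule l2_eqI) (use fn_scaleR'[of 1 a] in eventually_elim, simp)
  show "a \<bullet> b = b \<bullet> a" by (simp add: inner_l2_def inner_commute)
  show "(a + b) \<bullet> c = a \<bullet> c + b \<bullet> c"
  proof -
    have "(a + b) \<bullet> c = (\<integral>x. fn a x \<bullet> fn c x + fn b x \<bullet> fn c x \<partial>lebesgue)"
      unfolding inner_l2_def
      by (rule integral_cong_AE) (measurable, use fn_add'[of a b] in eventually_elim, simp add: inner_add_left)
    then show ?thesis by (simp add: inner_l2_def integrable_inner_sq_int)
  qed
  show "r *\<^sub>R a \<bullet> b = r * (a \<bullet> b)"
  proof -
    have "r *\<^sub>R a \<bullet> b = (\<integral>x. r * (fn a x \<bullet> fn b x) \<partial>lebesgue)"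
      unfolding inner_l2_def
      by (rule integral_cong_AE) (measurable, use fn_scaleR'[of r a] in eventually_elim, simp)
    then show ?thesis by (simp add: inner_l2_def)
  qed
  show "0 \<le> a \<bullet> a" by (simp add: inner_l2_def)
  show "a \<bullet> a = 0 \<longleftrightarrow> a = 0"
  proof
    assume "a \<bullet> a = 0"
    then have "AE x in lebesgue. fn a x \<bullet> fn a x = 0"
      by (subst (asm) inner_l2_def, subst (asm) integral_nonneg_eq_0_iff_AE) (auto simp: integrable_inner_sq_int)
    moreover have "AE x in lebesgue. fn (0 :: ('a, 'b) l2) x = 0" by (rule fn_0')
    ultimately have "AE x in lebesgue. fn a x = fn 0 x" by eventually_elim simp
    then show "a = 0" by (rule l2_eqI)
  next
    assume [simp]: "a = 0"
    have "a \<bullet> a = (\<integral>x. 0 \<partial>(lebesgue :: 'a measure))"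
      unfolding inner_l2_def by (rule integral_cong_AE) (measurable, use fn_0' in eventually_elim, simp)
    then show "a \<bullet> a = 0" by simp
  qed
  show "norm a = sqrt (a \<bullet> a)" by (simp add: norm_l2_def)
  show "sgn a = inverse (norm a) *\<^sub>R a" by (simp add: sgn_l2_def)
  show "dist a b = norm (a - b)" by (simp add: dist_l2_def)
  show "(uniformity :: (('a, 'b) l2 \<times> ('a, 'b) l2) filter) = (INF e\<in>{0 <..}. principal {(x, y). dist x y < e})"
    by (simp add: uniformity_l2_def)
  show "open U \<longleftrightarrow> (\<forall>x\<in>U. eventually (\<lambda>(x', y). x' = x \<longrightarrow> y \<in> U) uniformity)" for U :: "('a, 'b) l2 set"
    by (simp add: open_l2_def)
qed

end

lemmas fn_0 = fn_0' and fn_add = fn_add' and fn_scaleR = fn_scaleR' and fn_minus = fn_minus'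

lemma fn_diff: "AE x in lebesgue. fn (a - b) x = fn a x - fn b x"
  using fn_add[of a "- b"] fn_minus[of b] by eventually_elim simp

lemma power2_norm_l2: "(norm (a::('a::euclidean_space,'b::euclidean_space) l2))\<^sup>2 = (\<integral>x. (norm (fn a x))\<^sup>2 \<partial>lebesgue)"
  by (simp add: power2_norm_eq_inner inner_l2_def)

lemma nn_integral_power2_norm_l2: "(\<integral>\<^sup>+x. ennreal ((norm (fn a x))\<^sup>2) \<partial>lebesgue) = ennreal ((norm a)\<^sup>2)"
  unfolding power2_norm_l2 by (rule nn_integral_eq_integral) (auto simp: sq_intD)

lemma inner_l2_of:
  assumes "sq_int f" "sq_int g"
  shows "l2_of f \<bullet> l2_of g = (\<integral>x. f x \<bullet> g x \<partial>lebesgue)"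
  unfolding inner_l2_def
  by (rule integral_cong_AE) (use assms in \<open>auto simp: sq_intD intro!: borel_measurable_inner\<close>,
      use fn_l2_of[OF assms(1)] fn_l2_of[OF assms(2)] in eventually_elim, simp)

text \<open>Riesz-Fischer: a rapidly convergent subsequence converges almost everywhere, and Fatou's
  lemma shows that the pointwise limit is also the limit in norm.\<close>

instance l2 :: (euclidean_space, euclidean_space) complete_space
proof
  fix X :: "nat => ('a, 'b) l2" assume "Cauchy X"
  have "\<exists>N. \<forall>m\<ge>N. \<forall>n\<ge>N. norm (X m - X n) < (1/4)^k" for k :: nat
    using CauchyD[OF \<open>Cauchy X\<close>, of "(1/4)^k"] by simp
  then obtain N where N: "\<And>k m n. m \<ge> N k ==> n \<ge> N k ==> norm (X m - X n) < (1/4)^k" by metis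
  \<comment> \<open>Partial sums are increasing and still dominate \<open>N\<close>.\<close>
  define M where "M k = (\<Sum>i\<le>k. N i)" for k
  have M: "N k \<le> M k" "M k \<le> M (Suc k)" for k
    by (auto simp: M_def intro: member_le_sum)
  define Y where "Y k = X (M k)" for k
  have Y: "norm (Y (Suc k) - Y k) < (1/4)^k" for k
    unfolding Y_def using M[of k] by (intro N) auto
  \<comment> \<open>With differences below 4^-k in norm, the weight 4^k leaves a convergent
    integral; where the weighted sum is finite, the differences decay like 2^-k and are
    summable.\<close>
  let ?d = "\<lambda>k x. norm (fn (Y (Suc k) - Y k) x)"
  have "(\<integral>\<^sup>+x. (\<Sum>k. ennreal (4^k * (?d k x)\<^sup>2)) \<partial>lebesgue) = (\<Sum>k. \<integral>\<^sup>+x. ennreal (4^k * (?d k x)\<^sup>2) \<partial>lebesgue)"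
    by (rule nn_integral_suminf) simp
  also have "\<dots> = (\<Sum>k. ennreal (4^k * (norm (Y (Suc k) - Y k))\<^sup>2))"
    by (simp add: ennreal_mult' nn_integral_cmult nn_integral_power2_norm_l2)
  also have "\<dots> \<le> (\<Sum>k. ennreal ((1/4)^k))"
  proof (intro suminf_le ennreal_leI)
    fix k
    have "(norm (Y (Suc k) - Y k))\<^sup>2 \<le> ((1/4)^k)\<^sup>2" using Y[of k] by (intro power_mono) auto
    then have "4^k * (norm (Y (Suc k) - Y k))\<^sup>2 \<le> 4^k * ((1/4)^k)\<^sup>2" by (intro mult_left_mono) auto
    also have "\<dots> = (1/4::real)^k" by (simp add: power2_eq_square power_divide field_simps)
    finally show "4^k * (norm (Y (Suc k) - Y k))\<^sup>2 \<le> (1/4)^k" .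
  qed auto
  also have "\<dots> < \<infinity>" by (subst suminf_ennreal2) (auto intro!: summable_geometric)
  finally have "(\<integral>\<^sup>+x. (\<Sum>k. ennreal (4^k * (?d k x)\<^sup>2)) \<partial>lebesgue) \<noteq> \<infinity>" by simp
  then have "AE x in lebesgue. (\<Sum>k. ennreal (4^k * (?d k x)\<^sup>2)) \<noteq> \<infinity>"
    by (intro nn_integral_PInf_AE) auto
  moreover have "AE x in lebesgue. \<forall>k. fn (Y (Suc k) - Y k) x = fn (Y (Suc k)) x - fn (Y k) x"
    by (subst AE_all_countable) (intro allI fn_diff)
  ultimately have conv: "AE x in lebesgue. convergent (\<lambda>k. fn (Y k) x)"
  proof eventually_elim
    case (elim x)
    define K where "K = enn2real (\<Sum>k. ennreal (4^k * (?d k x)\<^sup>2))"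
    have K: "(\<Sum>k. ennreal (4^k * (?d k x)\<^sup>2)) = ennreal K" "0 \<le> K"
      unfolding K_def using elim(1) by (simp_all only: ennreal_enn2real_if if_False infinity_ennreal_def enn2real_nonneg)
    have bound: "?d k x \<le> sqrt K * (1/2)^k" for k
    proof -
      have "sum (\<lambda>k. ennreal (4^k * (?d k x)\<^sup>2)) {k} \<le> (\<Sum>k. ennreal (4^k * (?d k x)\<^sup>2))"
        by (rule sum_le_suminf) simp_all
      also have "\<dots> = ennreal K" by (rule K(1))
      finally have "ennreal (4^k * (?d k x)\<^sup>2) \<le> ennreal K" by simp
      then have "4^k * (?d k x)\<^sup>2 \<le> K" using K(2) by simp
      moreover have "(2^k)\<^sup>2 = (4::real)^k" by (simp add: power2_eq_square power_mult_distrib[symmetric])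
      ultimately have "(2^k * ?d k x)\<^sup>2 \<le> K" by (simp only: power_mult_distrib)
      then have "2^k * ?d k x \<le> sqrt K" by (rule real_le_rsqrt)
      then show ?thesis by (simp add: power_divide field_simps)
    qed
    have "summable (\<lambda>k. sqrt K * (1/2)^k)" by (intro summable_mult summable_geometric) simp
    then have "summable (\<lambda>k. fn (Y (Suc k) - Y k) x)"
      by (rule summable_comparison_test[rotated]) (use bound in auto)
    then have "summable (\<lambda>k. fn (Y (Suc k)) x - fn (Y k) x)" using elim(2) by simp
    then have "convergent (\<lambda>n. \<Sum>k<n. fn (Y (Suc k)) x - fn (Y k) x)"
      by (simp add: summable_iff_convergent)
    then have "convergent (\<lambda>n. fn (Y n) x - fn (Y 0) x)" 
      by (simp only: sum_lessThan_telescope[of "\<lambda>k. fn (Y k) x"])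
    then show ?case using convergent_add[OF _ convergent_const, of "\<lambda>n. fn (Y n) x - fn (Y 0) x" "fn (Y 0) x"] by simp
  qed
  define g where "g x = lim (\<lambda>k. fn (Y k) x)" for x
  have g_meas[measurable]: "g \<in> borel_measurable lebesgue" unfolding g_def by measurable
  have g: "AE x in lebesgue. (\<lambda>k. fn (Y k) x) \<longlonglongrightarrow> g x"
    using conv by eventually_elim (simp add: g_def convergent_LIMSEQ_iff)
  \<comment> \<open>Fatou in the second index yields square integrability of the limit and the rate
    of convergence together.\<close>
  have fatou: "(\<integral>\<^sup>+x. ennreal ((norm (g x - fn (Y k) x))\<^sup>2) \<partial>lebesgue) \<le> ennreal (((1/4)^k)\<^sup>2)" for k
  proof -
    have "(\<integral>\<^sup>+x. ennreal ((norm (g x - fn (Y k) x))\<^sup>2) \<partial>lebesgue)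
        = (\<integral>\<^sup>+x. liminf (\<lambda>n. ennreal ((norm (fn (Y n) x - fn (Y k) x))\<^sup>2)) \<partial>lebesgue)"
    proof (rule nn_integral_cong_AE, use g in eventually_elim)
      case (elim x)
      then have "(\<lambda>n. ennreal ((norm (fn (Y n) x - fn (Y k) x))\<^sup>2)) \<longlonglongrightarrow> ennreal ((norm (g x - fn (Y k) x))\<^sup>2)"
        by (intro tendsto_ennrealI tendsto_intros)
      then show ?case by (rule lim_imp_Liminf[OF sequentially_bot, symmetric])
    qed
    also have "\<dots> \<le> liminf (\<lambda>n. \<integral>\<^sup>+x. ennreal ((norm (fn (Y n) x - fn (Y k) x))\<^sup>2) \<partial>lebesgue)"
      by (rule nn_integral_liminf) measurable
    also have "\<dots> = liminf (\<lambda>n. ennreal ((norm (Y n - Y k))\<^sup>2))"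
    proof -
      have "(\<integral>\<^sup>+x. ennreal ((norm (fn (Y n) x - fn (Y k) x))\<^sup>2) \<partial>lebesgue) = ennreal ((norm (Y n - Y k))\<^sup>2)" for n
        unfolding nn_integral_power2_norm_l2[symmetric]
        by (rule nn_integral_cong_AE, use fn_diff[of "Y n" "Y k"] in eventually_elim) simp
      then show ?thesis by simp
    qed
    also have "\<dots> \<le> ennreal (((1/4)^k)\<^sup>2)"
    proof (rule Liminf_le)
      have "ennreal ((norm (Y n - Y k))\<^sup>2) \<le> ennreal (((1/4)^k)\<^sup>2)" if "n \<ge> k" for n
      proof -
        have "M k \<le> M n" using lift_Suc_mono_le[of M, OF M(2) that] .
        then have "norm (Y n - Y k) < (1/4)^k" unfolding Y_def using M(1)[of k] by (intro N) auto
        then show ?thesis by (intro ennreal_leI power_mono) auto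
      qed
      then show "\<forall>\<^sub>F n in sequentially. ennreal ((norm (Y n - Y k))\<^sup>2) \<le> ennreal (((1/4)^k)\<^sup>2)"
        by (auto simp: eventually_sequentially)
    qed simp
    finally show ?thesis .
  qed
  have sq_diff: "sq_int (\<lambda>x. g x - fn (Y k) x)" for k
    unfolding sq_int_def using fatou[of k]
    by (auto simp: integrable_iff_bounded intro: le_less_trans)
  have sq: "sq_int g" using sq_int_add[OF sq_diff[of 0] sq_int_fn[of "Y 0"]] by simp
  have close: "norm (l2_of g - Y k) \<le> (1/4)^k" for k
  proof -
    have "ennreal ((norm (l2_of g - Y k))\<^sup>2) = (\<integral>\<^sup>+x. ennreal ((norm (g x - fn (Y k) x))\<^sup>2) \<partial>lebesgue)"
      unfolding nn_integral_power2_norm_l2[symmetric]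
      by (rule nn_integral_cong_AE, use fn_diff[of "l2_of g" "Y k"] fn_l2_of[OF sq] in eventually_elim) simp
    then have "ennreal ((norm (l2_of g - Y k))\<^sup>2) \<le> ennreal (((1/4)^k)\<^sup>2)" using fatou[of k] by (simp only:)
    then have "(norm (l2_of g - Y k))\<^sup>2 \<le> ((1/4)^k)\<^sup>2" by (subst (asm) ennreal_le_iff) simp_all
    then show ?thesis by (rule power2_le_imp_le) simp
  qed
  have "X \<longlonglongrightarrow> l2_of g"
  proof (rule LIMSEQ_I)
    fix e :: real assume "0 < e"
    then obtain k where k: "(1/4)^k < e / 2" using real_arch_pow_inv[of "e/2" "1/4"] by auto
    have "norm (X n - l2_of g) < e" if "n \<ge> N k" for n
    proof -
      have "norm (X n - Y k) < (1/4)^k" using N[OF that M(1)[of k]] by (simp add: Y_def)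
      then show ?thesis using close[of k] k norm_triangle_ineq4[of "X n - Y k" "l2_of g - Y k"] by simp
    qed
    then show "\<exists>no. \<forall>n\<ge>no. norm (X n - l2_of g) < e" by blast
  qed
  then show "convergent X" by (auto simp: convergent_def)
qed

lemma integrable_fn_bounded_set:
  assumes "bounded S" "S \<in> sets lebesgue"
  shows "integrable lebesgue (\<lambda>x. indicator S x *\<^sub>R fn a x)"
proof (rule Bochner_Integration.integrable_bound[of lebesgue "\<lambda>x. indicator S x + (norm (fn a x))\<^sup>2"])
  have "S \<in> lmeasurable" using assms by (simp add: bounded_set_imp_lmeasurable)
  then show "integrable lebesgue (\<lambda>x. indicator S x + (norm (fn a x))\<^sup>2)"
    by (intro Bochner_Integration.integrable_add) (auto simp: sq_intD lmeasurable_iff_integrable)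
  have "t \<le> 1 + t\<^sup>2" for t :: real
  proof -
    have "0 \<le> (t - 1/2)\<^sup>2" by simp
    then show ?thesis by (simp add: power2_diff power_divide)
  qed
  then show "AE x in lebesgue. norm (indicator S x *\<^sub>R fn a x) \<le> norm (indicator S x + (norm (fn a x))\<^sup>2)"
    by (auto simp: indicator_def)
  show "(\<lambda>x. indicator S x *\<^sub>R fn a x) \<in> borel_measurable lebesgue" using assms(2) by measurable
qed

text \<open>The family consists of indicators of finite unions of basic open sets, cut off by balls,
  times basis vectors. Finite unions exhaust every open set monotonically, so a vector orthogonal to
  the family has vanishing integrals over open sets in each ball.\<close>

lemma countable_total_l2:
  obtains e :: "nat => ('a::euclidean_space, 'b::euclidean_space) l2"
  where "\<And>v. (\<And>k. v \<bullet> e k = 0) ==> v = 0"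
proof -
  obtain \<B> :: "'a set set" where \<B>: "countable \<B>" "topological_basis \<B>" using ex_countable_basis by blast
  have opB: "open A" if "A \<in> \<B>" for A using topological_basis_open[OF \<B>(2) that] .
  define I where "I = {C. finite C \<and> C \<subseteq> \<B>} \<times> (UNIV :: nat set) \<times> (Basis :: 'b set)"
  have cI: "countable I" unfolding I_def
    by (intro countable_SIGMA countable_Collect_finite_subset \<B>(1)) (auto intro: countable_finite)
  define E where "E = (\<lambda>(C, N, b). l2_of (\<lambda>x. indicator (\<Union>C \<inter> ball 0 (real N)) x *\<^sub>R (b::'b)) :: ('a, 'b) l2) ` I"
  have cE: "countable E" unfolding E_def using cI by simp
  have neE: "E \<noteq> {}" unfolding E_def I_def using nonempty_Basis by auto
  have total: "v = 0" if v: "\<And>a. a \<in> E ==> v \<bullet> a = 0" for v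
  proof -
    have sq: "sq_int (\<lambda>x. indicator (U \<inter> ball 0 (real N)) x *\<^sub>R b)" if "open U" for U :: "'a set" and N and b :: 'b
    proof -
      have "U \<inter> ball 0 (real N) \<in> lmeasurable" using that by (intro bounded_set_imp_lmeasurable) auto
      then have "integrable lebesgue (\<lambda>x. (norm b)\<^sup>2 * indicator (U \<inter> ball 0 (real N)) x :: real)"
        by (intro integrable_mult_right) (simp add: lmeasurable_iff_integrable)
      moreover have "(\<lambda>x. (norm (indicator (U \<inter> ball 0 (real N)) x *\<^sub>R b))\<^sup>2) = (\<lambda>x. (norm b)\<^sup>2 * indicator (U \<inter> ball 0 (real N)) x)"
        by (auto simp: indicator_def)
      ultimately show ?thesis using that by (simp add: sq_int_def) (intro borel_measurable_scaleR borel_measurable_indicator, auto)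
    qed
    have zero: "(\<integral>x. indicator (\<Union>C \<inter> ball 0 (real N)) x * (fn v x \<bullet> b) \<partial>lebesgue) = 0"
      if C: "finite C" "C \<subseteq> \<B>" and b: "b \<in> Basis" for C N b
    proof -
      have op: "open (\<Union>C)" using C opB by auto
      have "l2_of (\<lambda>x. indicator (\<Union>C \<inter> ball 0 (real N)) x *\<^sub>R b) \<in> E" unfolding E_def I_def using C b by force
      from v[OF this] inner_l2_of[OF sq_int_fn sq[OF op], of v N b] show ?thesis by (simp add: mult.commute)
    qed
    have "AE x in lebesgue. indicator (ball 0 (real N)) x * (fn v x \<bullet> b) = 0" if b: "b \<in> Basis" for N b
    proof (rule zero_open_integrals_imp_AE)
      let ?F = "\<lambda>x. indicator (ball 0 (real N)) x * (fn v x \<bullet> b)"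
      have "integrable lebesgue (\<lambda>x. (indicator (ball 0 (real N)) x *\<^sub>R fn v x) \<bullet> b)"
        by (intro integrable_inner_left integrable_fn_bounded_set) auto
      then show F: "integrable lebesgue ?F" by simp
      fix U :: "'a set" assume U: "open U"
      obtain \<D> where D: "\<D> \<subseteq> \<B>" "U = \<Union>\<D>" using U \<B>(2) by (auto simp: topological_basis_def)
      have cD: "countable \<D>" using D(1) \<B>(1) countable_subset by blast
      \<comment> \<open>Members of the cover with code at most \<open>n\<close>: a finite union,
        increasing to \<open>U\<close>.\<close>
      define W where "W n = \<Union>{A \<in> \<D>. to_nat_on \<D> A \<le> n}" for n
      have fin: "finite {A \<in> \<D>. to_nat_on \<D> A \<le> n}" for n
      proof (rule inj_on_finite)
        show "inj_on (to_nat_on \<D>) {A \<in> \<D>. to_nat_on \<D> A \<le> n}"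
          using inj_on_to_nat_on[OF cD] by (rule inj_on_subset) auto
        show "to_nat_on \<D> ` {A \<in> \<D>. to_nat_on \<D> A \<le> n} \<subseteq> {..n}" by auto
      qed simp
      have Wop: "open (W n)" for n using D(1) opB by (auto simp: W_def)
      have "(\<lambda>n. \<integral>x. indicator (W n) x * ?F x \<partial>lebesgue) \<longlonglongrightarrow> (\<integral>x. indicator U x * ?F x \<partial>lebesgue)"
      proof (rule integral_dominated_convergence[where w = "\<lambda>x. norm (?F x)"])
        show "AE x in lebesgue. (\<lambda>n. indicator (W n) x * ?F x) \<longlonglongrightarrow> indicator U x * ?F x"
        proof (rule AE_I2)
          fix x
          have "(\<lambda>n. indicator (W n) x :: real) \<longlonglongrightarrow> indicator U x"
          proof (cases "x \<in> U")
            case True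
            then obtain A where "A \<in> \<D>" "x \<in> A" using D by auto
            then have "x \<in> W n" if "n \<ge> to_nat_on \<D> A" for n using that by (auto simp: W_def)
            then have "\<forall>\<^sub>F n in sequentially. indicator (W n) x = (indicator U x :: real)"
              using True unfolding eventually_sequentially by (intro exI[of _ "to_nat_on \<D> A"]) simp
            then show ?thesis by (rule tendsto_eventually)
          next
            case False
            then have "x \<notin> W n" for n using D by (auto simp: W_def)
            then show ?thesis using False by simp
          qed
          then show "(\<lambda>n. indicator (W n) x * ?F x) \<longlonglongrightarrow> indicator U x * ?F x" by (intro tendsto_intros)
        qed
        show "integrable lebesgue (\<lambda>x. norm (?F x))" using F by simp
        show "(\<lambda>x. indicator U x * ?F x) \<in> borel_measurable lebesgue"
          using U F by (intro borel_measurable_times borel_measurable_indicator) auto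
        show "(\<lambda>x. indicator (W n) x * ?F x) \<in> borel_measurable lebesgue" for n
          using Wop F by (intro borel_measurable_times borel_measurable_indicator) auto
      qed (auto simp: indicator_def)
      moreover have "(\<integral>x. indicator (W n) x * ?F x \<partial>lebesgue) = 0" for n
      proof -
        have "(\<lambda>x. indicator (W n) x * ?F x) = (\<lambda>x. indicator (W n \<inter> ball 0 (real N)) x * (fn v x \<bullet> b))"
          by (auto simp: indicator_def)
        then show ?thesis unfolding W_def using zero[OF fin _ b] D(1) by auto
      qed
      ultimately show "(\<integral>x. indicator U x * ?F x \<partial>lebesgue) = 0" by (simp add: LIMSEQ_const_iff)
    qed
    then have "AE x in lebesgue. \<forall>N. \<forall>b\<in>Basis. indicator (ball 0 (real N)) x * (fn v x \<bullet> b) = 0"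
      by (subst AE_all_countable) (intro allI AE_finite_allI finite_Basis)
    then have "AE x in lebesgue. fn v x = 0"
    proof eventually_elim
      case (elim x)
      obtain N :: nat where "norm x < real N" using reals_Archimedean2 by blast
      then have "fn v x \<bullet> b = 0" if "b \<in> Basis" for b
        using elim that by (metis indicator_simps(1) mem_ball_0 mult_1)
      then show ?case by (metis euclidean_all_zero_iff)
    qed
    then have "AE x in lebesgue. fn v x = fn 0 x" 
      using fn_0 by eventually_elim simp
    then show "v = 0" by (rule l2_eqI)
  qed
  show thesis
    by (rule that[of "from_nat_into E"]) (metis total cE neE from_nat_into_surj)
qed

text \<open>Coefficient matrices, cut-offs, component projections and commutators all act on
  \<open>l2\<close> in this way. Measurability in \<open>x\<close> is expressed through the action
  on measurable functions, which is exactly what \<open>ptw\<close> requires.\<close>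

definition ptw_bounded :: "real => ('a::euclidean_space => 'b::euclidean_space => 'c::euclidean_space) => bool" where
  "ptw_bounded C K \<longleftrightarrow> (\<forall>x. linear (K x)) \<and>
     (\<forall>f\<in>borel_measurable lebesgue. (\<lambda>x. K x (f x)) \<in> borel_measurable lebesgue) \<and>
     (AE x in lebesgue. \<forall>y. norm (K x y) \<le> C * norm y)"

definition ptw :: "('a::euclidean_space => 'b::euclidean_space => 'c::euclidean_space) => ('a, 'b) l2 => ('a, 'c) l2" where
  "ptw K a = l2_of (\<lambda>x. K x (fn a x))"

context
  fixes C :: real and K :: "'a::euclidean_space => 'b::euclidean_space => 'c::euclidean_space"
  assumes K: "ptw_bounded C K"
begin

lemma sq_int_ptw: "sq_int f ==> sq_int (\<lambda>x. K x (f x))"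
proof (rule sq_int_bound[where C = C])
  show "AE x in lebesgue. norm (K x (f x)) \<le> C * norm (f x)"
    using K unfolding ptw_bounded_def by (auto elim!: AE_mp)
qed (use K in \<open>auto simp: ptw_bounded_def sq_int_def\<close>)

lemma fn_ptw: "AE x in lebesgue. fn (ptw K a) x = K x (fn a x)"
  unfolding ptw_def by (rule fn_l2_of[OF sq_int_ptw]) simp

lemma ptw_l2_of: "sq_int f ==> ptw K (l2_of f) = l2_of (\<lambda>x. K x (f x))"
  by (rule l2_eqI) (use fn_ptw[of "l2_of f"] fn_l2_of[of f] fn_l2_of[OF sq_int_ptw, of f] in \<open>auto elim!: AE_mp\<close>)

lemma norm_ptw: "norm (ptw K a) \<le> \<bar>C\<bar> * norm a"
proof -
  have "(norm (ptw K a))\<^sup>2 \<le> (\<integral>x. C\<^sup>2 * (norm (fn a x))\<^sup>2 \<partial>lebesgue)"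
    unfolding power2_norm_l2
  proof (rule integral_mono_AE)
    have "AE x in lebesgue. \<forall>y. norm (K x y) \<le> C * norm y" using K by (simp add: ptw_bounded_def)
    then show "AE x in lebesgue. (norm (fn (ptw K a) x))\<^sup>2 \<le> C\<^sup>2 * (norm (fn a x))\<^sup>2"
      using fn_ptw[of a]
    proof eventually_elim
      case (elim x)
      then have "(norm (fn (ptw K a) x))\<^sup>2 \<le> (C * norm (fn a x))\<^sup>2" by (intro power_mono) auto
      then show ?case by (simp add: power_mult_distrib)
    qed
  qed (auto simp: sq_intD)
  also have "\<dots> = (\<bar>C\<bar> * norm a)\<^sup>2" by (simp add: power2_norm_l2 power_mult_distrib)
  finally show ?thesis by (rule power2_le_imp_le) simp
qed

lemma bounded_linear_ptw: "bounded_linear (ptw K)"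
proof (rule bounded_linear_intro[where K = "\<bar>C\<bar>"])
  have lin: "linear (K x)" for x using K by (simp add: ptw_bounded_def)
  show "ptw K (a + b) = ptw K a + ptw K b" for a b
    by (rule l2_eqI) (use fn_ptw[of "a + b"] fn_ptw[of a] fn_ptw[of b] fn_add[of a b] fn_add[of "ptw K a" "ptw K b"] in eventually_elim,
        simp add: linear_add[OF lin])
  show "ptw K (r *\<^sub>R a) = r *\<^sub>R ptw K a" for r a
    by (rule l2_eqI) (use fn_ptw[of "r *\<^sub>R a"] fn_ptw[of a] fn_scaleR[of r a] fn_scaleR[of r "ptw K a"] in eventually_elim,
        simp add: linear_scale[OF lin])
  show "norm (ptw K a) \<le> norm a * \<bar>C\<bar>" for a using norm_ptw[of a] by (simp add: mult.commute)
qed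

lemma inner_ptw: "ptw K a \<bullet> b = (\<integral>x. K x (fn a x) \<bullet> fn b x \<partial>lebesgue)"
  unfolding inner_l2_def
  by (rule integral_cong_AE) (use sq_intD(1)[OF sq_int_ptw[OF sq_int_fn]] in \<open>auto intro!: borel_measurable_inner\<close>,
      use fn_ptw[of a] in eventually_elim, simp)

end

section \<open>Lipschitz functions and integration by parts\<close>

text \<open>The points where difference quotients over intervals around \<open>x\<close> drop below
  \<open>p\<close> and exceed \<open>q\<close> at arbitrarily small scales. With strict inequalities
  each scale contributes an open set, so this is a G-delta set.\<close>

definition osc_set :: "(real => real) => real => real => real set" where
  "osc_set f p q = {x. (\<forall>n::nat. \<exists>a b. a < x \<and> x < b \<and> b - a < 1 / Suc n \<and> f b - f a < p * (b - a)) \<and>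
     (\<forall>n::nat. \<exists>a b. a < x \<and> x < b \<and> b - a < 1 / Suc n \<and> q * (b - a) < f b - f a)}"

text \<open>Increasing functions with sum the identity are 1-Lipschitz, so their Stieltjes measures
  have no atoms, and the increments add up to the length of every interval. In particular each of
  the two measures is dominated by Lebesgue measure.\<close>

lemma interval_measure_add_eq_lborel:
  fixes F G :: "real => real"
  assumes F: "mono F" and G: "mono G" and FG: "\<And>x. F x + G x = x"
    and A: "A \<in> sets borel"
  shows "emeasure (interval_measure F) A + emeasure (interval_measure G) A = emeasure lborel A"
proof -
  have lip: "\<bar>F x - F y\<bar> \<le> \<bar>x - y\<bar>" "\<bar>G x - G y\<bar> \<le> \<bar>x - y\<bar>" for x y
    using FG[of x] FG[of y] monoD[OF F, of x y] monoD[OF F, of y x] monoD[OF G, of x y] monoD[OF G, of y x] by linarith+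
  have "1-lipschitz_on UNIV F" "1-lipschitz_on UNIV G"
    using lip by (auto intro!: lipschitz_onI simp: dist_real_def)
  then have cont: "continuous_on UNIV F" "continuous_on UNIV G" by (auto intro: lipschitz_on_continuous_on)
  have contw: "continuous (at_right x) F" "continuous (at_right x) G" for x
    using cont by (auto simp: continuous_on_eq_continuous_within intro: continuous_within_subset)
  define m where "m A = emeasure (interval_measure F) A + emeasure (interval_measure G) A" for A
  define M where "M = measure_of UNIV (sets borel) m"
  have sM: "sets M = sets borel" unfolding M_def using sets.sigma_sets_eq[of "borel::real measure"] by simp
  have M: "emeasure M A = m A" if "A \<in> sets borel" for A
    unfolding M_def
  proof (rule emeasure_measure_of_sigma)
    show "sigma_algebra UNIV (sets (borel :: real measure))"
      using sets.sigma_algebra_axioms[of "borel::real measure"] by simp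
    show "positive (sets borel) m" by (auto simp: positive_def m_def)
    show "countably_additive (sets borel) m"
    proof (rule countably_additiveI)
      fix B :: "nat => real set" assume B: "range B \<subseteq> sets borel" "disjoint_family B" "(\<Union>i. B i) \<in> sets borel"
      have "(\<Sum>i. m (B i)) = (\<Sum>i. emeasure (interval_measure F) (B i)) + (\<Sum>i. emeasure (interval_measure G) (B i))"
        unfolding m_def by (rule suminf_add[symmetric]) auto
      then show "(\<Sum>i. m (B i)) = m (\<Union>i. B i)"
        using B by (simp add: m_def suminf_emeasure)
    qed
  qed (use that in auto)
  have "lborel = M"
  proof (rule lborel_eqI)
    fix l u :: real assume lu: "\<And>b. b \<in> Basis ==> l \<bullet> b \<le> u \<bullet> b"
    then have le: "l \<le> u" by simp
    have "emeasure (interval_measure H) {l<..<u} = ennreal (H u - H l)" if H: "mono H" "continuous_on UNIV H" for H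
    proof (cases "l = u")
      case False
      then have "{l..u} = {l<..<u} \<union> {l} \<union> {u}" using le by auto
      have sing: "emeasure (interval_measure H) {x} = 0" for x
        using emeasure_interval_measure_Icc[of x x H] H by (auto simp: mono_def)
      have "{l<..u} = {l<..<u} \<union> {u}" using False le by auto
      moreover have "emeasure (interval_measure H) ({l<..<u} \<union> {u}) = emeasure (interval_measure H) {l<..<u}"
        by (rule emeasure_Un_null_set) (auto simp: null_sets_def sing)
      ultimately have "emeasure (interval_measure H) {l<..u} = emeasure (interval_measure H) {l<..<u}" by metis
      moreover have "emeasure (interval_measure H) {l<..u} = ennreal (H u - H l)"
        using H le by (intro emeasure_interval_measure_Ioc)
          (auto simp: mono_def continuous_on_eq_continuous_within intro: continuous_within_subset)
      ultimately show ?thesis by simp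
    qed simp
    then have "m {l<..<u} = ennreal (F u - F l) + ennreal (G u - G l)" using F G cont by (simp add: m_def)
    also have "\<dots> = ennreal (u - l)"
      using FG[of u] FG[of l] monoD[OF F le] monoD[OF G le] by (subst ennreal_plus[symmetric]) (auto simp: algebra_simps)
    finally show "emeasure M (box l u) = (\<Prod>b\<in>Basis. (u - l) \<bullet> b)" by (simp add: M box_real)
  qed (rule sM)
  then show ?thesis using M[OF A] by (simp add: m_def)
qed

text \<open>The short intervals with quotient at most \<open>p\<close> form a Vitali cover of
  \<open>E\<close> inside an open set of nearly the same measure. A disjoint subfamily covers all
  but a Lebesgue null set, which the Stieltjes measure also neglects, and the increments over the
  subfamily sum to at most \<open>p\<close> times its length.\<close>

lemma interval_measure_vitali_bound:
  fixes F G :: "real => real"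
  assumes F: "mono F" and G: "mono G" and FG: "\<And>x. F x + G x = x"
    and E: "E \<in> sets borel" "emeasure lborel E < \<infinity>" and p: "0 \<le> p"
    and fine: "\<And>x d. x \<in> E ==> 0 < d ==> \<exists>a b. a \<le> x \<and> x \<le> b \<and> a < b \<and> b - a < d \<and> F b - F a \<le> p * (b - a)"
  shows "emeasure (interval_measure F) E \<le> ennreal p * emeasure lborel E"
proof (rule ennreal_le_epsilon)
  fix e :: real assume "0 < e"
  let ?\<nu> = "interval_measure F"
  have abs: "emeasure ?\<nu> A \<le> emeasure lborel A" if "A \<in> sets borel" for A
    using interval_measure_add_eq_lborel[OF F G FG that] by (metis add.right_neutral add_left_mono zero_le)
  have cont: "continuous_on UNIV F"
  proof -
    have "\<bar>F x - F y\<bar> \<le> \<bar>x - y\<bar>" for x y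
      using FG[of x] FG[of y] monoD[OF F, of x y] monoD[OF F, of y x] monoD[OF G, of x y] monoD[OF G, of y x] by linarith
    then have "1-lipschitz_on UNIV F" by (auto intro!: lipschitz_onI simp: dist_real_def)
    then show ?thesis by (rule lipschitz_on_continuous_on)
  qed
  \<comment> \<open>After multiplication by \<open>p\<close> the excess is at most \<open>e\<close>;
    adding 1 admits \<open>p = 0\<close>.\<close>
  obtain T where T: "open T" "E \<subseteq> T" "T - E \<in> lmeasurable" "emeasure lebesgue (T - E) < ennreal (e / (p + 1))"
    using sets_lebesgue_outer_open[of E "e / (p + 1)"] E(1) \<open>0 < e\<close> p by auto
  define K where "K = {(a, b). a < b \<and> {a..b} \<subseteq> T \<and> F b - F a \<le> p * (b - a)}"
  have cb: "cball ((a + b) / 2) ((b - a) / 2) = {a..b}" for a b :: real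
    by (auto simp: cball_eq_atLeastAtMost field_simps)
  obtain C where C: "countable C" "C \<subseteq> K"
    "pairwise (\<lambda>i j. disjnt (cball ((fst i + snd i) / 2) ((snd i - fst i) / 2)) (cball ((fst j + snd j) / 2) ((snd j - fst j) / 2))) C"
    "negligible (E - (\<Union>i\<in>C. cball ((fst i + snd i) / 2) ((snd i - fst i) / 2)))"
  proof (rule Vitali_covering_theorem_cballs[of K "\<lambda>i. (snd i - fst i) / 2" E "\<lambda>i. (fst i + snd i) / 2"])
    show "0 < (snd i - fst i) / 2" if "i \<in> K" for i using that by (auto simp: K_def)
    fix x d :: real assume x: "x \<in> E" "0 < d"
    then obtain r where r: "r > 0" "ball x r \<subseteq> T" using T by (meson openE subsetD)
    obtain a b where ab: "a \<le> x" "x \<le> b" "a < b" "b - a < min d r" "F b - F a \<le> p * (b - a)"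
      using fine[OF x(1), of "min d r"] x(2) r(1) by auto
    have "{a..b} \<subseteq> T" using r(2) ab by (auto simp: subset_eq dist_real_def)
    with ab show "\<exists>i. i \<in> K \<and> x \<in> cball ((fst i + snd i) / 2) ((snd i - fst i) / 2) \<and> (snd i - fst i) / 2 < d"
      by (intro exI[of _ "(a, b)"]) (auto simp: K_def cb)
  qed
  let ?I = "\<lambda>i. {fst i..snd i}"
  have disj: "disjoint_family_on ?I C" using C(3) by (auto simp: disjoint_family_on_def pairwise_def disjnt_def cb)
  have C': "fst i < snd i" "?I i \<subseteq> T" "F (snd i) - F (fst i) \<le> p * (snd i - fst i)" if "i \<in> C" for i
    using subsetD[OF C(2) that] by (cases i; simp add: K_def)+
  have UC: "(\<Union>i\<in>C. ?I i) \<in> sets borel" using C(1) by (intro sets.countable_UN') auto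
  have null: "emeasure ?\<nu> (E - (\<Union>i\<in>C. ?I i)) = 0"
  proof -
    have mE: "E - (\<Union>i\<in>C. ?I i) \<in> sets borel" using E UC by auto
    have "emeasure lborel (E - (\<Union>i\<in>C. ?I i)) = 0"
      using C(4) mE by (simp add: cb negligible_iff_null_sets null_sets_def)
    then show ?thesis using abs[OF mE] by simp
  qed
  have "emeasure ?\<nu> E \<le> emeasure ?\<nu> ((\<Union>i\<in>C. ?I i) \<union> (E - (\<Union>i\<in>C. ?I i)))"
    using E UC by (intro emeasure_mono) auto
  also have "\<dots> \<le> emeasure ?\<nu> (\<Union>i\<in>C. ?I i) + emeasure ?\<nu> (E - (\<Union>i\<in>C. ?I i))"
    using E UC by (intro emeasure_subadditive) auto
  also have "\<dots> = emeasure ?\<nu> (\<Union>i\<in>C. ?I i)" by (simp add: null)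
  also have "\<dots> = (\<integral>\<^sup>+i. emeasure ?\<nu> (?I i) \<partial>count_space C)"
    using disj C(1) by (intro emeasure_UN_countable) auto
  also have "\<dots> \<le> (\<integral>\<^sup>+i. ennreal p * emeasure lborel (?I i) \<partial>count_space C)"
  proof (rule nn_integral_mono)
    fix i assume "i \<in> space (count_space C)"
    then have i: "i \<in> C" by simp
    have "emeasure ?\<nu> (?I i) = ennreal (F (snd i) - F (fst i))"
      using C'(1)[OF i] F cont by (intro emeasure_interval_measure_Icc) (auto simp: mono_def)
    also have "\<dots> \<le> ennreal (p * (snd i - fst i))" using C'(3)[OF i] by (rule ennreal_leI)
    also have "\<dots> = ennreal p * emeasure lborel (?I i)" using C'(1)[OF i] p by (simp add: ennreal_mult)
    finally show "emeasure ?\<nu> (?I i) \<le> ennreal p * emeasure lborel (?I i)" .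
  qed
  also have "\<dots> = ennreal p * (\<integral>\<^sup>+i. emeasure lborel (?I i) \<partial>count_space C)" by (rule nn_integral_cmult) simp
  also have "\<dots> = ennreal p * emeasure lborel (\<Union>i\<in>C. ?I i)"
    using disj C(1) by (subst emeasure_UN_countable) auto
  also have "\<dots> \<le> ennreal p * emeasure lborel T"
    using C'(2) T(1) by (intro mult_left_mono emeasure_mono) auto
  also have "emeasure lborel T \<le> emeasure lborel E + emeasure lborel (T - E)"
    using emeasure_subadditive[of E lborel "T - E"] E(1) T(1,2) by (simp add: Un_absorb1)
  also have "emeasure lborel (T - E) \<le> ennreal (e / (p + 1))"
    using T(4) T(1) E(1) by simp
  finally have "emeasure ?\<nu> E \<le> ennreal p * (emeasure lborel E + ennreal (e / (p + 1)))"
    by (simp add: mult_left_mono)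
  also have "\<dots> = ennreal p * emeasure lborel E + ennreal (p * (e / (p + 1)))"
    using p \<open>0 < e\<close> by (simp only: distrib_left) (subst ennreal_mult, auto)
  also have "\<dots> \<le> ennreal p * emeasure lborel E + ennreal e"
    using p \<open>0 < e\<close> by (intro add_left_mono ennreal_leI) (simp add: field_simps)
  finally show "emeasure ?\<nu> E \<le> ennreal p * emeasure lborel E + ennreal e" .
qed

lemma osc_set_borel:
  fixes f :: "real => real" shows "osc_set f p q \<in> sets borel"
proof -
  have "osc_set f p q = (\<Inter>n. \<Union>{{a<..<b} | a b. b - a < 1 / Suc n \<and> f b - f a < p * (b - a)}) \<inter>
      (\<Inter>n. \<Union>{{a<..<b} | a b. b - a < 1 / Suc n \<and> q * (b - a) < f b - f a})"
    by (auto simp: osc_set_def) (metis greaterThanLessThan_iff)+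
  moreover have "open (\<Union>{{a<..<b} | a b. P a b})" for P :: "real => real => bool" by (rule open_Union) auto
  ultimately show ?thesis by (auto intro!: sets.Int sets.countable_INT')
qed

text \<open>On a bounded part of the set, the measure of \<open>F\<close> is at most
  \<open>p\<close> times and that of \<open>G\<close> at most \<open>1 - q\<close> times Lebesgue
  measure. Their sum is Lebesgue measure, and p + 1 - q < 1 leaves only measure zero.\<close>

lemma osc_set_null_mono:
  assumes F: "mono F" and G: "mono G" and FG: "\<And>x. F x + G x = x" and pq: "p < q"
  shows "emeasure lborel (osc_set F p q) = 0"
proof -
  have le: "0 \<le> F b - F a" "F b - F a \<le> b - a" if "a < b" for a b
    using FG[of a] FG[of b] monoD[OF F, of a b] monoD[OF G, of a b] that by auto
  have "emeasure lborel (osc_set F p q \<inter> {- real N..real N}) = 0" for N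
  proof (cases "osc_set F p q = {}")
    case False
    then obtain x where x: "x \<in> osc_set F p q" by blast
    obtain a b where "a < x" "x < b" "F b - F a < p * (b - a)" using x by (auto simp: osc_set_def)
    \<comment> \<open>Increments of \<open>F\<close> are nonnegative, so a point of the set forces
      \<open>p > 0\<close>; likewise \<open>q < 1\<close> below since they do not exceed the
      length.\<close>
    then have p: "0 < p" using le(1)[of a b] by (smt (verit) mult_le_0_iff)
    obtain a b where ab: "a < x" "x < b" "q * (b - a) < F b - F a" using x by (auto simp: osc_set_def)
    then have lt: "a < b" by simp
    have "q * (b - a) < 1 * (b - a)" unfolding mult_1 by (rule less_le_trans[OF ab(3) le(2)[OF lt]])
    moreover have "0 < b - a" using lt by simp
    ultimately have q: "q < 1" using mult_less_cancel_right_pos[of "b - a" q 1] by blast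
    let ?E = "osc_set F p q \<inter> {- real N..real N}"
    have E: "?E \<in> sets borel" using osc_set_borel by auto
    have "emeasure lborel ?E \<le> emeasure lborel {- real N..real N}" by (intro emeasure_mono) auto
    then have fin: "emeasure lborel ?E < \<infinity>" by (simp add: order_le_less_trans)
    have 1: "emeasure (interval_measure F) ?E \<le> ennreal p * emeasure lborel ?E"
    proof (rule interval_measure_vitali_bound[OF F G FG E fin])
      fix x d :: real assume x: "x \<in> ?E" "0 < d"
      obtain n where n: "1 / real (Suc n) < d" using nat_approx_posE[OF x(2)] by auto
      have "\<forall>n::nat. \<exists>a b. a < x \<and> x < b \<and> b - a < 1 / Suc n \<and> F b - F a < p * (b - a)"
        using x(1) unfolding osc_set_def by blast
      then obtain a b where "a < x" "x < b" "b - a < 1 / Suc n" "F b - F a < p * (b - a)" by blast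
      then have "a \<le> x \<and> x \<le> b \<and> a < b \<and> b - a < d \<and> F b - F a \<le> p * (b - a)" using n by auto
      then show "\<exists>a b. a \<le> x \<and> x \<le> b \<and> a < b \<and> b - a < d \<and> F b - F a \<le> p * (b - a)" by blast
    qed (use p in auto)
    have 2: "emeasure (interval_measure G) ?E \<le> ennreal (1 - q) * emeasure lborel ?E"
    proof (rule interval_measure_vitali_bound[OF G F _ E fin])
      fix x d :: real assume x: "x \<in> ?E" "0 < d"
      obtain n where n: "1 / real (Suc n) < d" using nat_approx_posE[OF x(2)] by auto
      have "\<forall>n::nat. \<exists>a b. a < x \<and> x < b \<and> b - a < 1 / Suc n \<and> q * (b - a) < F b - F a"
        using x(1) unfolding osc_set_def by blast
      then obtain a b where "a < x" "x < b" "b - a < 1 / Suc n" "q * (b - a) < F b - F a" by blast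
      then have "a \<le> x \<and> x \<le> b \<and> a < b \<and> b - a < d \<and> G b - G a \<le> (1 - q) * (b - a)"
        using n FG[of a] FG[of b] by (simp add: algebra_simps)
      then show "\<exists>a b. a \<le> x \<and> x \<le> b \<and> a < b \<and> b - a < d \<and> G b - G a \<le> (1 - q) * (b - a)" by blast
    qed (use q FG in \<open>auto simp: add.commute\<close>)
    have "emeasure lborel ?E \<le> ennreal p * emeasure lborel ?E + ennreal (1 - q) * emeasure lborel ?E"
      using add_mono[OF 1 2] interval_measure_add_eq_lborel[OF F G FG E] by simp
    moreover have m: "emeasure lborel ?E = ennreal (measure lborel ?E)"
      using fin by (intro emeasure_eq_ennreal_measure) auto
    ultimately have "ennreal (measure lborel ?E) \<le> ennreal (p * measure lborel ?E + (1 - q) * measure lborel ?E)"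
      using p q by (simp add: ennreal_mult)
    then have "measure lborel ?E \<le> p * measure lborel ?E + (1 - q) * measure lborel ?E"
      using p q by (subst (asm) ennreal_le_iff) simp_all
    then have "(q - p) * measure lborel ?E \<le> 0" by (simp add: algebra_simps)
    then have "measure lborel ?E = 0" using pq measure_nonneg[of lborel ?E]
      by (simp add: mult_le_0_iff)
    then show ?thesis using m by simp
  qed simp
  then have "(\<Union>N. osc_set F p q \<inter> {- real N..real N}) \<in> null_sets lborel"
    using osc_set_borel by (intro null_sets_UN) (auto simp: null_sets_def)
  moreover have "(\<Union>N. osc_set F p q \<inter> {- real N..real N}) = osc_set F p q"
    by auto (meson abs_le_iff minus_le_iff real_arch_simple)
  ultimately show ?thesis by (auto simp: null_sets_def)
qed

text \<open>Normalisation: x/2 + f/(2K) and x/2 - f/(2K) are increasing with sum x, and a slope r of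
  \<open>f\<close> becomes (r + K)/(2K). The choice K = L + 1 keeps the divisor positive.\<close>

lemma osc_set_null:
  assumes f: "L-lipschitz_on UNIV f" and pq: "p < q"
  shows "emeasure lborel (osc_set f p q) = 0"
proof -
  define K where "K = L + 1"
  have K: "0 < K" using lipschitz_on_nonneg[OF f] by (simp add: K_def)
  have lip: "\<bar>f x - f y\<bar> \<le> K * \<bar>x - y\<bar>" for x y
    using lipschitz_onD[OF f, of x y] by (auto simp: dist_real_def K_def distrib_right)
  define F where "F x = x / 2 + f x / (2 * K)" for x
  define G where "G x = x / 2 - f x / (2 * K)" for x
  have "f x - f y \<le> K * (y - x)" "f y - f x \<le> K * (y - x)" if "x \<le> y" for x y
    using lip[of x y] that by (auto simp: abs_le_iff)
  note le = this
  have eq: "F b - F a = ((b - a) * K + (f b - f a)) / (2 * K)" for a b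
    using K by (simp add: F_def field_simps)
  have eqG: "G b - G a = ((b - a) * K - (f b - f a)) / (2 * K)" for a b
    using K by (simp add: G_def field_simps)
  have "0 \<le> F y - F x" "0 \<le> G y - G x" if "x \<le> y" for x y
    unfolding eq eqG using K le[OF that] by (auto intro!: divide_nonneg_pos simp: algebra_simps)
  then have mono: "mono F" "mono G" by (auto intro!: monoI)
  have eqr: "(r + K) / (2 * K) * (b - a) = ((b - a) * K + r * (b - a)) / (2 * K)" for r a b
    by (simp add: algebra_simps)
  have "F b - F a < (r + K) / (2 * K) * (b - a) \<longleftrightarrow> f b - f a < r * (b - a)"
    "(r + K) / (2 * K) * (b - a) < F b - F a \<longleftrightarrow> r * (b - a) < f b - f a" for r a b
    unfolding eq eqr using K by (simp_all add: divide_less_cancel)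
  then have "osc_set f p q = osc_set F ((p + K) / (2 * K)) ((q + K) / (2 * K))"
    by (simp add: osc_set_def)
  moreover have "(p + K) / (2 * K) < (q + K) / (2 * K)" using K pq by (simp add: divide_strict_right_mono)
  ultimately show ?thesis using osc_set_null_mono[OF mono, of "(p + K) / (2 * K)" "(q + K) / (2 * K)"]
    by (simp add: F_def G_def)
qed

lemma osc_set_shift: "0 \<in> osc_set (\<lambda>t. f (s + t)) p q \<longleftrightarrow> s \<in> osc_set f p q"
proof -
  have *: "(\<exists>a b. a < 0 \<and> 0 < b \<and> b - a < d \<and> P (f (s + b) - f (s + a)) (b - a)) \<longleftrightarrow>
      (\<exists>a b. a < s \<and> s < b \<and> b - a < d \<and> P (f b - f a) (b - a))" (is "?A \<longleftrightarrow> ?B") for d :: real and P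
  proof
    assume ?A
    then obtain a b where "a < 0 \<and> 0 < b \<and> b - a < d \<and> P (f (s + b) - f (s + a)) (b - a)" by blast
    then show ?B by (intro exI[of _ "s + a"] exI[of _ "s + b"]) simp
  next
    assume ?B
    then obtain a b where "a < s \<and> s < b \<and> b - a < d \<and> P (f b - f a) (b - a)" by blast
    then show ?A by (intro exI[of _ "a - s"] exI[of _ "b - s"]) simp
  qed
  show ?thesis
    unfolding osc_set_def
    using *[of _ "\<lambda>u v. u < p * v"] *[of _ "\<lambda>u v. q * v < u"] by simp
qed

text \<open>If the lower and upper limits of the quotient at 0 differ, two rationals fit between
  them, and quotients below one and above the other occur at every scale. These have an endpoint at
  0; by continuity that endpoint can be moved slightly beyond 0 without losing the strict
  inequality.\<close>

lemma differentiable_if_not_osc: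
  fixes f :: "real => real"
  assumes f: "L-lipschitz_on UNIV f" and no: "\<And>p q. p \<in> \<rat> ==> q \<in> \<rat> ==> p < q ==> 0 \<notin> osc_set f p q"
  shows "\<exists>D. (f has_real_derivative D) (at 0)"
proof -
  define Q where "Q h = (f h - f 0) / h" for h
  have cont: "isCont f x" for x using lipschitz_on_continuous_on[OF f] by (simp add: continuous_on_eq_continuous_at)
  have small: "\<exists>a b. a < 0 \<and> 0 < b \<and> b - a < 1 / Suc n \<and> P (f b - f a) (b - a)"
    if fr: "\<exists>\<^sub>F h in at 0. R (Q h)" and PR: "\<And>h. h > 0 ==> R (Q h) ==> P (f h - f 0) h"
      "\<And>h. h < 0 ==> R (Q h) ==> P (f 0 - f h) (- h)"
      and op: "open {(u, v). P u v}" for n :: nat and R :: "real => bool" and P :: "real => real => bool"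
  proof -
    have "\<forall>\<^sub>F h in at (0::real). \<bar>h\<bar> < 1 / Suc n"
      by (rule eventually_at_in_open'[of "{-1 / Suc n <..<1 / Suc n}" 0, THEN eventually_mono]) (auto simp: field_simps abs_less_iff)
    moreover have "\<forall>\<^sub>F h in at (0::real). h \<noteq> 0" by (auto simp: eventually_at_filter)
    ultimately have "\<forall>\<^sub>F h in at (0::real). \<bar>h\<bar> < 1 / Suc n \<and> h \<noteq> 0" by (rule eventually_conj)
    from frequently_ex[OF frequently_eventually_conj[OF fr this]]
    obtain h where h: "R (Q h)" "\<bar>h\<bar> < 1 / Suc n" "h \<noteq> 0" by blast
    \<comment> \<open>The increment and the length vary continuously with the moved endpoint, and
      the condition \<open>P\<close> is open.\<close>
    have perturb: "\<exists>t>0. t < r \<and> P (u (- t)) (v (- t)) \<and> P (u t) (v t)" if "P (u 0) (v 0)" "isCont u 0" "isCont v 0" "r > 0" for u v and r :: real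
    proof -
      have "((\<lambda>t. (u t, v t)) \<longlongrightarrow> (u 0, v 0)) (at 0)" using that by (intro tendsto_Pair) (auto simp: isCont_def)
      then have "\<forall>\<^sub>F t in at 0. (u t, v t) \<in> {(u, v). P u v}"
        using op that(1) by (intro topological_tendstoD) auto
      then obtain d where d: "d > 0" "\<And>t. t \<noteq> 0 ==> dist t 0 < d ==> P (u t) (v t)" by (auto simp: eventually_at)
      show ?thesis
        using that(4) d by (intro exI[of _ "min (d/2) (r/2)"]) (auto intro!: d(2) simp: min_def)
    qed
    show ?thesis
    proof (cases "h > 0")
      case True
      have "isCont (\<lambda>t. f h - f t) 0" "isCont (\<lambda>t. h - t) 0" using cont by (auto intro!: continuous_intros)
      from perturb[OF _ this, of "1 / Suc n - h"] obtain t where "t > 0" "t < 1 / Suc n - h" "P (f h - f (- t)) (h - (- t))"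
        using PR(1)[OF True h(1)] h(2) True by auto
      then show ?thesis using True by (intro exI[of _ "- t"] exI[of _ h]) auto
    next
      case False
      then have neg: "h < 0" using h(3) by simp
      have "isCont (\<lambda>t. f t - f h) 0" "isCont (\<lambda>t. t - h) 0" using cont by (auto intro!: continuous_intros)
      from perturb[OF _ this, of "1 / Suc n + h"] obtain t where "t > 0" "t < 1 / Suc n + h" "P (f t - f h) (t - h)"
        using PR(2)[OF neg h(1)] h(2) neg by auto
      then show ?thesis using neg by (intro exI[of _ h] exI[of _ t]) auto
    qed
  qed
  let ?m = "Liminf (at 0) (\<lambda>h. ereal (Q h))" and ?M = "Limsup (at 0) (\<lambda>h. ereal (Q h))"
  have mM: "?m \<le> ?M" by (rule Liminf_le_Limsup) simp
  have "?m = ?M"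
  proof (rule ccontr)
    assume "?m \<noteq> ?M"
    with mM have lt: "?m < ?M" by simp
    \<comment> \<open>The larger number is chosen first, so that the smaller one can be put between
      the lower limit and it.\<close>
    obtain q' where q': "?m < ereal (real_of_rat q')" "ereal (real_of_rat q') < ?M" using ereal_dense3[OF lt] by auto
    obtain p' where p': "?m < ereal (real_of_rat p')" "ereal (real_of_rat p') < ereal (real_of_rat q')" using ereal_dense3[OF q'(1)] by auto
    define p q where "p = real_of_rat p'" and "q = real_of_rat q'"
    have fp: "\<exists>\<^sub>F h in at 0. Q h < p"
    proof (rule ccontr)
      assume "\<not> ?thesis"
      then have "\<forall>\<^sub>F h in at 0. ereal p \<le> ereal (Q h)" by (simp add: frequently_def not_less)
      then have "ereal p \<le> ?m" by (rule Liminf_bounded)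
      with p' show False by (simp add: p_def)
    qed
    have fq: "\<exists>\<^sub>F h in at 0. q < Q h"
    proof (rule ccontr)
      assume "\<not> ?thesis"
      then have "\<forall>\<^sub>F h in at 0. ereal (Q h) \<le> ereal q" by (simp add: frequently_def not_less)
      then have "?M \<le> ereal q" by (rule Limsup_bounded)
      with q' show False by (simp add: q_def)
    qed
    have "0 \<in> osc_set f p q"
      unfolding osc_set_def mem_Collect_eq
    proof (intro conjI allI)
      fix n :: nat
      have "open {(u, v). u < p * v}" "open {(u, v). q * v < (u::real)}"
        by (auto simp: case_prod_unfold intro!: open_Collect_less continuous_intros)
      then show "\<exists>a b. a < 0 \<and> 0 < b \<and> b - a < 1 / Suc n \<and> f b - f a < p * (b - a)"
        "\<exists>a b. a < 0 \<and> 0 < b \<and> b - a < 1 / Suc n \<and> q * (b - a) < f b - f a"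
        using small[OF fp, of "\<lambda>u v. u < p * v" n] small[OF fq, of "\<lambda>u v. q * v < u" n]
        by (auto simp: Q_def field_simps)
    qed
    moreover have "p \<in> \<rat>" "q \<in> \<rat>" "p < q" using p' by (auto simp: p_def q_def)
    ultimately show False using no by blast
  qed
  have bd: "- L \<le> Q h" "Q h \<le> L" for h
  proof -
    have "\<bar>Q h\<bar> \<le> L"
      using lipschitz_onD[OF f, of h 0] lipschitz_on_nonneg[OF f] by (cases "h = 0") (auto simp: Q_def dist_real_def divide_simps)
    then show "- L \<le> Q h" "Q h \<le> L" by linarith+
  qed
  have "((\<lambda>h. ereal (Q h)) \<longlongrightarrow> ?M) (at 0)" using \<open>?m = ?M\<close> by (intro Liminf_eq_Limsup) auto
  moreover have "ereal (- L) \<le> ?m" by (rule Liminf_bounded) (simp add: bd)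
  moreover have "?M \<le> ereal L" by (rule Limsup_bounded) (simp add: bd)
  ultimately obtain D where "((\<lambda>h. ereal (Q h)) \<longlongrightarrow> ereal D) (at 0)" using \<open>?m = ?M\<close> by (cases ?M) auto
  then have "(Q \<longlongrightarrow> D) (at 0)" by (simp add: tendsto_ereal)
  then have "(f has_real_derivative D) (at 0)" by (simp add: has_field_derivative_iff Q_def[abs_def])
  then show ?thesis by blast
qed

text \<open>The bad set meets each line in direction \<open>e\<close> in a null set. Averaging its
  translates by t e over t in [0,1] and exchanging integrals gives zero, while each translate has
  the measure of the set itself; so Fubini works without coordinates adapted to
  \<open>e\<close>.\<close>

lemma lipschitz_directional_derivative_AE:
  fixes f :: "'a::euclidean_space => real"
  assumes f: "L-lipschitz_on UNIV f"
  shows "AE x in lebesgue. \<exists>D. ((\<lambda>t. f (x + t *\<^sub>R e)) has_real_derivative D) (at 0)"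
proof -
  have cont: "continuous_on UNIV f" using f by (rule lipschitz_on_continuous_on)
  have lip: "(L * norm e)-lipschitz_on UNIV (\<lambda>t. f (x + t *\<^sub>R e))" for x
  proof (rule lipschitz_onI)
    show "dist (f (x + s *\<^sub>R e)) (f (x + t *\<^sub>R e)) \<le> L * norm e * dist s t" for s t
      using lipschitz_onD[OF f, of "x + s *\<^sub>R e" "x + t *\<^sub>R e"]
      by (simp add: dist_norm scaleR_diff_left[symmetric] ac_simps)
  qed (use lipschitz_on_nonneg[OF f] in auto)
  define E where "E p q = {x. 0 \<in> osc_set (\<lambda>t. f (x + t *\<^sub>R e)) p q}" for p q
  have E_borel: "E p q \<in> sets borel" for p q
  proof -
    define U where "U a b n = {x. a < 0 \<and> 0 < b \<and> b - a < 1 / Suc n \<and> f (x + b *\<^sub>R e) - f (x + a *\<^sub>R e) < p * (b - a)}" for a b :: real and n :: nat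
    define W where "W a b n = {x. a < 0 \<and> 0 < b \<and> b - a < 1 / Suc n \<and> q * (b - a) < f (x + b *\<^sub>R e) - f (x + a *\<^sub>R e)}" for a b :: real and n :: nat
    have c: "continuous_on UNIV (\<lambda>x. f (x + b *\<^sub>R e) - f (x + a *\<^sub>R e))" for a b
      by (intro continuous_intros continuous_on_compose2[OF cont]) auto
    have "open (U a b n)" "open (W a b n)" for a b n
      unfolding U_def W_def by (intro open_Collect_conj open_Collect_const open_Collect_less c continuous_on_const)+
    then have "open (\<Union>a b. U a b n)" "open (\<Union>a b. W a b n)" for n by (intro open_UN ballI; blast)+
    then have "(\<Inter>n. \<Union>a b. U a b n) \<inter> (\<Inter>n. \<Union>a b. W a b n) \<in> sets borel" by (intro sets.Int sets.countable_INT') auto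
    moreover have "E p q = (\<Inter>n. \<Union>a b. U a b n) \<inter> (\<Inter>n. \<Union>a b. W a b n)"
      by (auto simp: E_def osc_set_def U_def W_def)
    ultimately show ?thesis by simp
  qed
  have E_null: "E p q \<in> null_sets lborel" if "p < q" for p q
  proof -
    note [measurable] = E_borel[of p q]
    have sect: "(\<integral>\<^sup>+t. indicator {0..1} t * indicator (E p q) (x + t *\<^sub>R e) \<partial>lborel) = 0" for x
    proof -
      have mem: "x + t *\<^sub>R e \<in> E p q \<longleftrightarrow> t \<in> osc_set (\<lambda>t. f (x + t *\<^sub>R e)) p q" for t
        using osc_set_shift[of "\<lambda>t. f (x + t *\<^sub>R e)" t p q] by (simp add: E_def scaleR_add_left add.assoc)
      have "(\<integral>\<^sup>+t. indicator {0..1} t * indicator (E p q) (x + t *\<^sub>R e) \<partial>lborel)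
          \<le> (\<integral>\<^sup>+t. indicator (osc_set (\<lambda>t. f (x + t *\<^sub>R e)) p q) t \<partial>lborel)"
        by (intro nn_integral_mono) (auto simp: indicator_def mem)
      also have "\<dots> = 0" using osc_set_null[OF lip \<open>p < q\<close>, of x] osc_set_borel by simp
      finally show ?thesis by simp
    qed
    have trans: "(\<integral>\<^sup>+x. indicator (E p q) (x + t *\<^sub>R e) \<partial>lborel) = emeasure lborel (E p q)" for t
    proof -
      have "emeasure lborel (E p q) = emeasure (distr lborel borel ((+) (t *\<^sub>R e))) (E p q)"
        by (simp add: lborel_distr_plus)
      also have "\<dots> = (\<integral>\<^sup>+x. indicator (E p q) x \<partial>distr lborel borel ((+) (t *\<^sub>R e)))" by simp
      also have "\<dots> = (\<integral>\<^sup>+x. indicator (E p q) (t *\<^sub>R e + x) \<partial>lborel)" by (rule nn_integral_distr) auto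
      finally show ?thesis by (simp add: add.commute)
    qed
    have "emeasure lborel (E p q) = (\<integral>\<^sup>+t. indicator {0..1::real} t * emeasure lborel (E p q) \<partial>lborel)"
      by (simp add: nn_integral_multc)
    also have "\<dots> = (\<integral>\<^sup>+t. (\<integral>\<^sup>+x. indicator {0..1} t * indicator (E p q) (x + t *\<^sub>R e) \<partial>lborel) \<partial>lborel)"
      by (simp add: nn_integral_cmult trans)
    also have "\<dots> = (\<integral>\<^sup>+x. (\<integral>\<^sup>+t. indicator {0..1} t * indicator (E p q) (x + t *\<^sub>R e) \<partial>lborel) \<partial>lborel)"
      by (rule lborel_pair.Fubini'[symmetric]) measurable
    also have "\<dots> = 0" by (simp add: sect)
    finally show ?thesis by (auto simp: null_sets_def)
  qed
  define B where "B = (\<Union>(p,q)\<in>{(p, q). p \<in> \<rat> \<and> q \<in> \<rat> \<and> p < q}. E p q)"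
  have "countable {(p, q::real). p \<in> \<rat> \<and> q \<in> \<rat> \<and> p < q}"
    by (rule countable_subset[of _ "\<rat> \<times> \<rat>"]) (auto simp: countable_rat)
  then have "B \<in> null_sets lborel" unfolding B_def by (intro null_sets_UN') (auto intro: E_null)
  then have "AE x in lborel. x \<notin> B" by (rule AE_not_in)
  then have "AE x in lborel. \<exists>D. ((\<lambda>t. f (x + t *\<^sub>R e)) has_real_derivative D) (at 0)"
  proof (rule AE_mp, intro AE_I2 impI)
    fix x assume "x \<notin> B"
    then show "\<exists>D. ((\<lambda>t. f (x + t *\<^sub>R e)) has_real_derivative D) (at 0)"
      by (intro differentiable_if_not_osc[OF lip]) (auto simp: B_def E_def)
  qed
  then show ?thesis by (rule AE_completion)
qed


section \<open>Partial derivatives of Lipschitz functions and integration by parts\<close>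

lemma continuous_imp_lebesgue_measurable:
  fixes f :: "'a::euclidean_space => 'b::{metric_space,second_countable_topology}"
  assumes "continuous_on UNIV f"
  shows "f \<in> borel_measurable lborel" "f \<in> borel_measurable lebesgue"
  using borel_measurable_continuous_onI[OF assms] by (auto intro: measurable_completion)

lemma integrable_lebesgue_on_compact:
  fixes f :: "'a::euclidean_space => real"
  assumes "compact K" "continuous_on K f"
  shows "integrable (lebesgue_on K) f"
proof -
  have "integrable lborel (\<lambda>x. indicator K x *\<^sub>R f x)"
    using borel_integrable_compact[OF assms] by (simp add: set_integrable_def)
  then have "integrable lebesgue (\<lambda>x. indicator K x *\<^sub>R f x)"
    by (subst integrable_completion) (auto intro: borel_measurable_integrable)
  then show ?thesis using assms(1) by (subst integrable_restrict_space) (auto intro: fmeasurableD lmeasurable_compact)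
qed

lemma abs_quotient_le: "\<bar>a\<bar> \<le> L * t ==> 0 < t ==> \<bar>a / t\<bar> \<le> (L::real)"
  by (simp add: abs_divide pos_divide_le_eq)

lemma partial_eq: "((\<lambda>t. f (x + t *\<^sub>R axis i 1)) has_real_derivative D) (at 0) ==> partial i f x = D"
  unfolding partial_def by (rule DERIV_imp_deriv)

lemma partial_lipschitz_AE:
  fixes f :: "real^'n => real"
  assumes f: "L-lipschitz_on UNIV f"
  shows "AE x in lebesgue. ((\<lambda>t. f (x + t *\<^sub>R axis i 1)) has_real_derivative partial i f x) (at 0)"
  using lipschitz_directional_derivative_AE[OF f, of "axis i 1"]
  by eventually_elim (metis partial_eq)

lemma partial_lipschitz_AE_tendsto:
  fixes f :: "real^'n => real"
  assumes f: "L-lipschitz_on UNIV f"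
  shows "AE x in lebesgue. (\<lambda>n. (f (x + (1 / Suc n) *\<^sub>R axis i 1) - f x) / (1 / Suc n)) \<longlonglongrightarrow> partial i f x"
  using partial_lipschitz_AE[OF f, of i]
proof eventually_elim
  case (elim x)
  then have "((\<lambda>t. (f (x + t *\<^sub>R axis i 1) - f x) / t) \<longlongrightarrow> partial i f x) (at 0)"
    by (simp add: has_field_derivative_iff)
  moreover have "filterlim (\<lambda>n. 1 / real (Suc n)) (at 0) sequentially"
    by (rule filterlim_atI) (use LIMSEQ_inverse_real_of_nat in \<open>auto simp: field_simps\<close>)
  ultimately show ?case by (rule filterlim_compose)
qed

lemma borel_measurable_partial_lipschitz:
  fixes f :: "real^'n => real"
  assumes f: "L-lipschitz_on UNIV f"
  shows "partial i f \<in> borel_measurable lebesgue"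
proof (rule borel_measurable_AE)
  let ?q = "\<lambda>n x. (f (x + (1 / Suc n) *\<^sub>R axis i 1) - f x) / (1 / Suc n)"
  have cont: "continuous_on UNIV f" using f by (rule lipschitz_on_continuous_on)
  have "?q n \<in> borel_measurable lborel" for n
    by (intro continuous_imp_lebesgue_measurable continuous_intros continuous_on_compose2[OF cont]) auto
  then have "(\<lambda>x. lim (\<lambda>n. ?q n x)) \<in> borel_measurable lborel" by (rule borel_measurable_lim_metric)
  then show "(\<lambda>x. lim (\<lambda>n. ?q n x)) \<in> borel_measurable lebesgue" by (rule measurable_completion)
  show "AE x in lebesgue. lim (\<lambda>n. ?q n x) = partial i f x"
    using partial_lipschitz_AE_tendsto[OF f, of i] by eventually_elim (rule limI)
qed

lemma partial_lipschitz_bound: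
  fixes f :: "real^'n => real"
  assumes f: "L-lipschitz_on UNIV f"
  shows "AE x in lebesgue. \<bar>partial i f x\<bar> \<le> L"
  using partial_lipschitz_AE_tendsto[OF f, of i]
proof eventually_elim
  case (elim x)
  show ?case
  proof (rule LIMSEQ_le_const2[OF tendsto_rabs[OF elim]], intro exI allI impI)
    fix n
    have "\<bar>f (x + (1 / Suc n) *\<^sub>R axis i 1) - f x\<bar> \<le> L * (1 / Suc n)"
      using lipschitz_onD[OF f, of "x + (1 / Suc n) *\<^sub>R axis i 1" x]
      by (simp add: dist_norm norm_axis_1)
    then show "\<bar>(f (x + (1 / Suc n) *\<^sub>R axis i 1) - f x) / (1 / Suc n)\<bar> \<le> L"
      by (rule abs_quotient_le) simp
  qed
qed

lemma partial_zero_outside: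
  fixes f :: "real^'n => real"
  assumes K: "closed K" "\<And>y. y \<notin> K ==> f y = 0" and x: "x \<notin> K"
  shows "partial i f x = 0"
proof (rule partial_eq)
  have "\<forall>\<^sub>F t in at 0. x + t *\<^sub>R axis i 1 \<in> - K"
  proof (rule topological_tendstoD)
    show "((\<lambda>t. x + t *\<^sub>R axis i 1) \<longlongrightarrow> x) (at 0)" by (auto intro!: tendsto_eq_intros)
  qed (use K x in auto)
  then have "\<forall>\<^sub>F t in at 0. f (x + t *\<^sub>R axis i 1) = 0" by eventually_elim (use K(2) in auto)
  then have "\<forall>\<^sub>F t in nhds 0. 0 = f (x + t *\<^sub>R axis i 1)"
    unfolding eventually_at_filter by eventually_elim (use K(2) x in auto)
  then show "((\<lambda>t. f (x + t *\<^sub>R axis i 1)) has_real_derivative 0) (at 0)"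
    by (rule DERIV_cong_ev[THEN iffD1, OF refl _ refl]) simp
qed

lemma integrable_partial_lipschitz:
  fixes f :: "real^'n => real"
  assumes f: "L-lipschitz_on UNIV f" and K: "compact K" "\<And>x. x \<notin> K ==> f x = 0"
  shows "integrable lebesgue (partial i f)"
proof (rule Bochner_Integration.integrable_bound[of lebesgue "\<lambda>x. L * indicator K x"])
  have "K \<in> lmeasurable" using K(1) by (rule lmeasurable_compact)
  then show "integrable lebesgue (\<lambda>x. L * indicator K x)"
    by (intro integrable_mult_right) (simp add: lmeasurable_iff_integrable)
  show "AE x in lebesgue. norm (partial i f x) \<le> norm (L * indicator K x)"
    using partial_lipschitz_bound[OF f, of i]
    by eventually_elim (use partial_zero_outside[OF compact_imp_closed[OF K(1)] K(2)] lipschitz_on_nonneg[OF f] in \<open>auto simp: indicator_def\<close>)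
qed (rule borel_measurable_partial_lipschitz[OF f])

text \<open>The difference quotients have integral zero by translation invariance and are bounded by
  the Lipschitz constant, so dominated convergence applies.\<close>

lemma integral_partial_lipschitz:
  fixes f :: "real^'n => real"
  assumes f: "L-lipschitz_on UNIV f" and K: "compact K" "\<And>x. x \<notin> K ==> f x = 0"
  shows "(\<integral>x. partial i f x \<partial>lebesgue) = 0"
proof -
  let ?q = "\<lambda>n x. (f (x + (1 / Suc n) *\<^sub>R axis i 1) - f x) / (1 / Suc n)"
  have cont: "continuous_on UNIV f" using f by (rule lipschitz_on_continuous_on)
  have f_meas: "f \<in> borel_measurable borel" using cont by (rule borel_measurable_continuous_onI)
  obtain R where "\<And>x. x \<in> K ==> norm x \<le> R" using compact_imp_bounded[OF K(1)] by (auto simp: bounded_iff)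
  then have R: "K \<subseteq> cball 0 R" by auto
  have q_meas: "?q n \<in> borel_measurable lborel" for n
    by (intro continuous_imp_lebesgue_measurable continuous_intros continuous_on_compose2[OF cont]) auto
  have int_f: "integrable lborel f"
  proof -
    have "integrable lborel (\<lambda>x. indicator K x *\<^sub>R f x)"
      using borel_integrable_compact[OF K(1) continuous_on_subset[OF cont subset_UNIV]] by (simp add: set_integrable_def)
    moreover have "(\<lambda>x. indicator K x *\<^sub>R f x) = f"
    proof
      show "indicator K x *\<^sub>R f x = f x" for x using K(2)[of x] by (cases "x \<in> K") auto
    qed
    ultimately show ?thesis by simp
  qed
  have shift: "has_bochner_integral lborel (\<lambda>x. f (x + c)) (\<integral>x. f x \<partial>lborel)" for c
  proof -
    have 1: "integrable (distr lborel borel ((+) c)) f" using int_f by (simp add: lborel_distr_plus)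
    have "integrable lborel (\<lambda>x. f (c + x))" using integrable_distr[OF _ 1] by simp
    moreover have "(\<integral>x. f (c + x) \<partial>lborel) = (\<integral>x. f x \<partial>distr lborel borel ((+) c))"
      by (rule integral_distr[symmetric]) (use f_meas in auto)
    ultimately show ?thesis by (simp add: lborel_distr_plus has_bochner_integral_iff add.commute)
  qed
  have zero: "(\<integral>x. ?q n x \<partial>lebesgue) = 0" for n
  proof -
    have "(\<integral>x. ?q n x \<partial>lebesgue) = (\<integral>x. ?q n x \<partial>lborel)" by (rule integral_completion[OF q_meas])
    also have "\<dots> = ((\<integral>x. f x \<partial>lborel) - (\<integral>x. f x \<partial>lborel)) / (1 / Suc n)"
      by (intro has_bochner_integral_integral_eq has_bochner_integral_divide_zero has_bochner_integral_diff shift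
          has_bochner_integral_integrable[OF int_f])
    also have "\<dots> = 0" by simp
    finally show ?thesis .
  qed
  have "(\<lambda>n. \<integral>x. ?q n x \<partial>lebesgue) \<longlonglongrightarrow> (\<integral>x. partial i f x \<partial>lebesgue)"
  \<comment> \<open>The steps 1/(n+1) are at most 1, so all quotients vanish outside the ball of
    radius R + 1.\<close>
  proof (rule integral_dominated_convergence[where w = "\<lambda>x. L * indicator (cball 0 (R + 1)) x"])
    have "cball (0::real^'n) (R + 1) \<in> lmeasurable" by simp
    then show "integrable lebesgue (\<lambda>x::real^'n. L * indicator (cball 0 (R + 1)) x)"
      by (intro integrable_mult_right) (simp add: lmeasurable_iff_integrable)
    show "AE x in lebesgue. norm (?q n x) \<le> L * indicator (cball 0 (R + 1)) x" for n
    proof (rule AE_I2)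
      fix x
      show "norm (?q n x) \<le> L * indicator (cball 0 (R + 1)) x"
      proof (cases "norm x \<le> R + 1")
        case True
        have "\<bar>f (x + (1 / Suc n) *\<^sub>R axis i 1) - f x\<bar> \<le> L * (1 / Suc n)"
          using lipschitz_onD[OF f, of "x + (1 / Suc n) *\<^sub>R axis i 1" x] by (simp add: dist_norm norm_axis_1)
        then have "\<bar>?q n x\<bar> \<le> L" by (rule abs_quotient_le) simp
        then show ?thesis using True by (simp only: real_norm_def) (simp add: indicator_def)
      next
        case False
        have "norm ((1 / Suc n) *\<^sub>R axis i 1 :: real^'n) \<le> 1" by (simp add: norm_axis_1)
        moreover have "norm x \<le> norm (x + (1 / Suc n) *\<^sub>R axis i 1) + norm ((1 / Suc n) *\<^sub>R axis i 1 :: real^'n)"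
          using norm_triangle_ineq4[of "x + (1 / Suc n) *\<^sub>R axis i 1" "(1 / Suc n) *\<^sub>R axis i 1"] by (simp only: add_diff_cancel)
        ultimately have "norm (x + (1 / Suc n) *\<^sub>R axis i 1) > R" using False by linarith
        then have "x \<notin> K" "x + (1 / Suc n) *\<^sub>R axis i 1 \<notin> K" using R False by (auto simp: subset_eq)
        then show ?thesis using K(2) False by (simp add: indicator_def)
      qed
    qed
    show "?q n \<in> borel_measurable lebesgue" for n by (rule measurable_completion[OF q_meas])
  qed (use borel_measurable_partial_lipschitz[OF f] partial_lipschitz_AE_tendsto[OF f] in auto)
  then show ?thesis unfolding zero by (simp add: LIMSEQ_const_iff)
qed

lemma lipschitz_on_mult_bounded:
  fixes f g :: "'a::metric_space => real"
  assumes f: "L-lipschitz_on S f" and g: "M-lipschitz_on S g"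
    and bf: "\<And>x. x \<in> S ==> \<bar>f x\<bar> \<le> B" and bg: "\<And>x. x \<in> S ==> \<bar>g x\<bar> \<le> C" and nn: "0 \<le> B" "0 \<le> C"
  shows "(L * C + B * M)-lipschitz_on S (\<lambda>x. f x * g x)"
proof (rule lipschitz_onI)
  fix x y assume xy: "x \<in> S" "y \<in> S"
  have "\<bar>f x * g x - f y * g y\<bar> = \<bar>(f x - f y) * g x + f y * (g x - g y)\<bar>" by (simp add: algebra_simps)
  also have "\<dots> \<le> \<bar>f x - f y\<bar> * \<bar>g x\<bar> + \<bar>f y\<bar> * \<bar>g x - g y\<bar>" by (metis abs_mult abs_triangle_ineq)
  also have "\<dots> \<le> (L * dist x y) * C + B * (M * dist x y)"
    using lipschitz_onD[OF f xy] lipschitz_onD[OF g xy] bf[OF xy(2)] bg[OF xy(1)] nn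
    by (intro add_mono mult_mono) (auto simp: dist_real_def lipschitz_on_nonneg[OF f])
  finally show "dist (f x * g x) (f y * g y) \<le> (L * C + B * M) * dist x y" by (simp add: dist_real_def algebra_simps)
qed (use lipschitz_on_nonneg[OF f] lipschitz_on_nonneg[OF g] nn in auto)

text \<open>The product is Lipschitz with compact support, so its partial derivative integrates to
  zero, and the Leibniz rule holds almost everywhere. Only \<open>f\<close> needs compact
  support.\<close>

lemma integral_by_parts_lipschitz:
  fixes f g :: "real^'n => real"
  assumes f: "L-lipschitz_on UNIV f" and K: "compact K" "\<And>x. x \<notin> K ==> f x = 0"
    and g: "M-lipschitz_on UNIV g" and bg: "\<And>x. \<bar>g x\<bar> \<le> C"
  shows "integrable lebesgue (\<lambda>x. f x * partial i g x)" "integrable lebesgue (\<lambda>x. g x * partial i f x)"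
    "(\<integral>x. f x * partial i g x \<partial>lebesgue) = - (\<integral>x. g x * partial i f x \<partial>lebesgue)"
proof -
  have C: "0 \<le> C" using bg[of 0] by simp
  have cf: "continuous_on UNIV f" and cg: "continuous_on UNIV g" using f g by (auto intro: lipschitz_on_continuous_on)
  have "compact (f ` K)" using K(1) cf by (meson compact_continuous_image continuous_on_subset subset_UNIV)
  then obtain B0 where B0: "\<And>x. x \<in> K ==> \<bar>f x\<bar> \<le> B0" using compact_imp_bounded bounded_iff by (metis imageI real_norm_def)
  define B where "B = max B0 0"
  have B: "\<bar>f x\<bar> \<le> B" for x using B0[of x] K(2)[of x] by (cases "x \<in> K") (auto simp: B_def)
  have B': "0 \<le> B" by (simp add: B_def)
  have fg: "(L * C + B * M)-lipschitz_on UNIV (\<lambda>x. f x * g x)"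
    by (rule lipschitz_on_mult_bounded[OF f g B bg B' C])
  have meas: "f \<in> borel_measurable lebesgue" "g \<in> borel_measurable lebesgue"
    using cf cg by (auto intro!: measurable_completion borel_measurable_continuous_onI simp: measurable_lborel1)
  show int1: "integrable lebesgue (\<lambda>x. g x * partial i f x)"
  proof (rule Bochner_Integration.integrable_bound[OF integrable_mult_right[OF integrable_partial_lipschitz[OF f K], of C]])
    show "(\<lambda>x. g x * partial i f x) \<in> borel_measurable lebesgue"
      using meas borel_measurable_partial_lipschitz[OF f] by (intro borel_measurable_times)
    show "AE x in lebesgue. norm (g x * partial i f x) \<le> norm (C * partial i f x)"
      using bg C by (auto simp: abs_mult intro!: mult_right_mono)
  qed
  have "integrable lebesgue (partial i (\<lambda>x. f x * g x))"
    by (rule integrable_partial_lipschitz[OF fg K(1)]) (simp add: K(2))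
  moreover have prod: "AE x in lebesgue. partial i (\<lambda>x. f x * g x) x = f x * partial i g x + g x * partial i f x"
    using partial_lipschitz_AE[OF f, of i] partial_lipschitz_AE[OF g, of i]
  proof eventually_elim
    case (elim x)
    from DERIV_mult[OF this] show ?case by (intro partial_eq) (simp add: mult.commute add.commute)
  qed
  ultimately have "integrable lebesgue (\<lambda>x. partial i (\<lambda>x. f x * g x) x - g x * partial i f x)"
    using int1 by (intro Bochner_Integration.integrable_diff)
  then show int2: "integrable lebesgue (\<lambda>x. f x * partial i g x)"
    by (rule integrable_cong_AE_imp) (use meas borel_measurable_partial_lipschitz[OF g] in \<open>auto intro!: borel_measurable_times\<close>,
        use prod in eventually_elim, simp)
  have "0 = (\<integral>x. partial i (\<lambda>x. f x * g x) x \<partial>lebesgue)"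
    by (rule integral_partial_lipschitz[OF fg K(1), symmetric]) (simp add: K(2))
  also have "\<dots> = (\<integral>x. f x * partial i g x + g x * partial i f x \<partial>lebesgue)"
    by (rule integral_cong_AE) (use int1 int2 borel_measurable_partial_lipschitz[OF fg] prod in auto)
  also have "\<dots> = (\<integral>x. f x * partial i g x \<partial>lebesgue) + (\<integral>x. g x * partial i f x \<partial>lebesgue)"
    using int1 int2 by (rule Bochner_Integration.integral_add[rotated])
  finally show "(\<integral>x. f x * partial i g x \<partial>lebesgue) = - (\<integral>x. g x * partial i f x \<partial>lebesgue)" by simp
qed

section \<open>Compactly supported functions of class C^1\<close>

lemma differentiable_partial:
  fixes f :: "real^'n => real"
  assumes "f differentiable (at x)"
  shows "((\<lambda>t. f (x + t *\<^sub>R axis i 1)) has_real_derivative partial i f x) (at 0)"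
    and "(f has_derivative (\<lambda>h. \<Sum>i\<in>UNIV. h $ i * partial i f x)) (at x)"
proof -
  obtain f' where f': "(f has_derivative f') (at x)" using assms by (auto simp: differentiable_def)
  have d: "((\<lambda>t. f (x + t *\<^sub>R axis i 1)) has_real_derivative f' (axis i 1)) (at 0)" for i
  proof -
    have "((\<lambda>t. x + t *\<^sub>R axis i 1) has_derivative (\<lambda>t. t *\<^sub>R axis i 1)) (at 0)"
      by (auto intro!: derivative_eq_intros)
    then have "((\<lambda>t. f (x + t *\<^sub>R axis i 1)) has_derivative (\<lambda>t. f' (t *\<^sub>R axis i 1))) (at 0)"
      by (rule has_derivative_compose) (simp add: f')
    moreover have "(\<lambda>t. f' (t *\<^sub>R axis i 1)) = (*) (f' (axis i 1))"
      using linear_scale[OF has_derivative_linear[OF f']] by (simp add: mult.commute fun_eq_iff)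
    ultimately show ?thesis unfolding has_field_derivative_def by simp
  qed
  have p: "partial i f x = f' (axis i 1)" for i by (rule partial_eq[OF d])
  show "((\<lambda>t. f (x + t *\<^sub>R axis i 1)) has_real_derivative partial i f x) (at 0)" using d p by simp
  have "f' h = (\<Sum>i\<in>UNIV. h $ i * partial i f x)" for h
  proof -
    have "f' h = f' (\<Sum>i\<in>UNIV. h $ i *\<^sub>R axis i 1)" by (simp add: basis_expansion scalar_mult_eq_scaleR[symmetric])
    also have "\<dots> = (\<Sum>i\<in>UNIV. h $ i * f' (axis i 1))"
      using has_derivative_linear[OF f'] by (simp add: linear_sum linear_scale)
    finally show ?thesis by (simp add: p)
  qed
  then have "f' = (\<lambda>h. \<Sum>i\<in>UNIV. h $ i * partial i f x)" by (rule ext)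
  then show "(f has_derivative (\<lambda>h. \<Sum>i\<in>UNIV. h $ i * partial i f x)) (at x)" using f' by simp
qed

lemma C1cD:
  assumes "f \<in> C1c S"
  shows "f differentiable (at x)" "continuous_on UNIV (partial i f)" "continuous_on UNIV f"
    "\<exists>K. compact K \<and> K \<subseteq> S \<and> (\<forall>x. x \<notin> K \<longrightarrow> f x = 0 \<and> (\<forall>i. partial i f x = 0))"
proof -
  show d: "f differentiable (at x)" for x using assms by (simp add: C1c_def)
  show "continuous_on UNIV (partial i f)" using assms by (simp add: C1c_def)
  show "continuous_on UNIV f" using d differentiable_imp_continuous_within by (force simp: continuous_on_eq_continuous_within)
  obtain K where "compact K" "K \<subseteq> S" "\<And>x. x \<notin> K ==> f x = 0" using assms by (auto simp: C1c_def supported_in_def)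
  then show "\<exists>K. compact K \<and> K \<subseteq> S \<and> (\<forall>x. x \<notin> K \<longrightarrow> f x = 0 \<and> (\<forall>i. partial i f x = 0))"
    using partial_zero_outside[OF compact_imp_closed, of K f] by (intro exI[of _ K]) blast
qed

lemma continuous_zero_outside_bounded:
  fixes g :: "'a::t2_space => real"
  assumes "continuous_on UNIV g" "compact K" "\<And>x. x \<notin> K ==> g x = 0"
  obtains B where "0 \<le> B" "\<And>x. \<bar>g x\<bar> \<le> B"
proof -
  have "compact (g ` K)" using assms by (meson compact_continuous_image continuous_on_subset subset_UNIV)
  then obtain B where B: "\<And>x. x \<in> K ==> \<bar>g x\<bar> \<le> B" using compact_imp_bounded bounded_iff by (metis imageI real_norm_def)
  have "\<bar>g x\<bar> \<le> max B 0" for x using B[of x] assms(3)[of x] by (cases "x \<in> K") auto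
  then show thesis using that[of "max B 0"] by simp
qed

lemma C1c_bounded_lipschitz:
  fixes f :: "real^'n => real"
  assumes f: "f \<in> C1c S"
  obtains L B where "L-lipschitz_on UNIV f" "0 \<le> B" "\<And>x. \<bar>f x\<bar> \<le> B" "\<And>x i. \<bar>partial i f x\<bar> \<le> B"
proof -
  obtain K where K: "compact K" "K \<subseteq> S" "\<And>x. x \<notin> K ==> f x = 0" "\<And>x i. x \<notin> K ==> partial i f x = 0"
    using C1cD(4)[OF f] by blast
  obtain B0 where B0: "0 \<le> B0" "\<And>x. \<bar>f x\<bar> \<le> B0"
    using continuous_zero_outside_bounded[OF C1cD(3)[OF f] K(1,3)] by blast
  have "\<exists>B. 0 \<le> B \<and> (\<forall>x. \<bar>partial i f x\<bar> \<le> B)" for i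
    using continuous_zero_outside_bounded[OF C1cD(2)[OF f] K(1,4)] by metis
  then obtain B where B: "\<And>i. 0 \<le> B i" "\<And>i x. \<bar>partial i f x\<bar> \<le> B i" by metis
  define L where "L = (\<Sum>i\<in>UNIV. B i)"
  have L: "0 \<le> L" unfolding L_def by (intro sum_nonneg B)
  have "norm (f x - f y) \<le> L * norm (x - y)" for x y
  proof (rule differentiable_bound[OF convex_UNIV])
    fix x
    show "(f has_derivative (\<lambda>h. \<Sum>i\<in>UNIV. h $ i * partial i f x)) (at x within UNIV)"
      using differentiable_partial(2)[OF C1cD(1)[OF f]] by simp
    show "onorm (\<lambda>h. \<Sum>i\<in>UNIV. h $ i * partial i f x) \<le> L"
    proof (rule onorm_bound[OF L])
      fix h :: "real^'n"
      have "norm (\<Sum>i\<in>UNIV. h $ i * partial i f x) \<le> (\<Sum>i\<in>UNIV. norm h * B i)"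
        by (rule sum_norm_le) (auto simp: abs_mult intro!: mult_mono B component_le_norm_cart)
      then show "norm (\<Sum>i\<in>UNIV. h $ i * partial i f x) \<le> L * norm h"
        by (simp add: L_def sum_distrib_left mult.commute)
    qed
  qed auto
  then have "L-lipschitz_on UNIV f" using L by (auto intro!: lipschitz_onI simp: dist_norm)
  moreover have "B i \<le> L" for i unfolding L_def by (rule member_le_sum) (auto intro: B)
  then have "\<bar>partial i f x\<bar> \<le> max B0 L" for x i using B(2)[where i=i and x=x] by (meson le_max_iff_disj order.trans)
  moreover have "\<bar>f x\<bar> \<le> max B0 L" for x using B0(2)[of x] by (meson le_max_iff_disj order.trans)
  ultimately show thesis using that[of L "max B0 L"] B0(1) by simp
qed

lemma test_functions_subset_C1c:
  fixes S :: "(real^'n) set"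
  shows "test_functions S \<subseteq> C1c S"
proof
  fix f :: "real^'n => real" assume "f \<in> test_functions S"
  then have f: "smooth f" "supported_in S f" by (auto simp: test_functions_def)
  have "f differentiable (at x)" for x using f(1)[unfolded smooth_def, rule_format, of "[]" x] by simp
  moreover have "partial i f differentiable (at x)" for i x
    using f(1)[unfolded smooth_def, rule_format, of "[i]" x] by simp
  then have "continuous_on UNIV (partial i f)" for i
    using differentiable_imp_continuous_within by (force simp: continuous_on_eq_continuous_within)
  ultimately show "f \<in> C1c S" using f(2) by (auto simp: C1c_def)
qed

definition X_classical :: "('m::finite => real^'n => real^'n) => (real^'n => real) => real^'n => real^'m" where
  "X_classical X f x = (\<chi> j. \<Sum>i\<in>UNIV. X j x $ i * partial i f x)"

text \<open>The coefficient is Lipschitz on \<open>\<Omega>0\<close> only, yet the product is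
  globally Lipschitz: if one point lies outside the support, the difference involves the coefficient
  at the other point alone.\<close>

lemma lipschitz_mult_test_function:
  fixes c :: "real^'n => real"
  assumes c: "L-lipschitz_on \<Omega>0 c" and \<psi>: "\<psi> \<in> C1c S" and S: "S \<subseteq> \<Omega>0"
  obtains M K where "M-lipschitz_on UNIV (\<lambda>x. c x * \<psi> x)" "compact K" "K \<subseteq> S" "\<And>x. x \<notin> K ==> \<psi> x = 0"
proof -
  obtain K where K: "compact K" "K \<subseteq> S" "\<And>x. x \<notin> K ==> \<psi> x = 0" using C1cD(4)[OF \<psi>] by blast
  obtain M B where MB: "M-lipschitz_on UNIV \<psi>" "0 \<le> B" "\<And>x. \<bar>\<psi> x\<bar> \<le> B" using C1c_bounded_lipschitz[OF \<psi>] by metis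
  have K0: "K \<subseteq> \<Omega>0" using K S by auto
  have "continuous_on K c" using lipschitz_on_continuous_on[OF c] K0 continuous_on_subset by blast
  then have "bounded (c ` K)" using K(1) by (intro compact_imp_bounded compact_continuous_image)
  then obtain D where D: "\<And>x. x \<in> K ==> \<bar>c x\<bar> \<le> D" "0 \<le> D"
    by (metis bounded_iff imageI norm_ge_zero order.trans real_norm_def abs_ge_zero bounded_pos less_imp_le)
  have L: "0 \<le> L" "0 \<le> M" using lipschitz_on_nonneg c MB by auto
  have one: "\<bar>c x * \<psi> x - c y * \<psi> y\<bar> \<le> (D * M + L * B) * dist x y" if x: "x \<in> K" for x y
  proof (cases "y \<in> K")
    case True
    have "\<bar>c x * \<psi> x - c y * \<psi> y\<bar> = \<bar>c x * (\<psi> x - \<psi> y) + (c x - c y) * \<psi> y\<bar>" by (simp add: algebra_simps)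
    also have "\<dots> \<le> \<bar>c x\<bar> * \<bar>\<psi> x - \<psi> y\<bar> + \<bar>c x - c y\<bar> * \<bar>\<psi> y\<bar>" by (metis abs_mult abs_triangle_ineq)
    also have "\<dots> \<le> D * (M * dist x y) + (L * dist x y) * B"
      using D(1)[OF x] D(2) L lipschitz_onD[OF MB(1), of x y] lipschitz_onD[OF c, of x y] MB(3)[of y] x True K0
      by (intro add_mono mult_mono) (auto simp: dist_real_def)
    finally show ?thesis by (simp add: algebra_simps)
  next
    case False
    then have "\<bar>c x * \<psi> x - c y * \<psi> y\<bar> = \<bar>c x\<bar> * \<bar>\<psi> x - \<psi> y\<bar>" using K(3) by (simp add: abs_mult)
    also have "\<dots> \<le> D * (M * dist x y)"
      using D(1)[OF x] D(2) lipschitz_onD[OF MB(1), of x y] by (intro mult_mono) (auto simp: dist_real_def)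
    also have "\<dots> \<le> (D * M + L * B) * dist x y" using L MB(2) by (simp add: algebra_simps)
    finally show ?thesis .
  qed
  have "(D * M + L * B)-lipschitz_on UNIV (\<lambda>x. c x * \<psi> x)"
  proof (rule lipschitz_onI)
    fix x y
    show "dist (c x * \<psi> x) (c y * \<psi> y) \<le> (D * M + L * B) * dist x y"
    proof (cases "x \<in> K \<or> y \<in> K")
      case True
      then show ?thesis using one[of x y] one[of y x] by (auto simp: dist_real_def dist_commute abs_minus_commute)
    next
      case False
      then show ?thesis using K(3) L D(2) MB(2) by simp
    qed
  qed (use L D MB in auto)
  then show thesis using that K by blast
qed

text \<open>The coefficient stays with the test function: their product is the compactly supported
  Lipschitz factor in the integration by parts, and \<open>\<phi>\<close> is the bounded
  one.\<close>

lemma is_X_deriv_C1c: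
  fixes X :: "'m::finite => real^'n => real^'n"
  assumes X: "L-lipschitz_on \<Omega>0 (X j)" and S: "S \<subseteq> \<Omega>0" "S \<in> sets lebesgue" and \<phi>: "\<phi> \<in> C1c T"
  shows "is_X_deriv X S j \<phi> (\<lambda>x. X_classical X \<phi> x $ j)"
  unfolding is_X_deriv_def
proof (intro conjI allI impI ballI)
  have cX: "continuous_on \<Omega>0 (\<lambda>x. X j x $ i)" for i
    using lipschitz_on_continuous_on[OF X] by (intro continuous_intros)
  fix K assume K: "compact K \<and> K \<subseteq> S"
  show "integrable (lebesgue_on K) (\<lambda>x. X_classical X \<phi> x $ j)"
    unfolding X_classical_def
    using K S continuous_on_subset[OF lipschitz_on_continuous_on[OF X], of K] continuous_on_subset[OF C1cD(2)[OF \<phi>], of K]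
    by (intro integrable_lebesgue_on_compact) (auto intro!: continuous_intros)
next
  fix \<psi> assume "\<psi> \<in> test_functions S"
  then have \<psi>: "\<psi> \<in> C1c S" using test_functions_subset_C1c by blast
  obtain M B where MB: "M-lipschitz_on UNIV \<phi>" "\<And>x. \<bar>\<phi> x\<bar> \<le> B" using C1c_bounded_lipschitz[OF \<phi>] by metis
  obtain K where K: "compact K" "K \<subseteq> S" "\<And>x. x \<notin> K ==> \<psi> x = 0" using C1cD(4)[OF \<psi>] by blast
  have \<psi>0: "\<psi> x = 0" if "x \<notin> S" for x using K(2,3) that by blast
  let ?f = "\<lambda>i x. X j x $ i * \<psi> x"
  have "L-lipschitz_on \<Omega>0 (\<lambda>x. X j x $ i)" for i
  proof (rule lipschitz_onI)
    show "dist (X j x $ i) (X j y $ i) \<le> L * dist x y" if "x \<in> \<Omega>0" "y \<in> \<Omega>0" for x y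
      using order.trans[OF dist_vec_nth_le lipschitz_onD[OF X that]] .
  qed (rule lipschitz_on_nonneg[OF X])
  then have "\<exists>M. M-lipschitz_on UNIV (?f i)" for i using lipschitz_mult_test_function[OF _ \<psi> S(1)] by metis
  then obtain N where N: "\<And>i. (N i)-lipschitz_on UNIV (?f i)" by metis
  have f0: "?f i x = 0" if "x \<notin> K" for i x using K(3)[OF that] by simp
  note ibp = integral_by_parts_lipschitz[OF N K(1) f0 MB]
  have "(\<integral>x. X_classical X \<phi> x $ j * \<psi> x \<partial>lebesgue_on S) = (\<integral>x. (\<Sum>i\<in>UNIV. ?f i x * partial i \<phi> x) \<partial>lebesgue)"
    using S(2) \<psi>0
    by (subst integral_restrict_space) (auto simp: X_classical_def indicator_def sum_distrib_left sum_distrib_right algebra_simps intro!: Bochner_Integration.integral_cong)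
  also have "\<dots> = (\<Sum>i\<in>UNIV. \<integral>x. ?f i x * partial i \<phi> x \<partial>lebesgue)"
    by (rule Bochner_Integration.integral_sum) (use ibp(1) in auto)
  also have "\<dots> = - (\<Sum>i\<in>UNIV. \<integral>x. \<phi> x * partial i (?f i) x \<partial>lebesgue)"
    by (simp add: ibp(3) sum_negf)
  also have "(\<Sum>i\<in>UNIV. \<integral>x. \<phi> x * partial i (?f i) x \<partial>lebesgue) = (\<integral>x. (\<Sum>i\<in>UNIV. \<phi> x * partial i (?f i) x) \<partial>lebesgue)"
    by (rule Bochner_Integration.integral_sum[symmetric]) (use ibp(2) in auto)
  also have "\<dots> = (\<integral>x. \<phi> x * (\<Sum>i\<in>UNIV. partial i (?f i) x) \<partial>lebesgue_on S)"
  proof -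
    have "partial i (?f i) x = 0" if "x \<notin> S" for i x
      by (rule partial_zero_outside[OF compact_imp_closed[OF K(1)], of "?f i"]) (use f0 that K(2) in auto)
    then show ?thesis
      using S(2) by (subst integral_restrict_space) (auto simp: indicator_def sum_distrib_left intro!: Bochner_Integration.integral_cong)
  qed
  finally show "(\<integral>x. X_classical X \<phi> x $ j * \<psi> x \<partial>lebesgue_on S) =
     - (\<integral>x. \<phi> x * (\<Sum>i\<in>UNIV. partial i (?f i) x) \<partial>lebesgue_on S)" .
qed

section \<open>Test functions\<close>

text \<open>Allowing a polynomial factor in 1/t makes the family closed under differentiation, so
  smoothness of exp(-1/t) needs no induction on derivatives.\<close>

definition flat_exp :: "real poly => real => real" where
  "flat_exp p t = (if 0 < t then poly p (1 / t) * exp (- (1 / t)) else 0)"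

lemma poly_exp_tendsto_0: "((\<lambda>s. poly p s * exp (- s)) \<longlongrightarrow> (0::real)) at_top"
proof -
  have "((\<lambda>s. \<Sum>i\<le>degree p. coeff p i * (s ^ i / exp s)) \<longlongrightarrow> (\<Sum>i\<le>degree p. coeff p i * 0)) at_top"
    by (intro tendsto_sum tendsto_mult tendsto_const tendsto_power_div_exp_0)
  moreover have "(\<lambda>s. \<Sum>i\<le>degree p. coeff p i * (s ^ i / exp s)) = (\<lambda>s. poly p s * exp (- s))"
    by (simp add: fun_eq_iff poly_altdef exp_minus sum_distrib_right divide_inverse mult.assoc)
  ultimately show ?thesis by simp
qed

text \<open>With s = 1/t the derivative in t is -s^2 d/ds, and -s^2 (p(s) exp(-s))' = s^2 (p -
  p')(s) exp(-s). At 0 exponential decay beats the polynomial.\<close>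

lemma flat_exp_deriv: "(flat_exp p has_real_derivative flat_exp ([:0, 0, 1:] * (p - pderiv p)) t) (at t)"
proof -
  consider "t > 0" | "t < 0" | "t = 0" by linarith
  then show ?thesis
  proof cases
    case 1
    have "((\<lambda>t. poly p (1 / t) * exp (- (1 / t))) has_real_derivative flat_exp ([:0, 0, 1:] * (p - pderiv p)) t) (at t)"
      using 1 by (auto intro!: derivative_eq_intros simp: flat_exp_def field_simps power2_eq_square)
    moreover have "\<forall>\<^sub>F s in nhds t. s \<in> {0<..}" using 1 by (intro eventually_nhds_in_open) auto
    then have "\<forall>\<^sub>F s in nhds t. poly p (1 / s) * exp (- (1 / s)) = flat_exp p s"
      by eventually_elim (simp add: flat_exp_def)
    ultimately show ?thesis by (subst (asm) DERIV_cong_ev[OF refl _ refl]) auto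
  next
    case 2
    have "\<forall>\<^sub>F s in nhds t. s \<in> {..<0}" using 2 by (intro eventually_nhds_in_open) auto
    then have "\<forall>\<^sub>F s in nhds t. 0 = flat_exp p s" by eventually_elim (simp add: flat_exp_def)
    moreover have "((\<lambda>_. 0) has_real_derivative flat_exp ([:0, 0, 1:] * (p - pderiv p)) t) (at t)"
      using 2 by (simp add: flat_exp_def)
    ultimately show ?thesis by (subst (asm) DERIV_cong_ev[OF refl _ refl]) auto
  next
    case 3
    have "((\<lambda>s. (flat_exp p s - flat_exp p 0) / s) \<longlongrightarrow> 0) (at 0)"
    proof (rule filterlim_split_at_real)
      have "((\<lambda>s. 0) \<longlongrightarrow> (0::real)) (at_left 0)" by simp
      moreover have "\<forall>\<^sub>F s in at_left (0::real). 0 = (flat_exp p s - flat_exp p 0) / s"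
        by (auto simp: flat_exp_def eventually_at_filter)
      ultimately show "((\<lambda>s. (flat_exp p s - flat_exp p 0) / s) \<longlongrightarrow> 0) (at_left 0)"
        by (rule Lim_transform_eventually)
      \<comment> \<open>The extra factor \<open>[:0, 1:]\<close> is the division by the
        increment.\<close>
      have "((\<lambda>s. poly ([:0, 1:] * p) (inverse s) * exp (- inverse s)) \<longlongrightarrow> (0::real)) (at_right 0)"
        by (rule filterlim_compose[OF poly_exp_tendsto_0 filterlim_inverse_at_top_right])
      moreover have "\<forall>\<^sub>F s in at_right (0::real). poly ([:0, 1:] * p) (inverse s) * exp (- inverse s) = (flat_exp p s - flat_exp p 0) / s"
        by (auto simp: flat_exp_def eventually_at_filter field_simps)
      ultimately show "((\<lambda>s. (flat_exp p s - flat_exp p 0) / s) \<longlongrightarrow> 0) (at_right 0)"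
        by (rule Lim_transform_eventually)
    qed
    then show ?thesis using 3 by (simp add: has_field_derivative_iff flat_exp_def)
  qed
qed

text \<open>Since \<open>smooth\<close> quantifies over iterated partial derivatives, a class of
  differentiable functions stable under \<open>partial\<close> consists of smooth functions. The
  generators are what bumps in boxes and coordinate functions require.\<close>

inductive_set smooth_algebra :: "(real^'n => real) set" where
  const: "(\<lambda>_. c) \<in> smooth_algebra"
| coord: "(\<lambda>x. x $ i) \<in> smooth_algebra"
| flat1: "(\<lambda>x. flat_exp p (x $ i - a)) \<in> smooth_algebra"
| flat2: "(\<lambda>x. flat_exp p (a - x $ i)) \<in> smooth_algebra"
| add: "f \<in> smooth_algebra ==> g \<in> smooth_algebra ==> (\<lambda>x. f x + g x) \<in> smooth_algebra"
| mult: "f \<in> smooth_algebra ==> g \<in> smooth_algebra ==> (\<lambda>x. f x * g x) \<in> smooth_algebra"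

lemma smooth_algebra_step:
  fixes f :: "real^'n => real" and j :: 'n
  assumes "f \<in> smooth_algebra"
  shows "(\<forall>x. f differentiable (at x)) \<and> partial j f \<in> smooth_algebra"
  using assms
proof induction
  case (const c)
  have "partial j (\<lambda>_::real^'n. c) = (\<lambda>_. 0)" by (rule ext, rule partial_eq) simp
  then show ?case by (simp add: smooth_algebra.const)
next
  case (coord i)
  have d: "(\<lambda>x::real^'n. x $ i) differentiable (at x)" for x
    by (intro bounded_linear_imp_differentiable bounded_linear_vec_nth)
  have "partial j (\<lambda>x::real^'n. x $ i) = (\<lambda>_. if i = j then 1 else 0)"
    by (rule ext, rule partial_eq) (auto simp: axis_def intro!: derivative_eq_intros)
  then show ?case using d by (simp add: smooth_algebra.const)
next
  case (flat1 p i a)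
  have d: "(\<lambda>x::real^'n. flat_exp p (x $ i - a)) differentiable (at x)" for x
  proof (rule differentiable_compose[of "flat_exp p"])
    show "flat_exp p differentiable (at (x $ i - a))"
      using flat_exp_deriv unfolding has_field_derivative_def by (rule differentiableI)
    show "(\<lambda>x. x $ i - a) differentiable (at x)"
      by (intro differentiable_diff differentiable_const bounded_linear_imp_differentiable bounded_linear_vec_nth)
  qed
  have "partial j (\<lambda>x::real^'n. flat_exp p (x $ i - a)) x = (if i = j then 1 else 0) * flat_exp ([:0, 0, 1:] * (p - pderiv p)) (x $ i - a)" for x
  proof (rule partial_eq)
    have "((\<lambda>t. (x + t *\<^sub>R axis j 1) $ i - a) has_real_derivative (if i = j then 1 else 0)) (at 0)"
      by (auto simp: axis_def intro!: derivative_eq_intros)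
    from DERIV_chain2[OF _ this, of "flat_exp p", OF flat_exp_deriv]
    show "((\<lambda>t. flat_exp p ((x + t *\<^sub>R axis j 1) $ i - a)) has_real_derivative
       (if i = j then 1 else 0) * flat_exp ([:0, 0, 1:] * (p - pderiv p)) (x $ i - a)) (at 0)" by (simp add: mult.commute)
  qed
  then have "partial j (\<lambda>x::real^'n. flat_exp p (x $ i - a)) = (\<lambda>x. (if i = j then 1 else 0) * flat_exp ([:0, 0, 1:] * (p - pderiv p)) (x $ i - a))" by (rule ext)
  also have "\<dots> \<in> smooth_algebra" by (intro smooth_algebra.mult smooth_algebra.const smooth_algebra.flat1)
  finally show ?case using d by blast
next
  case (flat2 p a i)
  have d: "(\<lambda>x::real^'n. flat_exp p (a - x $ i)) differentiable (at x)" for x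
  proof (rule differentiable_compose[of "flat_exp p"])
    show "flat_exp p differentiable (at (a - x $ i))"
      using flat_exp_deriv unfolding has_field_derivative_def by (rule differentiableI)
    show "(\<lambda>x. a - x $ i) differentiable (at x)"
      by (intro differentiable_diff differentiable_const bounded_linear_imp_differentiable bounded_linear_vec_nth)
  qed
  have "partial j (\<lambda>x::real^'n. flat_exp p (a - x $ i)) x = (if i = j then - 1 else 0) * flat_exp ([:0, 0, 1:] * (p - pderiv p)) (a - x $ i)" for x
  proof (rule partial_eq)
    have "((\<lambda>t. a - (x + t *\<^sub>R axis j 1) $ i) has_real_derivative (if i = j then - 1 else 0)) (at 0)"
      by (auto simp: axis_def intro!: derivative_eq_intros)
    from DERIV_chain2[OF _ this, of "flat_exp p", OF flat_exp_deriv]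
    show "((\<lambda>t. flat_exp p (a - (x + t *\<^sub>R axis j 1) $ i)) has_real_derivative
       (if i = j then - 1 else 0) * flat_exp ([:0, 0, 1:] * (p - pderiv p)) (a - x $ i)) (at 0)" by (simp add: mult.commute)
  qed
  then have "partial j (\<lambda>x::real^'n. flat_exp p (a - x $ i)) = (\<lambda>x. (if i = j then - 1 else 0) * flat_exp ([:0, 0, 1:] * (p - pderiv p)) (a - x $ i))" by (rule ext)
  also have "\<dots> \<in> smooth_algebra" by (intro smooth_algebra.mult smooth_algebra.const smooth_algebra.flat2)
  finally show ?case using d by blast
next
  case (add f g)
  have "partial j (\<lambda>x. f x + g x) x = partial j f x + partial j g x" for x
    by (rule partial_eq, rule DERIV_add) (use add.IH differentiable_partial(1) in blast)+
  then have "partial j (\<lambda>x. f x + g x) = (\<lambda>x. partial j f x + partial j g x)" by (rule ext)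
  then show ?case using add.IH by (auto intro!: smooth_algebra.intros differentiable_add)
next
  case (mult f g)
  have "partial j (\<lambda>x. f x * g x) x = partial j f x * g x + f x * partial j g x" for x
  proof (rule partial_eq)
    have "f differentiable (at x)" "g differentiable (at x)" using mult.IH by auto
    from DERIV_mult[OF differentiable_partial(1)[OF this(1)] differentiable_partial(1)[OF this(2)], of j]
    show "((\<lambda>t. f (x + t *\<^sub>R axis j 1) * g (x + t *\<^sub>R axis j 1)) has_real_derivative
        partial j f x * g x + f x * partial j g x) (at 0)" by (simp add: mult.commute add.commute)
  qed
  then have "partial j (\<lambda>x. f x * g x) = (\<lambda>x. partial j f x * g x + f x * partial j g x)" by (rule ext)
  then show ?case using mult.IH mult.hyps by (auto intro!: smooth_algebra.intros differentiable_mult)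
qed

lemma smooth_algebra_smooth: "f \<in> smooth_algebra ==> smooth f"
proof -
  assume f: "f \<in> smooth_algebra"
  have "foldr partial is f \<in> smooth_algebra" for "is"
    by (induction "is") (use f smooth_algebra_step in auto)
  then show ?thesis using smooth_algebra_step by (auto simp: smooth_def)
qed

lemma smooth_algebra_prod:
  "(\<And>i. i \<in> I ==> f i \<in> smooth_algebra) ==> (\<lambda>x. \<Prod>i\<in>I. f i x) \<in> smooth_algebra"
  by (induction I rule: infinite_finite_induct) (auto intro: smooth_algebra.intros)

lemma smooth_algebra_power: "f \<in> smooth_algebra ==> (\<lambda>x. f x ^ n) \<in> smooth_algebra"
  by (induction n) (auto intro: smooth_algebra.intros)

section \<open>Bumps in boxes and the fundamental lemma for test functions\<close>

definition bump :: "real^'n => real^'n => real^'n => real" where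
  "bump a b x = (\<Prod>i\<in>UNIV. flat_exp 1 (x $ i - a $ i) * flat_exp 1 (b $ i - x $ i))"

lemma flat_exp_1: "0 \<le> flat_exp 1 t" "flat_exp 1 t \<le> 1" "0 < flat_exp 1 t \<longleftrightarrow> 0 < t"
  by (auto simp: flat_exp_def)

lemma bump_smooth_algebra: "bump a b \<in> smooth_algebra"
  unfolding bump_def[abs_def] by (intro smooth_algebra_prod smooth_algebra.intros)

lemma bump_range: "0 \<le> bump a b x" "bump a b x \<le> 1"
  unfolding bump_def using flat_exp_1
  by (auto intro!: prod_nonneg prod_le_1 mult_le_one)

lemma bump_pos_iff: "0 < bump a b x \<longleftrightarrow> x \<in> box a b"
proof
  assume pos: "0 < bump a b x"
  have "a $ i < x $ i \<and> x $ i < b $ i" for i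
  proof (rule ccontr)
    assume "\<not> ?thesis"
    then have "flat_exp 1 (x $ i - a $ i) * flat_exp 1 (b $ i - x $ i) = 0" by (auto simp: flat_exp_def)
    then have "bump a b x = 0" unfolding bump_def by (intro prod_zero) auto
    with pos show False by simp
  qed
  then show "x \<in> box a b" by (simp add: mem_box_cart)
qed (auto simp: bump_def mem_box_cart flat_exp_1 intro!: prod_pos mult_pos_pos)

lemma bump_zero: "x \<notin> cbox a b ==> bump a b x = 0"
  using bump_pos_iff[of a b x] bump_range(1)[of a b x] box_subset_cbox[of a b] by fastforce

lemma smooth_algebra_bump_test_function:
  assumes "f \<in> smooth_algebra" "cbox a b \<subseteq> S"
  shows "(\<lambda>x. bump a b x * f x) \<in> test_functions S"
  using assms bump_zero
  by (auto simp: test_functions_def supported_in_def intro!: smooth_algebra_smooth smooth_algebra.mult bump_smooth_algebra exI[of _ "cbox a b"])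

lemma test_functions_mono: "S \<subseteq> T ==> test_functions S \<subseteq> test_functions T"
  by (auto simp: test_functions_def supported_in_def)

lemma open_box_exhaustion:
  fixes U :: "(real^'n) set"
  assumes U: "open U"
  shows "\<exists>A B :: nat => real^'n. (\<forall>k. cbox (A k) (B k) \<subseteq> U) \<and> (\<Union>k. box (A k) (B k)) = U"
proof -
  let ?F = "{box a b | a b. cbox a b \<subseteq> U}"
  obtain F where F: "F \<subseteq> ?F" "countable F" "\<Union>F = \<Union>?F"
    using Lindelof[of ?F] by (auto simp: open_box)
  have cov: "\<Union>?F = U"
  proof
    show "\<Union>?F \<subseteq> U" using box_subset_cbox by fastforce
    show "U \<subseteq> \<Union>?F"
    proof
      fix x assume "x \<in> U"
      then obtain e where e: "e > 0" "cball x e \<subseteq> U" using U open_contains_cball by blast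
      obtain a b where ab: "x \<in> box a b" "box a b \<subseteq> ball x e" using rational_boxes[OF e(1), of x] by blast
      have "cbox a b = closure (box a b)" using ab(1) closure_box[of a b] by blast
      also have "\<dots> \<subseteq> cball x e" using closure_mono[OF ab(2)] e(1) by simp
      finally have "cbox a b \<subseteq> cball x e" .
      then show "x \<in> \<Union>?F" using ab(1) e(2) by blast
    qed
  qed
  \<comment> \<open>The empty set is added so that the countable family can be enumerated even if
    \<open>U\<close> is empty; \<open>box 1 0\<close> represents it.\<close>
  define F' where "F' = insert {} F"
  have "countable F'" "F' \<noteq> {}" using F by (auto simp: F'_def)
  then have range: "range (from_nat_into F') = F'" by (rule range_from_nat_into[rotated])
  have "{} = box (1::real^'n) 0" "cbox (1::real^'n) 0 = {}"
    by (auto simp: mem_box_cart) (metis less_trans not_one_less_zero, metis order.trans not_one_le_zero)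
  then have e: "\<exists>a b::real^'n. {} = box a b \<and> cbox a b \<subseteq> U" by (metis empty_subsetI)
  have "\<exists>a b. from_nat_into F' k = box a b \<and> cbox a b \<subseteq> U" for k
  proof (cases "from_nat_into F' k = {}")
    case True
    then show ?thesis using e by simp
  next
    case False
    then have "from_nat_into F' k \<in> F" using range by (auto simp: F'_def)
    then show ?thesis using F(1) by blast
  qed
  then obtain A B where AB: "\<And>k. from_nat_into F' k = box (A k) (B k)" "\<And>k. cbox (A k) (B k) \<subseteq> U" by metis
  have "(\<Union>k. box (A k) (B k)) = \<Union>F'" using range AB(1) by (metis (no_types, lifting) image_cong)
  also have "\<dots> = U" using F(3) cov by (simp add: F'_def)
  finally show ?thesis using AB(2) by blast
qed

text \<open>Take 1 minus the product of (1 - bump_k)^n over k < n. Each factor lies in [0,1], and a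
  single positive bump drives its power to 0, so the approximation converges at every point of
  \<open>U\<close> although the bumps are not normalised.\<close>

lemma test_functions_approx_indicator:
  fixes U :: "(real^'n) set"
  assumes U: "open U"
  obtains \<psi> where "\<And>n. \<psi> n \<in> test_functions U" "\<And>n x. 0 \<le> \<psi> n x" "\<And>n x. \<psi> n x \<le> 1"
    "\<And>x. (\<lambda>n. \<psi> n x) \<longlonglongrightarrow> indicator U x"
proof -
  obtain A B :: "nat => real^'n" where AB0: "(\<forall>k. cbox (A k) (B k) \<subseteq> U) \<and> (\<Union>k. box (A k) (B k)) = U"
    using open_box_exhaustion[OF U] by (elim exE)
  note AB = AB0[THEN conjunct1, rule_format] AB0[THEN conjunct2]
  define \<rho> where "\<rho> n x = (\<Prod>k<n. (1 - bump (A k) (B k) x) ^ n)" for n :: nat and x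
  have fac: "0 \<le> 1 - bump (A k) (B k) x" "1 - bump (A k) (B k) x \<le> 1" for k x using bump_range[of "A k" "B k" x] by auto
  have fac': "0 \<le> (1 - bump (A k) (B k) x) ^ n" "(1 - bump (A k) (B k) x) ^ n \<le> 1" for k x n
    by (intro zero_le_power fac, intro power_le_one fac)
  have \<rho>: "0 \<le> \<rho> n x" "\<rho> n x \<le> 1" for n x
    unfolding \<rho>_def using fac' by (intro prod_nonneg ballI, blast, intro prod_le_1 conjI, blast+)
  have \<rho>_sm: "\<rho> n \<in> smooth_algebra" for n
  proof -
    have "(\<lambda>x. 1 + (-1) * bump (A k) (B k) x) \<in> smooth_algebra" for k by (intro smooth_algebra.intros bump_smooth_algebra)
    then show ?thesis unfolding \<rho>_def[abs_def] by (intro smooth_algebra_prod smooth_algebra_power) simp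
  qed
  define \<psi> where "\<psi> n x = 1 - \<rho> n x" for n x
  have "(\<lambda>x. 1 + (-1) * \<rho> n x) \<in> smooth_algebra" for n by (intro smooth_algebra.intros \<rho>_sm)
  then have "\<psi> n \<in> smooth_algebra" for n unfolding \<psi>_def[abs_def] by simp
  moreover have "supported_in U (\<psi> n)" for n
    unfolding supported_in_def
  proof (intro exI conjI allI impI)
    show "compact (\<Union>k<n. cbox (A k) (B k))" by (intro compact_UN) auto
    show "(\<Union>k<n. cbox (A k) (B k)) \<subseteq> U" using AB(1) by blast
    show "\<psi> n x = 0" if "x \<notin> (\<Union>k<n. cbox (A k) (B k))" for x
      using that by (auto simp: \<psi>_def \<rho>_def bump_zero)
  qed
  ultimately have "\<psi> n \<in> test_functions U" for n by (simp add: test_functions_def smooth_algebra_smooth)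
  moreover have "0 \<le> \<psi> n x" "\<psi> n x \<le> 1" for n x using \<rho>[of n x] by (auto simp: \<psi>_def)
  moreover have "(\<lambda>n. \<psi> n x) \<longlonglongrightarrow> indicator U x" for x
  proof (cases "x \<in> U")
    case True
    then obtain k where k: "x \<in> box (A k) (B k)" unfolding AB(2)[symmetric] by blast
    let ?b = "1 - bump (A k) (B k) x"
    have b: "0 \<le> ?b" "?b < 1" using fac[of k x] bump_pos_iff k by auto
    have "\<rho> n x \<le> ?b ^ n" if "n > k" for n
    proof -
      have "\<rho> n x = ?b ^ n * (\<Prod>j\<in>{..<n} - {k}. (1 - bump (A j) (B j) x) ^ n)"
        unfolding \<rho>_def using that by (subst prod.remove[of _ k]) auto
      also have "\<dots> \<le> ?b ^ n * 1"
        using fac' b by (intro mult_left_mono prod_le_1 conjI zero_le_power) (auto simp: bump_range)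
      finally show ?thesis by simp
    qed
    then have ev: "\<forall>\<^sub>F n in sequentially. \<rho> n x \<le> ?b ^ n" by (auto simp: eventually_sequentially intro!: exI[of _ "Suc k"])
    have lim: "(\<lambda>n. ?b ^ n) \<longlonglongrightarrow> 0" using b by (intro LIMSEQ_realpow_zero)
    have "(\<lambda>n. \<rho> n x) \<longlonglongrightarrow> 0"
      by (rule tendsto_sandwich[OF _ ev tendsto_const lim]) (simp add: \<rho>(1))
    then have "(\<lambda>n. 1 - \<rho> n x) \<longlonglongrightarrow> 1 - 0" by (intro tendsto_intros)
    then show ?thesis using True by (simp add: \<psi>_def)
  next
    case False
    then have "bump (A k) (B k) x = 0" for k using AB(1)[of k] by (intro bump_zero) auto
    then show ?thesis using False by (simp add: \<psi>_def \<rho>_def)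
  qed
  ultimately show thesis using that by blast
qed

text \<open>\<open>F\<close> is only locally integrable, so the argument runs on each box of an
  exhaustion. There, test functions approximate the indicator of an open subset boundedly, and
  nonnegative integrals over open sets follow by dominated convergence.\<close>

lemma test_functions_nonneg_imp_AE:
  fixes \<Omega> :: "(real^'n) set" and F :: "real^'n => real"
  assumes \<Omega>: "open \<Omega>" and F: "\<And>K. compact K ==> K \<subseteq> \<Omega> ==> integrable (lebesgue_on K) F"
    and nonneg: "\<And>\<psi>. \<psi> \<in> test_functions \<Omega> ==> (\<And>x. 0 \<le> \<psi> x) ==> 0 \<le> (\<integral>x. F x * \<psi> x \<partial>lebesgue_on \<Omega>)"
  shows "AE x in lebesgue_on \<Omega>. 0 \<le> F x"
proof -
  obtain A B :: "nat => real^'n" where AB0: "(\<forall>k. cbox (A k) (B k) \<subseteq> \<Omega>) \<and> (\<Union>k. box (A k) (B k)) = \<Omega>"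
    using open_box_exhaustion[OF \<Omega>] by (elim exE)
  note AB = AB0[THEN conjunct1, rule_format] AB0[THEN conjunct2]
  have \<Omega>m: "\<Omega> \<in> sets lebesgue" using \<Omega> by auto
  have "AE x in lebesgue. 0 \<le> indicator (box (A k) (B k)) x * F x" for k
  proof (rule nonneg_open_integrals_imp_AE)
    let ?W = "box (A k) (B k)"
    let ?G = "\<lambda>x. indicator ?W x * F x"
    have Wm: "?W \<in> sets lebesgue" by simp
    have "integrable lebesgue (\<lambda>x. indicator (cbox (A k) (B k)) x *\<^sub>R F x)"
      using F[of "cbox (A k) (B k)"] AB(1) by (simp add: integrable_restrict_space)
    from integrable_real_mult_indicator[OF Wm this]
    have "integrable lebesgue (\<lambda>x. indicator (cbox (A k) (B k)) x *\<^sub>R F x * indicator ?W x)" by simp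
    moreover have "(\<lambda>x. indicator (cbox (A k) (B k)) x *\<^sub>R F x * indicator ?W x) = ?G"
      using box_subset_cbox[of "A k" "B k"] by (auto simp: indicator_def fun_eq_iff)
    ultimately show G: "integrable lebesgue ?G" by simp
    fix U :: "(real^'n) set" assume U: "open U"
    obtain \<psi> where \<psi>: "\<And>n. \<psi> n \<in> test_functions (U \<inter> ?W)" "\<And>n x. 0 \<le> \<psi> n x" "\<And>n x. \<psi> n x \<le> 1"
      "\<And>x. (\<lambda>n. \<psi> n x) \<longlonglongrightarrow> indicator (U \<inter> ?W) x"
      by (rule test_functions_approx_indicator[OF open_Int[OF U open_box]]) (rule that)
    have W\<Omega>: "?W \<subseteq> \<Omega>" unfolding AB(2)[symmetric] by blast
    have \<psi>0: "\<psi> n x = 0" if "x \<notin> ?W" for n x using \<psi>(1)[of n] that by (auto simp: test_functions_def supported_in_def)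
    have \<psi>m: "\<psi> n \<in> borel_measurable lebesgue" for n
      using C1cD(3) test_functions_subset_C1c \<psi>(1) continuous_imp_lebesgue_measurable(2) by blast
    have "(\<lambda>n. \<integral>x. ?G x * \<psi> n x \<partial>lebesgue) \<longlonglongrightarrow> (\<integral>x. ?G x * indicator (U \<inter> ?W) x \<partial>lebesgue)"
    proof (rule integral_dominated_convergence[where w = "\<lambda>x. norm (?G x)"])
      show "(\<lambda>x. ?G x * indicator (U \<inter> ?W) x) \<in> borel_measurable lebesgue"
        using U by (intro borel_measurable_times[OF borel_measurable_integrable[OF G]] borel_measurable_indicator) auto
      show "(\<lambda>x. ?G x * \<psi> n x) \<in> borel_measurable lebesgue" for n
        by (rule borel_measurable_times[OF borel_measurable_integrable[OF G] \<psi>m])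
      show "AE x in lebesgue. (\<lambda>n. ?G x * \<psi> n x) \<longlonglongrightarrow> ?G x * indicator (U \<inter> ?W) x"
        by (intro AE_I2 tendsto_mult tendsto_const \<psi>(4))
      show "AE x in lebesgue. norm (?G x * \<psi> n x) \<le> norm (?G x)" for n
        using \<psi>(2,3) by (auto simp: abs_mult intro!: mult_left_le)
    qed (use G in auto)
    moreover have "0 \<le> (\<integral>x. ?G x * \<psi> n x \<partial>lebesgue)" for n
    proof -
      have "0 \<le> (\<integral>x. F x * \<psi> n x \<partial>lebesgue_on \<Omega>)"
        using nonneg[of "\<psi> n"] \<psi>(1,2) test_functions_mono[of "U \<inter> ?W" \<Omega>] W\<Omega> by blast
      also have "\<dots> = (\<integral>x. indicator \<Omega> x *\<^sub>R (F x * \<psi> n x) \<partial>lebesgue)"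
        using \<Omega>m by (simp add: integral_restrict_space)
      also have "\<dots> = (\<integral>x. ?G x * \<psi> n x \<partial>lebesgue)"
        using \<psi>0 W\<Omega> by (intro Bochner_Integration.integral_cong) (auto simp: indicator_def)
      finally show ?thesis .
    qed
    ultimately have "0 \<le> (\<integral>x. ?G x * indicator (U \<inter> ?W) x \<partial>lebesgue)" by (intro LIMSEQ_le_const) auto
    also have "\<dots> = (\<integral>x. indicator U x * ?G x \<partial>lebesgue)"
      by (intro Bochner_Integration.integral_cong) (auto simp: indicator_def)
    finally show "0 \<le> (\<integral>x. indicator U x * ?G x \<partial>lebesgue)" .
  qed
  then have "AE x in lebesgue. \<forall>k. 0 \<le> indicator (box (A k) (B k)) x * F x" by (subst AE_all_countable) blast
  then have "AE x in lebesgue. x \<in> \<Omega> \<longrightarrow> 0 \<le> F x"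
  proof eventually_elim
    case (elim x)
    show ?case
    proof
      assume "x \<in> \<Omega>"
      then obtain k where "x \<in> box (A k) (B k)" unfolding AB(2)[symmetric] by blast
      then show "0 \<le> F x" using elim[rule_format, of k] by simp
    qed
  qed
  then show ?thesis using \<Omega>m by (simp add: AE_restrict_space_iff)
qed

lemma test_functions_zero_imp_AE:
  fixes \<Omega> :: "(real^'n) set" and F :: "real^'n => real"
  assumes \<Omega>: "open \<Omega>" and F: "\<And>K. compact K ==> K \<subseteq> \<Omega> ==> integrable (lebesgue_on K) F"
    and zero: "\<And>\<psi>. \<psi> \<in> test_functions \<Omega> ==> (\<integral>x. F x * \<psi> x \<partial>lebesgue_on \<Omega>) = 0"
  shows "AE x in lebesgue_on \<Omega>. F x = 0"
proof -
  have "AE x in lebesgue_on \<Omega>. 0 \<le> F x" by (rule test_functions_nonneg_imp_AE[OF \<Omega> F]) (simp_all add: zero)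
  moreover have "AE x in lebesgue_on \<Omega>. 0 \<le> - F x"
    by (rule test_functions_nonneg_imp_AE[OF \<Omega>]) (use F zero in auto)
  ultimately show ?thesis by eventually_elim simp
qed

section \<open>Subunit curves\<close>

lemma AE_lebesgue_iff_negligible: "(AE x in lebesgue. P x) \<longleftrightarrow> negligible {x. \<not> P x}"
  by (simp add: completion.AE_iff_null_sets negligible_iff_null_sets)

lemma AC_imp_continuous_on:
  assumes "abs_continuous_curve T \<gamma>"
  shows "continuous_on {0..T} \<gamma>"
  unfolding continuous_on_iff
proof (intro ballI allI impI)
  fix t e :: real assume t: "t \<in> {0..T}" and "0 < e"
  then obtain d where d: "d > 0" "\<And>P. finite P \<and> (\<forall>(s,t)\<in>P. 0 \<le> s \<and> s < t \<and> t \<le> T) \<and>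
        disjoint_family_on (\<lambda>(s,t). {s<..<t}) P \<and> (\<Sum>(s,t)\<in>P. t - s) < d
        ==> (\<Sum>(s,t)\<in>P. norm (\<gamma> t - \<gamma> s)) < e"
    using assms unfolding abs_continuous_curve_def by meson
  have "dist (\<gamma> s) (\<gamma> t) < e" if s: "s \<in> {0..T}" "dist s t < d" for s
  proof -
    have "norm (\<gamma> v - \<gamma> u) < e" if "0 \<le> u" "u < v" "v \<le> T" "v - u < d" for u v
      using d(2)[of "{(u, v)}"] that by (simp add: disjoint_family_on_def)
    from this[of s t] this[of t s] show ?thesis
      using s t \<open>0 < e\<close> by (cases s t rule: linorder_cases) (auto simp: dist_norm norm_minus_commute abs_if split: if_splits)
  qed
  with d(1) show "\<exists>d>0. \<forall>x'\<in>{0..T}. dist x' t < d \<longrightarrow> dist (\<gamma> x') (\<gamma> t) < e" by blast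
qed

text \<open>The mean value inequality for an absolutely continuous curve whose derivative is
  controlled off a null set. A gauge forces intervals tagged in the null set into an open set of
  small measure, where absolute continuity controls the increments; on the others the derivative
  does.\<close>

lemma AC_norm_bound:
  fixes \<gamma> :: "real => 'a::real_normed_vector"
  assumes AC: "abs_continuous_curve T \<gamma>" and ab: "0 \<le> a" "a \<le> b" "b \<le> T" and N: "negligible N" and M: "0 \<le> M"
    and der: "\<And>t. t \<in> {a..b} ==> t \<notin> N ==> \<exists>v. (\<gamma> has_vector_derivative v) (at t within {0..T}) \<and> norm v \<le> M"
  shows "norm (\<gamma> b - \<gamma> a) \<le> M * (b - a)"
proof (rule field_le_epsilon)
  fix e' :: real assume "0 < e'"
  \<comment> \<open>The total error is e (b - a) from the good intervals plus e from the bad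
    ones.\<close>
  define e where "e = e' / (b - a + 1)"
  have e: "0 < e" using \<open>0 < e'\<close> ab by (simp add: e_def)
  obtain d where d: "d > 0" "\<And>P. finite P \<and> (\<forall>(s,t)\<in>P. 0 \<le> s \<and> s < t \<and> t \<le> T) \<and>
        disjoint_family_on (\<lambda>(s,t). {s<..<t}) P \<and> (\<Sum>(s,t)\<in>P. t - s) < d
        ==> (\<Sum>(s,t)\<in>P. norm (\<gamma> t - \<gamma> s)) < e"
    using AC e unfolding abs_continuous_curve_def by meson
  have Nn: "N \<in> null_sets lebesgue" using N by (simp add: negligible_iff_null_sets)
  obtain U where U: "open U" "N \<subseteq> U" "U - N \<in> lmeasurable" "emeasure lebesgue (U - N) < ennreal d"
    using sets_lebesgue_outer_open[of N d] Nn d(1) by (metis null_setsD2)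
  have Um: "emeasure lebesgue U < ennreal d"
    using emeasure_Diff_null_set[OF Nn, of U] U by simp
  have "\<exists>r>0. \<forall>s\<in>{0..T}. \<bar>s - t\<bar> < r \<longrightarrow> norm (\<gamma> s - \<gamma> t) \<le> (M + e) * \<bar>s - t\<bar>" if t: "t \<in> {a..b}" "t \<notin> N" for t
  proof -
    obtain v where v: "(\<gamma> has_vector_derivative v) (at t within {0..T})" "norm v \<le> M" using der[OF t] by blast
    then obtain r where r: "r > 0" "\<And>s. s \<in> {0..T} ==> \<bar>s - t\<bar> < r ==> norm (\<gamma> s - \<gamma> t - (s - t) *\<^sub>R v) \<le> e * \<bar>s - t\<bar>"
      unfolding has_vector_derivative_def has_derivative_within_alt using e by (metis real_norm_def)
    have "norm (\<gamma> s - \<gamma> t) \<le> (M + e) * \<bar>s - t\<bar>" if "s \<in> {0..T}" "\<bar>s - t\<bar> < r" for s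
    proof -
      have "norm (\<gamma> s - \<gamma> t) \<le> norm (\<gamma> s - \<gamma> t - (s - t) *\<^sub>R v) + norm ((s - t) *\<^sub>R v)"
        by (metis add.commute norm_triangle_sub)
      also have "\<dots> \<le> e * \<bar>s - t\<bar> + \<bar>s - t\<bar> * M" using r(2)[OF that] v(2) by (auto intro!: add_mono mult_left_mono)
      finally show ?thesis by (simp add: algebra_simps)
    qed
    with r(1) show ?thesis by blast
  qed
  then obtain r where r: "\<And>t. t \<in> {a..b} ==> t \<notin> N ==> r t > 0"
    "\<And>t s. t \<in> {a..b} ==> t \<notin> N ==> s \<in> {0..T} ==> \<bar>s - t\<bar> < r t ==> norm (\<gamma> s - \<gamma> t) \<le> (M + e) * \<bar>s - t\<bar>"
    by metis
  \<comment> \<open>Tags in \<open>N\<close> are confined to \<open>U\<close>, the others to the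
    range where the linear approximation of the curve holds.\<close>
  define g where "g t = (if t \<in> N then U else if t \<in> {a..b} then ball t (r t) else ball t 1)" for t
  have "gauge g" using U(1,2) r(1) by (auto simp: gauge_def g_def)
  then obtain p where p: "p tagged_division_of {a..b}" "g fine p" using fine_division_exists_real by blast
  have fin: "finite p" using p(1) by blast
  have p_elt: "\<exists>u v. k = {u..v} \<and> u \<le> v \<and> a \<le> u \<and> v \<le> b \<and> x \<in> {u..v} \<and> {u..v} \<subseteq> g x" if xk: "(x, k) \<in> p" for x k
  proof -
    obtain u v where uv: "k = cbox u v" using tagged_division_ofD(4)[OF p(1) xk] by blast
    have "x \<in> k" "k \<subseteq> {a..b}" using tagged_division_ofD(2,3)[OF p(1) xk] by auto
    moreover have "k \<subseteq> g x" using p(2) xk by (auto simp: fine_def)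
    ultimately show ?thesis using uv by (intro exI[of _ u] exI[of _ v]) auto
  qed
  define p1 where "p1 = {(x, k) \<in> p. x \<notin> N}"
  \<comment> \<open>Degenerate intervals are dropped: absolute continuity speaks of s < t, and
    distinct tags on them could share an interval.\<close>
  define p2 where "p2 = {(x, k) \<in> p. x \<in> N \<and> Inf k < Sup k}"
  let ?inc = "\<lambda>(x::real, k). norm (\<gamma> (Sup k) - \<gamma> (Inf k))"
  have "norm (\<gamma> b - \<gamma> a) = norm (\<Sum>(x, k)\<in>p. \<gamma> (Sup k) - \<gamma> (Inf k))"
    using additive_tagged_division_1[OF ab(2) p(1), of \<gamma>] by simp
  also have "\<dots> \<le> sum ?inc p" by (rule order.trans[OF norm_sum]) (simp add: case_prod_unfold)
  also have "\<dots> = sum ?inc p1 + sum ?inc (p - p1)"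
  proof -
    have "p1 \<subseteq> p" by (auto simp: p1_def)
    from sum.subset_diff[OF this fin, of ?inc] show ?thesis by simp
  qed
  also have "sum ?inc (p - p1) = sum ?inc p2"
  proof (rule sum.mono_neutral_right)
    show "\<forall>i\<in>p - p1 - p2. ?inc i = 0"
    proof
      fix i assume "i \<in> p - p1 - p2"
      then obtain x k where i: "i = (x, k)" "(x, k) \<in> p" "\<not> Inf k < Sup k" by (auto simp: p1_def p2_def)
      then obtain u v where "k = {u..v}" "u \<le> v" using p_elt by blast
      then show "?inc i = 0" using i by (simp add: cInf_atLeastAtMost cSup_atLeastAtMost)
    qed
  qed (use fin in \<open>auto simp: p1_def p2_def\<close>)
  also have "sum ?inc p1 \<le> (\<Sum>(x, k)\<in>p1. (M + e) * measure lborel k)"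
  proof (rule sum_mono)
    fix i assume "i \<in> p1"
    then obtain x k where i: "i = (x, k)" "(x, k) \<in> p" "x \<notin> N" by (auto simp: p1_def)
    then obtain u v where uv: "k = {u..v}" "u \<le> v" "a \<le> u" "v \<le> b" "x \<in> {u..v}" "{u..v} \<subseteq> g x" using p_elt by blast
    have x: "x \<in> {a..b}" using uv by auto
    have "{u..v} \<subseteq> ball x (r x)" using uv(6) i(3) x by (simp add: g_def)
    then have "u \<in> ball x (r x)" "v \<in> ball x (r x)" using uv(2) by auto
    then have 1: "norm (\<gamma> v - \<gamma> x) \<le> (M + e) * \<bar>v - x\<bar>" "norm (\<gamma> u - \<gamma> x) \<le> (M + e) * \<bar>u - x\<bar>"
      using uv ab r(2)[OF x i(3), of v] r(2)[OF x i(3), of u] by (auto simp: dist_real_def)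
    have "norm (\<gamma> v - \<gamma> u) \<le> norm (\<gamma> v - \<gamma> x) + norm (\<gamma> u - \<gamma> x)"
      using norm_triangle_ineq4[of "\<gamma> v - \<gamma> x" "\<gamma> u - \<gamma> x"] by simp
    also have "\<dots> \<le> (M + e) * (v - x) + (M + e) * (x - u)" using 1 uv(5) by simp
    finally show "?inc i \<le> (case i of (x, k) => (M + e) * measure lborel k)"
      using uv(2) by (simp add: i uv(1) algebra_simps)
  qed
  also have "\<dots> \<le> (\<Sum>(x, k)\<in>p. (M + e) * measure lborel k)"
    using e fin M by (intro sum_mono2) (auto simp: p1_def)
  also have "\<dots> = (M + e) * (b - a)"
    using additive_content_tagged_division[of p a b] p(1) ab(2)
    by (simp add: sum_distrib_left[symmetric] case_prod_unfold)
  also have "sum ?inc p2 \<le> e"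
  proof -
    define iv where "iv = (\<lambda>(x::real, k::real set). (Inf k, Sup k))"
    have p2_elt: "\<exists>u v. k = {u..v} \<and> u < v \<and> a \<le> u \<and> v \<le> b \<and> {u..v} \<subseteq> U \<and> iv (x, k) = (u, v)" if xk: "(x, k) \<in> p2" for x k
    proof -
      have "(x, k) \<in> p" "x \<in> N" "Inf k < Sup k" using xk by (auto simp: p2_def)
      moreover from p_elt[OF this(1)] obtain u v where "k = {u..v}" "u \<le> v" "a \<le> u" "v \<le> b" "{u..v} \<subseteq> g x" by blast
      ultimately show ?thesis by (intro exI[of _ u] exI[of _ v]) (auto simp: g_def iv_def)
    qed
    have disj: "{u<..<v} \<inter> {u'<..<v'} = {}"
      if "(x, k) \<in> p2" "(x', k') \<in> p2" "(x, k) \<noteq> (x', k')" "iv (x, k) = (u, v)" "iv (x', k') = (u', v')" for x k x' k' u v u' v'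
    proof -
      have "interior k \<inter> interior k' = {}"
        using tagged_division_ofD(5)[OF p(1), of x k x' k'] that by (auto simp: p2_def)
      then show ?thesis using p2_elt[OF that(1)] p2_elt[OF that(2)] that(4,5) by auto
    qed
    have inj: "inj_on iv p2"
    proof (rule inj_onI, rule ccontr)
      fix i i' assume i: "i \<in> p2" "i' \<in> p2" "iv i = iv i'" "i \<noteq> i'"
      obtain x k x' k' where eq: "i = (x, k)" "i' = (x', k')" by (cases i, cases i')
      obtain u v where uv: "u < v" "iv i = (u, v)" using p2_elt[of x k] i(1) eq by blast
      have "{u<..<v} \<inter> {u<..<v} = {}"
        by (rule disj[of x k x' k']) (use i eq uv in auto)
      then show False using uv(1) dense[of u v] by auto
    qed
    let ?P = "iv ` p2"
    have P_elt: "0 \<le> s \<and> s < t \<and> t \<le> T \<and> {s..t} \<subseteq> U" if "(s, t) \<in> ?P" for s t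
      using that p2_elt ab by fastforce
    have fam: "disjoint_family_on (\<lambda>(s,t). {s<..<t}) ?P"
      unfolding disjoint_family_on_def
    proof (intro ballI impI)
      fix m n assume mn: "m \<in> ?P" "n \<in> ?P" "m \<noteq> n"
      then obtain x k x' k' where *: "m = iv (x, k)" "n = iv (x', k')" "(x, k) \<in> p2" "(x', k') \<in> p2" by auto
      then have "(x, k) \<noteq> (x', k')" using mn(3) by auto
      note ne = this
      obtain u v u' v' where uv: "m = (u, v)" "n = (u', v')" by (cases m, cases n)
      have "{u<..<v} \<inter> {u'<..<v'} = {}"
        by (rule disj[OF *(3,4) ne]) (use * uv in simp_all)
      then show "(case m of (s, t) => {s<..<t}) \<inter> (case n of (s, t) => {s<..<t}) = {}"
        by (simp add: uv)
    qed
    have "finite p2" by (rule finite_subset[OF _ fin]) (auto simp: p2_def)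
    then have finP: "finite ?P" by (rule finite_imageI)
    have "ennreal (\<Sum>(s,t)\<in>?P. t - s) = (\<Sum>(s,t)\<in>?P. ennreal (t - s))"
      by (subst sum_ennreal[symmetric]) (use P_elt in \<open>auto simp: case_prod_unfold intro: less_imp_le\<close>)
    also have "\<dots> = (\<Sum>i\<in>?P. emeasure lebesgue (case i of (s,t) => {s<..<t}))"
    proof (rule sum.cong)
      fix i assume i: "i \<in> ?P"
      have "fst i \<le> snd i" using P_elt[of "fst i" "snd i"] i by simp
      then show "(case i of (s, t) => ennreal (t - s)) = emeasure lebesgue (case i of (s, t) => {s<..<t})"
        by (simp add: case_prod_unfold)
    qed simp
    also have "\<dots> = emeasure lebesgue (\<Union>i\<in>?P. case i of (s,t) => {s<..<t})"
      using fam finP by (intro sum_emeasure) auto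
    also have "\<dots> \<le> emeasure lebesgue U"
    proof (intro emeasure_mono UN_least)
      fix i assume i: "i \<in> ?P"
      have "{fst i<..<snd i} \<subseteq> {fst i..snd i}" by auto
      also have "\<dots> \<subseteq> U" using P_elt[of "fst i" "snd i"] i by simp
      finally show "(case i of (s, t) => {s<..<t}) \<subseteq> U" by (simp add: case_prod_unfold)
    qed (use U(1) in auto)
    also have "\<dots> < ennreal d" by (rule Um)
    finally have lt: "ennreal (\<Sum>(s,t)\<in>?P. t - s) < ennreal d" .
    have "(\<Sum>(s,t)\<in>?P. t - s) < d"
    proof (rule ccontr)
      assume "\<not> ?thesis"
      then have "ennreal d \<le> ennreal (\<Sum>(s,t)\<in>?P. t - s)" by (intro ennreal_leI) simp
      with lt show False by simp
    qed
    then have "(\<Sum>(s,t)\<in>?P. norm (\<gamma> t - \<gamma> s)) < e"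
      using d(2)[of ?P] finP fam P_elt by blast
    also have "(\<Sum>(s,t)\<in>?P. norm (\<gamma> t - \<gamma> s)) = sum ?inc p2"
      by (subst sum.reindex[OF inj]) (simp add: iv_def case_prod_unfold)
    finally show ?thesis by simp
  qed
  finally have "norm (\<gamma> b - \<gamma> a) \<le> (M + e) * (b - a) + e" by simp
  also have "\<dots> = M * (b - a) + e * (b - a + 1)" by (simp add: algebra_simps)
  also have "e * (b - a + 1) = e'" using ab by (simp add: e_def)
  finally show "norm (\<gamma> b - \<gamma> a) \<le> M * (b - a) + e'" .
qed

text \<open>The Hilbert-Schmidt norm of the family of fields; it bounds the Euclidean speed of
  subunit curves and depends continuously on the point.\<close>

definition speed :: "('m::finite => real^'n => real^'n) => real^'n => real" where
  "speed X x = sqrt (\<Sum>j\<in>UNIV. (norm (X j x))\<^sup>2)"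

text \<open>Choose \<open>\<xi>\<close> equal to the velocity and apply Cauchy-Schwarz to each
  field.\<close>

lemma subunit_vector_norm:
  assumes "\<And>\<xi>. (v \<bullet> \<xi>)\<^sup>2 \<le> (\<Sum>j\<in>UNIV. (X j x \<bullet> \<xi>)\<^sup>2)"
  shows "norm v \<le> speed X x"
proof -
  have "(norm v)\<^sup>2 * (norm v)\<^sup>2 \<le> (\<Sum>j\<in>UNIV. (X j x \<bullet> v)\<^sup>2)"
    using assms[of v] by (simp add: power2_norm_eq_inner power2_eq_square[of "v \<bullet> v"])
  also have "\<dots> \<le> (\<Sum>j\<in>UNIV. (norm (X j x))\<^sup>2 * (norm v)\<^sup>2)"
    by (intro sum_mono) (metis Cauchy_Schwarz_ineq2 abs_le_square_iff abs_mult abs_norm_cancel power_mult_distrib)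
  also have "\<dots> = (speed X x)\<^sup>2 * (norm v)\<^sup>2"
    by (simp add: speed_def sum_distrib_right sum_nonneg)
  finally have le: "(norm v)\<^sup>2 * (norm v)\<^sup>2 \<le> (speed X x)\<^sup>2 * (norm v)\<^sup>2" .
  have "(norm v)\<^sup>2 \<le> (speed X x)\<^sup>2 \<or> v = 0"
    using mult_right_le_imp_le[OF le] by (cases "v = 0") simp_all
  moreover have "0 \<le> speed X x" by (simp add: speed_def sum_nonneg)
  ultimately show ?thesis by (auto intro: power2_le_imp_le)
qed

lemma subunit_iff:
  "subunit X T \<gamma> \<longleftrightarrow> abs_continuous_curve T \<gamma> \<and> (\<exists>N. negligible N \<and> (\<forall>t\<in>{0..T} - N.
     \<exists>v. (\<gamma> has_vector_derivative v) (at t within {0..T}) \<and> (\<forall>\<xi>. (v \<bullet> \<xi>)\<^sup>2 \<le> (\<Sum>j\<in>UNIV. (X j (\<gamma> t) \<bullet> \<xi>)\<^sup>2))))"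
proof -
  have "(AE t in lebesgue_on {0..T}. P t) \<longleftrightarrow> (\<exists>N. negligible N \<and> (\<forall>t\<in>{0..T} - N. P t))" for P
  proof -
    have "(AE t in lebesgue_on {0..T}. P t) \<longleftrightarrow> (AE t in lebesgue. t \<in> {0..T} \<longrightarrow> P t)"
      by (simp add: AE_restrict_space_iff)
    also have "\<dots> \<longleftrightarrow> negligible {t. \<not> (t \<in> {0..T} \<longrightarrow> P t)}" by (rule AE_lebesgue_iff_negligible)
    also have "\<dots> \<longleftrightarrow> (\<exists>N. negligible N \<and> (\<forall>t\<in>{0..T} - N. P t))"
    proof
      assume "\<exists>N. negligible N \<and> (\<forall>t\<in>{0..T} - N. P t)"
      then obtain N where N: "negligible N" "\<forall>t\<in>{0..T} - N. P t" by blast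
      show "negligible {t. \<not> (t \<in> {0..T} \<longrightarrow> P t)}" by (rule negligible_subset[OF N(1)]) (use N(2) in auto)
    qed auto
    finally show ?thesis .
  qed
  then show ?thesis unfolding subunit_def by simp
qed

lemma subunit_speed_bound:
  assumes sub: "subunit X T \<gamma>" and ab: "0 \<le> a" "a \<le> b" "b \<le> T" and M: "0 \<le> M"
    and bd: "\<And>t. t \<in> {a..b} ==> speed X (\<gamma> t) \<le> M"
  shows "norm (\<gamma> b - \<gamma> a) \<le> M * (b - a)"
proof -
  obtain N where N: "negligible N" "\<And>t. t \<in> {0..T} - N ==> \<exists>v. (\<gamma> has_vector_derivative v) (at t within {0..T}) \<and>
     (\<forall>\<xi>. (v \<bullet> \<xi>)\<^sup>2 \<le> (\<Sum>j\<in>UNIV. (X j (\<gamma> t) \<bullet> \<xi>)\<^sup>2))" and AC: "abs_continuous_curve T \<gamma>"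
    using sub unfolding subunit_iff by blast
  show ?thesis
  proof (rule AC_norm_bound[OF AC ab N(1) M])
    fix t assume t: "t \<in> {a..b}" "t \<notin> N"
    then obtain v where "(\<gamma> has_vector_derivative v) (at t within {0..T})" "\<And>\<xi>. (v \<bullet> \<xi>)\<^sup>2 \<le> (\<Sum>j\<in>UNIV. (X j (\<gamma> t) \<bullet> \<xi>)\<^sup>2)"
      using N(2)[of t] ab by auto
    then show "\<exists>v. (\<gamma> has_vector_derivative v) (at t within {0..T}) \<and> norm v \<le> M"
      using order.trans[OF subunit_vector_norm[of v X "\<gamma> t"] bd[OF t(1)]] by blast
  qed
qed

lemma lipschitz_imp_AC:
  assumes "L-lipschitz_on {0..T} \<gamma>"
  shows "abs_continuous_curve T \<gamma>"
  unfolding abs_continuous_curve_def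
proof (intro allI impI)
  fix e :: real assume "0 < e"
  have L: "0 \<le> L" using assms by (rule lipschitz_on_nonneg)
  show "\<exists>\<delta>>0. \<forall>P. finite P \<and> (\<forall>(s,t)\<in>P. 0 \<le> s \<and> s < t \<and> t \<le> T) \<and>
        disjoint_family_on (\<lambda>(s,t). {s<..<t}) P \<and> (\<Sum>(s,t)\<in>P. t - s) < \<delta>
        \<longrightarrow> (\<Sum>(s,t)\<in>P. norm (\<gamma> t - \<gamma> s)) < e"
  proof (intro exI[of _ "e / (L + 1)"] conjI allI impI)
    show "0 < e / (L + 1)" using L \<open>0 < e\<close> by simp
    fix P :: "(real \<times> real) set"
    assume P: "finite P \<and> (\<forall>(s,t)\<in>P. 0 \<le> s \<and> s < t \<and> t \<le> T) \<and>
        disjoint_family_on (\<lambda>(s,t). {s<..<t}) P \<and> (\<Sum>(s,t)\<in>P. t - s) < e / (L + 1)"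
    have "(\<Sum>(s,t)\<in>P. norm (\<gamma> t - \<gamma> s)) \<le> (\<Sum>(s,t)\<in>P. (L + 1) * (t - s))"
    proof (rule sum_mono)
      fix i assume "i \<in> P"
      then obtain s t where i: "i = (s, t)" "0 \<le> s" "s < t" "t \<le> T" using P by auto
      have "norm (\<gamma> t - \<gamma> s) \<le> L * (t - s)" using lipschitz_onD[OF assms, of t s] i by (simp add: dist_norm dist_real_def)
      then show "(case i of (s, t) => norm (\<gamma> t - \<gamma> s)) \<le> (case i of (s, t) => (L + 1) * (t - s))"
        using i by (simp add: distrib_right)
    qed
    also have "\<dots> = (L + 1) * (\<Sum>(s,t)\<in>P. t - s)" by (simp add: sum_distrib_left case_prod_unfold)
    also have "\<dots> < (L + 1) * (e / (L + 1))" using P L by (intro mult_strict_left_mono) auto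
    finally show "(\<Sum>(s,t)\<in>P. norm (\<gamma> t - \<gamma> s)) < e" using L by simp
  qed
qed

lemma continuous_on_speed: "(\<And>j. continuous_on S (X j)) ==> continuous_on S (speed X)"
  unfolding speed_def[abs_def] by (intro continuous_intros) auto

text \<open>The trace of the curve is compact, so the speed is bounded along it. Lipschitz bounds,
  unlike the definition of absolute continuity, transfer easily to reversed and concatenated
  curves.\<close>

lemma subunit_lipschitz:
  assumes X: "\<And>j. continuous_on UNIV (X j)" and sub: "subunit X T \<gamma>"
  obtains L where "L-lipschitz_on {0..T} \<gamma>"
proof -
  have "continuous_on {0..T} \<gamma>" using sub by (auto simp: subunit_def intro: AC_imp_continuous_on)
  then have "compact (\<gamma> ` {0..T})" by (intro compact_continuous_image) auto
  moreover have "continuous_on UNIV (speed X)" by (rule continuous_on_speed[OF X])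
  ultimately have "compact (speed X ` (\<gamma> ` {0..T}))"
    using compact_continuous_image[OF continuous_on_subset[OF _ subset_UNIV]] by blast
  then obtain M where M: "\<And>t. t \<in> {0..T} ==> norm (speed X (\<gamma> t)) \<le> M" "M > 0"
    using compact_imp_bounded bounded_pos by (metis imageI)
  have le: "norm (\<gamma> b - \<gamma> a) \<le> M * (b - a)" if "0 \<le> a" "a \<le> b" "b \<le> T" for a b
    using M that by (intro subunit_speed_bound[OF sub that]) (force simp: abs_le_iff)+
  have "M-lipschitz_on {0..T} \<gamma>"
  proof (rule lipschitz_onI)
    fix s t assume "s \<in> {0..T}" "t \<in> {0..T}"
    then show "dist (\<gamma> s) (\<gamma> t) \<le> M * dist s t"
      using le[of s t] le[of t s] by (cases "s \<le> t") (auto simp: dist_norm dist_real_def norm_minus_commute abs_if)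
  qed (use M in simp)
  then show thesis by (rule that)
qed

lemma cc_dist_refl: "cc_dist X x x = 0"
proof -
  have "subunit X 0 (\<lambda>_. x)"
    unfolding subunit_iff
    by (auto intro!: lipschitz_imp_AC[of 0] exI[of _ "{}"] exI[of _ 0] sum_nonneg lipschitz_on_constant)
  then have "cc_dist X x x \<le> ennreal 0" unfolding cc_dist_def by (intro Inf_lower) force
  then show ?thesis by simp
qed

lemma subunit_reverse:
  assumes X: "\<And>j. continuous_on UNIV (X j)" and sub: "subunit X T \<gamma>" and T: "0 \<le> T"
  shows "subunit X T (\<lambda>t. \<gamma> (T - t))"
  unfolding subunit_iff
proof
  obtain L where L: "L-lipschitz_on {0..T} \<gamma>" using subunit_lipschitz[OF X sub] by blast
  have "L-lipschitz_on {0..T} (\<lambda>t. \<gamma> (T - t))"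
  proof (rule lipschitz_onI)
    show "dist (\<gamma> (T - s)) (\<gamma> (T - t)) \<le> L * dist s t" if "s \<in> {0..T}" "t \<in> {0..T}" for s t
      using lipschitz_onD[OF L, of "T - s" "T - t"] that by (simp add: dist_real_def abs_minus_commute)
  qed (use L lipschitz_on_nonneg in blast)
  then show "abs_continuous_curve T (\<lambda>t. \<gamma> (T - t))" by (rule lipschitz_imp_AC)
  obtain N where N: "negligible N" "\<And>t. t \<in> {0..T} - N ==> \<exists>v. (\<gamma> has_vector_derivative v) (at t within {0..T}) \<and>
     (\<forall>\<xi>. (v \<bullet> \<xi>)\<^sup>2 \<le> (\<Sum>j\<in>UNIV. (X j (\<gamma> t) \<bullet> \<xi>)\<^sup>2))"
    using sub unfolding subunit_iff by blast
  have "negligible ((\<lambda>t. T + (-1) *\<^sub>R t) ` N)"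
    by (rule negligible_differentiable_image_negligible[OF _ N(1)]) (auto simp: differentiable_on_def intro!: derivative_intros)
  moreover have "\<exists>v. ((\<lambda>t. \<gamma> (T - t)) has_vector_derivative v) (at t within {0..T}) \<and>
     (\<forall>\<xi>. (v \<bullet> \<xi>)\<^sup>2 \<le> (\<Sum>j\<in>UNIV. (X j (\<gamma> (T - t)) \<bullet> \<xi>)\<^sup>2))" if t: "t \<in> {0..T} - (\<lambda>t. T + (-1) *\<^sub>R t) ` N" for t
  proof -
    have "T - t \<in> {0..T} - N" using t by (auto simp: image_iff)
    from N(2)[OF this] obtain v where v: "(\<gamma> has_vector_derivative v) (at (T - t) within {0..T})"
      "\<And>\<xi>. (v \<bullet> \<xi>)\<^sup>2 \<le> (\<Sum>j\<in>UNIV. (X j (\<gamma> (T - t)) \<bullet> \<xi>)\<^sup>2)" by blast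
    have im: "(\<lambda>t. T - t) ` {0..T} = {0..T}" by (auto simp: image_iff intro!: bexI[of _ "T - _"])
    have "((\<lambda>t. T - t) has_vector_derivative -1) (at t within {0..T})"
      by (auto intro!: derivative_eq_intros)
    from vector_diff_chain_within[OF this, of \<gamma> v] v(1) im
    have "((\<lambda>t. \<gamma> (T - t)) has_vector_derivative - v) (at t within {0..T})" by (simp add: o_def)
    then show ?thesis using v(2) by (intro exI[of _ "- v"]) simp
  qed
  ultimately show "\<exists>N. negligible N \<and> (\<forall>t\<in>{0..T} - N. \<exists>v. ((\<lambda>t. \<gamma> (T - t)) has_vector_derivative v) (at t within {0..T}) \<and>
     (\<forall>\<xi>. (v \<bullet> \<xi>)\<^sup>2 \<le> (\<Sum>j\<in>UNIV. (X j (\<gamma> (T - t)) \<bullet> \<xi>)\<^sup>2)))" by blast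
qed

lemma subunit_concat:
  assumes X: "\<And>j. continuous_on UNIV (X j)" and sub: "subunit X S \<gamma>" "subunit X T \<delta>" and T: "0 \<le> S" "0 \<le> T"
    and eq: "\<gamma> S = \<delta> 0"
  shows "subunit X (S + T) (\<lambda>t. if t \<le> S then \<gamma> t else \<delta> (t - S))" (is "subunit X _ ?\<eta>")
  unfolding subunit_iff
proof
  obtain L where L: "L-lipschitz_on {0..S} \<gamma>" using subunit_lipschitz[OF X sub(1)] by blast
  obtain L' where L': "L'-lipschitz_on {0..T} \<delta>" using subunit_lipschitz[OF X sub(2)] by blast
  have "L'-lipschitz_on {S..S + T} (\<lambda>t. \<delta> (t - S))"
  proof (rule lipschitz_onI)
    show "dist (\<delta> (s - S)) (\<delta> (t - S)) \<le> L' * dist s t" if "s \<in> {S..S+T}" "t \<in> {S..S+T}" for s t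
      using lipschitz_onD[OF L', of "s - S" "t - S"] that by (simp add: dist_real_def)
  qed (use L' lipschitz_on_nonneg in blast)
  then have "(max L L')-lipschitz_on {0..S + T} ?\<eta>"
    using L eq by (intro lipschitz_on_concat_max) auto
  then show "abs_continuous_curve (S + T) ?\<eta>" by (rule lipschitz_imp_AC)
  obtain N where N: "negligible N" "\<And>t. t \<in> {0..S} - N ==> \<exists>v. (\<gamma> has_vector_derivative v) (at t within {0..S}) \<and>
     (\<forall>\<xi>. (v \<bullet> \<xi>)\<^sup>2 \<le> (\<Sum>j\<in>UNIV. (X j (\<gamma> t) \<bullet> \<xi>)\<^sup>2))"
    using sub(1) unfolding subunit_iff by blast
  obtain N' where N': "negligible N'" "\<And>t. t \<in> {0..T} - N' ==> \<exists>v. (\<delta> has_vector_derivative v) (at t within {0..T}) \<and>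
     (\<forall>\<xi>. (v \<bullet> \<xi>)\<^sup>2 \<le> (\<Sum>j\<in>UNIV. (X j (\<delta> t) \<bullet> \<xi>)\<^sup>2))"
    using sub(2) unfolding subunit_iff by blast
  \<comment> \<open>The junction time is added to the exceptional set: the one-sided derivatives
    need not agree there.\<close>
  let ?N = "N \<union> {S} \<union> (+) S ` N'"
  have "negligible ?N" using N(1) N'(1) by (auto intro: negligible_translation)
  moreover have "\<exists>v. (?\<eta> has_vector_derivative v) (at t within {0..S + T}) \<and>
     (\<forall>\<xi>. (v \<bullet> \<xi>)\<^sup>2 \<le> (\<Sum>j\<in>UNIV. (X j (?\<eta> t) \<bullet> \<xi>)\<^sup>2))" if t: "t \<in> {0..S + T} - ?N" for t
  proof (cases "t < S")
    case True
    then obtain v where v: "(\<gamma> has_vector_derivative v) (at t within {0..S})"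
      "\<And>\<xi>. (v \<bullet> \<xi>)\<^sup>2 \<le> (\<Sum>j\<in>UNIV. (X j (\<gamma> t) \<bullet> \<xi>)\<^sup>2)" using N(2)[of t] t by auto
    have "(?\<eta> has_vector_derivative v) (at t within {0..S})"
      by (rule has_vector_derivative_transform[OF _ _ v(1)]) (use t True in auto)
    moreover have "at t within {0..S} = at t within {0..S + T}"
      by (rule at_within_nhd[of t "{..<S}"]) (use True T in auto)
    ultimately show ?thesis using v(2) True by (intro exI[of _ v]) auto
  next
    case False
    then have tS: "S < t" using t by auto
    have "t - S \<in> {0..T} - N'" using t tS by (auto simp: image_iff)
    from N'(2)[OF this] obtain v where v: "(\<delta> has_vector_derivative v) (at (t - S) within {0..T})"
      "\<And>\<xi>. (v \<bullet> \<xi>)\<^sup>2 \<le> (\<Sum>j\<in>UNIV. (X j (\<delta> (t - S)) \<bullet> \<xi>)\<^sup>2)" by blast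
    have im: "(\<lambda>t. t - S) ` {S..S + T} = {0..T}"
      by (auto simp: image_iff intro!: bexI[of _ "_ + S"])
    have "((\<lambda>t. t - S) has_vector_derivative 1) (at t within {S..S + T})"
      by (auto intro!: derivative_eq_intros)
    from vector_diff_chain_within[OF this, of \<delta> v] v(1) im
    have "((\<lambda>t. \<delta> (t - S)) has_vector_derivative v) (at t within {S..S + T})" by (simp add: o_def)
    then have "(?\<eta> has_vector_derivative v) (at t within {S..S + T})"
      by (rule has_vector_derivative_transform[rotated 2]) (use t tS eq in auto)
    moreover have "at t within {S..S + T} = at t within {0..S + T}"
      by (rule at_within_nhd[of t "{S<..}"]) (use tS T in auto)
    ultimately show ?thesis using v(2) tS by (intro exI[of _ v]) auto
  qed
  ultimately show "\<exists>N. negligible N \<and> (\<forall>t\<in>{0..S + T} - N. \<exists>v. (?\<eta> has_vector_derivative v) (at t within {0..S + T}) \<and>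
     (\<forall>\<xi>. (v \<bullet> \<xi>)\<^sup>2 \<le> (\<Sum>j\<in>UNIV. (X j (?\<eta> t) \<bullet> \<xi>)\<^sup>2)))" by blast
qed

lemma cc_dist_less_iff:
  "cc_dist X x y < r \<longleftrightarrow> (\<exists>T \<gamma>. 0 \<le> T \<and> ennreal T < r \<and> subunit X T \<gamma> \<and> \<gamma> 0 = x \<and> \<gamma> T = y)"
  unfolding cc_dist_def Inf_less_iff by blast

lemma cc_dist_commute:
  assumes X: "\<And>j. continuous_on UNIV (X j)"
  shows "cc_dist X x y = cc_dist X y x"
proof -
  have "cc_dist X x y \<le> cc_dist X y x" for x y
  proof (rule dense_ge)
    fix r assume "cc_dist X y x < r"
    then obtain T \<gamma> where T: "0 \<le> T" "ennreal T < r" "subunit X T \<gamma>" "\<gamma> 0 = y" "\<gamma> T = x"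
      unfolding cc_dist_less_iff by blast
    have "cc_dist X x y < r" unfolding cc_dist_less_iff
      by (intro exI[of _ T] exI[of _ "\<lambda>t. \<gamma> (T - t)"]) (use T subunit_reverse[OF X T(3,1)] in auto)
    then show "cc_dist X x y \<le> r" by simp
  qed
  then show ?thesis by (intro antisym)
qed

lemma cc_dist_triangle_less:
  assumes X: "\<And>j. continuous_on UNIV (X j)" and "cc_dist X x y < ennreal r" "cc_dist X y z < ennreal s"
  shows "cc_dist X x z < ennreal (r + s)"
proof -
  obtain T \<gamma> where T: "0 \<le> T" "ennreal T < ennreal r" "subunit X T \<gamma>" "\<gamma> 0 = x" "\<gamma> T = y"
    using assms(2) unfolding cc_dist_less_iff by blast
  obtain S \<delta> where S: "0 \<le> S" "ennreal S < ennreal s" "subunit X S \<delta>" "\<delta> 0 = y" "\<delta> S = z"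
    using assms(3) unfolding cc_dist_less_iff by blast
  have "subunit X (T + S) (\<lambda>t. if t \<le> T then \<gamma> t else \<delta> (t - T))"
    using T S by (intro subunit_concat[OF X]) auto
  moreover have "T < r" "S < s" using T(1,2) S(1,2) by (simp_all add: ennreal_less_iff)
  then have "ennreal (T + S) < ennreal (r + s)" using T(1) S(1) by (simp add: ennreal_less_iff del: ennreal_plus)
  ultimately show ?thesis
    unfolding cc_dist_less_iff
    by (intro exI[of _ "T + S"] exI[of _ "\<lambda>t. if t \<le> T then \<gamma> t else \<delta> (t - T)"]) (use T S in auto)
qed

text \<open>Until it first leaves the Euclidean ball a curve has speed at most \<open>M\<close>, so
  leaving takes time at least e/M. Hence small metric balls are small in the Euclidean
  sense.\<close>

lemma cc_dist_local_lower_bound: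
  fixes X :: "'m::finite => real^'n => real^'n"
  assumes e: "0 < e" and M: "0 < M" and bd: "\<And>y. y \<in> cball x e ==> speed X y \<le> M"
    and d: "cc_dist X x y < ennreal (e / M)"
  shows "dist x y < e"
proof (rule ccontr)
  assume far: "\<not> dist x y < e"
  obtain T \<gamma> where T: "0 \<le> T" "ennreal T < ennreal (e / M)" "subunit X T \<gamma>" "\<gamma> 0 = x" "\<gamma> T = y"
    using d unfolding cc_dist_less_iff by blast
  have TM: "M * T < e" using T(1,2) M e by (simp add: ennreal_less_iff field_simps)
  have cont: "continuous_on {0..T} (\<lambda>t. dist x (\<gamma> t))"
    using AC_imp_continuous_on[of T \<gamma>] T(3) by (auto simp: subunit_def intro!: continuous_on_dist continuous_on_const)
  define S where "S = {t \<in> {0..T}. e \<le> dist x (\<gamma> t)}"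
  have "closed ({0..T} \<inter> (\<lambda>t. dist x (\<gamma> t)) -` {e..})"
    by (rule continuous_closed_preimage[OF cont]) auto
  moreover have "S = {0..T} \<inter> (\<lambda>t. dist x (\<gamma> t)) -` {e..}" by (auto simp: S_def)
  ultimately have "closed S" by simp
  have ne: "T \<in> S" using far T by (simp add: S_def)
  have bdd: "bdd_below S" by (auto simp: S_def intro!: bdd_belowI[of _ 0])
  \<comment> \<open>The first time at distance at least \<open>e\<close>; the bound M t0 is proved
    before it and extended by continuity.\<close>
  define t0 where "t0 = Inf S"
  have t0: "t0 \<in> S" unfolding t0_def using closed_contains_Inf[OF _ bdd \<open>closed S\<close>] ne by blast
  have before: "dist x (\<gamma> t) < e" if "0 \<le> t" "t < t0" for t
    using cInf_lower[OF _ bdd, of t] that t0 by (force simp: S_def t0_def not_le[symmetric])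
  have pos: "0 < t0" using t0 T(4) e by (cases "t0 = 0") (auto simp: S_def)
  have near: "\<gamma> s \<in> cball x e" if "0 \<le> s" "s < t0" for s using before[OF that] by simp
  have le: "dist x (\<gamma> t) \<le> M * t0" if t: "t \<in> {0..<t0}" for t
  proof -
    have "norm (\<gamma> t - \<gamma> 0) \<le> M * (t - 0)"
      by (rule subunit_speed_bound[OF T(3)])
        (use t t0 M in \<open>auto simp: S_def intro!: bd near\<close>)
    also have "\<dots> \<le> M * t0" using t M by (intro mult_left_mono) auto
    finally show ?thesis using T(4) by (simp add: dist_norm norm_minus_commute)
  qed
  have "dist x (\<gamma> t0) \<le> M * t0"
  proof (rule continuous_le_on_closure[of "{0..<t0}" "\<lambda>t. dist x (\<gamma> t)"])
    have "closure {0..<t0} = {0..t0}" using pos by simp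
    then show "continuous_on (closure {0..<t0}) (\<lambda>t. dist x (\<gamma> t))" "t0 \<in> closure {0..<t0}"
      using cont t0 pos by (auto simp: S_def intro: continuous_on_subset)
  qed (rule le)
  also have "\<dots> \<le> M * T" using t0 M by (auto simp: S_def)
  finally show False using TM t0 by (auto simp: S_def)
qed

section \<open>The kernel of the representation formula\<close>

lemma ennreal_divide_le_of_le_mult: "a \<le> c * b ==> a / b \<le> (c::ennreal)"
proof (cases "b = 0 \<or> b = top")
  case False
  assume "a \<le> c * b"
  then have "a / b \<le> c * b / b" by (rule divide_right_mono_ennreal)
  also have "\<dots> = c" using False by (simp add: ennreal_mult_divide_eq)
  finally show ?thesis .
qed auto

lemma ennreal_inverse_le_of_le_mult:
  fixes a b :: ennreal
  assumes "a \<le> ennreal c * b" "0 < a"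
  shows "1 / b \<le> ennreal c / a"
proof (cases "b = top \<or> a = top")
  case True
  then have "b = top" using assms(1) by (cases b) (auto simp: ennreal_mult_eq_top_iff top_unique)
  then show ?thesis by simp
next
  case False
  have b: "b \<noteq> 0" using assms by auto
  have "a * (1 / b) \<le> ennreal c * b * (1 / b)" using assms(1) by (rule mult_right_mono) simp
  also have "\<dots> = ennreal c" 
  proof -
    have "ennreal c * b * (1 / b) = ennreal c * (b / b)" by (simp add: divide_ennreal_def mult.assoc)
    also have "b / b = 1" using False b by (intro ennreal_divide_self) (auto simp: less_top)
    finally show ?thesis by simp
  qed
  finally have "a * (1 / b) / a \<le> ennreal c / a" by (rule divide_right_mono_ennreal)
  then show ?thesis using False assms(2) by (simp add: mult.commute[of a] ennreal_mult_divide_eq)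
qed

lemma ennreal_inverse_antimono: "a \<le> b ==> inverse b \<le> inverse (a::ennreal)"
  using ennreal_inverse_le_of_le_mult[of a 1 b] by (cases "a = 0") (auto simp: divide_ennreal_def zero_less_iff_neq_zero)

locale cc_space =
  fixes X :: "'m::finite => real^'n => real^'n" and \<Omega> \<Omega>0 :: "(real^'n) set"
  assumes open_\<Omega>: "open \<Omega>" and bounded_\<Omega>: "bounded \<Omega>"
    and open_\<Omega>0: "open \<Omega>0" and closure_\<Omega>: "closure \<Omega> \<subseteq> \<Omega>0"
    and lipschitz: "lipschitz_fields X \<Omega>0"
    and H1: "cond_H1 X \<Omega>0" and H2: "cond_H2 X \<Omega>0" and H3: "cond_H3 X \<Omega>0"
begin

lemma X_continuous: "continuous_on UNIV (X j)"
proof -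
  have "isCont (X j) x" for x
  proof -
    obtain e L where "e > 0" "L-lipschitz_on (ball x e) (X j)" using lipschitz unfolding lipschitz_fields_def by blast
    then have "continuous_on (ball x e) (X j)" by (intro lipschitz_on_continuous_on)
    then show ?thesis using \<open>e > 0\<close> by (simp add: continuous_on_eq_continuous_at)
  qed
  then show ?thesis by (simp add: continuous_on_eq_continuous_at)
qed

lemma X_lipschitz: "\<exists>L. L-lipschitz_on \<Omega>0 (X j)"
  using lipschitz unfolding lipschitz_fields_def by blast

lemmas cc_commute = cc_dist_commute[OF X_continuous]
lemmas cc_triangle = cc_dist_triangle_less[OF X_continuous]

lemma compact_closure_\<Omega>: "compact (closure \<Omega>)" using bounded_\<Omega> by simp

section \<open>Metric balls, their volumes and a dyadic kernel\<close>

abbreviation B :: "real => real^'n => (real^'n) set" where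
  "B r x \<equiv> cc_ball X \<Omega>0 x (ennreal r)"

text \<open>The relation is open by (H1). Kept as a subset of the product, it makes volumes,
  averages and kernels jointly measurable.\<close>

definition near :: "real => ((real^'n) \<times> (real^'n)) set" where
  "near r = {p \<in> \<Omega>0 \<times> \<Omega>0. cc_dist X (fst p) (snd p) < ennreal r}"

lemma open_near: "open (near r)"
proof -
  have "near r = (\<Omega>0 \<times> \<Omega>0) \<inter> (\<lambda>p. cc_dist X (fst p) (snd p)) -` {..<ennreal r}" by (auto simp: near_def)
  also have "open \<dots>"
    using H1 open_\<Omega>0 unfolding cond_H1_def by (intro continuous_open_preimage) (auto simp: open_Times)
  finally show ?thesis .
qed

lemma near_sets [measurable]: "near r \<in> sets (borel \<Otimes>\<^sub>M borel)"
  using open_near borel_prod by (metis borel_open)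

lemma near_slice: "x \<in> \<Omega>0 ==> Pair x -` near r = B r x"
  by (auto simp: near_def cc_ball_def)

lemma near_slice': "y \<in> \<Omega>0 ==> (\<lambda>x. (x, y)) -` near r = B r y"
  by (auto simp: near_def cc_ball_def cc_commute[of _ y])

lemma open_B: "x \<in> \<Omega>0 ==> open (B r x)"
proof -
  assume x: "x \<in> \<Omega>0"
  have "open (Pair x -` near r)" by (intro open_vimage open_near continuous_intros)
  then show ?thesis using near_slice[OF x] by simp
qed

lemma B_subset: "B r x \<subseteq> \<Omega>0" by (auto simp: cc_ball_def)

lemma center_B: "x \<in> \<Omega>0 ==> 0 < r ==> x \<in> B r x" by (simp add: cc_ball_def cc_dist_refl)

text \<open>Slicing \<open>near\<close> gives a Borel function of the centre; on
  \<open>\<Omega>0\<close> it is the measure of the ball.\<close>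

definition vol :: "real => real^'n => ennreal" where
  "vol r x = emeasure lborel (Pair x -` near r)"

lemma vol_eq: "x \<in> \<Omega>0 ==> vol r x = emeasure lborel (B r x)"
  by (simp add: vol_def near_slice)

lemma vol_measurable [measurable]: "vol r \<in> borel_measurable borel"
proof -
  have "near r \<in> sets (borel \<Otimes>\<^sub>M lborel)" by (simp cong: sets_pair_measure_cong)
  then show ?thesis unfolding vol_def[abs_def] by (rule lborel.measurable_emeasure_Pair)
qed

lemma vol_pos: "x \<in> \<Omega>0 ==> 0 < r ==> 0 < vol r x"
proof -
  assume x: "x \<in> \<Omega>0" and r: "0 < r"
  have "\<not> negligible (B r x)" using open_not_negligible[OF open_B[OF x]] center_B[OF x r] by blast
  then have "B r x \<notin> null_sets lborel" by (auto simp: negligible_iff_null_sets dest: null_sets_completionI)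
  then have "vol r x \<noteq> 0" using open_B[OF x] by (simp add: vol_eq[OF x] null_sets_def)
  then show "0 < vol r x" by (simp add: zero_less_iff_neq_zero)
qed

text \<open>A dyadic majorant of d(x,y)/|B(x,d(x,y))| for d(x,y) < R: the term for R 2^-k has the
  ball of half that radius in the denominator. It is visibly measurable and can be integrated term
  by term in either variable.\<close>

definition kern :: "real => real^'n => real^'n => ennreal" where
  "kern R x y = (\<Sum>k. ennreal (R / 2^k) * indicator (near (R / 2^k)) (x, y) / vol (R / 2^Suc k) x)"

lemma kern_measurable [measurable]: "(\<lambda>p. kern R (fst p) (snd p)) \<in> borel_measurable (borel \<Otimes>\<^sub>M borel)"
  unfolding kern_def by measurable

text \<open>The single term with R/2^(k+1) <= d(x,y) < R/2^k already dominates. At distance 0 the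
  left side is 0 by the conventions of extended division.\<close>

lemma cc_kernel_le_kern:
  assumes xy: "x \<in> \<Omega>0" "y \<in> \<Omega>0" and d: "cc_dist X x y < ennreal R"
  shows "cc_dist X x y / emeasure lebesgue (cc_ball X \<Omega>0 x (cc_dist X x y)) \<le> kern R x y"
proof (cases "cc_dist X x y = 0")
  case False
  define \<delta> where "\<delta> = enn2real (cc_dist X x y)"
  have \<delta>: "cc_dist X x y = ennreal \<delta>" using less_trans[OF d ennreal_less_top] by (simp add: \<delta>_def)
  have pos: "0 < \<delta>" using False \<delta> by (cases "\<delta> > 0") (auto simp: ennreal_neg)
  have \<delta>R: "\<delta> < R" using d pos by (simp add: \<delta> ennreal_less_iff)
  have "\<exists>k. R / 2 ^ k \<le> \<delta>"
  proof -
    obtain k where "(1/2) ^ k < \<delta> / R" using real_arch_pow_inv[of "\<delta> / R" "1/2"] pos \<delta>R by auto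
    then have "R / 2 ^ k \<le> \<delta>" using pos \<delta>R by (simp add: field_simps power_divide)
    then show ?thesis by blast
  qed
  \<comment> \<open>The first dyadic radius not exceeding the distance; \<open>m\<close> is positive
    as the distance is below \<open>R\<close>, so the previous radius exists.\<close>
  define m where "m = (LEAST k. R / 2 ^ k \<le> \<delta>)"
  have m: "R / 2 ^ m \<le> \<delta>" unfolding m_def by (rule LeastI_ex) fact
  have "m \<noteq> 0" using m \<delta>R by (cases m) auto
  then obtain k where k: "m = Suc k" by (cases m) auto
  have "\<not> R / 2 ^ k \<le> \<delta>" using not_less_Least[of k "\<lambda>k. R / 2 ^ k \<le> \<delta>"] k by (simp add: m_def)
  then have lt: "\<delta> < R / 2 ^ k" by simp
  have "emeasure lebesgue (cc_ball X \<Omega>0 x (ennreal \<delta>)) = vol \<delta> x"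
    using open_B[OF xy(1), of \<delta>] vol_eq[OF xy(1)] by simp
  moreover have "vol (R / 2 ^ Suc k) x \<le> vol \<delta> x"
    unfolding vol_eq[OF xy(1)] using m k open_B[OF xy(1)]
    by (intro emeasure_mono) (auto simp: cc_ball_def elim!: order.strict_trans2 intro!: ennreal_leI)
  ultimately have "cc_dist X x y / emeasure lebesgue (cc_ball X \<Omega>0 x (cc_dist X x y)) \<le> ennreal (R / 2^k) / vol (R / 2 ^ Suc k) x"
    unfolding \<delta> divide_ennreal_def using lt
    by (intro mult_mono ennreal_leI ennreal_inverse_antimono) auto
  also have "\<dots> = ennreal (R / 2^k) * indicator (near (R / 2^k)) (x, y) / vol (R / 2^Suc k) x"
    using xy lt pos by (simp add: near_def \<delta> ennreal_less_iff)
  also have "\<dots> \<le> kern R x y"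
    unfolding kern_def
    using sum_le_suminf[of "\<lambda>k. ennreal (R / 2^k) * indicator (near (R / 2^k)) (x, y) / vol (R / 2^Suc k) x" "{k}"] by simp
  finally show ?thesis .
qed simp

section \<open>Doubling and Schur's test\<close>

definition doubling :: "(real^'n) set => real => real => bool" where
  "doubling K C R \<longleftrightarrow> K \<subseteq> \<Omega>0 \<and> 0 \<le> C \<and> (\<forall>x\<in>K. \<forall>r. 0 < r \<longrightarrow> r \<le> R \<longrightarrow> vol (2 * r) x \<le> ennreal C * vol r x)"

lemma doublingD: "doubling K C R ==> x \<in> K ==> 0 < r ==> r \<le> R ==> vol (2 * r) x \<le> ennreal C * vol r x"
  by (auto simp: doubling_def)

lemma suminf_geometric_half: "0 \<le> R ==> (\<Sum>k. ennreal (R / 2 ^ k)) = ennreal (2 * R)"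
proof -
  assume R: "0 \<le> R"
  have "(\<lambda>k. R * (1/2) ^ k) sums (R * (1 / (1 - 1/2)))" by (intro sums_mult geometric_sums) simp
  then have "(\<lambda>k. R / 2 ^ k) sums (2 * R)" by (simp add: power_divide field_simps)
  then show ?thesis using R by (intro sums_unique[symmetric] sums_ennreal[THEN iffD2]) auto
qed

text \<open>The \<open>k\<close>-th term integrates to R 2^-k times the ratio of the volumes at
  radii R 2^-k and R 2^-(k+1), at most \<open>C\<close> by doubling; the radii sum to 2 R.\<close>

lemma kern_integral_right:
  assumes D: "doubling K C R" and R: "0 < R" and x: "x \<in> K"
  shows "(\<integral>\<^sup>+y. kern R x y \<partial>lborel) \<le> ennreal (2 * C * R)"
proof -
  have C: "0 \<le> C" using D by (simp add: doubling_def)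
  have [measurable]: "(\<lambda>y. indicator (near r) (x, y) :: ennreal) \<in> borel_measurable borel" for r
    by (rule measurable_compose[of "Pair x" _ "borel \<Otimes>\<^sub>M borel"]) auto
  have "(\<integral>\<^sup>+y. kern R x y \<partial>lborel) = (\<Sum>k. \<integral>\<^sup>+y. ennreal (R / 2^k) * indicator (near (R / 2^k)) (x, y) / vol (R / 2^Suc k) x \<partial>lborel)"
    unfolding kern_def by (rule nn_integral_suminf) measurable
  also have "\<dots> = (\<Sum>k. ennreal (R / 2^k) * (vol (R / 2^k) x / vol (R / 2^Suc k) x))"
  proof (rule suminf_cong)
    fix k
    have sl: "Pair x -` near (R / 2^k) \<in> sets lborel" using open_near by (auto intro!: borel_open open_vimage continuous_intros)
    have "(\<integral>\<^sup>+y. ennreal (R / 2^k) * indicator (near (R / 2^k)) (x, y) / vol (R / 2^Suc k) x \<partial>lborel)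
        = (\<integral>\<^sup>+y. (ennreal (R / 2^k) / vol (R / 2^Suc k) x) * indicator (Pair x -` near (R / 2^k)) y \<partial>lborel)"
      by (rule nn_integral_cong) (auto simp: indicator_def divide_ennreal_def mult.commute)
    also have "\<dots> = (ennreal (R / 2^k) / vol (R / 2^Suc k) x) * vol (R / 2^k) x"
      using sl by (simp add: nn_integral_cmult vol_def)
    finally show "(\<integral>\<^sup>+y. ennreal (R / 2^k) * indicator (near (R / 2^k)) (x, y) / vol (R / 2^Suc k) x \<partial>lborel)
        = ennreal (R / 2^k) * (vol (R / 2^k) x / vol (R / 2^Suc k) x)" by (simp add: divide_ennreal_def ac_simps)
  qed
  also have "\<dots> \<le> (\<Sum>k. ennreal (R / 2^k) * ennreal C)"
  proof (intro suminf_le mult_left_mono ennreal_divide_le_of_le_mult)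
    fix k
    have "R / 2 ^ Suc k \<le> R / 2 ^ 0" using R by (intro divide_left_mono power_increasing) auto
    then show "vol (R / 2^k) x \<le> ennreal C * vol (R / 2^Suc k) x"
      using doublingD[OF D x, of "R / 2 ^ Suc k"] R by simp
  qed auto
  also have "\<dots> = ennreal (2 * R) * ennreal C" by (simp only: ennreal_suminf_multc suminf_geometric_half[OF less_imp_le[OF R]])
  also have "\<dots> = ennreal (2 * C * R)" using R C by (simp add: ennreal_mult[symmetric] ac_simps)
  finally show ?thesis .
qed

text \<open>The ball about \<open>y\<close> lies in the ball of twice the radius about
  \<open>x\<close>; two doublings lead down to half the radius.\<close>

lemma vol_compare:
  assumes D: "doubling K C R" and x: "x \<in> K" and y: "y \<in> \<Omega>0" and r: "0 < r" "r \<le> R" and n: "cc_dist X x y < ennreal r"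
  shows "vol r y \<le> ennreal (C\<^sup>2) * vol (r / 2) x"
proof -
  have x0: "x \<in> \<Omega>0" and C: "0 \<le> C" using D x by (auto simp: doubling_def)
  have "cc_dist X x z < ennreal (2 * r)" if "cc_dist X y z < ennreal r" for z
    using cc_triangle[OF n that] by simp
  then have "B r y \<subseteq> B (2 * r) x" by (auto simp: cc_ball_def)
  then have "vol r y \<le> vol (2 * r) x"
    unfolding vol_eq[OF x0] vol_eq[OF y] using open_B[OF x0] by (intro emeasure_mono) auto
  also have "\<dots> \<le> ennreal C * vol r x" by (rule doublingD[OF D x r])
  also have "vol r x \<le> ennreal C * vol (r / 2) x" using doublingD[OF D x, of "r / 2"] r by simp
  finally have "vol r y \<le> ennreal C * (ennreal C * vol (r / 2) x)" by (simp add: mult_left_mono)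
  then show ?thesis using C by (simp add: power2_eq_square ennreal_mult mult.assoc)
qed

text \<open>The weights are volumes centred at the integration variable. \<open>vol_compare\<close>
  moves them to the fixed point \<open>y\<close>, at the price of a second factor \<open>C\<close>;
  then the terms sum as before.\<close>

lemma kern_integral_left:
  assumes D: "doubling K C R" and R: "0 < R" and K: "K \<in> sets borel"
  shows "(\<integral>\<^sup>+x. indicator K x * kern R x y \<partial>lborel) \<le> ennreal (2 * C\<^sup>2 * R)"
proof (cases "y \<in> \<Omega>0")
  case y: True
  have C: "0 \<le> C" and K0: "K \<subseteq> \<Omega>0" using D by (auto simp: doubling_def)
  note [measurable] = K
  have [measurable]: "(\<lambda>x. indicator (near r) (x, y) :: ennreal) \<in> borel_measurable borel" for r
    by (rule measurable_compose[of "\<lambda>x. (x, y)" _ "borel \<Otimes>\<^sub>M borel"]) auto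
  have "(\<integral>\<^sup>+x. indicator K x * kern R x y \<partial>lborel)
      = (\<integral>\<^sup>+x. (\<Sum>k. indicator K x * (ennreal (R / 2^k) * indicator (near (R / 2^k)) (x, y) / vol (R / 2^Suc k) x)) \<partial>lborel)"
    unfolding kern_def by (simp only: ennreal_suminf_cmult)
  also have "\<dots> = (\<Sum>k. \<integral>\<^sup>+x. indicator K x * (ennreal (R / 2^k) * indicator (near (R / 2^k)) (x, y) / vol (R / 2^Suc k) x) \<partial>lborel)"
    by (rule nn_integral_suminf) measurable
  also have "\<dots> \<le> (\<Sum>k. ennreal (R / 2^k) * ennreal (C\<^sup>2))"
  proof (rule suminf_le)
    fix k
    let ?r = "R / 2 ^ k"
    have r: "0 < ?r" "?r \<le> R" using R divide_left_mono[of 1 "2 ^ k" R] by auto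
    have vpos: "0 < vol ?r y" by (rule vol_pos[OF y r(1)])
    have sl: "(\<lambda>x. (x, y)) -` near ?r \<in> sets lborel" using open_near by (auto intro!: borel_open open_vimage continuous_intros)
    have "(\<integral>\<^sup>+x. indicator K x * (ennreal ?r * indicator (near ?r) (x, y) / vol (R / 2^Suc k) x) \<partial>lborel)
        \<le> (\<integral>\<^sup>+x. (ennreal ?r * (ennreal (C\<^sup>2) / vol ?r y)) * indicator ((\<lambda>x. (x, y)) -` near ?r) x \<partial>lborel)"
    proof (rule nn_integral_mono)
      fix x
      show "indicator K x * (ennreal ?r * indicator (near ?r) (x, y) / vol (R / 2^Suc k) x)
        \<le> (ennreal ?r * (ennreal (C\<^sup>2) / vol ?r y)) * indicator ((\<lambda>x. (x, y)) -` near ?r) x"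
      proof (cases "x \<in> K \<and> (x, y) \<in> near ?r")
        case True
        then have "vol ?r y \<le> ennreal (C\<^sup>2) * vol (?r / 2) x"
          by (intro vol_compare[OF D _ y r]) (auto simp: near_def)
        from ennreal_inverse_le_of_le_mult[OF this vpos] have "1 / vol (R / 2 ^ Suc k) x \<le> ennreal (C\<^sup>2) / vol ?r y"
          by (simp add: mult.commute)
        then have "ennreal ?r * (1 / vol (R / 2 ^ Suc k) x) \<le> ennreal ?r * (ennreal (C\<^sup>2) / vol ?r y)" by (rule mult_left_mono) simp
        then show ?thesis using True by (simp add: divide_ennreal_def)
      next
        case False
        then show ?thesis by (auto simp: indicator_def)
      qed
    qed
    also have "\<dots> = (ennreal ?r * (ennreal (C\<^sup>2) / vol ?r y)) * vol ?r y"
      using sl by (simp add: nn_integral_cmult near_slice'[OF y] vol_eq[OF y])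
    also have "\<dots> = ennreal ?r * (ennreal (C\<^sup>2) / vol ?r y * vol ?r y)" by (simp add: mult.assoc)
    also have "\<dots> \<le> ennreal ?r * ennreal (C\<^sup>2)"
    proof (intro mult_left_mono)
      show "ennreal (C\<^sup>2) / vol ?r y * vol ?r y \<le> ennreal (C\<^sup>2)"
      proof (cases "vol ?r y = top")
        case False
        have "ennreal (C\<^sup>2) / vol ?r y * vol ?r y = ennreal (C\<^sup>2) * (vol ?r y / vol ?r y)"
          by (simp add: divide_ennreal_def ac_simps)
        also have "vol ?r y / vol ?r y = 1" using False vpos by (intro ennreal_divide_self) (auto simp: less_top)
        finally show ?thesis by simp
      qed simp
    qed simp
    finally show "(\<integral>\<^sup>+x. indicator K x * (ennreal ?r * indicator (near ?r) (x, y) / vol (R / 2^Suc k) x) \<partial>lborel) \<le> ennreal ?r * ennreal (C\<^sup>2)" .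
  qed auto
  also have "\<dots> = ennreal (2 * R) * ennreal (C\<^sup>2)" by (simp only: ennreal_suminf_multc suminf_geometric_half[OF less_imp_le[OF R]])
  also have "\<dots> = ennreal (2 * C\<^sup>2 * R)" using R C by (simp add: ennreal_mult[symmetric] ac_simps)
  finally show ?thesis .
next
  case False
  then have "kern R x y = 0" for x by (simp add: kern_def near_def)
  then show ?thesis by simp
qed

text \<open>Schur's test: Cauchy-Schwarz for the measure with density \<open>kern R x\<close>, then
  Fubini. The constant is the product of the two marginal bounds, and each is proportional to
  \<open>R\<close>.\<close>

lemma kern_operator_bound:
  assumes D: "doubling K C R" and R: "0 < R" and K: "K \<in> sets borel" and f[measurable]: "f \<in> borel_measurable borel"
  shows "(\<integral>\<^sup>+x. indicator K x * (\<integral>\<^sup>+y. kern R x y * f y \<partial>lborel)\<^sup>2 \<partial>lborel) \<le> ennreal (4 * C ^ 3 * R\<^sup>2) * (\<integral>\<^sup>+y. (f y)\<^sup>2 \<partial>lborel)"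
proof -
  let ?J = "\<lambda>x. \<integral>\<^sup>+y. indicator K x * (kern R x y * (f y)\<^sup>2) \<partial>lborel"
    and ?I = "\<lambda>x. \<integral>\<^sup>+y. kern R x y * f y \<partial>lborel"
    and ?L = "\<lambda>x. \<integral>\<^sup>+y. kern R x y * (f y)\<^sup>2 \<partial>lborel"
    and ?F = "\<integral>\<^sup>+y. (f y)\<^sup>2 \<partial>lborel"
  have C: "0 \<le> C" using D by (auto simp: doubling_def)
  note [measurable] = K
  have ky[measurable]: "kern R x \<in> borel_measurable borel" for x
    using measurable_compose[of "Pair x" borel "borel \<Otimes>\<^sub>M borel", OF _ kern_measurable[of R]] by simp
  have kp[measurable]: "(\<lambda>(x, y). kern R x y) \<in> borel_measurable (lborel \<Otimes>\<^sub>M lborel)"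
    using kern_measurable[of R] by (simp add: case_prod_unfold cong: measurable_cong_sets sets_pair_measure_cong)
  have CS: "(?I x)\<^sup>2 \<le> ennreal (2 * C * R) * (?L x)" if x: "x \<in> K" for x
  proof -
    let ?M = "density lborel (kern R x)"
    have "(?I x)\<^sup>2 = (\<integral>\<^sup>+y. f y * 1 \<partial>?M)\<^sup>2" by (simp add: nn_integral_density)
    also have "\<dots> \<le> (\<integral>\<^sup>+y. (f y)\<^sup>2 \<partial>?M) * (\<integral>\<^sup>+y. 1\<^sup>2 \<partial>?M)" by (rule Cauchy_Schwarz_nn_integral) auto
    also have "\<dots> = (?L x) * (\<integral>\<^sup>+y. kern R x y \<partial>lborel)"
      by (simp add: nn_integral_density emeasure_density)
    also have "\<dots> \<le> (?L x) * ennreal (2 * C * R)"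
      by (intro mult_left_mono kern_integral_right[OF D R x]) simp
    finally show ?thesis by (simp add: mult.commute)
  qed
  have "(\<integral>\<^sup>+x. indicator K x * (?I x)\<^sup>2 \<partial>lborel)
      \<le> (\<integral>\<^sup>+x. ennreal (2 * C * R) * ?J x \<partial>lborel)"
  proof (rule nn_integral_mono)
    fix x
    show "indicator K x * (?I x)\<^sup>2 \<le> ennreal (2 * C * R) * ?J x"
      using CS[of x] by (cases "x \<in> K") auto
  qed
  also have "\<dots> = ennreal (2 * C * R) * (\<integral>\<^sup>+x. ?J x \<partial>lborel)"
    by (rule nn_integral_cmult) measurable
  also have "(\<integral>\<^sup>+x. ?J x \<partial>lborel)
      = (\<integral>\<^sup>+y. (\<integral>\<^sup>+x. indicator K x * (kern R x y * (f y)\<^sup>2) \<partial>lborel) \<partial>lborel)"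
    by (rule lborel_pair.Fubini') measurable
  also have "\<dots> = (\<integral>\<^sup>+y. (f y)\<^sup>2 * (\<integral>\<^sup>+x. indicator K x * kern R x y \<partial>lborel) \<partial>lborel)"
  proof (rule nn_integral_cong)
    fix y
    have kx[measurable]: "(\<lambda>x. kern R x y) \<in> borel_measurable borel"
      using measurable_compose[of "\<lambda>x. (x, y)" borel "borel \<Otimes>\<^sub>M borel", OF _ kern_measurable[of R]] by simp
    show "(\<integral>\<^sup>+x. indicator K x * (kern R x y * (f y)\<^sup>2) \<partial>lborel) = (f y)\<^sup>2 * (\<integral>\<^sup>+x. indicator K x * kern R x y \<partial>lborel)"
      by (subst nn_integral_cmult[symmetric]) (auto simp: ac_simps)
  qed
  also have "\<dots> \<le> (\<integral>\<^sup>+y. (f y)\<^sup>2 * ennreal (2 * C\<^sup>2 * R) \<partial>lborel)"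
    by (intro nn_integral_mono mult_left_mono kern_integral_left[OF D R K]) simp
  also have "\<dots> = ?F * ennreal (2 * C\<^sup>2 * R)" by (rule nn_integral_multc) measurable
  finally have "(\<integral>\<^sup>+x. indicator K x * (?I x)\<^sup>2 \<partial>lborel)
      \<le> ennreal (2 * C * R) * (?F * ennreal (2 * C\<^sup>2 * R))" by (simp add: mult_left_mono)
  also have "\<dots> = ennreal (2 * C * R) * ennreal (2 * C\<^sup>2 * R) * ?F" by (simp add: ac_simps)
  also have "ennreal (2 * C * R) * ennreal (2 * C\<^sup>2 * R) = ennreal (4 * C ^ 3 * R\<^sup>2)"
    using C R by (subst ennreal_mult[symmetric]) (auto simp: power2_eq_square power3_eq_cube ac_simps)
  finally show ?thesis .
qed

end

section \<open>The energy space\<close>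

lemma sq_int_continuous:
  fixes f :: "'a::euclidean_space => 'b::euclidean_space"
  assumes f: "continuous_on UNIV f" and K: "compact K" "\<And>x. x \<notin> K ==> f x = 0"
  shows "sq_int f"
  unfolding sq_int_def
proof
  show "f \<in> borel_measurable lebesgue" using f by (rule continuous_imp_lebesgue_measurable)
  have "continuous_on K (\<lambda>x. (norm (f x))\<^sup>2)" using continuous_on_subset[OF f subset_UNIV] by (intro continuous_intros)
  then have "integrable (lebesgue_on K) (\<lambda>x. (norm (f x))\<^sup>2)" using K(1) by (intro integrable_lebesgue_on_compact)
  moreover have "K \<in> sets lebesgue" using K(1) by (intro fmeasurableD lmeasurable_compact)
  ultimately have "integrable lebesgue (\<lambda>x. indicator K x *\<^sub>R (norm (f x))\<^sup>2)" by (simp add: integrable_restrict_space)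
  moreover have "(\<lambda>x. indicator K x *\<^sub>R (norm (f x))\<^sup>2) = (\<lambda>x. (norm (f x))\<^sup>2)"
  proof
    show "indicator K x *\<^sub>R (norm (f x))\<^sup>2 = (norm (f x))\<^sup>2" for x using K(2)[of x] by (cases "x \<in> K") auto
  qed
  ultimately show "integrable lebesgue (\<lambda>x. (norm (f x))\<^sup>2)" by simp
qed

lemma subspace_closure:
  fixes S :: "'a::real_normed_vector set"
  assumes "subspace S" shows "subspace (closure S)"
proof (rule subspaceI)
  show "0 \<in> closure S" using subspace_0[OF assms] closure_subset by blast
next
  fix x y assume "x \<in> closure S" "y \<in> closure S"
  then obtain f g where f: "\<And>n. f n \<in> S" "f \<longlonglongrightarrow> x" and g: "\<And>n. g n \<in> S" "g \<longlonglongrightarrow> y"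
    unfolding closure_sequential by blast
  then show "x + y \<in> closure S"
    unfolding closure_sequential by (intro exI[of _ "\<lambda>n. f n + g n"]) (auto intro: tendsto_add subspace_add[OF assms])
next
  fix x and c :: real assume "x \<in> closure S"
  then obtain f where f: "\<And>n. f n \<in> S" "f \<longlonglongrightarrow> x" unfolding closure_sequential by blast
  then show "c *\<^sub>R x \<in> closure S"
    unfolding closure_sequential
    by (intro exI[of _ "\<lambda>n. c *\<^sub>R f n"]) (auto intro!: tendsto_scaleR tendsto_const subspace_scale[OF assms])
qed

lemma partial_add: "f differentiable (at x) ==> g differentiable (at x) ==> partial i (\<lambda>x. f x + g x) x = partial i f x + partial i g x"
  by (rule partial_eq, rule DERIV_add) (simp_all add: differentiable_partial(1))

lemma partial_cmult: "f differentiable (at x) ==> partial i (\<lambda>x. c * f x) x = c * partial i f x"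
  by (rule partial_eq, rule DERIV_cmult) (simp add: differentiable_partial(1))

lemma partial_mult:
  assumes "f differentiable (at x)" "g differentiable (at x)"
  shows "partial i (\<lambda>x. f x * g x) x = partial i f x * g x + f x * partial i g x"
proof (rule partial_eq)
  from DERIV_mult[OF differentiable_partial(1)[OF assms(1)] differentiable_partial(1)[OF assms(2)], of i]
  show "((\<lambda>t. f (x + t *\<^sub>R axis i 1) * g (x + t *\<^sub>R axis i 1)) has_real_derivative partial i f x * g x + f x * partial i g x) (at 0)"
    by (simp add: mult.commute add.commute)
qed

lemma C1c_add:
  assumes fg: "f \<in> C1c S" "g \<in> C1c S" shows "(\<lambda>x. f x + g x) \<in> C1c S"
proof -
  have "partial i (\<lambda>x. f x + g x) = (\<lambda>x. partial i f x + partial i g x)" for i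
    by (rule ext, rule partial_add) (use fg C1cD(1) in auto)
  moreover obtain K L where "compact K" "K \<subseteq> S" "\<forall>x. x \<notin> K \<longrightarrow> f x = 0" "compact L" "L \<subseteq> S" "\<forall>x. x \<notin> L \<longrightarrow> g x = 0"
    using fg by (auto simp: C1c_def supported_in_def)
  then have "supported_in S (\<lambda>x. f x + g x)" unfolding supported_in_def by (intro exI[of _ "K \<union> L"]) auto
  ultimately show ?thesis using fg by (auto simp: C1c_def intro!: differentiable_add continuous_intros)
qed

lemma C1c_cmult:
  assumes f: "f \<in> C1c S" shows "(\<lambda>x. c * f x) \<in> C1c S"
proof -
  have "partial i (\<lambda>x. c * f x) = (\<lambda>x. c * partial i f x)" for i
    by (rule ext, rule partial_cmult) (use f C1cD(1) in auto)
  moreover obtain K where "compact K" "K \<subseteq> S" "\<forall>x. x \<notin> K \<longrightarrow> f x = 0"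
    using f by (auto simp: C1c_def supported_in_def)
  then have "supported_in S (\<lambda>x. c * f x)" unfolding supported_in_def by (intro exI[of _ K]) auto
  ultimately show ?thesis using f by (auto simp: C1c_def intro!: differentiable_mult continuous_intros)
qed

lemma C1c_mult:
  assumes fg: "f \<in> C1c S" "g \<in> C1c S" shows "(\<lambda>x. f x * g x) \<in> C1c S"
proof -
  have "partial i (\<lambda>x. f x * g x) = (\<lambda>x. partial i f x * g x + f x * partial i g x)" for i
    by (rule ext, rule partial_mult) (use fg C1cD(1) in auto)
  moreover obtain K where "compact K" "K \<subseteq> S" "\<forall>x. x \<notin> K \<longrightarrow> f x = 0"
    using fg(1) by (auto simp: C1c_def supported_in_def)
  then have "supported_in S (\<lambda>x. f x * g x)" unfolding supported_in_def by (intro exI[of _ K]) auto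
  ultimately show ?thesis using fg C1cD(2,3)[OF fg(1)] C1cD(2,3)[OF fg(2)]
    by (auto simp: C1c_def intro!: differentiable_mult continuous_intros)
qed

lemma partial_const: "partial i (\<lambda>_. c) x = 0"
  by (rule partial_eq) simp

lemma C1c_0:
  fixes S :: "(real^'n) set"
  shows "(\<lambda>_. 0) \<in> C1c S"
proof -
  have "partial i (\<lambda>_::real^'n. 0) = (\<lambda>_. 0)" for i :: 'n by (rule ext, rule partial_const)
  then show ?thesis by (auto simp: C1c_def supported_in_def)
qed

lemma X_classical_0: "X_classical X (\<lambda>_. 0) x = 0"
  by (simp add: X_classical_def vec_eq_iff partial_const)

lemma X_classical_add: "f differentiable (at x) ==> g differentiable (at x) ==> X_classical X (\<lambda>x. f x + g x) x = X_classical X f x + X_classical X g x"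
  by (simp add: X_classical_def vec_eq_iff partial_add distrib_left sum.distrib)

lemma X_classical_cmult: "f differentiable (at x) ==> X_classical X (\<lambda>x. c * f x) x = c *\<^sub>R X_classical X f x"
  by (simp add: X_classical_def vec_eq_iff partial_cmult sum_distrib_left ac_simps)

lemma X_classical_mult: "f differentiable (at x) ==> g differentiable (at x) ==>
    X_classical X (\<lambda>x. f x * g x) x = g x *\<^sub>R X_classical X f x + f x *\<^sub>R X_classical X g x"
  by (simp add: X_classical_def vec_eq_iff partial_mult sum_distrib_left sum.distrib algebra_simps)

type_synonym ('n, 'm) l2_pair = "(real^'n, real \<times> (real^'m)) l2"

context cc_space
begin

definition pr :: "(real^'n => real) => ('n, 'm) l2_pair" where
  "pr \<phi> = l2_of (\<lambda>x. (\<phi> x, X_classical X \<phi> x))"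

text \<open>Complete by construction. The pairs of \<open>H10\<close> functions lie in it, and
  equations tested with C^1 functions extend to it by density.\<close>

definition V :: "('n, 'm) l2_pair set" where
  "V = closure (pr ` C1c \<Omega>)"

lemma X_classical_continuous: "\<phi> \<in> C1c S ==> continuous_on UNIV (X_classical X \<phi>)"
  unfolding X_classical_def[abs_def]
  by (intro continuous_on_vec_lambda continuous_intros X_continuous C1cD(2))

lemma C1c_support:
  assumes "\<phi> \<in> C1c S"
  obtains K where "compact K" "K \<subseteq> S" "\<And>x. x \<notin> K ==> \<phi> x = 0" "\<And>x. x \<notin> K ==> X_classical X \<phi> x = 0"
proof -
  obtain K where K: "compact K" "K \<subseteq> S" "\<forall>x. x \<notin> K \<longrightarrow> \<phi> x = 0 \<and> (\<forall>i. partial i \<phi> x = 0)" using C1cD(4)[OF assms] by blast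
  then have "X_classical X \<phi> x = 0" if "x \<notin> K" for x using that by (simp add: X_classical_def vec_eq_iff)
  then show thesis using that K by blast
qed

lemma sq_int_pr:
  assumes \<phi>: "\<phi> \<in> C1c S" shows "sq_int (\<lambda>x. (\<phi> x, X_classical X \<phi> x))"
proof -
  obtain K where K: "compact K" "\<And>x. x \<notin> K ==> \<phi> x = 0" "\<And>x. x \<notin> K ==> X_classical X \<phi> x = 0"
    using C1c_support[OF \<phi>] by metis
  show ?thesis
    by (rule sq_int_continuous[OF _ K(1)])
      (use K in \<open>auto intro!: continuous_on_Pair X_classical_continuous[OF \<phi>] C1cD(3)[OF \<phi>] simp: zero_prod_def\<close>)
qed

lemma fn_pr: "\<phi> \<in> C1c S ==> AE x in lebesgue. fn (pr \<phi>) x = (\<phi> x, X_classical X \<phi> x)"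
  unfolding pr_def by (rule fn_l2_of[OF sq_int_pr])

lemma subspace_V: "subspace V" and closed_V: "closed V"
proof -
  have "subspace (pr ` C1c \<Omega>)"
  proof (rule subspaceI)
    have "pr (\<lambda>_. 0) = 0"
    proof (rule l2_eqI)
      show "AE x in lebesgue. fn (pr (\<lambda>_. 0)) x = fn 0 x"
        using fn_pr[OF C1c_0] fn_0 by eventually_elim (simp add: X_classical_0 flip: zero_prod_def)
    qed
    then show "0 \<in> pr ` C1c \<Omega>" using C1c_0[of \<Omega>] by (metis imageI)
  next
    fix a b assume "a \<in> pr ` C1c \<Omega>" "b \<in> pr ` C1c \<Omega>"
    then obtain f g where fg: "f \<in> C1c \<Omega>" "g \<in> C1c \<Omega>" "a = pr f" "b = pr g" by blast
    have "pr f + pr g = pr (\<lambda>x. f x + g x)"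
    proof (rule l2_eqI)
      show "AE x in lebesgue. fn (pr f + pr g) x = fn (pr (\<lambda>x. f x + g x)) x"
        using fn_add[of "pr f" "pr g"] fn_pr[OF fg(1)] fn_pr[OF fg(2)] fn_pr[OF C1c_add[OF fg(1,2)]]
        by eventually_elim (simp add: X_classical_add[OF C1cD(1)[OF fg(1)] C1cD(1)[OF fg(2)]])
    qed
    then show "a + b \<in> pr ` C1c \<Omega>" using fg C1c_add[OF fg(1,2)] by (metis imageI)
  next
    fix a and c :: real assume "a \<in> pr ` C1c \<Omega>"
    then obtain f where f: "f \<in> C1c \<Omega>" "a = pr f" by blast
    have "c *\<^sub>R pr f = pr (\<lambda>x. c * f x)"
    proof (rule l2_eqI)
      show "AE x in lebesgue. fn (c *\<^sub>R pr f) x = fn (pr (\<lambda>x. c * f x)) x"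
        using fn_scaleR[of c "pr f"] fn_pr[OF f(1)] fn_pr[OF C1c_cmult[OF f(1), of c]]
        by eventually_elim (simp add: X_classical_cmult[OF C1cD(1)[OF f(1)]])
    qed
    then show "c *\<^sub>R a \<in> pr ` C1c \<Omega>" using f C1c_cmult[OF f(1)] by (metis imageI)
  qed
  then show "subspace V" unfolding V_def by (rule subspace_closure)
  show "closed V" by (simp add: V_def)
qed

lemma pr_in_V: "\<phi> \<in> C1c \<Omega> ==> pr \<phi> \<in> V"
  unfolding V_def by (rule subsetD[OF closure_subset imageI])

text \<open>A uniform radius for all centres in the compact closure: the speed is bounded on a
  Euclidean neighbourhood \<open>K\<close> inside \<open>\<Omega>0\<close>, so small balls, even
  those of the full space, stay in \<open>K\<close>. The latter is the proviso of (H3).\<close>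

lemma geometry:
  obtains K R C where "compact K" "closure \<Omega> \<subseteq> K" "0 < R" "doubling K C R"
    "\<And>x r. x \<in> closure \<Omega> ==> r \<le> R ==> B r x \<subseteq> K"
    "\<And>x r. x \<in> closure \<Omega> ==> r \<le> R ==> cc_ball X UNIV x (ennreal r) \<subseteq> \<Omega>0"
proof -
  obtain e where e: "e > 0" "(\<Union>x\<in>closure \<Omega>. cball x e) \<subseteq> \<Omega>0"
    using compact_subset_open_imp_cball_epsilon_subset[OF compact_closure_\<Omega> open_\<Omega>0 closure_\<Omega>] by blast
  define K where "K = {x + y | x y. x \<in> closure \<Omega> \<and> y \<in> cball 0 e}"
  have K: "compact K" unfolding K_def by (intro compact_sums compact_closure_\<Omega> compact_cball)
  have cb: "cball x e \<subseteq> K" if "x \<in> closure \<Omega>" for x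
  proof
    fix z assume "z \<in> cball x e"
    then show "z \<in> K" unfolding K_def using that
      by (intro CollectI exI[of _ x] exI[of _ "z - x"]) (auto simp: dist_norm norm_minus_commute)
  qed
  have K0: "K \<subseteq> \<Omega>0"
  proof
    fix z assume "z \<in> K"
    then obtain x y where xy: "z = x + y" "x \<in> closure \<Omega>" "norm y \<le> e" by (auto simp: K_def)
    then have "z \<in> cball x e" by (simp add: dist_norm)
    with e(2) xy(2) show "z \<in> \<Omega>0" by blast
  qed
  have sc: "continuous_on UNIV (speed X)" by (rule continuous_on_speed[OF X_continuous])
  have "compact (speed X ` K)"
    by (rule compact_continuous_image[OF continuous_on_subset[OF sc subset_UNIV] K])
  then obtain M where M: "M > 0" "\<And>y. y \<in> K ==> norm (speed X y) \<le> M"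
    using compact_imp_bounded bounded_pos by (metis imageI)
  have small: "dist x y < e" if xy: "x \<in> closure \<Omega>" "cc_dist X x y < ennreal (e / M)" for x y
  proof (rule cc_dist_local_lower_bound[OF e(1) M(1) _ xy(2)])
    fix z assume "z \<in> cball x e"
    then have "z \<in> K" using cb[OF xy(1)] by blast
    then show "speed X z \<le> M" using M(2)[of z] by simp
  qed
  obtain rK CK where rK: "rK > 0" "CK > 0" "\<forall>x\<in>K. \<forall>r. 0 < r \<and> r < rK \<longrightarrow>
        emeasure lebesgue (cc_ball X \<Omega>0 x (ennreal (2 * r))) \<le> ennreal CK * emeasure lebesgue (cc_ball X \<Omega>0 x (ennreal r))"
    using H2 K K0 unfolding cond_H2_def by meson
  \<comment> \<open>The first bound keeps balls inside \<open>K\<close>; the second stays strictly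
    below the threshold in (H2).\<close>
  define R where "R = min (e / M) (rK / 2)"
  have R: "R > 0" "R < rK" "R \<le> e / M" using e(1) M(1) rK(1) by (auto simp: R_def)
  have doub: "doubling K CK R"
    unfolding doubling_def
  proof (intro conjI ballI allI impI K0)
    fix x r assume x: "x \<in> K" and r: "0 < r" "r \<le> (R::real)"
    then have x0: "x \<in> \<Omega>0" using K0 by blast
    show "vol (2 * r) x \<le> ennreal CK * vol r x"
      using rK(3)[rule_format, OF x, of r] r R(2) open_B[OF x0] by (simp add: vol_eq[OF x0])
  qed (use rK in simp)
  have dd: "dist x y < e" if "x \<in> closure \<Omega>" "r \<le> R" "cc_dist X x y < ennreal r" for x y r
  proof (rule small[OF that(1)])
    have "ennreal r \<le> ennreal (e / M)" using that(2) R(3) by (intro ennreal_leI) simp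
    with that(3) show "cc_dist X x y < ennreal (e / M)" by (rule order.strict_trans2)
  qed
  have inK: "y \<in> K" if "x \<in> closure \<Omega>" "r \<le> R" "cc_dist X x y < ennreal r" for x y r
    using dd[OF that] cb[OF that(1)] by (auto simp: subset_eq)
  show thesis
  proof (rule that[OF K _ R(1) doub])
    show "closure \<Omega> \<subseteq> K" using cb e(1) by fastforce
    show "B r x \<subseteq> K" if "x \<in> closure \<Omega>" "r \<le> R" for x r using inK[OF that] by (auto simp: cc_ball_def)
    show "cc_ball X UNIV x (ennreal r) \<subseteq> \<Omega>0" if "x \<in> closure \<Omega>" "r \<le> R" for x r
      using inK[OF that] K0 by (auto simp: cc_ball_def)
  qed
qed

text \<open>The mean over the ball, written with \<open>near\<close> so that it is measurable in the
  centre.\<close>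

definition avg :: "real => real^'n => (real^'n => real) => real" where
  "avg r x \<phi> = (\<integral>y. indicator (near r) (x, y) * \<phi> y \<partial>lborel) / enn2real (vol r x)"

lemma avg_eq:
  assumes x: "x \<in> \<Omega>0" and \<phi>: "\<phi> \<in> C1c S"
  shows "(\<integral>y. \<phi> y \<partial>lebesgue_on (B r x)) / measure lebesgue (B r x) = avg r x \<phi>"
proof -
  have \<phi>m: "\<phi> \<in> borel_measurable borel" using C1cD(3)[OF \<phi>] by (rule borel_measurable_continuous_onI)
  have Bb: "B r x \<in> sets borel" using open_B[OF x] by auto
  have "(\<integral>y. \<phi> y \<partial>lebesgue_on (B r x)) = (\<integral>y. indicator (B r x) y *\<^sub>R \<phi> y \<partial>lebesgue)"
    using Bb by (subst integral_restrict_space) auto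
  also have "\<dots> = (\<integral>y. indicator (B r x) y *\<^sub>R \<phi> y \<partial>lborel)"
    using Bb \<phi>m by (intro integral_completion) auto
  also have "\<dots> = (\<integral>y. indicator (near r) (x, y) * \<phi> y \<partial>lborel)"
    using x by (intro Bochner_Integration.integral_cong) (auto simp: near_def cc_ball_def indicator_def)
  finally show ?thesis using Bb by (simp add: avg_def vol_eq[OF x] measure_def)
qed

text \<open>(H3) for C^1 functions, with its kernel replaced by the dyadic one.\<close>

lemma representation:
  obtains c C where "0 < c" "0 < C"
    "\<And>x0 x r \<phi>. x0 \<in> \<Omega>0 ==> 0 < r ==> cc_ball X UNIV x0 (ennreal (c * r)) \<subseteq> \<Omega>0 ==> \<phi> \<in> C1c \<Omega> ==> x \<in> B r x0 ==>
      ennreal \<bar>\<phi> x - avg r x0 \<phi>\<bar> \<le> ennreal C * (\<integral>\<^sup>+y. kern ((1 + c) * r) x y * ennreal (norm (X_classical X \<phi> y)) \<partial>lborel)"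
proof -
  define Q where "Q c C \<longleftrightarrow> (\<forall>xb\<in>\<Omega>0. \<forall>r>0.
     cc_ball X UNIV xb (ennreal (c * r)) \<subseteq> \<Omega>0 \<longrightarrow>
      (\<forall>(u :: real^'n => real) (v :: real^'n => real^'m).
        (\<exists>L. L-lipschitz_on (cc_cball X \<Omega>0 xb (ennreal (c * r))) u) \<and>
        (\<forall>j. is_X_deriv X (B (c * r) xb) j u (\<lambda>y. v y $ j)) \<longrightarrow>
        (\<forall>x\<in>cc_cball X \<Omega>0 xb (ennreal r).
           ennreal \<bar>u x - (\<integral>y. u y \<partial>lebesgue_on (B r xb)) / measure lebesgue (B r xb)\<bar>
           \<le> ennreal C * (\<integral>\<^sup>+y. ennreal (norm (v y)) *
               (cc_dist X x y / emeasure lebesgue (cc_ball X \<Omega>0 x (cc_dist X x y)))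
               \<partial>lebesgue_on (B (c * r) xb)))))" for c C :: real
  have "\<exists>c>0. \<exists>C>0. Q c C" using H3 by (simp only: cond_H3_def Let_def Q_def)
  then obtain c C where cC: "0 < c" "0 < C" and Q: "Q c C" by blast
  note H = Q[unfolded Q_def]
  show thesis
  proof (rule that[OF cC])
    fix x0 x r \<phi>
    assume x0: "x0 \<in> \<Omega>0" and r: "0 < (r::real)" and sub: "cc_ball X UNIV x0 (ennreal (c * r)) \<subseteq> \<Omega>0"
      and \<phi>: "\<phi> \<in> C1c \<Omega>" and x: "x \<in> B r x0"
    let ?v = "X_classical X \<phi>"
    let ?k = "\<lambda>y. cc_dist X x y / emeasure lebesgue (cc_ball X \<Omega>0 x (cc_dist X x y))"
    let ?T = "\<integral>\<^sup>+y. ennreal (norm (?v y)) * ?k y \<partial>lebesgue_on (B (c * r) x0)"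
      and ?S = "\<integral>\<^sup>+y. kern ((1 + c) * r) x y * ennreal (norm (?v y)) \<partial>lborel"
    have xx: "x \<in> \<Omega>0" using x B_subset by blast
    obtain L where L: "L-lipschitz_on UNIV \<phi>" using C1c_bounded_lipschitz[OF \<phi>] by metis
    have Bl: "B (c * r) x0 \<in> sets lebesgue" using open_B[OF x0] by auto
    have der: "is_X_deriv X (B (c * r) x0) j \<phi> (\<lambda>y. ?v y $ j)" for j
    proof -
      obtain M where "M-lipschitz_on \<Omega>0 (X j)" using X_lipschitz by blast
      then show ?thesis by (rule is_X_deriv_C1c[OF _ B_subset Bl \<phi>])
    qed
    have xc: "x \<in> cc_cball X \<Omega>0 x0 (ennreal r)" using x by (auto simp: cc_ball_def cc_cball_def less_imp_le)
    have lip: "L-lipschitz_on (cc_cball X \<Omega>0 x0 (ennreal (c * r))) \<phi>" by (rule lipschitz_on_subset[OF L subset_UNIV])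
    have cond: "(\<exists>L. L-lipschitz_on (cc_cball X \<Omega>0 x0 (ennreal (c * r))) \<phi>) \<and>
        (\<forall>j. is_X_deriv X (B (c * r) x0) j \<phi> (\<lambda>y. ?v y $ j))"
      using lip der by blast
    have main: "ennreal \<bar>\<phi> x - avg r x0 \<phi>\<bar> \<le> ennreal C * ?T"
      using H[THEN bspec, OF x0, THEN spec, THEN mp, OF r, THEN mp, OF sub, THEN spec[of _ \<phi>], THEN spec[of _ ?v],
          THEN mp, OF cond, THEN bspec, OF xc]
      unfolding avg_eq[OF x0 \<phi>] .
    have "?T
        \<le> (\<integral>\<^sup>+y. kern ((1 + c) * r) x y * ennreal (norm (?v y)) \<partial>lebesgue_on (B (c * r) x0))"
    proof (rule nn_integral_mono)
      fix y assume "y \<in> space (lebesgue_on (B (c * r) x0))"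
      then have y: "y \<in> \<Omega>0" "cc_dist X x0 y < ennreal (c * r)" by (simp_all add: space_restrict_space cc_ball_def)
      have "cc_dist X x x0 < ennreal r" using x by (subst cc_commute) (simp add: cc_ball_def)
      \<comment> \<open>The two points are within r and c r of the centre, which explains the radius
        (1 + c) r of the kernel.\<close>
      from cc_triangle[OF this y(2)] have "cc_dist X x y < ennreal ((1 + c) * r)"
        by (simp add: distrib_right)
      then have le: "?k y \<le> kern ((1 + c) * r) x y" by (rule cc_kernel_le_kern[OF xx y(1)])
      show "ennreal (norm (?v y)) * ?k y \<le> kern ((1 + c) * r) x y * ennreal (norm (?v y))"
        unfolding mult.commute[of "ennreal (norm (?v y))"] by (rule mult_right_mono[OF le]) simp
    qed
    also have "\<dots> \<le> (\<integral>\<^sup>+y. kern ((1 + c) * r) x y * ennreal (norm (?v y)) \<partial>lebesgue)"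
    proof -
      have "(\<integral>\<^sup>+y. kern ((1 + c) * r) x y * ennreal (norm (?v y)) \<partial>lebesgue_on (B (c * r) x0))
         = (\<integral>\<^sup>+y. kern ((1 + c) * r) x y * ennreal (norm (?v y)) * indicator (B (c * r) x0) y \<partial>lebesgue)"
        using Bl by (subst nn_integral_restrict_space) auto
      also have "\<dots> \<le> (\<integral>\<^sup>+y. kern ((1 + c) * r) x y * ennreal (norm (?v y)) \<partial>lebesgue)"
        by (rule nn_integral_mono) (auto simp: indicator_def)
      finally show ?thesis .
    qed
    also have "\<dots> = ?S"
    proof -
      have "kern ((1 + c) * r) x \<in> borel_measurable borel"
        using measurable_compose[of "Pair x" borel "borel \<Otimes>\<^sub>M borel", OF _ kern_measurable] by simp
      moreover have "?v \<in> borel_measurable borel" using X_classical_continuous[OF \<phi>] by (rule borel_measurable_continuous_onI)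
      ultimately have "(\<lambda>y. kern ((1 + c) * r) x y * ennreal (norm (?v y))) \<in> borel_measurable lborel" by simp
      then show ?thesis by (simp only: nn_integral_completion)
    qed
    finally have "?T
      \<le> ?S" .
    then have "ennreal C * ?T
      \<le> ennreal C * ?S"
      by (rule mult_left_mono) simp
    with main show "ennreal \<bar>\<phi> x - avg r x0 \<phi>\<bar> \<le> ennreal C * (\<integral>\<^sup>+y. kern ((1 + c) * r) x y * ennreal (norm (X_classical X \<phi> y)) \<partial>lborel)"
      by (rule order.trans)
  qed
qed

lemma kern_L2_bound:
  assumes D: "doubling K C R" and R: "0 < R" and S: "S \<subseteq> K" and K: "K \<in> sets borel" and C': "0 \<le> C'" and \<phi>: "\<phi> \<in> C1c \<Omega>"
    and h: "\<And>x. x \<in> S ==> ennreal \<bar>h x\<bar> \<le> ennreal C' * (\<integral>\<^sup>+y. kern R x y * ennreal (norm (X_classical X \<phi> y)) \<partial>lborel)"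
  shows "(\<integral>\<^sup>+x. indicator S x * ennreal ((h x)\<^sup>2) \<partial>lborel)
    \<le> ennreal (C'\<^sup>2 * (4 * C ^ 3 * R\<^sup>2)) * (\<integral>\<^sup>+y. ennreal ((norm (X_classical X \<phi> y))\<^sup>2) \<partial>lebesgue)"
proof -
  have C: "0 \<le> C" using D by (auto simp: doubling_def)
  let ?v = "X_classical X \<phi>"
  have vm[measurable]: "?v \<in> borel_measurable borel" using X_classical_continuous[OF \<phi>] by (rule borel_measurable_continuous_onI)
  let ?I = "\<lambda>x. \<integral>\<^sup>+y. kern R x y * ennreal (norm (?v y)) \<partial>lborel"
  have kp[measurable]: "(\<lambda>(x, y). kern R x y) \<in> borel_measurable (lborel \<Otimes>\<^sub>M lborel)"
    using kern_measurable[of R] by (simp add: case_prod_unfold cong: measurable_cong_sets sets_pair_measure_cong)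
  have Im[measurable]: "?I \<in> borel_measurable borel"
  proof -
    have "?I \<in> borel_measurable lborel" by measurable
    then show ?thesis by simp
  qed
  note [measurable] = K
  have "(\<integral>\<^sup>+x. indicator S x * ennreal ((h x)\<^sup>2) \<partial>lborel) \<le> (\<integral>\<^sup>+x. ennreal (C'\<^sup>2) * (indicator K x * (?I x)\<^sup>2) \<partial>lborel)"
  proof (rule nn_integral_mono)
    fix x
    show "indicator S x * ennreal ((h x)\<^sup>2) \<le> ennreal (C'\<^sup>2) * (indicator K x * (?I x)\<^sup>2)"
    proof (cases "x \<in> S")
      case True
      have "ennreal ((h x)\<^sup>2) = (ennreal \<bar>h x\<bar>)\<^sup>2" by (simp add: ennreal_power)
      also have "\<dots> \<le> (ennreal C' * ?I x)\<^sup>2" using h[OF True] by (intro power_mono) auto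
      also have "\<dots> = ennreal (C'\<^sup>2) * (?I x)\<^sup>2" using C' by (simp add: power_mult_distrib ennreal_power)
      finally show ?thesis using True S by auto
    qed simp
  qed
  also have "\<dots> = ennreal (C'\<^sup>2) * (\<integral>\<^sup>+x. indicator K x * (?I x)\<^sup>2 \<partial>lborel)" by (rule nn_integral_cmult) measurable
  also have "\<dots> \<le> ennreal (C'\<^sup>2) * (ennreal (4 * C ^ 3 * R\<^sup>2) * (\<integral>\<^sup>+y. (ennreal (norm (?v y)))\<^sup>2 \<partial>lborel))"
    by (intro mult_left_mono kern_operator_bound[OF D R K]) auto
  also have "\<dots> = ennreal (C'\<^sup>2 * (4 * C ^ 3 * R\<^sup>2)) * (\<integral>\<^sup>+y. ennreal ((norm (?v y))\<^sup>2) \<partial>lborel)"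
    using C C' by (simp add: ennreal_mult ennreal_power mult.assoc)
  also have "(\<integral>\<^sup>+y. ennreal ((norm (?v y))\<^sup>2) \<partial>lborel) = (\<integral>\<^sup>+y. ennreal ((norm (?v y))\<^sup>2) \<partial>lebesgue)"
    by (rule nn_integral_completion[symmetric]) measurable
  finally show ?thesis .
qed

section \<open>The function and gradient components of a pair\<close>

definition Pfst :: "('n, 'm) l2_pair => ('n, 'm) l2_pair" where
  "Pfst = ptw (\<lambda>x p. (fst p, 0))"

definition Psnd :: "('n, 'm) l2_pair => ('n, 'm) l2_pair" where
  "Psnd = ptw (\<lambda>x p. (0, snd p))"

lemma ptw_fst: "ptw_bounded 1 (\<lambda>(x::real^'n) (p::real \<times> (real^'m)). (fst p, 0::real^'m))"
  unfolding ptw_bounded_def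
proof (intro conjI allI ballI AE_I2)
  show "linear (\<lambda>p::real \<times> (real^'m). (fst p, 0::real^'m))" by (intro linearI) auto
  show "norm (fst p, 0::real^'m) \<le> 1 * norm p" for p :: "real \<times> (real^'m)"
    using norm_fst_le by (cases p) (simp add: norm_Pair)
  fix f :: "real^'n => real \<times> (real^'m)" assume "f \<in> borel_measurable lebesgue"
  then show "(\<lambda>x. (fst (f x), 0::real^'m)) \<in> borel_measurable lebesgue"
    by (intro borel_measurable_continuous_on[where f = "\<lambda>p. (fst p, 0::real^'m)"] continuous_intros)
qed

lemma ptw_snd: "ptw_bounded 1 (\<lambda>(x::real^'n) (p::real \<times> (real^'m)). (0::real, snd p))"
  unfolding ptw_bounded_def
proof (intro conjI allI ballI AE_I2)
  show "linear (\<lambda>p::real \<times> (real^'m). (0::real, snd p))" by (intro linearI) auto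
  show "norm (0::real, snd p) \<le> 1 * norm p" for p :: "real \<times> (real^'m)"
    using norm_snd_le by (cases p) (simp add: norm_Pair)
  fix f :: "real^'n => real \<times> (real^'m)" assume "f \<in> borel_measurable lebesgue"
  then show "(\<lambda>x. (0::real, snd (f x))) \<in> borel_measurable lebesgue"
    by (intro borel_measurable_continuous_on[where f = "\<lambda>p. (0::real, snd p)"] continuous_intros)
qed

lemmas bounded_linear_Pfst = bounded_linear_ptw[OF ptw_fst, folded Pfst_def]
lemmas bounded_linear_Psnd = bounded_linear_ptw[OF ptw_snd, folded Psnd_def]
lemmas fn_Pfst = fn_ptw[OF ptw_fst, folded Pfst_def]
lemmas fn_Psnd = fn_ptw[OF ptw_snd, folded Psnd_def]

lemma Pfst_add_Psnd: "Pfst z + Psnd z = z"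
proof (rule l2_eqI)
  show "AE x in lebesgue. fn (Pfst z + Psnd z) x = fn z x"
    using fn_add[of "Pfst z" "Psnd z"] fn_Pfst[of z] fn_Psnd[of z]
  proof eventually_elim
    case (elim x)
    then show ?case by (cases "fn z x") simp
  qed
qed

lemma nn_integral_fst_pr:
  assumes "\<phi> \<in> C1c S"
  shows "(\<integral>\<^sup>+x. ennreal ((\<phi> x)\<^sup>2) \<partial>lebesgue) = ennreal ((norm (Pfst (pr \<phi>)))\<^sup>2)"
proof -
  have "AE x in lebesgue. ennreal ((\<phi> x)\<^sup>2) = ennreal ((norm (fn (Pfst (pr \<phi>)) x))\<^sup>2)"
    using fn_Pfst[of "pr \<phi>"] fn_pr[OF assms]
  proof eventually_elim
    case (elim x)
    show ?case unfolding elim(1) elim(2) by (simp add: norm_Pair)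
  qed
  then show ?thesis unfolding nn_integral_power2_norm_l2[symmetric] by (rule nn_integral_cong_AE)
qed

lemma nn_integral_snd_pr:
  assumes "\<phi> \<in> C1c S"
  shows "(\<integral>\<^sup>+x. ennreal ((norm (X_classical X \<phi> x))\<^sup>2) \<partial>lebesgue) = ennreal ((norm (Psnd (pr \<phi>)))\<^sup>2)"
proof -
  have "AE x in lebesgue. ennreal ((norm (X_classical X \<phi> x))\<^sup>2) = ennreal ((norm (fn (Psnd (pr \<phi>)) x))\<^sup>2)"
    using fn_Psnd[of "pr \<phi>"] fn_pr[OF assms]
  proof eventually_elim
    case (elim x)
    show ?case unfolding elim(1) elim(2) by (simp add: norm_Pair)
  qed
  then show ?thesis unfolding nn_integral_power2_norm_l2[symmetric] by (rule nn_integral_cong_AE)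
qed

end

section \<open>Rellich and Poincare\<close>

lemma power2_add_le: "(a + b)\<^sup>2 \<le> 2 * a\<^sup>2 + 2 * (b::real)\<^sup>2"
proof -
  have "0 \<le> (a - b)\<^sup>2" by simp
  then show ?thesis by (simp add: power2_sum power2_diff)
qed

lemma ennreal_power2_add_le:
  "ennreal ((a + b)\<^sup>2) \<le> 2 * ennreal (a\<^sup>2) + 2 * ennreal (b\<^sup>2)"
proof -
  have "ennreal ((a + b)\<^sup>2) \<le> ennreal (2 * a\<^sup>2 + 2 * b\<^sup>2)" by (rule ennreal_leI[OF power2_add_le])
  also have "\<dots> = 2 * ennreal (a\<^sup>2) + 2 * ennreal (b\<^sup>2)" by (simp add: ennreal_plus ennreal_mult)
  finally show ?thesis .
qed

context cc_space
begin

lemma doubling_mono: "doubling K C R ==> R' \<le> R ==> doubling K C R'"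
  by (auto simp: doubling_def)

lemma closure_in_\<Omega>0: "x \<in> closure \<Omega> ==> x \<in> \<Omega>0"
  using closure_\<Omega> by (rule subsetD)

text \<open>One kernel bound, used twice: averages about the moving point serve for compactness,
  averages about a fixed centre show that functions with vanishing gradient are constant on
  balls.\<close>

lemma local_estimates:
  obtains K R C where "compact K" "0 < R" "0 \<le> C"
    "\<And>x r. x \<in> closure \<Omega> ==> r \<le> R ==> B r x \<subseteq> K"
    "\<And>r \<phi>. 0 < r ==> r \<le> R ==> \<phi> \<in> C1c \<Omega> ==>
       (\<integral>\<^sup>+x. indicator (closure \<Omega>) x * ennreal ((\<phi> x - avg r x \<phi>)\<^sup>2) \<partial>lborel) \<le> ennreal (C * r\<^sup>2 * (norm (Psnd (pr \<phi>)))\<^sup>2)"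
    "\<And>x0 r \<phi>. x0 \<in> closure \<Omega> ==> 0 < r ==> r \<le> R ==> \<phi> \<in> C1c \<Omega> ==>
       (\<integral>\<^sup>+x. indicator (B r x0) x * ennreal ((\<phi> x - avg r x0 \<phi>)\<^sup>2) \<partial>lborel) \<le> ennreal (C * r\<^sup>2 * (norm (Psnd (pr \<phi>)))\<^sup>2)"
proof -
  let ?K = "\<lambda>c r \<phi> x. \<integral>\<^sup>+y. kern ((1 + c) * r) x y * ennreal (norm (X_classical X \<phi> y)) \<partial>lborel"
  obtain K R D where K: "compact K" "closure \<Omega> \<subseteq> K" "0 < R" "doubling K D R"
    and BK: "\<And>x r. x \<in> closure \<Omega> ==> r \<le> R ==> B r x \<subseteq> K"
    and BU: "\<And>x r. x \<in> closure \<Omega> ==> r \<le> R ==> cc_ball X UNIV x (ennreal r) \<subseteq> \<Omega>0"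
    by (rule geometry) (rule that)
  obtain c C where c: "0 < c" "0 < C" and rep:
    "\<And>x0 x r \<phi>. x0 \<in> \<Omega>0 ==> 0 < r ==> cc_ball X UNIV x0 (ennreal (c * r)) \<subseteq> \<Omega>0 ==> \<phi> \<in> C1c \<Omega> ==> x \<in> B r x0 ==>
      ennreal \<bar>\<phi> x - avg r x0 \<phi>\<bar> \<le> ennreal C * ?K c r \<phi> x"
    by (rule representation) blast
  \<comment> \<open>The kernel radius (1 + c) r has to stay within the doubling range
    \<open>R\<close>.\<close>
  define R1 where "R1 = R / (1 + c)"
  define E where "E = C\<^sup>2 * (4 * D ^ 3 * (1 + c)\<^sup>2)"
  have D: "0 \<le> D" using K(4) by (simp add: doubling_def)
  have R1: "0 < R1" "R1 \<le> R" using K(3) c by (auto simp: R1_def field_simps)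
  have Kb: "K \<in> sets borel" using K(1) by (rule borel_compact)
  have rR: "(1 + c) * r \<le> R" "c * r \<le> R" if "0 < r" "r \<le> R1" for r
  proof -
    show "(1 + c) * r \<le> R" using that(2) c by (simp add: R1_def field_simps)
    then show "c * r \<le> R" using that(1) by (simp add: algebra_simps)
  qed
  have gen: "(\<integral>\<^sup>+x. indicator S x * ennreal ((h x)\<^sup>2) \<partial>lborel) \<le> ennreal (E * r\<^sup>2 * (norm (Psnd (pr \<phi>)))\<^sup>2)"
    if r: "0 < r" "r \<le> R1" and \<phi>: "\<phi> \<in> C1c \<Omega>" and S: "S \<subseteq> K"
      and h: "\<And>x. x \<in> S ==> ennreal \<bar>h x\<bar> \<le> ennreal C * ?K c r \<phi> x"
    for r \<phi> S h
  proof -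
    have "0 < (1 + c) * r" using r(1) c(1) by simp
    from kern_L2_bound[OF doubling_mono[OF K(4) rR(1)[OF r]] this S Kb less_imp_le[OF c(2)] \<phi> h]
    have "(\<integral>\<^sup>+x. indicator S x * ennreal ((h x)\<^sup>2) \<partial>lborel)
        \<le> ennreal (C\<^sup>2 * (4 * D ^ 3 * ((1 + c) * r)\<^sup>2)) * (\<integral>\<^sup>+y. ennreal ((norm (X_classical X \<phi> y))\<^sup>2) \<partial>lebesgue)"
      by blast
    also have "\<dots> = ennreal (E * r\<^sup>2 * (norm (Psnd (pr \<phi>)))\<^sup>2)"
      unfolding nn_integral_snd_pr[OF \<phi>] using D by (subst ennreal_mult[symmetric]) (auto simp: E_def power_mult_distrib ac_simps)
    finally show ?thesis .
  qed
  show thesis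
  proof (rule that[OF K(1) R1(1)])
    show "0 \<le> E" using D by (simp add: E_def)
    show "B r x \<subseteq> K" if "x \<in> closure \<Omega>" "r \<le> R1" for x r using BK[OF that(1), of r] that(2) R1(2) by linarith
  next
    fix r \<phi> assume r: "0 < r" "r \<le> R1" and \<phi>: "\<phi> \<in> C1c \<Omega>"
    show "(\<integral>\<^sup>+x. indicator (closure \<Omega>) x * ennreal ((\<phi> x - avg r x \<phi>)\<^sup>2) \<partial>lborel) \<le> ennreal (E * r\<^sup>2 * (norm (Psnd (pr \<phi>)))\<^sup>2)"
    proof (rule gen[OF r \<phi> K(2)])
      fix x assume x: "x \<in> closure \<Omega>"
      show "ennreal \<bar>\<phi> x - avg r x \<phi>\<bar> \<le> ennreal C * ?K c r \<phi> x"
        by (rule rep[OF closure_in_\<Omega>0[OF x] r(1) BU[OF x rR(2)[OF r]] \<phi> center_B[OF closure_in_\<Omega>0[OF x] r(1)]])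
    qed
  next
    fix x0 r \<phi> assume x0: "x0 \<in> closure \<Omega>" and r: "0 < r" "r \<le> R1" and \<phi>: "\<phi> \<in> C1c \<Omega>"
    have "B r x0 \<subseteq> K" using BK[OF x0, of r] r(2) R1(2) by linarith
    then show "(\<integral>\<^sup>+x. indicator (B r x0) x * ennreal ((\<phi> x - avg r x0 \<phi>)\<^sup>2) \<partial>lborel) \<le> ennreal (E * r\<^sup>2 * (norm (Psnd (pr \<phi>)))\<^sup>2)"
      by (rule gen[OF r \<phi>]) (rule rep[OF closure_in_\<Omega>0[OF x0] r(1) BU[OF x0 rR(2)[OF r]] \<phi>])
  qed
qed

text \<open>Finitely many balls of radius r/2 cover the closure, and the ball of radius r about any
  point contains the covering ball in which it lies.\<close>

lemma vol_lower_bound: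
  assumes r: "0 < r"
  obtains \<delta> where "0 < \<delta>" "\<And>x. x \<in> closure \<Omega> ==> ennreal \<delta> \<le> vol r x"
proof -
  have "\<exists>d>0. ennreal d \<le> vol (r / 2) x" if "x \<in> closure \<Omega>" for x
  proof (cases "vol (r / 2) x")
    case (real d)
    then show ?thesis using vol_pos[OF closure_in_\<Omega>0[OF that], of "r / 2"] r by (intro exI[of _ d]) auto
  qed (auto intro: exI[of _ 1])
  then obtain d where d: "\<And>x. x \<in> closure \<Omega> ==> 0 < d x" "\<And>x. x \<in> closure \<Omega> ==> ennreal (d x) \<le> vol (r / 2) x"
    by metis
  obtain D where D: "D \<subseteq> closure \<Omega>" "finite D" "closure \<Omega> \<subseteq> (\<Union>x\<in>D. B (r / 2) x)"
  proof (rule compactE_image[OF compact_closure_\<Omega>])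
    show "open (B (r / 2) x)" if "x \<in> closure \<Omega>" for x by (rule open_B[OF closure_in_\<Omega>0[OF that]])
    show "closure \<Omega> \<subseteq> (\<Union>x\<in>closure \<Omega>. B (r / 2) x)"
    proof
      fix x assume x: "x \<in> closure \<Omega>"
      then show "x \<in> (\<Union>x\<in>closure \<Omega>. B (r / 2) x)" using center_B[OF closure_in_\<Omega>0[OF x], of "r / 2"] r by (intro UN_I[OF x]) simp
    qed
  qed
  show thesis
  \<comment> \<open>The inserted 1 keeps the minimum defined if the cover is empty.\<close>
  proof (rule that[of "Min (insert 1 (d ` D))"])
    show "0 < Min (insert 1 (d ` D))" using D d(1) by (subst Min_gr_iff) auto
    fix x assume x: "x \<in> closure \<Omega>"
    then obtain y where y: "y \<in> D" "x \<in> B (r / 2) y" using D(3) by blast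
    have y0: "y \<in> closure \<Omega>" using y(1) D(1) by blast
    have "B (r / 2) y \<subseteq> B r x"
    proof
      fix z assume z: "z \<in> B (r / 2) y"
      have "cc_dist X x y < ennreal (r / 2)" using y(2) by (subst cc_commute) (simp add: cc_ball_def)
      moreover have "cc_dist X y z < ennreal (r / 2)" using z by (simp add: cc_ball_def)
      ultimately have "cc_dist X x z < ennreal (r / 2 + r / 2)" by (rule cc_triangle)
      then show "z \<in> B r x" using z by (simp add: cc_ball_def)
    qed
    then have "vol (r / 2) y \<le> vol r x"
      using open_B[OF closure_in_\<Omega>0[OF x]] unfolding vol_eq[OF closure_in_\<Omega>0[OF x]] vol_eq[OF closure_in_\<Omega>0[OF y0]]
      by (intro emeasure_mono) auto
    moreover have "Min (insert 1 (d ` D)) \<le> d y" using D(2) y(1) by (intro Min_le) auto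
    then have "ennreal (Min (insert 1 (d ` D))) \<le> ennreal (d y)" by (rule ennreal_leI)
    ultimately show "ennreal (Min (insert 1 (d ` D))) \<le> vol r x" using d(2)[OF y0] by (meson order.trans)
  qed
qed

lemma avg_measurable:
  fixes \<phi> :: "real^'n => real"
  assumes [measurable]: "\<phi> \<in> borel_measurable borel"
  shows "(\<lambda>x. avg r x \<phi>) \<in> borel_measurable borel"
proof -
  have [measurable]: "near r \<in> sets (borel \<Otimes>\<^sub>M lborel)" by (simp cong: sets_pair_measure_cong)
  have "(\<lambda>(x, y). indicator (near r) (x, y) * \<phi> y) \<in> borel_measurable (borel \<Otimes>\<^sub>M lborel)" by measurable
  then have [measurable]: "(\<lambda>x. \<integral>y. indicator (near r) (x, y) * \<phi> y \<partial>lborel) \<in> borel_measurable borel"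
    by (rule lborel.borel_measurable_lebesgue_integral)
  show ?thesis unfolding avg_def by measurable
qed

text \<open>Averages are continuous functionals on the Hilbert space, hence converge along weakly
  convergent sequences.\<close>

lemma avg_as_inner:
  assumes x: "x \<in> closure \<Omega>" and b: "bounded (B r x)"
  obtains v where "\<And>\<phi>. \<phi> \<in> C1c \<Omega> ==> avg r x \<phi> = pr \<phi> \<bullet> v"
proof -
  have Bl: "B r x \<in> sets lebesgue" using open_B[OF closure_in_\<Omega>0[OF x]] by auto
  have lm: "B r x \<in> lmeasurable" using Bl b by (simp add: bounded_set_imp_lmeasurable)
  let ?m = "measure lebesgue (B r x)"
  let ?g = "\<lambda>y. (indicator (B r x) y / ?m, 0 :: real^'m)"
  have "integrable lebesgue (\<lambda>y. (1 / ?m)\<^sup>2 * indicat_real (B r x) y)"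
    using lm by (intro integrable_mult_right integrable_real_indicator) (auto simp: fmeasurable_def)
  moreover have "(\<lambda>y. (norm (?g y))\<^sup>2) = (\<lambda>y. (1 / ?m)\<^sup>2 * indicat_real (B r x) y)"
    by (auto simp: norm_Pair indicator_def)
  moreover have "(\<lambda>y. indicat_real (B r x) y / ?m) \<in> borel_measurable lebesgue" using Bl by measurable
  then have "?g \<in> borel_measurable lebesgue" by (intro borel_measurable_Pair) auto
  ultimately have g: "sq_int ?g" by (simp add: sq_int_def)
  show thesis
  proof (rule that[of "l2_of ?g"])
    fix \<phi> assume \<phi>: "\<phi> \<in> C1c \<Omega>"
    have "pr \<phi> \<bullet> l2_of ?g = (\<integral>y. (indicator (B r x) y *\<^sub>R \<phi> y) / ?m \<partial>lebesgue)"
      unfolding pr_def inner_l2_of[OF sq_int_pr[OF \<phi>] g] by (simp add: mult.commute)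
    also have "\<dots> = (\<integral>y. \<phi> y \<partial>lebesgue_on (B r x)) / ?m"
      using Bl by (simp add: integral_restrict_space)
    finally show "avg r x \<phi> = pr \<phi> \<bullet> l2_of ?g" using avg_eq[OF closure_in_\<Omega>0[OF x] \<phi>] by simp
  qed
qed

lemma C1c_outside: "\<phi> \<in> C1c (S :: (real^'n) set) ==> x \<notin> S ==> \<phi> x = 0"
  by (auto simp: C1c_def supported_in_def)

lemma bounded_small_balls:
  obtains R where "0 < R" "\<And>x r. x \<in> closure \<Omega> ==> r \<le> R ==> bounded (B r x)"
proof -
  obtain K R C where K: "compact K" "closure \<Omega> \<subseteq> K" "0 < R" "doubling K C R"
    and BK: "\<And>x r. x \<in> closure \<Omega> ==> r \<le> R ==> B r x \<subseteq> K"
    and BU: "\<And>x r. x \<in> closure \<Omega> ==> r \<le> R ==> cc_ball X UNIV x (ennreal r) \<subseteq> \<Omega>0"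
    by (rule geometry) (rule that)
  show thesis by (rule that[OF K(3)], rule bounded_subset[OF compact_imp_bounded[OF K(1)] BK])
qed

lemma norm_Pfst: "norm (Pfst z) \<le> norm z" and norm_Psnd: "norm (Psnd z) \<le> norm z"
  using norm_ptw[OF ptw_snd, of z] norm_ptw[OF ptw_fst, of z] by (simp_all add: Psnd_def Pfst_def)

text \<open>Split each function into its average and the deviation from it. The deviation is of
  order r in norm, uniformly along the sequence; for fixed r the averages tend to 0 pointwise and
  are uniformly bounded, so they vanish in norm as well.\<close>

lemma rellich_C1c:
  assumes \<phi>: "\<And>k. \<phi> k \<in> C1c \<Omega>" and M: "\<And>k. norm (pr (\<phi> k)) \<le> M"
    and R0: "0 < R0" and conv: "\<And>x r. x \<in> closure \<Omega> ==> 0 < r ==> r \<le> R0 ==> (\<lambda>k. avg r x (\<phi> k)) \<longlonglongrightarrow> 0"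
  shows "(\<lambda>k. norm (Pfst (pr (\<phi> k)))) \<longlonglongrightarrow> 0"
proof -
  obtain K R C where K: "compact K" and R: "0 < R" and C: "0 \<le> C"
    and BK: "\<And>x r. x \<in> closure \<Omega> ==> r \<le> R ==> B r x \<subseteq> K"
    and est: "\<And>r \<phi>. 0 < r ==> r \<le> R ==> \<phi> \<in> C1c \<Omega> ==>
       (\<integral>\<^sup>+x. indicator (closure \<Omega>) x * ennreal ((\<phi> x - avg r x \<phi>)\<^sup>2) \<partial>lborel) \<le> ennreal (C * r\<^sup>2 * (norm (Psnd (pr \<phi>)))\<^sup>2)"
    and "\<And>x0 r \<phi>. x0 \<in> closure \<Omega> ==> 0 < r ==> r \<le> R ==> \<phi> \<in> C1c \<Omega> ==>
       (\<integral>\<^sup>+x. indicator (B r x0) x * ennreal ((\<phi> x - avg r x0 \<phi>)\<^sup>2) \<partial>lborel) \<le> ennreal (C * r\<^sup>2 * (norm (Psnd (pr \<phi>)))\<^sup>2)"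
    by (rule local_estimates) (rule that)
  let ?a = "\<lambda>r k x. indicator (closure \<Omega>) x * ennreal ((avg r x (\<phi> k))\<^sup>2)"
    and ?g = "\<lambda>r k x. indicator (closure \<Omega>) x * ennreal ((\<phi> k x - avg r x (\<phi> k))\<^sup>2)"
    and ?n = "\<lambda>r k x y. indicator (near r) (x, y) * \<phi> k y"
    and ?d = "\<lambda>k y. indicat_real (closure \<Omega>) y + (\<phi> k y)\<^sup>2"
    and ?p = "\<lambda>k. (norm (Pfst (pr (\<phi> k))))\<^sup>2"
  let ?A = "\<lambda>r k. \<integral>\<^sup>+x. ?a r k x \<partial>lborel"
  have \<phi>b[measurable]: "\<phi> k \<in> borel_measurable borel" for k
    using C1cD(3)[OF \<phi>] by (rule borel_measurable_continuous_onI)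
  have clb[measurable]: "closure \<Omega> \<in> sets borel" by simp
  have lim: "(\<lambda>k. \<integral>\<^sup>+x. ?a r k x \<partial>lborel) \<longlonglongrightarrow> 0" if r: "0 < r" "r \<le> R" "r \<le> R0" for r
  proof -
    obtain \<delta> where \<delta>: "0 < \<delta>" "\<And>x. x \<in> closure \<Omega> ==> ennreal \<delta> \<le> vol r x" by (rule vol_lower_bound[OF r(1)]) (rule that)
    have fin: "emeasure lborel K < \<infinity>" using K by (rule emeasure_compact_finite)
    have \<delta>': "\<delta> \<le> enn2real (vol r x)" if x: "x \<in> closure \<Omega>" for x
    proof -
      have "vol r x \<le> emeasure lborel K" unfolding vol_eq[OF closure_in_\<Omega>0[OF x]]
        using K by (intro emeasure_mono BK[OF x r(2)]) (auto intro: borel_compact)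
      then have "vol r x < \<infinity>" using fin by (rule order.strict_trans1)
      then have "ennreal \<delta> \<le> ennreal (enn2real (vol r x))" using \<delta>(2)[OF x] by simp
      then show ?thesis by (simp add: ennreal_le_iff)
    qed
    define m where "m = measure lborel (closure \<Omega>)"
    have icl: "integrable lborel (indicat_real (closure \<Omega>))"
      using emeasure_compact_finite[OF compact_closure_\<Omega>] by (intro integrable_real_indicator) auto
    have phi2: "integrable lborel (\<lambda>y. (\<phi> k y)\<^sup>2)" "(\<integral>y. (\<phi> k y)\<^sup>2 \<partial>lborel) \<le> M\<^sup>2" for k
    proof -
      have "(\<integral>\<^sup>+y. ennreal ((\<phi> k y)\<^sup>2) \<partial>lborel) = ennreal (?p k)"
        using nn_integral_fst_pr[OF \<phi>[of k]] by (simp add: nn_integral_completion)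
      also have "\<dots> \<le> ennreal (M\<^sup>2)"
        using order.trans[OF norm_Pfst M] by (intro ennreal_leI power_mono) auto
      finally have le: "(\<integral>\<^sup>+y. ennreal ((\<phi> k y)\<^sup>2) \<partial>lborel) \<le> ennreal (M\<^sup>2)" .
      show int: "integrable lborel (\<lambda>y. (\<phi> k y)\<^sup>2)"
        using le by (intro integrableI_bounded) (auto simp: ennreal_power le_less_trans)
      show "(\<integral>y. (\<phi> k y)\<^sup>2 \<partial>lborel) \<le> M\<^sup>2"
        using le nn_integral_eq_integral[OF int] by (simp add: ennreal_le_iff)
    qed
    \<comment> \<open>The estimate |t| <= 1 + t^2 bounds the integral by the volume of the closure
      plus the squared norm.\<close>
    have num: "\<bar>\<integral>y. ?n r k x y \<partial>lborel\<bar> \<le> m + M\<^sup>2" for x k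
    proof -
      have dom: "integrable lborel (\<lambda>y. ?d k y)"
        using icl phi2(1) by simp
      have pt: "norm (?n r k x y) \<le> ?d k y" for y
      proof (cases "y \<in> closure \<Omega>")
        case True
        have "0 \<le> (\<bar>\<phi> k y\<bar> - 1)\<^sup>2" by simp
        then have "2 * \<bar>\<phi> k y\<bar> \<le> 1 + (\<phi> k y)\<^sup>2" by (simp add: power2_diff)
        then have "\<bar>\<phi> k y\<bar> \<le> 1 + (\<phi> k y)\<^sup>2" by linarith
        then show ?thesis using True by (auto simp: indicator_def)
      next
        case False
        then have "y \<notin> \<Omega>" using closure_subset by blast
        then show ?thesis using C1c_outside[OF \<phi>] by simp
      qed
      have "\<bar>\<integral>y. ?n r k x y \<partial>lborel\<bar> \<le> (\<integral>y. ?d k y \<partial>lborel)"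
      proof -
        have meas: "(\<lambda>y. ?n r k x y) \<in> borel_measurable lborel"
          by (simp, measurable)
        have "integrable lborel (\<lambda>y. ?n r k x y)"
        proof (rule Bochner_Integration.integrable_bound[OF dom meas], rule AE_I2)
          show "norm (?n r k x y) \<le> norm (?d k y)" for y
            using order.trans[OF pt abs_ge_self] by (simp only: real_norm_def)
        qed
        then show ?thesis using Bochner_Integration.integral_norm_bound_integral[OF _ dom pt] by simp
      qed
      also have "\<dots> = m + (\<integral>y. (\<phi> k y)\<^sup>2 \<partial>lborel)" using icl phi2(1) by (simp add: m_def)
      finally show ?thesis using phi2(2)[of k] by linarith
    qed
    have avb: "(avg r x (\<phi> k))\<^sup>2 \<le> ((m + M\<^sup>2) / \<delta>)\<^sup>2" if "x \<in> closure \<Omega>" for x k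
    proof (rule abs_le_square_iff[THEN iffD1])
      have "\<bar>avg r x (\<phi> k)\<bar> \<le> (m + M\<^sup>2) / \<delta>"
        unfolding avg_def abs_divide using num[of x k] \<delta>(1) \<delta>'[OF that] by (intro frac_le) auto
      then show "\<bar>avg r x (\<phi> k)\<bar> \<le> \<bar>(m + M\<^sup>2) / \<delta>\<bar>" by linarith
    qed
    note [measurable] = avg_measurable[OF \<phi>b]
    have "(\<lambda>k. \<integral>\<^sup>+x. ?a r k x \<partial>lborel) \<longlonglongrightarrow> (\<integral>\<^sup>+x. 0 \<partial>(lborel::(real^'n) measure))"
    proof (rule nn_integral_dominated_convergence[where w = "\<lambda>x. ennreal (((m + M\<^sup>2) / \<delta>)\<^sup>2) * indicator (closure \<Omega>) x"])
      show "AE x in lborel. ?a r k x \<le> ennreal (((m + M\<^sup>2) / \<delta>)\<^sup>2) * indicator (closure \<Omega>) x" for k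
        using avb by (intro AE_I2) (auto simp: indicator_def intro: ennreal_leI)
      have "(\<integral>\<^sup>+x. ennreal (((m + M\<^sup>2) / \<delta>)\<^sup>2) * indicator (closure \<Omega>) x \<partial>lborel) = ennreal (((m + M\<^sup>2) / \<delta>)\<^sup>2) * emeasure lborel (closure \<Omega>)"
        by (simp add: nn_integral_cmult_indicator)
      also have "\<dots> < \<infinity>" using emeasure_compact_finite[OF compact_closure_\<Omega>] by (simp add: ennreal_mult_less_top)
      finally show "(\<integral>\<^sup>+x. ennreal (((m + M\<^sup>2) / \<delta>)\<^sup>2) * indicator (closure \<Omega>) x \<partial>lborel) < \<infinity>" .
      show "AE x in lborel. (\<lambda>k. ?a r k x) \<longlonglongrightarrow> 0"
      proof (rule AE_I2)
        fix x :: "real^'n"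
        show "(\<lambda>k. ?a r k x) \<longlonglongrightarrow> 0"
        proof (cases "x \<in> closure \<Omega>")
          case True
          have "(\<lambda>k. (avg r x (\<phi> k))\<^sup>2) \<longlonglongrightarrow> 0\<^sup>2" by (intro tendsto_power conv True r)
          then have "(\<lambda>k. ennreal ((avg r x (\<phi> k))\<^sup>2)) \<longlonglongrightarrow> ennreal 0" by (intro tendsto_ennrealI) simp
          then show ?thesis using True by simp
        qed simp
      qed
    qed measurable
    then show ?thesis by simp
  qed
  have main: "ennreal (?p k) \<le> 2 * ennreal (C * r\<^sup>2 * M\<^sup>2) + 2 * ?A r k"
    if r: "0 < r" "r \<le> R" for k r
  proof -
    note [measurable] = avg_measurable[OF \<phi>b]
    have "ennreal (?p k) = (\<integral>\<^sup>+x. ennreal ((\<phi> k x)\<^sup>2) \<partial>lborel)"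
      using nn_integral_fst_pr[OF \<phi>[of k]] by (simp add: nn_integral_completion)
    also have "\<dots> \<le> (\<integral>\<^sup>+x. 2 * (?g r k x) + 2 * (?a r k x) \<partial>lborel)"
    proof (rule nn_integral_mono)
      fix x
      show "ennreal ((\<phi> k x)\<^sup>2) \<le> 2 * (?g r k x) + 2 * (?a r k x)"
      proof (cases "x \<in> closure \<Omega>")
        case True
        then show ?thesis using ennreal_power2_add_le[of "\<phi> k x - avg r x (\<phi> k)" "avg r x (\<phi> k)"] by simp
      next
        case False
        then have "x \<notin> \<Omega>" using closure_subset by blast
        then show ?thesis using C1c_outside[OF \<phi>] by simp
      qed
    qed
    also have "\<dots> = 2 * (\<integral>\<^sup>+x. ?g r k x \<partial>lborel) + 2 * ?A r k"
      by (simp add: nn_integral_add nn_integral_cmult)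
    also have "\<dots> \<le> 2 * ennreal (C * r\<^sup>2 * M\<^sup>2) + 2 * ?A r k"
    proof (intro add_right_mono mult_left_mono)
      have "C * r\<^sup>2 * (norm (Psnd (pr (\<phi> k))))\<^sup>2 \<le> C * r\<^sup>2 * M\<^sup>2"
        using C order.trans[OF norm_Psnd M] by (intro mult_left_mono power_mono) auto
      from order.trans[OF est[OF r \<phi>] ennreal_leI[OF this]]
      show "(\<integral>\<^sup>+x. ?g r k x \<partial>lborel) \<le> ennreal (C * r\<^sup>2 * M\<^sup>2)" .
    qed simp
    finally show ?thesis .
  qed
  have sq: "(\<lambda>k. ?p k) \<longlonglongrightarrow> 0"
  proof (rule LIMSEQ_I)
    fix e :: real assume e: "0 < e"
    \<comment> \<open>Chosen so that C r^2 M^2 <= e/8; deviation and averages then contribute at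
      most e/4 each.\<close>
    define r where "r = min (min R R0) (sqrt (e / (8 * (C * M\<^sup>2 + 1))))"
    have pos: "0 < C * M\<^sup>2 + 1" using C by (simp add: add_nonneg_pos)
    have r: "0 < r" "r \<le> R" "r \<le> R0" using R R0 e pos by (auto simp: r_def)
    have "r\<^sup>2 \<le> (sqrt (e / (8 * (C * M\<^sup>2 + 1))))\<^sup>2" using r(1) by (intro power_mono) (auto simp: r_def)
    also have "\<dots> = e / (8 * (C * M\<^sup>2 + 1))" using e pos by simp
    finally have "r\<^sup>2 * (C * M\<^sup>2 + 1) \<le> e / 8" using pos by (simp add: field_simps)
    then have small: "C * r\<^sup>2 * M\<^sup>2 \<le> e / 8" using zero_le_power2[of r] by (simp only: algebra_simps)
    have "\<forall>\<^sub>F k in sequentially. ?A r k < ennreal (e / 8)"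
      using lim[OF r] e by (intro order_tendstoD(2)) auto
    then obtain N where N: "\<And>k. k \<ge> N ==> ?A r k < ennreal (e / 8)"
      unfolding eventually_sequentially by blast
    show "\<exists>no. \<forall>k\<ge>no. norm (?p k - 0) < e"
    proof (intro exI allI impI)
      fix k assume k: "N \<le> k"
      have "ennreal (?p k) \<le> 2 * ennreal (e / 8) + 2 * ennreal (e / 8)"
        using small by (intro order.trans[OF main[OF r(1,2)]] add_mono mult_left_mono ennreal_leI less_imp_le[OF N[OF k]]) auto
      also have "\<dots> = ennreal (e / 2)"
      proof -
        have "2 * ennreal (e / 8) = ennreal (e / 4)" using e ennreal_mult[of 2 "e / 8"] by simp
        then show ?thesis using e ennreal_plus[of "e / 4" "e / 4"] by simp
      qed
      finally have "?p k \<le> e / 2" using e by (simp add: ennreal_le_iff)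
      then show "norm (?p k - 0) < e" using e by simp
    qed
  qed
  have "(\<lambda>k. sqrt (?p k)) \<longlonglongrightarrow> sqrt 0" by (intro tendsto_real_sqrt sq)
  then show ?thesis by simp
qed

lemma V_approx:
  assumes "z \<in> V" "0 < e" obtains \<phi> where "\<phi> \<in> C1c \<Omega>" "norm (z - pr \<phi>) < e"
proof -
  have "\<exists>y\<in>pr ` C1c \<Omega>. dist y z < e" using assms unfolding V_def closure_approachable by blast
  then show thesis using that by (auto simp: dist_norm norm_minus_commute)
qed

lemma V_approx_seq:
  assumes "\<And>k. z k \<in> V" obtains \<phi> where "\<And>k. \<phi> k \<in> C1c \<Omega>" "\<And>k. norm (z k - pr (\<phi> k)) < 1 / real (Suc k)"
proof -
  have "\<exists>\<phi>. \<phi> \<in> C1c \<Omega> \<and> norm (z k - pr \<phi>) < 1 / real (Suc k)" for k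
  proof -
    have "0 < 1 / real (Suc k)" by simp
    from V_approx[OF assms this] show ?thesis by metis
  qed
  then show thesis using that by metis
qed

lemma inverse_Suc_tendsto_0: "(\<lambda>k. 1 / real (Suc k)) \<longlonglongrightarrow> 0"
  using LIMSEQ_inverse_real_of_nat by (simp add: inverse_eq_divide)

text \<open>Subtract the limit and approximate by C^1 functions with error 1/(k+1). The
  approximations still tend weakly to 0, so all their averages tend to 0.\<close>

lemma rellich:
  assumes z: "\<And>k. z k \<in> V" and w: "weakly_tendsto z l"
  shows "(\<lambda>k. Pfst (z k)) \<longlonglongrightarrow> Pfst l"
proof -
  interpret Pfst: bounded_linear Pfst by (rule bounded_linear_Pfst)
  have lV: "l \<in> V" by (rule weakly_tendsto_closed_subspace[OF subspace_V closed_V w z])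
  define y where "y k = z k - l" for k
  have yV: "y k \<in> V" for k unfolding y_def by (rule subspace_diff[OF subspace_V z lV])
  have y0: "(\<lambda>k. y k \<bullet> v) \<longlonglongrightarrow> 0" for v
    using tendsto_diff[OF weakly_tendstoD[OF w, of v] tendsto_const[of "l \<bullet> v"]] by (simp add: y_def inner_diff_left)
  obtain M where M: "\<And>k. norm (z k) \<le> M" using weakly_tendsto_bound[OF w] by blast
  have My: "norm (y k) \<le> M + norm l" for k using norm_triangle_ineq4[of "z k" l] M[of k] by (simp add: y_def)
  obtain \<phi> where \<phi>: "\<And>k. \<phi> k \<in> C1c \<Omega>" and close: "\<And>k. norm (y k - pr (\<phi> k)) < 1 / real (Suc k)"
    using V_approx_seq[of y, OF yV] by metis
  have close1: "norm (y k - pr (\<phi> k)) \<le> 1" for k using close[of k] order.strict_trans2[OF close[of k], of 1] by simp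
  have prM: "norm (pr (\<phi> k)) \<le> M + norm l + 1" for k
    using norm_triangle_ineq4[of "y k" "y k - pr (\<phi> k)"] My[of k] close1[of k] by simp
  have conv: "(\<lambda>k. pr (\<phi> k) \<bullet> v) \<longlonglongrightarrow> 0" for v
  proof -
    have "(\<lambda>k. (y k - pr (\<phi> k)) \<bullet> v) \<longlonglongrightarrow> 0"
    proof (rule Lim_null_comparison)
      show "\<forall>\<^sub>F k in sequentially. norm ((y k - pr (\<phi> k)) \<bullet> v) \<le> (1 / real (Suc k)) * norm v"
      proof (intro always_eventually allI)
        fix k
        have "norm ((y k - pr (\<phi> k)) \<bullet> v) \<le> norm (y k - pr (\<phi> k)) * norm v" by (simp add: Cauchy_Schwarz_ineq2)
        also have "\<dots> \<le> (1 / real (Suc k)) * norm v" using close[of k] by (intro mult_right_mono) auto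
        finally show "norm ((y k - pr (\<phi> k)) \<bullet> v) \<le> (1 / real (Suc k)) * norm v" .
      qed
      show "(\<lambda>k. (1 / real (Suc k)) * norm v) \<longlonglongrightarrow> 0" using tendsto_mult_left_zero[OF inverse_Suc_tendsto_0] .
    qed
    from tendsto_diff[OF y0[of v] this] show ?thesis by (simp add: inner_diff_left)
  qed
  obtain R where R: "0 < R" and bd: "\<And>x r. x \<in> closure \<Omega> ==> r \<le> R ==> bounded (B r x)"
    by (rule bounded_small_balls) (rule that)
  have av: "(\<lambda>k. avg r x (\<phi> k)) \<longlonglongrightarrow> 0" if x: "x \<in> closure \<Omega>" "0 < r" "r \<le> R" for x r
  proof -
    obtain v where "\<And>\<phi>. \<phi> \<in> C1c \<Omega> ==> avg r x \<phi> = pr \<phi> \<bullet> v" by (rule avg_as_inner[OF x(1) bd[OF x(1,3)]]) (rule that)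
    then have "avg r x (\<phi> k) = pr (\<phi> k) \<bullet> v" for k using \<phi> by blast
    then show ?thesis using conv[of v] by simp
  qed
  have "(\<lambda>k. Pfst (pr (\<phi> k))) \<longlonglongrightarrow> 0"
    by (rule tendsto_norm_zero_cancel, rule rellich_C1c[OF \<phi> prM R av])
  moreover have "(\<lambda>k. Pfst (y k - pr (\<phi> k))) \<longlonglongrightarrow> 0"
  proof (rule Lim_null_comparison[OF _ inverse_Suc_tendsto_0], intro always_eventually allI)
    fix k show "norm (Pfst (y k - pr (\<phi> k))) \<le> 1 / real (Suc k)"
      using norm_Pfst[of "y k - pr (\<phi> k)"] close[of k] by linarith
  qed
  ultimately have "(\<lambda>k. Pfst (pr (\<phi> k)) + Pfst (y k - pr (\<phi> k)) + Pfst l) \<longlonglongrightarrow> 0 + 0 + Pfst l"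
    by (intro tendsto_add tendsto_const)
  then show ?thesis by (simp add: Pfst.diff y_def)
qed


section \<open>Functions with vanishing gradient and the Poincare inequality\<close>

lemma fn_0H: "AE x in lebesgue. fn (0 :: ('n, 'm) l2_pair) x = 0"
  by (rule fn_0)

lemma V_outside:
  assumes z: "z \<in> V" shows "AE x in lebesgue. x \<notin> \<Omega> \<longrightarrow> fn z x = 0"
proof -
  define R :: "real^'n => real \<times> (real^'m) => real \<times> (real^'m)" where "R x p = indicator (- \<Omega>) x *\<^sub>R p" for x p
  have R: "ptw_bounded 1 R"
    unfolding ptw_bounded_def R_def[abs_def]
  proof (intro conjI allI ballI AE_I2)
    show "linear (\<lambda>p. indicator (- \<Omega>) x *\<^sub>R p)" for x :: "real^'n" by (rule linear_scaleR)
    show "norm (indicator (- \<Omega>) x *\<^sub>R p) \<le> 1 * norm p" for x :: "real^'n" and p :: "real \<times> (real^'m)"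
      by (simp add: indicator_def)
    have "- \<Omega> \<in> sets lebesgue" using open_\<Omega> by (metis borel_closed closed_Compl sets_completionI_sets sets_lborel)
    moreover fix f :: "real^'n => real \<times> (real^'m)" assume "f \<in> borel_measurable lebesgue"
    ultimately show "(\<lambda>x. indicator (- \<Omega>) x *\<^sub>R f x) \<in> borel_measurable lebesgue"
      by (intro borel_measurable_scaleR borel_measurable_indicator)
  qed
  have "ptw R z = 0"
  proof -
    have "closed (ptw R -` {0})"
      using linear_continuous_on[OF bounded_linear_ptw[OF R], of UNIV] by (intro closed_vimage) auto
    moreover have "pr ` C1c \<Omega> \<subseteq> ptw R -` {0}"
    proof
      fix a assume "a \<in> pr ` C1c \<Omega>"
      then obtain \<phi> where \<phi>: "\<phi> \<in> C1c \<Omega>" "a = pr \<phi>" by blast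
      obtain K where K: "K \<subseteq> \<Omega>" "\<And>x. x \<notin> K ==> \<phi> x = 0" "\<And>x. x \<notin> K ==> X_classical X \<phi> x = 0"
        using C1c_support[OF \<phi>(1)] by metis
      have "ptw R (pr \<phi>) = 0"
      proof (rule l2_eqI)
        show "AE x in lebesgue. fn (ptw R (pr \<phi>)) x = fn 0 x"
          using fn_ptw[OF R, of "pr \<phi>"] fn_pr[OF \<phi>(1)] fn_0H
        proof eventually_elim
          case (elim x)
          show ?case
          proof (cases "x \<in> \<Omega>")
            case True then show ?thesis using elim by (simp add: R_def prod_eq_iff)
          next
            case False
            then have "x \<notin> K" using K(1) by blast
            then show ?thesis using elim K(2,3)[of x] by (simp add: R_def prod_eq_iff)
          qed
        qed
      qed
      then show "a \<in> ptw R -` {0}" using \<phi>(2) by simp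
    qed
    ultimately have "V \<subseteq> ptw R -` {0}" unfolding V_def by (intro closure_minimal)
    then show ?thesis using z by blast
  qed
  have "AE x in lebesgue. R x (fn z x) = 0"
    using fn_ptw[OF R, of z] fn_0H unfolding \<open>ptw R z = 0\<close> by eventually_elim simp
  then show ?thesis by eventually_elim (auto simp: R_def)
qed

lemma AE_eq_contr_null:
  assumes "AE x in lebesgue. x \<in> U \<longrightarrow> False" "open (U :: (real^'n) set)" shows "U = {}"
proof (rule ccontr)
  assume "U \<noteq> {}"
  have "negligible {x. \<not> (x \<in> U \<longrightarrow> False)}" using assms(1) by (simp only: AE_lebesgue_iff_negligible)
  then have "negligible U" by simp
  then show False using open_not_negligible[OF assms(2) \<open>U \<noteq> {}\<close>] by blast
qed

text \<open>The C^1 approximations of \<open>z\<close> have gradients tending to 0, so by the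
  estimate with fixed centre their deviations from the ball averages tend to 0; the averages
  converge to the constant. The radius is the same for all centres.\<close>

lemma const_on_balls:
  assumes z: "z \<in> V" and z0: "Psnd z = 0"
  obtains r m where "0 < r" "\<And>x0. x0 \<in> closure \<Omega> ==> AE x in lebesgue. x \<in> B r x0 \<longrightarrow> fst (fn z x) = m x0"
proof -
  obtain K R C where K: "compact K" and R: "0 < R" and C: "0 \<le> C"
    and BK: "\<And>x r. x \<in> closure \<Omega> ==> r \<le> R ==> B r x \<subseteq> K"
    and "\<And>r \<phi>. 0 < r ==> r \<le> R ==> \<phi> \<in> C1c \<Omega> ==>
       (\<integral>\<^sup>+x. indicator (closure \<Omega>) x * ennreal ((\<phi> x - avg r x \<phi>)\<^sup>2) \<partial>lborel) \<le> ennreal (C * r\<^sup>2 * (norm (Psnd (pr \<phi>)))\<^sup>2)"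
    and est: "\<And>x0 r \<phi>. x0 \<in> closure \<Omega> ==> 0 < r ==> r \<le> R ==> \<phi> \<in> C1c \<Omega> ==>
       (\<integral>\<^sup>+x. indicator (B r x0) x * ennreal ((\<phi> x - avg r x0 \<phi>)\<^sup>2) \<partial>lborel) \<le> ennreal (C * r\<^sup>2 * (norm (Psnd (pr \<phi>)))\<^sup>2)"
    by (rule local_estimates) (rule that)
  obtain \<phi> where \<phi>: "\<And>k. \<phi> k \<in> C1c \<Omega>" and close: "\<And>k. norm (z - pr (\<phi> k)) < 1 / real (Suc k)"
    using V_approx_seq[of "\<lambda>_. z", OF z] by metis
  interpret Psnd: bounded_linear Psnd by (rule bounded_linear_Psnd)
  have nS: "norm (Psnd (pr (\<phi> k))) \<le> 1 / real (Suc k)" for k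
    using norm_Psnd[of "z - pr (\<phi> k)"] close[of k] by (simp add: Psnd.diff z0)
  have nF: "norm (Pfst (z - pr (\<phi> k))) \<le> 1 / real (Suc k)" for k
    using norm_Pfst[of "z - pr (\<phi> k)"] close[of k] by simp
  have conv: "(\<lambda>k. pr (\<phi> k)) \<longlonglongrightarrow> z"
  proof (rule Lim_null[THEN iffD2], rule Lim_null_comparison[OF _ inverse_Suc_tendsto_0], intro always_eventually allI)
    show "norm (pr (\<phi> k) - z) \<le> 1 / real (Suc k)" for k using close[of k] by (simp add: norm_minus_commute)
  qed
  have "\<exists>m. AE x in lebesgue. x \<in> B R x0 \<longrightarrow> fst (fn z x) = m" if x0: "x0 \<in> closure \<Omega>" for x0
  proof -
    have bd: "bounded (B R x0)" by (rule bounded_subset[OF compact_imp_bounded[OF K] BK[OF x0 order.refl]])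
    have Bb[measurable]: "B R x0 \<in> sets borel" using open_B[OF closure_in_\<Omega>0[OF x0]] by auto
    then have [measurable]: "B R x0 \<in> sets lebesgue" by auto
    obtain v where v: "\<And>\<phi>. \<phi> \<in> C1c \<Omega> ==> avg R x0 \<phi> = pr \<phi> \<bullet> v" by (rule avg_as_inner[OF x0 bd]) (rule that)
    define m where "m = z \<bullet> v"
    have am: "(\<lambda>k. (avg R x0 (\<phi> k) - m)\<^sup>2) \<longlonglongrightarrow> 0"
    proof -
      have "(\<lambda>k. (avg R x0 (\<phi> k) - m)\<^sup>2) \<longlonglongrightarrow> (m - m)\<^sup>2" unfolding v[OF \<phi>] m_def
        by (intro tendsto_power tendsto_diff tendsto_inner conv tendsto_const)
      then show ?thesis by simp
    qed
    have fz[measurable]: "(\<lambda>x. fst (fn z x)) \<in> borel_measurable lebesgue"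
      by (rule borel_measurable_continuous_on[OF _ measurable_fn]) (intro continuous_intros)
    have [measurable]: "\<phi> k \<in> borel_measurable lebesgue" for k using C1cD(3)[OF \<phi>] by (rule continuous_imp_lebesgue_measurable(2))
    let ?f = "\<lambda>k x. ennreal ((fst (fn z x) - \<phi> k x)\<^sup>2)"
      and ?g = "\<lambda>k x. indicator (B R x0) x * ennreal ((\<phi> k x - avg R x0 (\<phi> k))\<^sup>2)"
      and ?c = "\<lambda>k x. ennreal ((avg R x0 (\<phi> k) - m)\<^sup>2) * indicator (B R x0) x"
    let ?I = "\<integral>\<^sup>+x. indicator (B R x0) x * ennreal ((fst (fn z x) - m)\<^sup>2) \<partial>lebesgue"
    \<comment> \<open>The three errors are approximation, oscillation and convergence of the
      averages; 2, 4, 4 come from applying (a + b)^2 <= 2 a^2 + 2 b^2 twice.\<close>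
    define e where "e k = 2 * (1 / real (Suc k))\<^sup>2 + 4 * (C * R\<^sup>2 * (1 / real (Suc k))\<^sup>2) + 4 * ((avg R x0 (\<phi> k) - m)\<^sup>2 * measure lebesgue (B R x0))" for k
    have "?I \<le> ennreal (e k)" for k
    proof -
      have 1: "(\<integral>\<^sup>+x. ?f k x \<partial>lebesgue) \<le> ennreal ((1 / real (Suc k))\<^sup>2)"
      proof -
        have "(\<integral>\<^sup>+x. ?f k x \<partial>lebesgue) = (\<integral>\<^sup>+x. ennreal ((norm (fn (Pfst (z - pr (\<phi> k))) x))\<^sup>2) \<partial>lebesgue)"
        proof (rule nn_integral_cong_AE)
          show "AE x in lebesgue. ?f k x = ennreal ((norm (fn (Pfst (z - pr (\<phi> k))) x))\<^sup>2)"
            using fn_Pfst[of "z - pr (\<phi> k)"] fn_diff[of z "pr (\<phi> k)"] fn_pr[OF \<phi>[of k]]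
            by eventually_elim (simp add: norm_Pair)
        qed
        also have "\<dots> \<le> ennreal ((1 / real (Suc k))\<^sup>2)"
          unfolding nn_integral_power2_norm_l2 using nF[of k] by (intro ennreal_leI power_mono) auto
        finally show ?thesis .
      qed
      have 2: "(\<integral>\<^sup>+x. ?g k x \<partial>lebesgue) \<le> ennreal (C * R\<^sup>2 * (1 / real (Suc k))\<^sup>2)"
        unfolding nn_integral_completion using C nS[of k]
        by (intro order.trans[OF est[OF x0 R order.refl \<phi>]] ennreal_leI mult_left_mono power_mono) auto
      have 3: "(\<integral>\<^sup>+x. ?c k x \<partial>lebesgue) = ennreal ((avg R x0 (\<phi> k) - m)\<^sup>2 * measure lebesgue (B R x0))"
      proof -
        have "B R x0 \<in> lmeasurable" using bd by (intro bounded_set_imp_lmeasurable) auto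
        then have "emeasure lebesgue (B R x0) = ennreal (measure lebesgue (B R x0))" by (rule emeasure_eq_measure2)
        then show ?thesis by (simp add: nn_integral_cmult_indicator ennreal_mult)
      qed
      have "?I \<le> (\<integral>\<^sup>+x. (2 * ?f k x + 4 * (?g k x))
          + 4 * (?c k x) \<partial>lebesgue)"
      proof (rule nn_integral_mono)
        fix x
        show "indicator (B R x0) x * ennreal ((fst (fn z x) - m)\<^sup>2) \<le> (2 * ?f k x + 4 * (?g k x))
          + 4 * (?c k x)"
        proof (cases "x \<in> B R x0")
          case True
          let ?a = "fst (fn z x) - \<phi> k x" and ?b = "\<phi> k x - avg R x0 (\<phi> k)" and ?c = "avg R x0 (\<phi> k) - m"
          have "(?a + (?b + ?c))\<^sup>2 \<le> 2 * ?a\<^sup>2 + 4 * ?b\<^sup>2 + 4 * ?c\<^sup>2"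
            using power2_add_le[of ?a "?b + ?c"] power2_add_le[of ?b ?c] by linarith
          then have "ennreal ((fst (fn z x) - m)\<^sup>2) \<le> ennreal (2 * ?a\<^sup>2 + 4 * ?b\<^sup>2 + 4 * ?c\<^sup>2)" by (intro ennreal_leI) simp
          also have "\<dots> = 2 * ennreal (?a\<^sup>2) + 4 * ennreal (?b\<^sup>2) + 4 * ennreal (?c\<^sup>2)"
            by (simp add: ennreal_plus ennreal_mult)
          finally show ?thesis using True by simp
        qed simp
      qed
      also have "\<dots> = 2 * (\<integral>\<^sup>+x. ?f k x \<partial>lebesgue) + 4 * (\<integral>\<^sup>+x. ?g k x \<partial>lebesgue)
          + 4 * (\<integral>\<^sup>+x. ?c k x \<partial>lebesgue)"
      proof -
        have [measurable]: "(\<lambda>x. ?f k x) \<in> borel_measurable lebesgue"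
          "(\<lambda>x. ?g k x) \<in> borel_measurable lebesgue"
          "(\<lambda>x. ?c k x) \<in> borel_measurable lebesgue" by measurable
        show ?thesis by (simp add: nn_integral_add nn_integral_cmult del: nn_integral_completion)
      qed
      also have "\<dots> \<le> 2 * ennreal ((1 / real (Suc k))\<^sup>2) + 4 * ennreal (C * R\<^sup>2 * (1 / real (Suc k))\<^sup>2) + 4 * ennreal ((avg R x0 (\<phi> k) - m)\<^sup>2 * measure lebesgue (B R x0))"
        unfolding 3 by (intro add_mono mult_left_mono 1 2 order.refl) auto
      also have "\<dots> = ennreal (e k)"
        unfolding e_def using C by (simp add: ennreal_plus ennreal_mult)
      finally show ?thesis .
    qed
    moreover have "(\<lambda>k. ennreal (e k)) \<longlonglongrightarrow> ennreal 0"
    proof (rule tendsto_ennrealI)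
      have "e \<longlonglongrightarrow> 2 * 0\<^sup>2 + 4 * (C * R\<^sup>2 * 0\<^sup>2) + 4 * (0 * measure lebesgue (B R x0))"
        unfolding e_def by (intro tendsto_intros inverse_Suc_tendsto_0 am)
      then show "e \<longlonglongrightarrow> 0" by simp
    qed
    ultimately have "?I \<le> ennreal 0" by (intro LIMSEQ_le_const) auto
    then have "?I = 0" by simp
    then have "AE x in lebesgue. indicator (B R x0) x * ennreal ((fst (fn z x) - m)\<^sup>2) = 0"
      by (subst (asm) nn_integral_0_iff_AE) measurable
    then have "AE x in lebesgue. x \<in> B R x0 \<longrightarrow> fst (fn z x) = m" by eventually_elim auto
    then show ?thesis by blast
  qed
  then have "\<forall>x0\<in>closure \<Omega>. \<exists>m. AE x in lebesgue. x \<in> B R x0 \<longrightarrow> fst (fn z x) = m" by (rule ballI)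
  from bchoice[OF this] obtain m where m: "\<forall>x0\<in>closure \<Omega>. AE x in lebesgue. x \<in> B R x0 \<longrightarrow> fst (fn z x) = m x0" ..
  show thesis by (rule that[OF R]) (rule m[THEN bspec])
qed

text \<open>The union \<open>W\<close> of the balls with nonzero constant is open, and it is closed
  because the radius is uniform. It is contained in the bounded closure of \<open>\<Omega>\<close>,
  as \<open>z\<close> vanishes outside, so connectedness of the whole space makes it empty.
  Connectedness of \<open>\<Omega>\<close> does not enter.\<close>

lemma kernel_Psnd:
  assumes z: "z \<in> V" and z0: "Psnd z = 0"
  shows "z = 0"
proof -
  obtain r m where r: "0 < r" and m: "\<And>x0. x0 \<in> closure \<Omega> ==> AE x in lebesgue. x \<in> B r x0 \<longrightarrow> fst (fn z x) = m x0"
    by (rule const_on_balls[OF z z0]) (rule that)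
  have opB: "open (B r x)" if "x \<in> closure \<Omega>" for x by (rule open_B[OF closure_in_\<Omega>0[OF that]])
  have cB: "x \<in> B r x" if "x \<in> closure \<Omega>" for x by (rule center_B[OF closure_in_\<Omega>0[OF that] r])
  have eq: "m x = m y" if x: "x \<in> closure \<Omega>" and y: "y \<in> closure \<Omega>" and ne: "B r x \<inter> B r y \<noteq> {}" for x y
  proof (rule ccontr)
    assume ne': "m x \<noteq> m y"
    have "AE t in lebesgue. t \<in> B r x \<inter> B r y \<longrightarrow> False" using m[OF x] m[OF y] by eventually_elim (use ne' in auto)
    from AE_eq_contr_null[OF this open_Int[OF opB[OF x] opB[OF y]]] ne show False by blast
  qed
  define W where "W = (\<Union>x\<in>{x\<in>closure \<Omega>. m x \<noteq> 0}. B r x)"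
  have "open W" unfolding W_def using opB by blast
  have W\<Omega>: "W \<subseteq> closure \<Omega>"
  proof -
    have "B r x - closure \<Omega> = {}" if x: "x \<in> closure \<Omega>" "m x \<noteq> 0" for x
    proof (rule AE_eq_contr_null)
      show "AE t in lebesgue. t \<in> B r x - closure \<Omega> \<longrightarrow> False"
        using m[OF x(1)] V_outside[OF z]
      proof eventually_elim
        case (elim t)
        then show ?case using x(2) closure_subset[of \<Omega>] by auto
      qed
      show "open (B r x - closure \<Omega>)" using opB[OF x(1)] by (intro open_Diff) auto
    qed
    then show ?thesis unfolding W_def by blast
  qed
  \<comment> \<open>A limit point carries its own ball of the common radius, which meets one of the
    balls of \<open>W\<close>; overlapping balls share their constant.\<close>
  have "closure W \<subseteq> W"
  proof
    fix y assume y: "y \<in> closure W"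
    have yO: "y \<in> closure \<Omega>" using y closure_mono[OF W\<Omega>] by auto
    have "B r y \<inter> W \<noteq> {}"
      using open_Int_closure_eq_empty[OF opB[OF yO], of W] cB[OF yO] y by blast
    then obtain x where x: "x \<in> closure \<Omega>" "m x \<noteq> 0" "B r x \<inter> B r y \<noteq> {}" unfolding W_def by blast
    have "m y \<noteq> 0" using eq[OF x(1) yO x(3)] x(2) by simp
    then show "y \<in> W" unfolding W_def using yO cB[OF yO] by blast
  qed
  then have "closed W" using closure_subset_eq by blast
  then have "W = {} \<or> W = UNIV" using \<open>open W\<close> clopen by blast
  moreover have "W \<noteq> UNIV"
    using bounded_subset[OF compact_imp_bounded[OF compact_closure_\<Omega>] W\<Omega>] not_bounded_UNIV by metis
  ultimately have "W = {}" by blast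
  then have m0: "m x = 0" if "x \<in> closure \<Omega>" for x using cB[OF that] that unfolding W_def by blast
  obtain D where D: "D \<subseteq> closure \<Omega>" "finite D" "closure \<Omega> \<subseteq> (\<Union>x\<in>D. B r x)"
  proof (rule compactE_image[OF compact_closure_\<Omega>, of "closure \<Omega>" "B r"])
    show "closure \<Omega> \<subseteq> (\<Union>x\<in>closure \<Omega>. B r x)" using cB by blast
  qed (use opB in auto)
  have "AE x in lebesgue. \<forall>x0\<in>D. x \<in> B r x0 \<longrightarrow> fst (fn z x) = m x0"
    using D(1,2) m by (intro AE_finite_allI) blast+
  then have f0: "AE x in lebesgue. fst (fn z x) = 0"
    using V_outside[OF z]
  proof eventually_elim
    case (elim x)
    show ?case
    proof (cases "x \<in> \<Omega>")
      case True
      then obtain x0 where x0: "x0 \<in> D" "x \<in> B r x0" using D(3) closure_subset by blast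
      then have "fst (fn z x) = m x0" using elim(1) by blast
      then show ?thesis using m0 x0(1) D(1) by auto
    next
      case False
      then show ?thesis using elim(2) by simp
    qed
  qed
  have "Pfst z = 0"
  proof (rule l2_eqI)
    show "AE x in lebesgue. fn (Pfst z) x = fn 0 x" using f0 fn_Pfst[of z] fn_0H
      by eventually_elim (simp add: prod_eq_iff)
  qed
  then show ?thesis using Pfst_add_Psnd[of z] z0 by simp
qed

text \<open>A normalised sequence with gradients tending to 0 has a weak limit with zero gradient,
  hence limit 0. By Rellich the function components then tend to 0 strongly, and so do the pairs,
  against the normalisation.\<close>

lemma poincare:
  obtains C where "0 < C" "\<And>z. z \<in> V ==> norm z \<le> C * norm (Psnd z)"
proof (rule ccontr)
  assume no: "\<not> thesis"
  interpret Psnd: bounded_linear Psnd by (rule bounded_linear_Psnd)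
  have "\<exists>z. z \<in> V \<and> norm z = 1 \<and> norm (Psnd z) \<le> 1 / real (Suc k)" for k
  proof -
    have "\<not> (\<forall>z\<in>V. norm z \<le> real (Suc k) * norm (Psnd z))"
    proof
      assume "\<forall>z\<in>V. norm z \<le> real (Suc k) * norm (Psnd z)"
      then show False using no that[of "real (Suc k)"] by auto
    qed
    then obtain z where z: "z \<in> V" "real (Suc k) * norm (Psnd z) < norm z" by (auto simp: not_le)
    have "0 \<le> real (Suc k) * norm (Psnd z)" by simp
    then have nz: "0 < norm z" using z(2) by linarith
    show ?thesis
    proof (intro exI conjI)
      show "(1 / norm z) *\<^sub>R z \<in> V" by (rule subspace_scale[OF subspace_V z(1)])
      show "norm ((1 / norm z) *\<^sub>R z) = 1" using nz by simp
      show "norm (Psnd ((1 / norm z) *\<^sub>R z)) \<le> 1 / real (Suc k)"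
        using z(2) nz unfolding Psnd.scaleR by (simp add: field_simps del: of_nat_Suc)
    qed
  qed
  then obtain z where z: "\<And>k. z k \<in> V" "\<And>k. norm (z k) = 1" "\<And>k. norm (Psnd (z k)) \<le> 1 / real (Suc k)" by metis
  obtain s l where s: "strict_mono s" and w: "weakly_tendsto (\<lambda>h. z (s h)) l"
    using weak_compactness[of z 1] z(2) by (metis order.refl)
  have P0: "(\<lambda>k. Psnd (z k)) \<longlonglongrightarrow> 0"
    by (rule Lim_null_comparison[OF _ inverse_Suc_tendsto_0]) (simp add: z(3) del: of_nat_Suc)
  have P0s: "(\<lambda>h. Psnd (z (s h))) \<longlonglongrightarrow> 0"
    using LIMSEQ_subseq_LIMSEQ[OF P0 s] by (simp add: o_def)
  have lV: "l \<in> V" by (rule weakly_tendsto_closed_subspace[OF subspace_V closed_V w z(1)])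
  have "Psnd l \<bullet> v = 0" for v
  proof (rule LIMSEQ_unique)
    show "(\<lambda>h. Psnd (z (s h)) \<bullet> v) \<longlonglongrightarrow> Psnd l \<bullet> v"
      by (rule weakly_tendstoD[OF weakly_tendsto_bounded_linear[OF bounded_linear_Psnd w]])
    show "(\<lambda>h. Psnd (z (s h)) \<bullet> v) \<longlonglongrightarrow> 0" using tendsto_inner[OF P0s tendsto_const[of v]] by simp
  qed
  then have "Psnd l = 0" using inner_eq_zero_iff by blast
  then have l0: "l = 0" by (rule kernel_Psnd[OF lV])
  have "(\<lambda>h. Pfst (z (s h))) \<longlonglongrightarrow> Pfst l" by (rule rellich[OF z(1) w])
  moreover have "Pfst l = 0" unfolding l0 by (rule linear_0[OF bounded_linear.linear[OF bounded_linear_Pfst]])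
  ultimately have "(\<lambda>h. Pfst (z (s h)) + Psnd (z (s h))) \<longlonglongrightarrow> 0" using P0s tendsto_add by fastforce
  then have "(\<lambda>h. norm (z (s h))) \<longlonglongrightarrow> 0" using tendsto_norm_zero by (simp add: Pfst_add_Psnd)
  then show False by (simp add: z(2) LIMSEQ_const_iff)
qed

end

section \<open>Sobolev functions\<close>

lemma AE_lebesgue_on_iff:
  "S \<in> sets lebesgue ==> (AE x in lebesgue_on S. P x) \<longleftrightarrow> (AE x in lebesgue. x \<in> S \<longrightarrow> P x)"
  by (simp add: AE_restrict_space_iff)

lemma measurable_lebesgue_cong_AE:
  fixes f g :: "'a::euclidean_space => 'b::euclidean_space"
  assumes f: "f \<in> borel_measurable lebesgue" and eq: "AE x in lebesgue. f x = g x"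
  shows "g \<in> borel_measurable lebesgue"
proof (rule measurableI)
  fix A :: "'b set" assume A: "A \<in> sets borel"
  have N: "negligible {x. f x \<noteq> g x}" using eq by (simp add: AE_lebesgue_iff_negligible)
  have fA: "f -` A \<in> sets lebesgue" using measurable_sets[OF f A] by simp
  have gA: "g -` A = (f -` A - {x. f x \<noteq> g x}) \<union> (g -` A \<inter> {x. f x \<noteq> g x})" by auto
  have "negligible (g -` A \<inter> {x. f x \<noteq> g x})" by (rule negligible_subset[OF N]) auto
  then have "(f -` A - {x. f x \<noteq> g x}) \<union> (g -` A \<inter> {x. f x \<noteq> g x}) \<in> sets lebesgue"
    by (intro sets.Un sets.Diff fA negligible_imp_sets N)
  then have "g -` A \<in> sets lebesgue" by (simp only: gA[symmetric])
  then show "g -` A \<inter> space lebesgue \<in> sets lebesgue" by simp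
qed simp

lemma L2_iff_sq_int:
  fixes f :: "real^'n => 'b::euclidean_space"
  assumes S: "S \<in> sets lebesgue"
  shows "f \<in> L2 S \<longleftrightarrow> sq_int (\<lambda>x. indicator S x *\<^sub>R f x)"
proof -
  have "(\<lambda>x. (norm (indicator S x *\<^sub>R f x))\<^sup>2) = (\<lambda>x. indicator S x *\<^sub>R (norm (f x))\<^sup>2)" by (auto simp: indicator_def)
  then show ?thesis using S
    by (simp add: L2_def sq_int_def borel_measurable_restrict_space_iff integrable_restrict_space)
qed

lemma sq_int_linear_image:
  fixes T :: "'b::euclidean_space => 'c::euclidean_space"
  assumes "sq_int f" "bounded_linear T" shows "sq_int (\<lambda>x. T (f x))"
proof -
  obtain K where K: "\<And>y. norm (T y) \<le> norm y * K" using bounded_linear.bounded[OF assms(2)] by blast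
  show ?thesis
  proof (rule sq_int_bound[OF assms(1), of _ K])
    show "(\<lambda>x. T (f x)) \<in> borel_measurable lebesgue"
      by (rule borel_measurable_continuous_on[OF linear_continuous_on[OF assms(2)] sq_intD(1)[OF assms(1)]])
  qed (use K in \<open>auto simp: mult.commute\<close>)
qed

lemma sq_int_Pair:
  assumes "sq_int f" "sq_int g" shows "sq_int (\<lambda>x. (f x, g x))"
proof -
  have "sq_int (\<lambda>x. (f x, 0) + (0, g x))"
    by (intro sq_int_add sq_int_linear_image[OF assms(1), of "\<lambda>y. (y, 0)"] sq_int_linear_image[OF assms(2), of "\<lambda>y. (0, y)"]
        bounded_linear_Pair bounded_linear_ident bounded_linear_zero)
  then show ?thesis by simp
qed

lemma sq_int_sum: "finite I ==> (\<And>i. i \<in> I ==> sq_int (f i)) ==> sq_int (\<lambda>x. \<Sum>i\<in>I. f i x)"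
proof (induction I rule: finite_induct)
  case (insert i I)
  then show ?case using sq_int_add[of "f i" "\<lambda>x. \<Sum>i\<in>I. f i x"] by simp
qed simp

lemma sq_int_vec:
  fixes f :: "'i::finite => 'a::euclidean_space => real"
  assumes "\<And>i. sq_int (f i)" shows "sq_int (\<lambda>x. \<chi> i. f i x)"
proof -
  have "sq_int (\<lambda>x. \<Sum>i\<in>UNIV. f i x *\<^sub>R axis i (1::real))"
    by (intro sq_int_sum sq_int_linear_image[OF assms] bounded_linear_scaleR_left) simp
  moreover have "(\<lambda>x. \<Sum>i\<in>UNIV. f i x *\<^sub>R axis i (1::real)) = (\<lambda>x. \<chi> i. f i x)"
    by (rule ext) (simp add: vec_eq_iff axis_def if_distrib sum.delta' cong: if_cong)
  ultimately show ?thesis by simp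
qed

lemma sq_int_indicator_compact:
  fixes K :: "'a::euclidean_space set"
  assumes "compact K" shows "sq_int (indicat_real K)"
proof -
  have "K \<in> lmeasurable" by (rule lmeasurable_compact[OF assms])
  moreover have "(\<lambda>x. (norm (indicat_real K x))\<^sup>2) = indicat_real K" by (auto simp: indicator_def)
  ultimately show ?thesis by (simp add: sq_int_def lmeasurable_iff_integrable fmeasurableD)
qed

lemma integrable_locally_times_C1c:
  fixes v :: "real^'n => real"
  assumes v: "\<And>K. compact K ==> K \<subseteq> S ==> integrable (lebesgue_on K) v" and \<psi>: "\<psi> \<in> C1c S" and S: "S \<in> sets lebesgue"
  shows "integrable (lebesgue_on S) (\<lambda>x. v x * \<psi> x)"
proof -
  obtain K where K: "compact K" "K \<subseteq> S" "\<forall>x. x \<notin> K \<longrightarrow> \<psi> x = 0 \<and> (\<forall>i. partial i \<psi> x = 0)" using C1cD(4)[OF \<psi>] by blast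
  obtain L b where b: "L-lipschitz_on UNIV \<psi>" "\<And>x. \<bar>\<psi> x\<bar> \<le> b" using C1c_bounded_lipschitz[OF \<psi>] by metis
  have Kl: "K \<in> sets lebesgue" using K(1) by (intro fmeasurableD lmeasurable_compact)
  have "integrable lebesgue (\<lambda>x. indicator K x *\<^sub>R v x)"
    using v[OF K(1,2)] Kl by (simp add: integrable_restrict_space)
  then have dom: "integrable lebesgue (\<lambda>x. b * (indicator K x *\<^sub>R v x))" by (rule integrable_mult_right)
  have "integrable lebesgue (\<lambda>x. \<psi> x * (indicator K x *\<^sub>R v x))"
  proof (rule Bochner_Integration.integrable_bound[OF dom])
    show "(\<lambda>x. \<psi> x * (indicator K x *\<^sub>R v x)) \<in> borel_measurable lebesgue"
      by (intro borel_measurable_times continuous_imp_lebesgue_measurable(2)[OF C1cD(3)[OF \<psi>]] borel_measurable_integrable)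
        (use v[OF K(1,2)] Kl in \<open>simp add: integrable_restrict_space\<close>)
    show "AE x in lebesgue. norm (\<psi> x * (indicator K x *\<^sub>R v x)) \<le> norm (b * (indicator K x *\<^sub>R v x))"
    proof (rule AE_I2)
      fix x
      have "\<bar>\<psi> x\<bar> \<le> \<bar>b\<bar>" using b(2)[of x] by linarith
      then show "norm (\<psi> x * (indicator K x *\<^sub>R v x)) \<le> norm (b * (indicator K x *\<^sub>R v x))"
        using mult_right_mono[of "\<bar>\<psi> x\<bar>" "\<bar>b\<bar>" "\<bar>indicator K x *\<^sub>R v x\<bar>"] by (simp add: abs_mult)
    qed
  qed
  moreover have "(\<lambda>x. \<psi> x * (indicator K x *\<^sub>R v x)) = (\<lambda>x. indicator S x *\<^sub>R (v x * \<psi> x))"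
  proof
    show "\<psi> x * (indicator K x *\<^sub>R v x) = indicator S x *\<^sub>R (v x * \<psi> x)" for x
      using K(2,3) by (cases "x \<in> K") (auto simp: indicator_def)
  qed
  ultimately show ?thesis using S by (simp add: integrable_restrict_space)
qed

text \<open>\<open>Xgrad\<close> selects a representative by choice; this makes the selection
  irrelevant up to null sets.\<close>

lemma is_X_deriv_unique:
  fixes S :: "(real^'n) set"
  assumes S: "open S" and v: "is_X_deriv X S j u v" and w: "is_X_deriv X S j u w"
  shows "AE x in lebesgue_on S. v x = w x"
proof -
  have Sl: "S \<in> sets lebesgue" using S by auto
  have li: "integrable (lebesgue_on K) v" "integrable (lebesgue_on K) w" if "compact K" "K \<subseteq> S" for K
    using v w that by (auto simp: is_X_deriv_def)
  have "AE x in lebesgue_on S. v x - w x = 0"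
  proof (rule test_functions_zero_imp_AE[OF S])
    show "integrable (lebesgue_on K) (\<lambda>x. v x - w x)" if "compact K" "K \<subseteq> S" for K
      using li[OF that] by (rule Bochner_Integration.integrable_diff)
    fix \<psi> assume \<psi>: "\<psi> \<in> test_functions S"
    then have C: "\<psi> \<in> C1c S" using test_functions_subset_C1c by blast
    have "(\<integral>x. (v x - w x) * \<psi> x \<partial>lebesgue_on S) = (\<integral>x. v x * \<psi> x \<partial>lebesgue_on S) - (\<integral>x. w x * \<psi> x \<partial>lebesgue_on S)"
      unfolding left_diff_distrib
      by (rule Bochner_Integration.integral_diff; rule integrable_locally_times_C1c[OF _ C Sl]; rule li)
    then show "(\<integral>x. (v x - w x) * \<psi> x \<partial>lebesgue_on S) = 0" using v w \<psi> by (simp add: is_X_deriv_def)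
  qed
  then show ?thesis by simp
qed

context cc_space
begin

section \<open>Weak derivatives on the domain\<close>

lemma \<Omega>_sets [measurable]: "\<Omega> \<in> sets lebesgue" using open_\<Omega> by auto

lemma is_X_deriv_C1c': "\<phi> \<in> C1c \<Omega> ==> is_X_deriv X \<Omega> j \<phi> (\<lambda>x. X_classical X \<phi> x $ j)"
proof -
  assume \<phi>: "\<phi> \<in> C1c \<Omega>"
  obtain M where M: "M-lipschitz_on \<Omega>0 (X j)" using X_lipschitz by blast
  have "\<Omega> \<subseteq> \<Omega>0" using closure_\<Omega> closure_subset[of \<Omega>] by (rule order.trans[rotated])
  from is_X_deriv_C1c[where S = \<Omega> and X = X and j = j, OF M this \<Omega>_sets \<phi>] show ?thesis .
qed

text \<open>This makes the right-hand side of \<open>is_X_deriv\<close> an honest integral for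
  square integrable \<open>u\<close>, so that weak derivatives can be subtracted.\<close>

lemma sq_int_partial_coeff:
  assumes \<psi>: "\<psi> \<in> C1c \<Omega>"
  shows "sq_int (\<lambda>x. \<Sum>i\<in>UNIV. partial i (\<lambda>y. X j y $ i * \<psi> y) x)"
proof (rule sq_int_sum)
  fix i :: 'n
  obtain M where M: "M-lipschitz_on \<Omega>0 (X j)" using X_lipschitz by blast
  have "M-lipschitz_on \<Omega>0 (\<lambda>y. X j y $ i)"
  proof (rule lipschitz_onI)
    show "dist (X j x $ i) (X j y $ i) \<le> M * dist x y" if "x \<in> \<Omega>0" "y \<in> \<Omega>0" for x y
      using lipschitz_onD[OF M that] dist_vec_nth_le[of "X j x" i "X j y"] by linarith
  qed (rule lipschitz_on_nonneg[OF M])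
  have sub: "\<Omega> \<subseteq> \<Omega>0" using closure_\<Omega> closure_subset[of \<Omega>] by (rule order.trans[rotated])
  obtain L where L: "L-lipschitz_on UNIV (\<lambda>y. X j y $ i * \<psi> y)"
    using lipschitz_mult_test_function[OF \<open>M-lipschitz_on \<Omega>0 (\<lambda>y. X j y $ i)\<close> \<psi> sub] by metis
  obtain K where K: "compact K" "\<forall>x. x \<notin> K \<longrightarrow> \<psi> x = 0 \<and> (\<forall>i. partial i \<psi> x = 0)" using C1cD(4)[OF \<psi>] by blast
  show "sq_int (partial i (\<lambda>y. X j y $ i * \<psi> y))"
  proof (rule sq_int_bound[OF sq_int_indicator_compact[OF K(1)], of _ L])
    show "partial i (\<lambda>y. X j y $ i * \<psi> y) \<in> borel_measurable lebesgue" by (rule borel_measurable_partial_lipschitz[OF L])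
    show "AE x in lebesgue. norm (partial i (\<lambda>y. X j y $ i * \<psi> y) x) \<le> L * norm (indicat_real K x)"
      using partial_lipschitz_bound[OF L, of i]
    proof eventually_elim
      case (elim x)
      show ?case
      proof (cases "x \<in> K")
        case False
        have "partial i (\<lambda>y. X j y $ i * \<psi> y) x = 0"
          by (rule partial_zero_outside[OF compact_imp_closed[OF K(1)] _ False]) (use K(2) in simp)
        then show ?thesis using False by simp
      qed (use elim in simp)
    qed
  qed
qed simp

lemma is_X_deriv_diff:
  assumes u: "u \<in> L2 \<Omega>" "u' \<in> L2 \<Omega>" and v: "is_X_deriv X \<Omega> j u v" "is_X_deriv X \<Omega> j u' v'"
  shows "is_X_deriv X \<Omega> j (\<lambda>x. u x - u' x) (\<lambda>x. v x - v' x)"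
  unfolding is_X_deriv_def
proof (intro conjI allI ballI impI)
  show "integrable (lebesgue_on K) (\<lambda>x. v x - v' x)" if "compact K \<and> K \<subseteq> \<Omega>" for K
    using v that by (auto simp: is_X_deriv_def)
  fix \<psi> assume \<psi>: "\<psi> \<in> test_functions \<Omega>"
  then have C: "\<psi> \<in> C1c \<Omega>" using test_functions_subset_C1c by blast
  let ?d = "\<lambda>x. \<Sum>i\<in>UNIV. partial i (\<lambda>y. X j y $ i * \<psi> y) x"
  have int: "integrable (lebesgue_on \<Omega>) (\<lambda>x. u x * ?d x)" if "u \<in> L2 \<Omega>" for u
  proof -
    have "integrable lebesgue (\<lambda>x. (indicator \<Omega> x *\<^sub>R u x) \<bullet> ?d x)"
      using that sq_int_partial_coeff[OF C] by (intro integrable_inner_sq_int) (simp_all add: L2_iff_sq_int)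
    then show ?thesis by (simp add: integrable_restrict_space mult.assoc)
  qed
  have li: "integrable (lebesgue_on K) v" "integrable (lebesgue_on K) v'" if "compact K" "K \<subseteq> \<Omega>" for K
    using v that by (auto simp: is_X_deriv_def)
  have "(\<integral>x. (v x - v' x) * \<psi> x \<partial>lebesgue_on \<Omega>) = (\<integral>x. v x * \<psi> x \<partial>lebesgue_on \<Omega>) - (\<integral>x. v' x * \<psi> x \<partial>lebesgue_on \<Omega>)"
    unfolding left_diff_distrib
    by (rule Bochner_Integration.integral_diff; rule integrable_locally_times_C1c[OF _ C \<Omega>_sets]; rule li)
  also have "\<dots> = - ((\<integral>x. u x * ?d x \<partial>lebesgue_on \<Omega>) - (\<integral>x. u' x * ?d x \<partial>lebesgue_on \<Omega>))"
    using v \<psi> by (simp add: is_X_deriv_def)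
  also have "\<dots> = - (\<integral>x. (u x - u' x) * ?d x \<partial>lebesgue_on \<Omega>)"
    unfolding left_diff_distrib by (subst Bochner_Integration.integral_diff[OF int[OF u(1)] int[OF u(2)]]) simp
  finally show "(\<integral>x. (v x - v' x) * \<psi> x \<partial>lebesgue_on \<Omega>) = - (\<integral>x. (u x - u' x) * ?d x \<partial>lebesgue_on \<Omega>)" .
qed

lemma Xgrad_eqI:
  assumes "\<And>j. is_X_deriv X \<Omega> j u (\<lambda>x. F x $ j)"
  shows "AE x in lebesgue. x \<in> \<Omega> \<longrightarrow> Xgrad X \<Omega> u x = F x"
proof -
  have "AE x in lebesgue. x \<in> \<Omega> \<longrightarrow> Xgrad X \<Omega> u x $ j = F x $ j" for j
  proof -
    have "is_X_deriv X \<Omega> j u (SOME v. is_X_deriv X \<Omega> j u v)" by (rule someI[where P = "is_X_deriv X \<Omega> j u", OF assms])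
    from is_X_deriv_unique[OF open_\<Omega> this assms[of j]] show ?thesis
      by (simp add: AE_lebesgue_on_iff Xgrad_def)
  qed
  then have "AE x in lebesgue. \<forall>j\<in>UNIV. x \<in> \<Omega> \<longrightarrow> Xgrad X \<Omega> u x $ j = F x $ j" by (intro AE_finite_allI) auto
  then show ?thesis by eventually_elim (simp add: vec_eq_iff)
qed

lemma W12_Xgrad:
  assumes u: "u \<in> W12 X \<Omega>"
  shows "is_X_deriv X \<Omega> j u (\<lambda>x. Xgrad X \<Omega> u x $ j)"
    and "sq_int (\<lambda>x. indicator \<Omega> x *\<^sub>R Xgrad X \<Omega> u x)"
proof -
  have "\<forall>j. \<exists>v. v \<in> L2 \<Omega> \<and> is_X_deriv X \<Omega> j u v" using u by (auto simp: W12_def)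
  from choice[OF this] obtain v where v: "\<And>j. v j \<in> L2 \<Omega>" "\<And>j. is_X_deriv X \<Omega> j u (v j)" by blast
  have "is_X_deriv X \<Omega> j u (SOME v. is_X_deriv X \<Omega> j u v)" for j by (rule someI[where P = "is_X_deriv X \<Omega> j u", OF v(2)])
  then show "is_X_deriv X \<Omega> j u (\<lambda>x. Xgrad X \<Omega> u x $ j)" by (simp add: Xgrad_def)
  have sq: "sq_int (\<lambda>x. \<chi> j. indicator \<Omega> x *\<^sub>R v j x)"
    by (rule sq_int_vec) (use v(1) in \<open>simp only: L2_iff_sq_int[OF \<Omega>_sets]\<close>)
  have "AE x in lebesgue. x \<in> \<Omega> \<longrightarrow> Xgrad X \<Omega> u x = (\<chi> j. v j x)" by (rule Xgrad_eqI) (use v(2) in simp)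
  then have eq: "AE x in lebesgue. (\<chi> j. indicator \<Omega> x *\<^sub>R v j x) = indicator \<Omega> x *\<^sub>R Xgrad X \<Omega> u x"
    by eventually_elim (simp add: vec_eq_iff indicator_def)
  show "sq_int (\<lambda>x. indicator \<Omega> x *\<^sub>R Xgrad X \<Omega> u x)"
    by (rule sq_int_cong_AE[OF sq eq measurable_lebesgue_cong_AE[OF sq_intD(1)[OF sq] eq]])
qed

section \<open>Sobolev functions as elements of the Hilbert space\<close>

definition emb :: "(real^'n => real) => ('n, 'm) l2_pair" where
  "emb u = l2_of (\<lambda>x. indicator \<Omega> x *\<^sub>R (u x, Xgrad X \<Omega> u x))"

lemma sq_int_emb:
  assumes u: "u \<in> W12 X \<Omega>" shows "sq_int (\<lambda>x. indicator \<Omega> x *\<^sub>R (u x, Xgrad X \<Omega> u x))"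
proof -
  have "sq_int (\<lambda>x. indicator \<Omega> x *\<^sub>R u x)" using u by (simp only: L2_iff_sq_int[OF \<Omega>_sets, symmetric] W12_def mem_Collect_eq)
  from sq_int_Pair[OF this W12_Xgrad(2)[OF u]] show ?thesis by (simp add: scaleR_Pair)
qed

lemma fn_emb: "u \<in> W12 X \<Omega> ==> AE x in lebesgue. fn (emb u) x = indicator \<Omega> x *\<^sub>R (u x, Xgrad X \<Omega> u x)"
  unfolding emb_def by (rule fn_l2_of[OF sq_int_emb])

lemma pr_eq_indicator: "\<phi> \<in> C1c \<Omega> ==> (\<phi> x, X_classical X \<phi> x) = indicator \<Omega> x *\<^sub>R (\<phi> x, X_classical X \<phi> x)"
proof -
  assume \<phi>: "\<phi> \<in> C1c \<Omega>"
  obtain K where "K \<subseteq> \<Omega>" "\<And>x. x \<notin> K ==> \<phi> x = 0" "\<And>x. x \<notin> K ==> X_classical X \<phi> x = 0"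
    using C1c_support[OF \<phi>] by metis
  then show ?thesis by (cases "x \<in> K") (auto simp: indicator_def)
qed

lemma C1c_Xgrad: "\<phi> \<in> C1c \<Omega> ==> AE x in lebesgue. x \<in> \<Omega> \<longrightarrow> Xgrad X \<Omega> \<phi> x = X_classical X \<phi> x"
  by (rule Xgrad_eqI) (rule is_X_deriv_C1c')

lemma C1c_L2:
  assumes \<phi>: "\<phi> \<in> C1c \<Omega>"
  shows "\<phi> \<in> L2 \<Omega>" "(\<lambda>x. X_classical X \<phi> x $ j) \<in> L2 \<Omega>"
proof -
  have sq: "sq_int (\<lambda>x. indicator \<Omega> x *\<^sub>R (\<phi> x, X_classical X \<phi> x))"
    using sq_int_pr[OF \<phi>] by (simp only: pr_eq_indicator[OF \<phi>, symmetric])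
  show "\<phi> \<in> L2 \<Omega>" using sq_int_linear_image[OF sq bounded_linear_fst] by (simp add: L2_iff_sq_int[OF \<Omega>_sets] scaleR_Pair)
  have "bounded_linear (\<lambda>p :: real \<times> (real^'m). snd p $ j)"
    by (rule bounded_linear_compose[OF bounded_linear_vec_nth bounded_linear_snd])
  from sq_int_linear_image[OF sq this] show "(\<lambda>x. X_classical X \<phi> x $ j) \<in> L2 \<Omega>" by (simp add: L2_iff_sq_int[OF \<Omega>_sets] scaleR_Pair)
qed

lemma C1c_W12:
  assumes \<phi>: "\<phi> \<in> C1c \<Omega>" shows "\<phi> \<in> W12 X \<Omega>"
  unfolding W12_def
proof (intro CollectI conjI allI)
  show "\<exists>v\<in>L2 \<Omega>. is_X_deriv X \<Omega> j \<phi> v" for j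
    by (rule bexI[where x = "\<lambda>x. X_classical X \<phi> x $ j"]) (rule is_X_deriv_C1c'[OF \<phi>], rule C1c_L2(2)[OF \<phi>])
qed (rule C1c_L2(1)[OF \<phi>])

lemma emb_C1c:
  assumes \<phi>: "\<phi> \<in> C1c \<Omega>" shows "emb \<phi> = pr \<phi>"
proof (rule l2_eqI)
  show "AE x in lebesgue. fn (emb \<phi>) x = fn (pr \<phi>) x"
    using fn_emb[OF C1c_W12[OF \<phi>]] fn_pr[OF \<phi>] C1c_Xgrad[OF \<phi>]
  proof eventually_elim
    case (elim x)
    show ?case unfolding elim(1,2) using elim(3) pr_eq_indicator[OF \<phi>, of x] by (cases "x \<in> \<Omega>") auto
  qed
qed

text \<open>The Sobolev norm of a difference is the Hilbert space distance of the pairs, so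
  approximability in \<open>H10\<close> becomes membership in the closure \<open>V\<close>.\<close>

lemma norm_emb_diff:
  assumes u: "u \<in> W12 X \<Omega>" and \<phi>: "\<phi> \<in> C1c \<Omega>"
  shows "norm (emb u - pr \<phi>) = W12_norm X \<Omega> (\<lambda>x. u x - \<phi> x)"
proof -
  let ?w = "\<lambda>x. u x - \<phi> x"
  let ?p = "\<lambda>x. indicator \<Omega> x *\<^sub>R (?w x, Xgrad X \<Omega> ?w x)"
  have "is_X_deriv X \<Omega> j ?w (\<lambda>x. (Xgrad X \<Omega> u x - X_classical X \<phi> x) $ j)" for j
    using is_X_deriv_diff[OF _ C1c_L2(1)[OF \<phi>] W12_Xgrad(1)[OF u] is_X_deriv_C1c'[OF \<phi>]] u by (simp add: W12_def)
  then have X: "AE x in lebesgue. x \<in> \<Omega> \<longrightarrow> Xgrad X \<Omega> ?w x = Xgrad X \<Omega> u x - X_classical X \<phi> x" by (rule Xgrad_eqI)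
  let ?d = "emb u - pr \<phi>"
  have fd: "AE x in lebesgue. fn ?d x = indicator \<Omega> x *\<^sub>R (?w x, Xgrad X \<Omega> ?w x)"
    using fn_diff[of "emb u" "pr \<phi>"] fn_emb[OF u] fn_pr[OF \<phi>] X
  proof eventually_elim
    case (elim x)
    show ?case unfolding elim(1,2,3) using elim(4) pr_eq_indicator[OF \<phi>, of x]
      by (cases "x \<in> \<Omega>") (auto simp: prod_eq_iff)
  qed
  have sq: "sq_int (\<lambda>x. indicator \<Omega> x *\<^sub>R (?w x, Xgrad X \<Omega> ?w x))"
    by (rule sq_int_cong_AE[OF sq_int_fn fd measurable_lebesgue_cong_AE[OF measurable_fn fd]])
  have d: "?d = l2_of (\<lambda>x. indicator \<Omega> x *\<^sub>R (?w x, Xgrad X \<Omega> ?w x))"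
  proof (rule l2_eqI)
    show "AE x in lebesgue. fn ?d x = fn (l2_of (\<lambda>x. indicator \<Omega> x *\<^sub>R (?w x, Xgrad X \<Omega> ?w x))) x"
      using fd fn_l2_of[OF sq] by eventually_elim simp
  qed
  have i1: "integrable (lebesgue_on \<Omega>) (\<lambda>x. \<bar>?w x\<bar>\<^sup>2)" "integrable (lebesgue_on \<Omega>) (\<lambda>x. (norm (Xgrad X \<Omega> ?w x))\<^sup>2)"
  proof -
    have "?w \<in> L2 \<Omega>" using sq_int_linear_image[OF sq bounded_linear_fst] by (simp add: L2_iff_sq_int[OF \<Omega>_sets] scaleR_Pair)
    then show "integrable (lebesgue_on \<Omega>) (\<lambda>x. \<bar>?w x\<bar>\<^sup>2)" by (simp add: L2_def)
    have "Xgrad X \<Omega> ?w \<in> L2 \<Omega>" using sq_int_linear_image[OF sq bounded_linear_snd] by (simp add: L2_iff_sq_int[OF \<Omega>_sets] scaleR_Pair)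
    then show "integrable (lebesgue_on \<Omega>) (\<lambda>x. (norm (Xgrad X \<Omega> ?w x))\<^sup>2)" by (simp add: L2_def)
  qed
  have "(norm ?d)\<^sup>2 = (\<integral>x. ?p x \<bullet> ?p x \<partial>lebesgue)"
    unfolding d power2_norm_eq_inner by (rule inner_l2_of[OF sq sq])
  also have "\<dots> = (\<integral>x. indicator \<Omega> x *\<^sub>R (\<bar>?w x\<bar>\<^sup>2 + (norm (Xgrad X \<Omega> ?w x))\<^sup>2) \<partial>lebesgue)"
    by (rule Bochner_Integration.integral_cong) (auto simp: indicator_def dot_square_norm power2_eq_square[of "u _ - \<phi> _"] norm_Pair)
  also have "\<dots> = (\<integral>x. \<bar>?w x\<bar>\<^sup>2 + (norm (Xgrad X \<Omega> ?w x))\<^sup>2 \<partial>lebesgue_on \<Omega>)"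
    by (rule integral_restrict_space[symmetric]) simp
  also have "\<dots> = (\<integral>x. \<bar>?w x\<bar>\<^sup>2 \<partial>lebesgue_on \<Omega>) + (\<integral>x. (norm (Xgrad X \<Omega> ?w x))\<^sup>2 \<partial>lebesgue_on \<Omega>)"
    by (rule Bochner_Integration.integral_add[OF i1])
  finally show ?thesis unfolding W12_norm_def by (simp add: real_sqrt_unique)
qed

lemma emb_in_V:
  assumes u: "u \<in> H10 X \<Omega>" shows "emb u \<in> V"
  unfolding V_def closure_approachable
proof (intro allI impI)
  fix e :: real assume "0 < e"
  then obtain \<phi> where \<phi>: "\<phi> \<in> C1c \<Omega>" "W12_norm X \<Omega> (\<lambda>x. u x - \<phi> x) < e" using u by (auto simp: H10_def)
  have "u \<in> W12 X \<Omega>" using u by (simp add: H10_def)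
  then have "norm (emb u - pr \<phi>) < e" using norm_emb_diff \<phi> by simp
  then show "\<exists>y\<in>pr ` C1c \<Omega>. dist y (emb u) < e" using \<phi>(1) by (auto simp: dist_norm norm_minus_commute)
qed

lemma C1c_H10:
  assumes \<phi>: "\<phi> \<in> C1c \<Omega>" shows "\<phi> \<in> H10 X \<Omega>"
proof -
  have "W12_norm X \<Omega> (\<lambda>x. \<phi> x - \<phi> x) = 0"
    using norm_emb_diff[OF C1c_W12[OF \<phi>] \<phi>] by (simp add: emb_C1c[OF \<phi>])
  then show ?thesis using \<phi> C1c_W12[OF \<phi>] unfolding H10_def by (intro CollectI conjI allI impI bexI[of _ \<phi>]) auto
qed

end

section \<open>Limits of fluxes\<close>

lemma borel_measurable_vecI:
  fixes F :: "'a => real^'i"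
  assumes "\<And>i. (\<lambda>x. F x $ i) \<in> borel_measurable M" shows "F \<in> borel_measurable M"
proof (subst borel_measurable_euclidean_space, rule ballI)
  fix b :: "real^'i" assume "b \<in> Basis"
  then obtain i where "b = axis i 1" by (auto simp: Basis_vec_def)
  then show "(\<lambda>x. F x \<bullet> b) \<in> borel_measurable M" using assms[of i] by (simp add: inner_axis)
qed

lemma symmetric_matrix_inner:
  fixes M :: "real^'m^'m"
  assumes "transpose M = M" shows "(M *v x) \<bullet> y = x \<bullet> (M *v y)"
  using dot_lmul_matrix[of x M y] transpose_matrix_vector[of M x] assms by simp

text \<open>Test nonnegativity with c \<eta> - M \<eta>; symmetry turns (M M \<eta>) . \<eta> into
  |M \<eta>|^2, and the upper bound is applied to the vector M \<eta>.\<close>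

lemma symmetric_elliptic_norm:
  fixes M :: "real^'m^'m"
  assumes sym: "transpose M = M" and c: "0 < c"
    and pos: "\<And>\<eta>. 0 \<le> (M *v \<eta>) \<bullet> \<eta>" and le: "\<And>\<eta>. (M *v \<eta>) \<bullet> \<eta> \<le> c * (norm \<eta>)\<^sup>2"
  shows "(norm (M *v \<eta>))\<^sup>2 \<le> c * ((M *v \<eta>) \<bullet> \<eta>)"
proof -
  let ?t = "M *v \<eta>" let ?q = "?t \<bullet> \<eta>"
  have "(M *v ?t) \<bullet> \<eta> = ?t \<bullet> ?t" by (rule symmetric_matrix_inner[OF sym])
  then have "(M *v (c *\<^sub>R \<eta> - ?t)) \<bullet> (c *\<^sub>R \<eta> - ?t) = c\<^sup>2 * ?q - 2 * c * (?t \<bullet> ?t) + (M *v ?t) \<bullet> ?t"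
    by (simp add: matrix_vector_mult_diff_distrib matrix_vector_mult_scaleR inner_diff_left inner_diff_right power2_eq_square algebra_simps)
  with pos[of "c *\<^sub>R \<eta> - ?t"] have "0 \<le> c\<^sup>2 * ?q - 2 * (c * (?t \<bullet> ?t)) + (M *v ?t) \<bullet> ?t" by simp
  moreover have "(M *v ?t) \<bullet> ?t \<le> c * (?t \<bullet> ?t)" using le[of ?t] by (simp only: power2_norm_eq_inner)
  ultimately have "c * (?t \<bullet> ?t) \<le> c\<^sup>2 * ?q" by linarith
  then have "c * (?t \<bullet> ?t) \<le> c * (c * ?q)" by (simp only: power2_eq_square mult.assoc)
  then show ?thesis using c by (simp add: power2_norm_eq_inner)
qed

context cc_space
begin

section \<open>Coefficient matrices as operators on pairs\<close>

definition Kmat :: "(real^'n => real^'m^'m) => real^'n => real \<times> (real^'m) => real \<times> (real^'m)" where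
  "Kmat a x p = (0, indicator \<Omega> x *\<^sub>R (a x *v snd p))"

definition opr :: "(real^'n => real^'m^'m) => ('n, 'm) l2_pair => ('n, 'm) l2_pair" where
  "opr a = ptw (Kmat a)"

lemma elliptic_AE:
  assumes a: "elliptic_matrix \<Omega> c0 c1 a" and c: "0 < c0" "c0 \<le> c1"
  shows "AE x in lebesgue. x \<in> \<Omega> \<longrightarrow> transpose (a x) = a x \<and> (\<forall>\<eta>. c0 * (norm \<eta>)\<^sup>2 \<le> (a x *v \<eta>) \<bullet> \<eta> \<and>
    (norm (a x *v \<eta>))\<^sup>2 \<le> c1 * ((a x *v \<eta>) \<bullet> \<eta>) \<and> norm (a x *v \<eta>) \<le> c1 * norm \<eta>)"
proof -
  have "AE x in lebesgue. x \<in> \<Omega> \<longrightarrow> transpose (a x) = a x" 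
    "AE x in lebesgue. x \<in> \<Omega> \<longrightarrow> (\<forall>\<eta>. c0 * (norm \<eta>)\<^sup>2 \<le> (a x *v \<eta>) \<bullet> \<eta> \<and> (a x *v \<eta>) \<bullet> \<eta> \<le> c1 * (norm \<eta>)\<^sup>2)"
    using a unfolding elliptic_matrix_def AE_lebesgue_on_iff[OF \<Omega>_sets] by blast+
  then show ?thesis
  proof eventually_elim
    case (elim x)
    show ?case
    proof (intro impI conjI allI)
      assume x: "x \<in> \<Omega>"
      show sym: "transpose (a x) = a x" using elim(1) x by blast
      have e: "c0 * (norm \<eta>)\<^sup>2 \<le> (a x *v \<eta>) \<bullet> \<eta>" "(a x *v \<eta>) \<bullet> \<eta> \<le> c1 * (norm \<eta>)\<^sup>2" for \<eta> using elim(2) x by blast+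
      fix \<eta>
      show "c0 * (norm \<eta>)\<^sup>2 \<le> (a x *v \<eta>) \<bullet> \<eta>" by (rule e)
      have p: "0 \<le> (a x *v \<eta>) \<bullet> \<eta>" for \<eta> 
      proof -
        have "0 \<le> c0 * (norm \<eta>)\<^sup>2" using c by simp
        with e(1)[of \<eta>] show ?thesis by linarith
      qed
      have c1: "0 < c1" using c by linarith
      show q: "(norm (a x *v \<eta>))\<^sup>2 \<le> c1 * ((a x *v \<eta>) \<bullet> \<eta>)" by (rule symmetric_elliptic_norm[OF sym c1 p e(2)])
      have "(norm (a x *v \<eta>))\<^sup>2 \<le> c1 * (c1 * (norm \<eta>)\<^sup>2)"
        using mult_left_mono[OF e(2)[of \<eta>], of c1] q c1 by linarith
      then have "(norm (a x *v \<eta>))\<^sup>2 \<le> (c1 * norm \<eta>)\<^sup>2" by (simp add: power2_eq_square ac_simps)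
      then show "norm (a x *v \<eta>) \<le> c1 * norm \<eta>" by (rule power2_le_imp_le) (use c1 in simp)
    qed
  qed
qed

lemma ptw_Kmat:
  assumes a: "elliptic_matrix \<Omega> c0 c1 a" and c: "0 < c0" "c0 \<le> c1"
  shows "ptw_bounded c1 (Kmat a)"
  unfolding ptw_bounded_def
proof (intro conjI allI ballI)
  show "linear (Kmat a x)" for x
    unfolding Kmat_def by (rule linearI) (auto simp: matrix_vector_right_distrib matrix_vector_mult_scaleR scaleR_add_right)
  show "AE x in lebesgue. \<forall>y. norm (Kmat a x y) \<le> c1 * norm y"
    using elliptic_AE[OF a c]
  proof eventually_elim
    case (elim x)
    show ?case
    proof
      fix y :: "real \<times> (real^'m)"
      have c1: "0 \<le> c1" using c by linarith
      show "norm (Kmat a x y) \<le> c1 * norm y"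
      proof (cases "x \<in> \<Omega>")
        case True
        have "norm (Kmat a x y) = norm (a x *v snd y)" using True by (simp add: Kmat_def norm_Pair)
        also have "\<dots> \<le> c1 * norm (snd y)" using elim True by blast
        also have "\<dots> \<le> c1 * norm y" using c1 norm_snd_le[of "snd y" "fst y"] by (intro mult_left_mono) auto
        finally show ?thesis .
      qed (use c1 in \<open>simp add: Kmat_def norm_Pair\<close>)
    qed
  qed
  fix f :: "real^'n => real \<times> (real^'m)" assume f: "f \<in> borel_measurable lebesgue"
  have fj: "(\<lambda>x. snd (f x) $ j) \<in> borel_measurable lebesgue" for j
    by (rule borel_measurable_continuous_on[OF _ f]) (intro continuous_intros)
  have aij: "(\<lambda>x. indicator \<Omega> x *\<^sub>R (a x $ i $ j)) \<in> borel_measurable lebesgue" for i j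
    using a by (simp add: elliptic_matrix_def borel_measurable_restrict_space_iff)
  have "(\<lambda>x. indicator \<Omega> x *\<^sub>R (a x *v snd (f x))) \<in> borel_measurable lebesgue"
  proof (rule borel_measurable_vecI)
    fix i
    have "(\<lambda>x. \<Sum>j\<in>UNIV. (indicator \<Omega> x *\<^sub>R (a x $ i $ j)) * snd (f x) $ j) \<in> borel_measurable lebesgue"
      by (intro borel_measurable_sum borel_measurable_times aij fj)
    then show "(\<lambda>x. (indicator \<Omega> x *\<^sub>R (a x *v snd (f x))) $ i) \<in> borel_measurable lebesgue"
      by (simp add: matrix_vector_mult_def sum_distrib_left mult.assoc)
  qed
  then show "(\<lambda>x. Kmat a x (f x)) \<in> borel_measurable lebesgue"
    unfolding Kmat_def by (intro borel_measurable_Pair) auto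
qed

lemmas fn_opr = fn_ptw[OF ptw_Kmat, folded opr_def]
lemmas bounded_linear_opr = bounded_linear_ptw[OF ptw_Kmat, folded opr_def]

lemma norm_opr:
  assumes "elliptic_matrix \<Omega> c0 c1 a" and c: "0 < c0" "c0 \<le> c1"
  shows "norm (opr a z) \<le> c1 * norm z"
  using norm_ptw[OF ptw_Kmat[OF assms], of z] c by (simp add: opr_def)

text \<open>Outside \<open>\<Omega>\<close> the flux is cut to zero, so the first inequality there
  rests on \<open>V_outside\<close>. The factors 1 give both inequalities the shape expected by
  \<open>mulp_mono\<close>.\<close>

lemma opr_AE:
  assumes a: "elliptic_matrix \<Omega> c0 c1 a" and c: "0 < c0" "c0 \<le> c1" and y: "y \<in> V"
  shows "AE x in lebesgue. c0 * (fn (Psnd y) x \<bullet> fn (Psnd y) x) \<le> 1 * (fn (opr a y) x \<bullet> fn y x)"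
    and "AE x in lebesgue. 1 * (fn (opr a y) x \<bullet> fn (opr a y) x) \<le> c1 * (fn (opr a y) x \<bullet> fn y x)"
proof -
  have "AE x in lebesgue. c0 * (fn (Psnd y) x \<bullet> fn (Psnd y) x) \<le> 1 * (fn (opr a y) x \<bullet> fn y x) \<and>
      1 * (fn (opr a y) x \<bullet> fn (opr a y) x) \<le> c1 * (fn (opr a y) x \<bullet> fn y x)"
    using elliptic_AE[OF a c] fn_opr[OF a c, of y] fn_Psnd[of y] V_outside[OF y]
  proof eventually_elim
    case (elim x)
    show ?case
    proof (cases "x \<in> \<Omega>")
      case True
      then show ?thesis using elim by (simp add: Kmat_def inner_Pair_0 inner_prod_def power2_norm_eq_inner)
    next
      case False
      then show ?thesis using elim by (simp add: Kmat_def inner_prod_def)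
    qed
  qed
  then show "AE x in lebesgue. c0 * (fn (Psnd y) x \<bullet> fn (Psnd y) x) \<le> 1 * (fn (opr a y) x \<bullet> fn y x)"
    and "AE x in lebesgue. 1 * (fn (opr a y) x \<bullet> fn (opr a y) x) \<le> c1 * (fn (opr a y) x \<bullet> fn y x)" by auto
qed

lemma opr_sym_AE:
  assumes a: "elliptic_matrix \<Omega> c0 c1 a" and c: "0 < c0" "c0 \<le> c1"
  shows "AE x in lebesgue. 1 * (fn (opr a y) x \<bullet> fn z x) \<le> 1 * (fn (opr a z) x \<bullet> fn y x)"
  using elliptic_AE[OF a c] fn_opr[OF a c, of y] fn_opr[OF a c, of z]
proof eventually_elim
  case (elim x)
  show ?case
  proof (cases "x \<in> \<Omega>")
    case True
    then have "transpose (a x) = a x" using elim by blast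
    from symmetric_matrix_inner[OF this, of "snd (fn y x)" "snd (fn z x)"]
    show ?thesis using elim by (simp add: Kmat_def inner_prod_def inner_commute)
  qed (use elim in \<open>simp add: Kmat_def inner_prod_def\<close>)
qed

text \<open>Ellipticity controls the gradient, Poincare the whole pair; the constant c0/C^2 is the
  same for all matrices of the class.\<close>

lemma opr_coercive:
  assumes "0 < c0" "c0 \<le> c1"
  obtains \<alpha> where "0 < \<alpha>" "\<And>(a :: real^'n => real^'m^'m) z. elliptic_matrix \<Omega> c0 c1 a ==> z \<in> V ==> \<alpha> * (norm z)\<^sup>2 \<le> opr a z \<bullet> z"
proof -
  obtain C where C: "0 < C" "\<And>z. z \<in> V ==> norm z \<le> C * norm (Psnd z)" by (rule poincare) (rule that)
  show thesis
  proof (rule that[of "c0 / C\<^sup>2"])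
    show "0 < c0 / C\<^sup>2" using assms C by simp
    fix a :: "real^'n => real^'m^'m" and z assume a: "elliptic_matrix \<Omega> c0 c1 a" and z: "z \<in> V"
    have "(norm z)\<^sup>2 \<le> (C * norm (Psnd z))\<^sup>2" by (rule power_mono[OF C(2)[OF z]]) simp
    then have "c0 / C\<^sup>2 * (norm z)\<^sup>2 \<le> c0 * (norm (Psnd z))\<^sup>2"
      using assms C(1) by (simp add: power_mult_distrib field_simps)
    also have "\<dots> = (\<integral>x. c0 * (fn (Psnd z) x \<bullet> fn (Psnd z) x) \<partial>lebesgue)"
      by (simp add: power2_norm_eq_inner inner_l2_def)
    also have "\<dots> \<le> (\<integral>x. 1 * (fn (opr a z) x \<bullet> fn z x) \<partial>lebesgue)"
      by (rule integral_mono_AE[OF _ _ opr_AE(1)[OF a assms z]]) (intro integrable_mult_right integrable_inner_sq_int sq_int_fn)+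
    also have "\<dots> = opr a z \<bullet> z" by (simp add: inner_l2_def)
    finally show "c0 / C\<^sup>2 * (norm z)\<^sup>2 \<le> opr a z \<bullet> z" .
  qed
qed

section \<open>Localisation by cut-off functions\<close>

definition mulp :: "(real^'n => real) => ('n, 'm) l2_pair => ('n, 'm) l2_pair" where
  "mulp \<psi> = ptw (\<lambda>x p. \<psi> x *\<^sub>R p)"

text \<open>The commutator term of the Leibniz rule: the pair of the product \<open>\<psi> u\<close>
  is \<open>mulp \<psi> z + mulX \<psi> z\<close>. It involves the function component of
  \<open>z\<close> only.\<close>

definition mulX :: "(real^'n => real) => ('n, 'm) l2_pair => ('n, 'm) l2_pair" where
  "mulX \<psi> = ptw (\<lambda>x p. (0, fst p *\<^sub>R X_classical X \<psi> x))"

lemma ptw_mulp: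
  assumes \<psi>: "\<psi> \<in> C1c \<Omega>"
  obtains b where "ptw_bounded b (\<lambda>x (p :: real \<times> (real^'m)). \<psi> x *\<^sub>R p)"
proof -
  obtain L b where b: "L-lipschitz_on UNIV \<psi>" "\<And>x. \<bar>\<psi> x\<bar> \<le> b" using C1c_bounded_lipschitz[OF \<psi>] by metis
  have m: "\<psi> \<in> borel_measurable lebesgue" by (rule continuous_imp_lebesgue_measurable(2)[OF C1cD(3)[OF \<psi>]])
  have "ptw_bounded b (\<lambda>x (p :: real \<times> (real^'m)). \<psi> x *\<^sub>R p)"
    unfolding ptw_bounded_def
  proof (intro conjI allI ballI AE_I2)
    show "linear (\<lambda>p :: real \<times> (real^'m). \<psi> x *\<^sub>R p)" for x by (rule linear_scaleR)
    show "norm (\<psi> x *\<^sub>R y) \<le> b * norm y" for x and y :: "real \<times> (real^'m)"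
      using mult_right_mono[OF b(2)[of x] norm_ge_zero[of y]] by simp
  qed (intro borel_measurable_scaleR m)
  then show thesis by (rule that)
qed

lemma ptw_mulX:
  assumes \<psi>: "\<psi> \<in> C1c \<Omega>"
  obtains b where "ptw_bounded b (\<lambda>x (p :: real \<times> (real^'m)). (0 :: real, fst p *\<^sub>R X_classical X \<psi> x))"
proof -
  obtain K where K: "compact K" "\<And>x. x \<notin> K ==> X_classical X \<psi> x = 0" using C1c_support[OF \<psi>] by metis
  note cont = X_classical_continuous[OF \<psi>]
  have "bounded (X_classical X \<psi> ` K)"
    by (rule compact_imp_bounded[OF compact_continuous_image[OF continuous_on_subset[OF cont subset_UNIV] K(1)]])
  then obtain b where b: "0 < b" "\<forall>y\<in>X_classical X \<psi> ` K. norm y \<le> b" unfolding bounded_pos by blast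
  have bd: "norm (X_classical X \<psi> x) \<le> b" for x using b K(2)[of x] by (cases "x \<in> K") auto
  have m: "X_classical X \<psi> \<in> borel_measurable lebesgue" by (rule continuous_imp_lebesgue_measurable(2)[OF cont])
  have "ptw_bounded b (\<lambda>x (p :: real \<times> (real^'m)). (0 :: real, fst p *\<^sub>R X_classical X \<psi> x))"
    unfolding ptw_bounded_def
  proof (intro conjI allI ballI AE_I2)
    show "linear (\<lambda>p :: real \<times> (real^'m). (0 :: real, fst p *\<^sub>R X_classical X \<psi> x))" for x
      by (intro linearI) (auto simp: scaleR_add_left)
    show "norm (0 :: real, fst y *\<^sub>R X_classical X \<psi> x) \<le> b * norm y" for x and y :: "real \<times> (real^'m)"
    proof -
      have "norm (0 :: real, fst y *\<^sub>R X_classical X \<psi> x) = norm (X_classical X \<psi> x) * \<bar>fst y\<bar>" by (simp add: norm_Pair)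
      also have "\<dots> \<le> b * norm y" using bd[of x] b(1) norm_fst_le[of "fst y" "snd y"] by (intro mult_mono) auto
      finally show ?thesis .
    qed
    fix f :: "real^'n => real \<times> (real^'m)" assume f: "f \<in> borel_measurable lebesgue"
    have "(\<lambda>x. fst (f x)) \<in> borel_measurable lebesgue"
      by (rule borel_measurable_continuous_on[OF _ f]) (intro continuous_intros)
    then show "(\<lambda>x. (0 :: real, fst (f x) *\<^sub>R X_classical X \<psi> x)) \<in> borel_measurable lebesgue"
      by (intro borel_measurable_Pair borel_measurable_scaleR m) auto
  qed
  then show thesis by (rule that)
qed

lemma
  assumes \<psi>: "\<psi> \<in> C1c \<Omega>"
  shows bounded_linear_mulp: "bounded_linear (mulp \<psi>)"
    and bounded_linear_mulX: "bounded_linear (mulX \<psi>)"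
    and fn_mulp: "AE x in lebesgue. fn (mulp \<psi> z) x = \<psi> x *\<^sub>R fn z x"
    and fn_mulX: "AE x in lebesgue. fn (mulX \<psi> z) x = (0, fst (fn z x) *\<^sub>R X_classical X \<psi> x)"
    and inner_mulp: "z \<bullet> mulp \<psi> w = (\<integral>x. \<psi> x * (fn z x \<bullet> fn w x) \<partial>lebesgue)"
    and integrable_mulp: "integrable lebesgue (\<lambda>x. \<psi> x * (fn z x \<bullet> fn w x))"
proof -
  obtain b where b: "ptw_bounded b (\<lambda>x (p :: real \<times> (real^'m)). \<psi> x *\<^sub>R p)" by (rule ptw_mulp[OF \<psi>]) (rule that)
  obtain b' where b': "ptw_bounded b' (\<lambda>x (p :: real \<times> (real^'m)). (0 :: real, fst p *\<^sub>R X_classical X \<psi> x))"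
    by (rule ptw_mulX[OF \<psi>]) (rule that)
  show "bounded_linear (mulp \<psi>)" unfolding mulp_def by (rule bounded_linear_ptw[OF b])
  show "bounded_linear (mulX \<psi>)" unfolding mulX_def by (rule bounded_linear_ptw[OF b'])
  show "AE x in lebesgue. fn (mulp \<psi> z) x = \<psi> x *\<^sub>R fn z x" unfolding mulp_def by (rule fn_ptw[OF b])
  show "AE x in lebesgue. fn (mulX \<psi> z) x = (0, fst (fn z x) *\<^sub>R X_classical X \<psi> x)" unfolding mulX_def by (rule fn_ptw[OF b'])
  have "z \<bullet> mulp \<psi> w = mulp \<psi> w \<bullet> z" by (rule inner_commute)
  also have "\<dots> = (\<integral>x. (\<psi> x *\<^sub>R fn w x) \<bullet> fn z x \<partial>lebesgue)" unfolding mulp_def by (rule inner_ptw[OF b])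
  finally show "z \<bullet> mulp \<psi> w = (\<integral>x. \<psi> x * (fn z x \<bullet> fn w x) \<partial>lebesgue)" by (simp add: inner_commute)
  have "integrable lebesgue (\<lambda>x. fn z x \<bullet> (\<psi> x *\<^sub>R fn w x))"
    by (intro integrable_inner_sq_int sq_int_fn sq_int_ptw[OF b])
  then show "integrable lebesgue (\<lambda>x. \<psi> x * (fn z x \<bullet> fn w x))" by simp
qed

lemma mulp_mono:
  assumes \<psi>: "\<psi> \<in> C1c \<Omega>" "\<And>x. 0 \<le> \<psi> x" and le: "AE x in lebesgue. c * (fn z x \<bullet> fn w x) \<le> d * (fn z' x \<bullet> fn w' x)"
  shows "c * (z \<bullet> mulp \<psi> w) \<le> d * (z' \<bullet> mulp \<psi> w')"
proof -
  have "(\<integral>x. c * (\<psi> x * (fn z x \<bullet> fn w x)) \<partial>lebesgue) \<le> (\<integral>x. d * (\<psi> x * (fn z' x \<bullet> fn w' x)) \<partial>lebesgue)"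
  proof (rule integral_mono_AE)
    show "AE x in lebesgue. c * (\<psi> x * (fn z x \<bullet> fn w x)) \<le> d * (\<psi> x * (fn z' x \<bullet> fn w' x))"
      using le
    proof eventually_elim
      case (elim x)
      from mult_left_mono[OF this \<psi>(2)[of x]] show ?case by (simp add: ac_simps)
    qed
  qed (intro integrable_mult_right integrable_mulp[OF \<psi>(1)])+
  then show ?thesis by (simp add: inner_mulp[OF \<psi>(1)])
qed

text \<open>The way back from localised integrals, which pass to limits, to pointwise
  inequalities.\<close>

lemma mulp_le_imp_AE:
  assumes le: "\<And>\<psi>. \<psi> \<in> C1c \<Omega> ==> (\<And>x. 0 \<le> \<psi> x) ==> c * (z \<bullet> mulp \<psi> w) \<le> d * (z' \<bullet> mulp \<psi> w')"
  shows "AE x in lebesgue. x \<in> \<Omega> \<longrightarrow> c * (fn z x \<bullet> fn w x) \<le> d * (fn z' x \<bullet> fn w' x)"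
proof -
  let ?F = "\<lambda>x. d * (fn z' x \<bullet> fn w' x) - c * (fn z x \<bullet> fn w x)"
  have int: "integrable lebesgue ?F" by (intro Bochner_Integration.integrable_diff integrable_mult_right integrable_inner_sq_int sq_int_fn)
  have "AE x in lebesgue_on \<Omega>. 0 \<le> ?F x"
  proof (rule test_functions_nonneg_imp_AE[OF open_\<Omega>])
    show "integrable (lebesgue_on K) ?F" if "compact K" for K
    proof -
      have "K \<in> sets lebesgue" using that by (intro fmeasurableD lmeasurable_compact)
      then show ?thesis using integrable_mult_indicator[OF _ int, of K] by (simp add: integrable_restrict_space)
    qed
    fix \<psi> assume t: "\<psi> \<in> test_functions \<Omega>" and pos: "\<And>x. 0 \<le> \<psi> x"
    have \<psi>: "\<psi> \<in> C1c \<Omega>" using t test_functions_subset_C1c by blast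
    have "(\<integral>x. ?F x * \<psi> x \<partial>lebesgue_on \<Omega>) = (\<integral>x. indicator \<Omega> x *\<^sub>R (?F x * \<psi> x) \<partial>lebesgue)"
      by (rule integral_restrict_space) simp
    also have "\<dots> = (\<integral>x. d * (\<psi> x * (fn z' x \<bullet> fn w' x)) - c * (\<psi> x * (fn z x \<bullet> fn w x)) \<partial>lebesgue)"
    proof (rule Bochner_Integration.integral_cong[OF refl])
      show "indicator \<Omega> x *\<^sub>R (?F x * \<psi> x) = d * (\<psi> x * (fn z' x \<bullet> fn w' x)) - c * (\<psi> x * (fn z x \<bullet> fn w x))" for x
        using C1c_outside[OF \<psi>, of x] by (cases "x \<in> \<Omega>") (auto simp: algebra_simps)
    qed
    also have "\<dots> = d * (z' \<bullet> mulp \<psi> w') - c * (z \<bullet> mulp \<psi> w)"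
      unfolding inner_mulp[OF \<psi>] by (subst Bochner_Integration.integral_diff) (intro integrable_mult_right integrable_mulp[OF \<psi>] | simp)+
    finally show "0 \<le> (\<integral>x. ?F x * \<psi> x \<partial>lebesgue_on \<Omega>)" using le[OF \<psi> pos] by simp
  qed
  then show ?thesis by (simp add: AE_lebesgue_on_iff)
qed

text \<open>For pairs of C^1 functions this is the product rule; both sides are continuous in
  \<open>z\<close>, so it extends to the closure.\<close>

lemma mulp_plus_mulX_in_V:
  assumes \<psi>: "\<psi> \<in> C1c \<Omega>" and z: "z \<in> V"
  shows "mulp \<psi> z + mulX \<psi> z \<in> V"
proof -
  let ?T = "\<lambda>z. mulp \<psi> z + mulX \<psi> z"
  have "bounded_linear ?T" by (intro bounded_linear_add bounded_linear_mulp bounded_linear_mulX \<psi>)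
  then have "closed (?T -` V)" using linear_continuous_on[of ?T UNIV] closed_V by (intro closed_vimage) auto
  moreover have "pr ` C1c \<Omega> \<subseteq> ?T -` V"
  proof
    fix y assume "y \<in> pr ` C1c \<Omega>"
    then obtain \<phi> where \<phi>: "\<phi> \<in> C1c \<Omega>" "y = pr \<phi>" by blast
    have "?T y = pr (\<lambda>x. \<psi> x * \<phi> x)"
    proof (rule l2_eqI)
      show "AE x in lebesgue. fn (?T y) x = fn (pr (\<lambda>x. \<psi> x * \<phi> x)) x"
        using fn_add[of "mulp \<psi> y" "mulX \<psi> y"] fn_mulp[OF \<psi>, of y] fn_mulX[OF \<psi>, of y] fn_pr[OF \<phi>(1)] fn_pr[OF C1c_mult[OF \<psi> \<phi>(1)]]
      proof eventually_elim
        case (elim x)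
        show ?case unfolding elim(1,2,3,5) using elim(4)
          by (simp add: \<phi>(2) X_classical_mult[OF C1cD(1)[OF \<psi>] C1cD(1)[OF \<phi>(1)]])
      qed
    qed
    then show "y \<in> ?T -` V" using pr_in_V[OF C1c_mult[OF \<psi> \<phi>(1)]] by simp
  qed
  ultimately have "closure (pr ` C1c \<Omega>) \<subseteq> ?T -` V" by (intro closure_minimal)
  then have "V \<subseteq> ?T -` V" by (simp only: V_def[symmetric])
  then show ?thesis using z by blast
qed

lemma mulX_Pfst: "\<psi> \<in> C1c \<Omega> ==> mulX \<psi> (Pfst z) = mulX \<psi> z"
proof (rule l2_eqI)
  assume \<psi>: "\<psi> \<in> C1c \<Omega>"
  show "AE x in lebesgue. fn (mulX \<psi> (Pfst z)) x = fn (mulX \<psi> z) x"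
    using fn_mulX[OF \<psi>, of "Pfst z"] fn_mulX[OF \<psi>, of z] fn_Pfst[of z]
    by eventually_elim simp
qed

text \<open>Compensated compactness: the products converge although both factors converge only weakly, because the
  commutator of the cut-off with the vector fields involves only the strongly convergent functions.\<close>

lemma div_curl:
  assumes \<psi>: "\<psi> \<in> C1c \<Omega>" and y: "\<And>h. y h \<in> V" "weakly_tendsto y z"
    and d: "weakly_tendsto d D" and f: "f \<longlonglongrightarrow> F" and eq: "\<And>h v. v \<in> V ==> d h \<bullet> v = f h \<bullet> v"
  shows "(\<lambda>h. d h \<bullet> mulp \<psi> (y h)) \<longlonglongrightarrow> D \<bullet> mulp \<psi> z"
proof -
  note bm = bounded_linear_mulp[OF \<psi>] and bX = bounded_linear_mulX[OF \<psi>]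
  have zV: "z \<in> V" by (rule weakly_tendsto_closed_subspace[OF subspace_V closed_V y(2,1)])
  have lim: "D \<bullet> v = F \<bullet> v" if v: "v \<in> V" for v
  proof (rule LIMSEQ_unique)
    show "(\<lambda>h. d h \<bullet> v) \<longlonglongrightarrow> D \<bullet> v" by (rule weakly_tendstoD[OF d])
    show "(\<lambda>h. d h \<bullet> v) \<longlonglongrightarrow> F \<bullet> v" unfolding eq[OF v] by (intro tendsto_inner f tendsto_const)
  qed
  have w: "weakly_tendsto (\<lambda>h. mulp \<psi> (y h) + mulX \<psi> (y h)) (mulp \<psi> z + mulX \<psi> z)"
    by (intro weakly_tendsto_add weakly_tendsto_bounded_linear[OF bm y(2)] weakly_tendsto_bounded_linear[OF bX y(2)])
  have "(\<lambda>h. d h \<bullet> (mulp \<psi> (y h) + mulX \<psi> (y h))) \<longlonglongrightarrow> D \<bullet> (mulp \<psi> z + mulX \<psi> z)"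
    using weakly_tendsto_inner[OF w f] lim[OF mulp_plus_mulX_in_V[OF \<psi> zV]]
    by (simp add: eq[OF mulp_plus_mulX_in_V[OF \<psi> y(1)]] inner_commute)
  \<comment> \<open>Rellich makes the commutator converge strongly, so its product with the weakly
    convergent flux converges.\<close>
  moreover have "(\<lambda>h. mulX \<psi> (y h)) \<longlonglongrightarrow> mulX \<psi> z"
    using bounded_linear.tendsto[OF bX rellich[OF y]] by (simp add: mulX_Pfst[OF \<psi>])
  then have "(\<lambda>h. d h \<bullet> mulX \<psi> (y h)) \<longlonglongrightarrow> D \<bullet> mulX \<psi> z" by (rule weakly_tendsto_inner[OF d])
  ultimately have "(\<lambda>h. d h \<bullet> (mulp \<psi> (y h) + mulX \<psi> (y h)) - d h \<bullet> mulX \<psi> (y h)) \<longlonglongrightarrow> D \<bullet> (mulp \<psi> z + mulX \<psi> z) - D \<bullet> mulX \<psi> z"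
    by (rule tendsto_diff)
  then show ?thesis by (simp add: inner_add_right)
qed

text \<open>Positivity of the localised form on \<open>y h - z\<close> bounds its value at
  \<open>y h\<close> below by 2 (y h . \<psi> z) - z . \<psi> z, which is affine in
  \<open>y h\<close> and passes to the weak limit.\<close>

lemma mulp_weak_lsc:
  assumes \<psi>: "\<psi> \<in> C1c \<Omega>" "\<And>x. 0 \<le> \<psi> x" and y: "weakly_tendsto y z" and t: "t \<longlonglongrightarrow> l" and c: "0 \<le> c"
    and le: "\<And>h. c * (y h \<bullet> mulp \<psi> (y h)) \<le> t h"
  shows "c * (z \<bullet> mulp \<psi> z) \<le> l"
proof (rule LIMSEQ_le)
  let ?q = "\<lambda>h. 2 * (y h \<bullet> mulp \<psi> z) - z \<bullet> mulp \<psi> z"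
  interpret M: bounded_linear "mulp \<psi>" by (rule bounded_linear_mulp[OF \<psi>(1)])
  show "t \<longlonglongrightarrow> l" by (rule t)
  have "(\<lambda>h. c * ?q h) \<longlonglongrightarrow> c * (2 * (z \<bullet> mulp \<psi> z) - z \<bullet> mulp \<psi> z)"
    by (intro tendsto_intros weakly_tendstoD[OF y])
  then show "(\<lambda>h. c * ?q h) \<longlonglongrightarrow> c * (z \<bullet> mulp \<psi> z)" by simp
  show "\<exists>N. \<forall>h\<ge>N. c * ?q h \<le> t h"
  proof (intro exI allI impI)
    fix h
    have sym: "z \<bullet> mulp \<psi> (y h) = y h \<bullet> mulp \<psi> z" by (simp add: inner_mulp[OF \<psi>(1)] inner_commute)
    have "0 * (z \<bullet> mulp \<psi> z) \<le> 1 * ((y h - z) \<bullet> mulp \<psi> (y h - z))" by (rule mulp_mono[OF \<psi>]) simp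
    then have "2 * (y h \<bullet> mulp \<psi> z) - z \<bullet> mulp \<psi> z \<le> y h \<bullet> mulp \<psi> (y h)"
      using sym by (simp add: M.diff inner_diff_left inner_diff_right)
    from mult_left_mono[OF this c] le[of h] show "c * ?q h \<le> t h" by linarith
  qed
qed

end

locale h_convergence = cc_space X \<Omega> \<Omega>0
  for X :: "'m::finite => real^'n => real^'n" and \<Omega> \<Omega>0 +
  fixes c0 c1 :: real and A :: "nat => real^'n => real^'m^'m"
  assumes c0: "0 < c0" and c01: "c0 \<le> c1" and elliptic: "\<And>h. elliptic_matrix \<Omega> c0 c1 (A h)"
begin

text \<open>\<open>D\<close> is the limit of the fluxes along some sequence of solutions with weak limit \<open>z\<close>.\<close>

definition adm :: "(nat => nat) => ('n, 'm) l2_pair => ('n, 'm) l2_pair => bool" where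
  "adm s z D \<longleftrightarrow> (\<exists>y f F. (\<forall>h. y h \<in> V) \<and> weakly_tendsto y z \<and> weakly_tendsto (\<lambda>h. opr (A (s h)) (y h)) D \<and>
     f \<longlonglongrightarrow> F \<and> (\<forall>h. \<forall>v\<in>V. opr (A (s h)) (y h) \<bullet> v = f h \<bullet> v))"

lemma admI:
  assumes "\<And>h. y h \<in> V" "weakly_tendsto y z" "weakly_tendsto (\<lambda>h. opr (A (s h)) (y h)) D"
    "f \<longlonglongrightarrow> F" "\<And>h v. v \<in> V ==> opr (A (s h)) (y h) \<bullet> v = f h \<bullet> v"
  shows "adm s z D"
  unfolding adm_def using assms by (intro exI[of _ y] exI[of _ f] exI[of _ F]) simp

lemma admE:
  assumes "adm s z D"
  obtains y f F where "\<And>h. y h \<in> V" "weakly_tendsto y z" "weakly_tendsto (\<lambda>h. opr (A (s h)) (y h)) D"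
    "f \<longlonglongrightarrow> F" "\<And>h v. v \<in> V ==> opr (A (s h)) (y h) \<bullet> v = f h \<bullet> v"
proof -
  obtain y f F where "(\<forall>h. y h \<in> V) \<and> weakly_tendsto y z \<and> weakly_tendsto (\<lambda>h. opr (A (s h)) (y h)) D \<and>
     f \<longlonglongrightarrow> F \<and> (\<forall>h. \<forall>v\<in>V. opr (A (s h)) (y h) \<bullet> v = f h \<bullet> v)"
    using assms unfolding adm_def by (elim exE)
  then show thesis by (intro that[of y f F]) simp_all
qed

lemma adm_subseq:
  assumes "adm s z D" "strict_mono r" shows "adm (\<lambda>h. s (r h)) z D"
proof -
  obtain y f F where y: "\<And>h. y h \<in> V" "weakly_tendsto y z" "weakly_tendsto (\<lambda>h. opr (A (s h)) (y h)) D"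
    and f: "f \<longlonglongrightarrow> F" "\<And>h v. v \<in> V ==> opr (A (s h)) (y h) \<bullet> v = f h \<bullet> v" by (rule admE[OF assms(1)]) (rule that)
  have fr: "(\<lambda>h. f (r h)) \<longlonglongrightarrow> F" using LIMSEQ_subseq_LIMSEQ[OF f(1) assms(2)] by (simp add: o_def)
  show ?thesis
    by (rule admI[OF y(1) weakly_tendsto_subseq[OF y(2) assms(2)] weakly_tendsto_subseq[OF y(3) assms(2)] fr f(2)])
qed

lemma linear_opr: "linear (opr (A h))"
  by (rule bounded_linear.linear[OF bounded_linear_opr[OF elliptic c0 c01]])

lemma adm_0: "adm s 0 0"
proof -
  have w: "weakly_tendsto (\<lambda>h. 0 :: ('n, 'm) l2_pair) 0" by (simp add: weakly_tendsto_def)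
  show ?thesis
    by (rule admI[where y = "\<lambda>_. 0" and f = "\<lambda>_. 0" and F = 0]) (simp_all add: w linear_0[OF linear_opr] subspace_0[OF subspace_V])
qed

lemma adm_add:
  assumes "adm s z D" "adm s z' D'" shows "adm s (z + z') (D + D')"
proof -
  obtain y f F where y: "\<And>h. y h \<in> V" "weakly_tendsto y z" "weakly_tendsto (\<lambda>h. opr (A (s h)) (y h)) D"
    and f: "f \<longlonglongrightarrow> F" "\<And>h v. v \<in> V ==> opr (A (s h)) (y h) \<bullet> v = f h \<bullet> v" by (rule admE[OF assms(1)]) (rule that)
  obtain y' f' F' where y': "\<And>h. y' h \<in> V" "weakly_tendsto y' z'" "weakly_tendsto (\<lambda>h. opr (A (s h)) (y' h)) D'"
    and f': "f' \<longlonglongrightarrow> F'" "\<And>h v. v \<in> V ==> opr (A (s h)) (y' h) \<bullet> v = f' h \<bullet> v" by (rule admE[OF assms(2)]) (rule that)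
  show ?thesis
  proof (rule admI[OF _ weakly_tendsto_add[OF y(2) y'(2)] _ tendsto_add[OF f(1) f'(1)]])
    show "y h + y' h \<in> V" for h by (rule subspace_add[OF subspace_V y(1) y'(1)])
    show "weakly_tendsto (\<lambda>h. opr (A (s h)) (y h + y' h)) (D + D')"
      using weakly_tendsto_add[OF y(3) y'(3)] by (simp add: linear_add[OF linear_opr])
    show "opr (A (s h)) (y h + y' h) \<bullet> v = (f h + f' h) \<bullet> v" if "v \<in> V" for h v
      using f(2)[OF that] f'(2)[OF that] by (simp add: linear_add[OF linear_opr] inner_add_left)
  qed
qed

lemma adm_scaleR:
  assumes "adm s z D" shows "adm s (c *\<^sub>R z) (c *\<^sub>R D)"
proof -
  obtain y f F where y: "\<And>h. y h \<in> V" "weakly_tendsto y z" "weakly_tendsto (\<lambda>h. opr (A (s h)) (y h)) D"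
    and f: "f \<longlonglongrightarrow> F" "\<And>h v. v \<in> V ==> opr (A (s h)) (y h) \<bullet> v = f h \<bullet> v" by (rule admE[OF assms(1)]) (rule that)
  have bs: "bounded_linear (\<lambda>z :: ('n, 'm) l2_pair. c *\<^sub>R z)" by (rule bounded_linear_scaleR_right)
  show ?thesis
  proof (rule admI[OF _ weakly_tendsto_bounded_linear[OF bs y(2)] _ tendsto_scaleR[OF tendsto_const f(1)]])
    show "c *\<^sub>R y h \<in> V" for h by (rule subspace_scale[OF subspace_V y(1)])
    show "weakly_tendsto (\<lambda>h. opr (A (s h)) (c *\<^sub>R y h)) (c *\<^sub>R D)"
      using weakly_tendsto_bounded_linear[OF bs y(3)] by (simp add: linear_scale[OF linear_opr])
    show "opr (A (s h)) (c *\<^sub>R y h) \<bullet> v = (c *\<^sub>R f h) \<bullet> v" if "v \<in> V" for h v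
      using f(2)[OF that] by (simp add: linear_scale[OF linear_opr])
  qed
qed

lemma adm_sum:
  assumes "finite I" "\<And>i. i \<in> I ==> adm s (z i) (D i)"
  shows "adm s (\<Sum>i\<in>I. c i *\<^sub>R z i) (\<Sum>i\<in>I. c i *\<^sub>R D i)"
  using assms
proof (induction I rule: finite_induct)
  case (insert i I)
  then have "adm s (c i *\<^sub>R z i) (c i *\<^sub>R D i)" "adm s (\<Sum>i\<in>I. c i *\<^sub>R z i) (\<Sum>i\<in>I. c i *\<^sub>R D i)"
    by (auto intro: adm_scaleR)
  from adm_add[OF this] insert.hyps show ?case by simp
qed (simp add: adm_0)

text \<open>For the approximating solutions both inequalities come from ellipticity. Localised by a
  cut-off, the right sides converge by \<open>div_curl\<close>, and the left sides are weakly lower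
  semicontinuous.\<close>

lemma adm_elliptic:
  assumes "adm s z D"
  shows "AE x in lebesgue. x \<in> \<Omega> \<longrightarrow> c0 * (fn (Psnd z) x \<bullet> fn (Psnd z) x) \<le> 1 * (fn D x \<bullet> fn z x)"
    and "AE x in lebesgue. x \<in> \<Omega> \<longrightarrow> 1 * (fn D x \<bullet> fn D x) \<le> c1 * (fn D x \<bullet> fn z x)"
proof -
  obtain y f F where y: "\<And>h. y h \<in> V" "weakly_tendsto y z" "weakly_tendsto (\<lambda>h. opr (A (s h)) (y h)) D"
    and f: "f \<longlonglongrightarrow> F" "\<And>h v. v \<in> V ==> opr (A (s h)) (y h) \<bullet> v = f h \<bullet> v" by (rule admE[OF assms]) (rule that)
  have lim: "(\<lambda>h. c * (opr (A (s h)) (y h) \<bullet> mulp \<psi> (y h))) \<longlonglongrightarrow> c * (D \<bullet> mulp \<psi> z)" if "\<psi> \<in> C1c \<Omega>" for \<psi> c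
    by (rule tendsto_mult_left) (rule div_curl[OF that y f])
  show "AE x in lebesgue. x \<in> \<Omega> \<longrightarrow> c0 * (fn (Psnd z) x \<bullet> fn (Psnd z) x) \<le> 1 * (fn D x \<bullet> fn z x)"
  proof (rule mulp_le_imp_AE)
    fix \<psi> assume \<psi>: "\<psi> \<in> C1c \<Omega>" "\<And>x. 0 \<le> \<psi> x"
    show "c0 * (Psnd z \<bullet> mulp \<psi> (Psnd z)) \<le> 1 * (D \<bullet> mulp \<psi> z)"
      by (rule mulp_weak_lsc[OF \<psi> weakly_tendsto_bounded_linear[OF bounded_linear_Psnd y(2)] lim[OF \<psi>(1)] less_imp_le[OF c0]])
        (rule mulp_mono[OF \<psi> opr_AE(1)[OF elliptic c0 c01 y(1)]])
  qed
  show "AE x in lebesgue. x \<in> \<Omega> \<longrightarrow> 1 * (fn D x \<bullet> fn D x) \<le> c1 * (fn D x \<bullet> fn z x)"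
  proof (rule mulp_le_imp_AE)
    fix \<psi> assume \<psi>: "\<psi> \<in> C1c \<Omega>" "\<And>x. 0 \<le> \<psi> x"
    show "1 * (D \<bullet> mulp \<psi> D) \<le> c1 * (D \<bullet> mulp \<psi> z)"
      by (rule mulp_weak_lsc[OF \<psi> y(3) lim[OF \<psi>(1)] zero_le_one])
        (rule mulp_mono[OF \<psi> opr_AE(2)[OF elliptic c0 c01 y(1)]])
  qed
qed

text \<open>Both mixed products converge by \<open>div_curl\<close>, and they coincide before the
  limit because the matrices are symmetric.\<close>

lemma adm_symmetric:
  assumes "adm s z D" "adm s z' D'"
  shows "AE x in lebesgue. x \<in> \<Omega> \<longrightarrow> 1 * (fn D x \<bullet> fn z' x) \<le> 1 * (fn D' x \<bullet> fn z x)"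
proof (rule mulp_le_imp_AE)
  obtain y f F where y: "\<And>h. y h \<in> V" "weakly_tendsto y z" "weakly_tendsto (\<lambda>h. opr (A (s h)) (y h)) D"
    and f: "f \<longlonglongrightarrow> F" "\<And>h v. v \<in> V ==> opr (A (s h)) (y h) \<bullet> v = f h \<bullet> v" by (rule admE[OF assms(1)]) (rule that)
  obtain y' f' F' where y': "\<And>h. y' h \<in> V" "weakly_tendsto y' z'" "weakly_tendsto (\<lambda>h. opr (A (s h)) (y' h)) D'"
    and f': "f' \<longlonglongrightarrow> F'" "\<And>h v. v \<in> V ==> opr (A (s h)) (y' h) \<bullet> v = f' h \<bullet> v" by (rule admE[OF assms(2)]) (rule that)
  fix \<psi> assume \<psi>: "\<psi> \<in> C1c \<Omega>" "\<And>x. 0 \<le> \<psi> x"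
  show "1 * (D \<bullet> mulp \<psi> z') \<le> 1 * (D' \<bullet> mulp \<psi> z)"
  proof (rule LIMSEQ_le)
    show "(\<lambda>h. 1 * (opr (A (s h)) (y h) \<bullet> mulp \<psi> (y' h))) \<longlonglongrightarrow> 1 * (D \<bullet> mulp \<psi> z')"
      by (rule tendsto_mult_left) (rule div_curl[OF \<psi>(1) y'(1,2) y(3) f])
    show "(\<lambda>h. 1 * (opr (A (s h)) (y' h) \<bullet> mulp \<psi> (y h))) \<longlonglongrightarrow> 1 * (D' \<bullet> mulp \<psi> z)"
      by (rule tendsto_mult_left) (rule div_curl[OF \<psi>(1) y(1,2) y'(3) f'])
    show "\<exists>N. \<forall>h\<ge>N. 1 * (opr (A (s h)) (y h) \<bullet> mulp \<psi> (y' h)) \<le> 1 * (opr (A (s h)) (y' h) \<bullet> mulp \<psi> (y h))"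
      by (intro exI allI impI) (rule mulp_mono[OF \<psi> opr_sym_AE[OF elliptic c0 c01]])
  qed
qed

lemma elliptic_id: "elliptic_matrix \<Omega> 1 1 (\<lambda>_. mat 1 :: real^'m^'m)"
  unfolding elliptic_matrix_def by (auto simp: power2_norm_eq_inner intro!: exI[of _ 1] AE_I2) (auto simp: mat_def)

text \<open>The operator of the identity matrix projects onto pairs with zero function component
  that vanish outside \<open>\<Omega>\<close>. It fixes every flux, hence also their weak
  limits.\<close>

lemma adm_range:
  assumes "adm s z D"
  shows "AE x in lebesgue. fst (fn D x) = 0 \<and> (x \<notin> \<Omega> \<longrightarrow> fn D x = 0)"
proof -
  obtain y where y: "weakly_tendsto (\<lambda>h. opr (A (s h)) (y h)) D" by (rule admE[OF assms]) (rule that)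
  let ?Q = "opr (\<lambda>_. mat 1)"
  have "?Q (opr (A h) w) = opr (A h) w" for h w
  proof (rule l2_eqI)
    show "AE x in lebesgue. fn (?Q (opr (A h) w)) x = fn (opr (A h) w) x"
      using fn_opr[OF elliptic_id zero_less_one order.refl, of "opr (A h) w"] fn_opr[OF elliptic c0 c01, of h w]
      by eventually_elim (simp add: Kmat_def indicator_def)
  qed
  then have "weakly_tendsto (\<lambda>h. opr (A (s h)) (y h)) (?Q D)"
    using weakly_tendsto_bounded_linear[OF bounded_linear_opr[OF elliptic_id zero_less_one order.refl] y] by simp
  then have "?Q D = D" using y weakly_tendsto_unique by blast
  then have "AE x in lebesgue. fn D x = Kmat (\<lambda>_. mat 1) x (fn D x)"
    using fn_opr[OF elliptic_id zero_less_one order.refl, of D] by simp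
  then show ?thesis
  proof eventually_elim
    case (elim x)
    then show ?case by (metis Kmat_def fst_conv indicator_simps(2) scaleR_zero_left zero_prod_def)
  qed
qed

end

section \<open>The limit matrix\<close>

lemma sum_option_UNIV:
  fixes f :: "'i::finite option => 'a::comm_monoid_add"
  shows "(\<Sum>q\<in>UNIV. f q) = f None + (\<Sum>i\<in>UNIV. f (Some i))"
  unfolding UNIV_option_conv by (subst sum.insert) (auto simp: sum.reindex)

lemma fn_sum:
  assumes "finite I"
  shows "AE x in lebesgue. fn (\<Sum>i\<in>I. c i *\<^sub>R z i) x = (\<Sum>i\<in>I. c i *\<^sub>R fn (z i :: ('a::euclidean_space, 'b::euclidean_space) l2) x)"
  using assms
proof (induction I rule: finite_induct)
  case empty
  show ?case using fn_0[where ?'a = 'a and ?'b = 'b] by simp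
next
  case (insert i I)
  from insert.IH fn_add[of "c i *\<^sub>R z i" "\<Sum>i\<in>I. c i *\<^sub>R z i"] fn_scaleR[of "c i" "z i"]
  show ?case by eventually_elim (simp add: insert.hyps)
qed

lemma partial_coord: "partial l (\<lambda>x. x $ i) x = (if l = i then 1 else 0)"
  by (rule partial_eq) (auto simp: axis_def intro!: derivative_eq_intros)

lemma X_classical_coord: "X_classical X (\<lambda>x. x $ i) x = (\<chi> j. X j x $ i)"
  by (simp add: X_classical_def partial_coord if_distrib sum.delta cong: if_cong)

section \<open>Inverting the coefficient matrix of the fields\<close>

definition coeff_matrix :: "('m::finite => real^'n => real^'n) => real^'n => real^'n^'m" where
  "coeff_matrix X x = (\<chi> j. X j x)"

definition gram :: "('m::finite => real^'n => real^'n) => real^'n => real^'m^'m" where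
  "gram X x = coeff_matrix X x ** transpose (coeff_matrix X x)"

text \<open>If the Gram matrix kills \<open>v\<close>, then the combination of the fields with
  coefficients \<open>v\<close> has norm zero, and independence gives \<open>v = 0\<close>.\<close>

lemma gram_det_nz:
  fixes X :: "'m::finite => real^'n => real^'n"
  assumes inj: "inj (\<lambda>j. X j x)" and ind: "independent (range (\<lambda>j. X j x))"
  shows "det (gram X x) \<noteq> 0"
proof -
  have "v = 0" if v: "gram X x *v v = 0" for v
  proof -
    let ?C = "coeff_matrix X x"
    let ?t = "transpose ?C *v v"
    have "?t \<bullet> ?t = (?C *v ?t) \<bullet> v"
      using dot_lmul_matrix[of v ?C ?t] transpose_matrix_vector[of ?C v] by (simp add: inner_commute)
    also have "?C *v ?t = 0" using v by (simp only: gram_def matrix_vector_mul_assoc)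
    finally have t0: "?t = 0" by simp
    have "?t = (\<Sum>j\<in>UNIV. v $ j *\<^sub>R X j x)"
      by (simp add: vec_eq_iff matrix_vector_mult_def transpose_def coeff_matrix_def mult.commute)
    with t0 have s0: "(\<Sum>j\<in>UNIV. v $ j *\<^sub>R X j x) = 0" by simp
    define u where "u = (\<lambda>y. v $ (inv (\<lambda>j. X j x) y))"
    have "(\<Sum>y\<in>range (\<lambda>j. X j x). u y *\<^sub>R y) = (\<Sum>j\<in>UNIV. v $ j *\<^sub>R X j x)"
      by (subst sum.reindex[OF inj]) (simp add: u_def inv_f_f[OF inj])
    with s0 have "(\<Sum>y\<in>range (\<lambda>j. X j x). u y *\<^sub>R y) = 0" by simp
    then have u0: "\<forall>y\<in>range (\<lambda>j. X j x). u y = 0"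
      using ind dependent_finite[of "range (\<lambda>j. X j x)"] by auto
    have "v $ j = 0" for j
    proof -
      have "u (X j x) = 0" using u0 by blast
      then show ?thesis by (simp add: u_def inv_f_f[OF inj])
    qed
    then show "v = 0" by (simp add: vec_eq_iff)
  qed
  then have "\<exists>B. B ** gram X x = mat 1" using matrix_left_invertible_ker[of "gram X x"] by blast
  then have "invertible (gram X x)" by (simp add: invertible_left_inverse)
  then show ?thesis by (simp add: invertible_det_nz)
qed

text \<open>Cramer's rule for a right inverse of the coefficient matrix, which is manifestly measurable in \<open>x\<close>.\<close>

definition right_solution :: "('m::finite => real^'n => real^'n) => real^'n => real^'m => real^'n" where
  "right_solution X x \<eta> = transpose (coeff_matrix X x) *v
     (\<chi> k. det (\<chi> i j. if j = k then \<eta> $ i else gram X x $ i $ j) / det (gram X x))"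

lemma right_solution:
  assumes "det (gram X x) \<noteq> 0"
  shows "(\<Sum>i\<in>UNIV. right_solution X x \<eta> $ i *\<^sub>R (\<chi> j. X j x $ i)) = \<eta>"
proof -
  let ?\<nu> = "\<chi> k. det (\<chi> i j. if j = k then \<eta> $ i else gram X x $ i $ j) / det (gram X x)"
  have "gram X x *v ?\<nu> = \<eta>" using cramer[OF assms, of ?\<nu> \<eta>] by simp
  then have "coeff_matrix X x *v right_solution X x \<eta> = \<eta>"
    unfolding right_solution_def by (simp only: gram_def matrix_vector_mul_assoc)
  moreover have "coeff_matrix X x *v right_solution X x \<eta> = (\<Sum>i\<in>UNIV. right_solution X x \<eta> $ i *\<^sub>R (\<chi> j. X j x $ i))"
    by (simp add: vec_eq_iff matrix_vector_mult_def coeff_matrix_def mult.commute)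
  ultimately show ?thesis by simp
qed

lemma borel_measurable_det:
  fixes M :: "'a => real^'i^'i"
  assumes "\<And>i j. (\<lambda>x. M x $ i $ j) \<in> borel_measurable N"
  shows "(\<lambda>x. det (M x)) \<in> borel_measurable N"
  unfolding det_def by (intro borel_measurable_sum borel_measurable_times borel_measurable_prod borel_measurable_const assms)

lemma borel_measurable_right_solution:
  assumes X: "\<And>j i. (\<lambda>x. X j x $ i) \<in> borel_measurable N"
  shows "(\<lambda>x. right_solution X x \<eta> $ i) \<in> borel_measurable N"
proof -
  have g: "(\<lambda>x. gram X x $ i $ j) \<in> borel_measurable N" for i j
    unfolding gram_def matrix_matrix_mult_def transpose_def coeff_matrix_def
    by (simp only: vec_lambda_beta) (intro borel_measurable_sum borel_measurable_times X)
  have d: "(\<lambda>x. det (\<chi> i j. if j = k then \<eta> $ i else gram X x $ i $ j)) \<in> borel_measurable N" for k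
  proof (rule borel_measurable_det)
    show "(\<lambda>x. (\<chi> i j. if j = k then \<eta> $ i else gram X x $ i $ j) $ i $ j) \<in> borel_measurable N" for i j
      by (cases "j = k") (simp_all add: g)
  qed
  show ?thesis
    unfolding right_solution_def matrix_vector_mult_def transpose_def coeff_matrix_def
    by (simp only: vec_lambda_beta) (intro borel_measurable_sum borel_measurable_times borel_measurable_divide X d borel_measurable_det g)
qed

context h_convergence
begin

text \<open>The exceptional null set must not depend on the coefficients, which later vary with the
  point. The inequalities hold off one null set for a countable dense set of coefficient vectors and
  extend to all by continuity.\<close>

lemma adm_quadratic:
  fixes Z D :: "'q::finite => ('n, 'm) l2_pair"
  assumes "\<And>q. adm s (Z q) (D q)"
  shows "AE x in lebesgue. x \<in> \<Omega> \<longrightarrow> (\<forall>cf::real^'q.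
    c0 * (norm (\<Sum>q\<in>UNIV. cf $ q *\<^sub>R snd (fn (Z q) x)))\<^sup>2 \<le> (\<Sum>q\<in>UNIV. cf $ q *\<^sub>R snd (fn (D q) x)) \<bullet> (\<Sum>q\<in>UNIV. cf $ q *\<^sub>R snd (fn (Z q) x)) \<and>
    (norm (\<Sum>q\<in>UNIV. cf $ q *\<^sub>R snd (fn (D q) x)))\<^sup>2 \<le> c1 * ((\<Sum>q\<in>UNIV. cf $ q *\<^sub>R snd (fn (D q) x)) \<bullet> (\<Sum>q\<in>UNIV. cf $ q *\<^sub>R snd (fn (Z q) x))))"
  (is "AE x in lebesgue. x \<in> \<Omega> \<longrightarrow> (\<forall>cf. ?P x cf)")
proof -
  obtain Q :: "(real^'q) set" where Q: "countable Q" "\<And>U. open U ==> U \<noteq> {} ==> \<exists>d\<in>Q. d \<in> U"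
    using countable_dense_setE by metis
  have single: "AE x in lebesgue. x \<in> \<Omega> \<longrightarrow> ?P x cf" for cf
  proof -
    let ?z = "\<Sum>q\<in>UNIV. cf $ q *\<^sub>R Z q" and ?d = "\<Sum>q\<in>UNIV. cf $ q *\<^sub>R D q"
    have a: "adm s ?z ?d" by (rule adm_sum) (simp_all add: assms)
    show ?thesis
      using adm_elliptic[OF a] adm_range[OF a] fn_Psnd[of ?z] fn_sum[OF finite[of "UNIV :: 'q set"], of "\<lambda>q. cf $ q" Z] fn_sum[OF finite[of "UNIV :: 'q set"], of "\<lambda>q. cf $ q" D]
    proof eventually_elim
      case (elim x)
      have z: "snd (fn ?z x) = (\<Sum>q\<in>UNIV. cf $ q *\<^sub>R snd (fn (Z q) x))" using elim(5) by (simp add: snd_sum)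
      have d: "snd (fn ?d x) = (\<Sum>q\<in>UNIV. cf $ q *\<^sub>R snd (fn (D q) x))" using elim(6) by (simp add: snd_sum)
      have "fst (fn ?d x) = 0" using elim(3) by blast
      then show ?case unfolding z[symmetric] d[symmetric] using elim(1,2,4)
        by (simp add: inner_prod_def power2_norm_eq_inner)
    qed
  qed
  have "AE x in lebesgue. \<forall>cf\<in>Q. x \<in> \<Omega> \<longrightarrow> ?P x cf"
    by (subst AE_ball_countable[OF Q(1)]) (intro ballI single)
  then show ?thesis
  proof eventually_elim
    case (elim x)
    show ?case
    proof (intro impI)
      assume x: "x \<in> \<Omega>"
      let ?w = "\<lambda>cf::real^'q. \<Sum>q\<in>UNIV. cf $ q *\<^sub>R snd (fn (Z q) x)" and ?e = "\<lambda>cf::real^'q. \<Sum>q\<in>UNIV. cf $ q *\<^sub>R snd (fn (D q) x)"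
      let ?S = "{cf. c0 * (norm (?w cf))\<^sup>2 \<le> ?e cf \<bullet> ?w cf} \<inter> {cf. (norm (?e cf))\<^sup>2 \<le> c1 * (?e cf \<bullet> ?w cf)}"
      have "closed ?S"
        by (intro closed_Int closed_Collect_le continuous_intros)
      then have op: "open (- ?S)" by blast
      have "- ?S = {}"
      proof (rule ccontr)
        assume "- ?S \<noteq> {}"
        from Q(2)[OF op this] obtain d where "d \<in> Q" "\<not> ?P x d" by blast
        then show False using elim x by blast
      qed
      then show "\<forall>cf. ?P x cf" by blast
    qed
  qed
qed

end

locale h_correctors = h_convergence X \<Omega> \<Omega>0 c0 c1 A
  for X :: "'m::finite => real^'n => real^'n" and \<Omega> \<Omega>0 c0 c1 A +
  fixes P Q :: "nat => real^'n"
  assumes LIC: "LIC X \<Omega>" and boxes: "\<And>k. cbox (P k) (Q k) \<subseteq> \<Omega>" "(\<Union>k. box (P k) (Q k)) = \<Omega>"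
begin

text \<open>The functions prescribed as weak limits of correctors. Those with a coordinate supply
  the columns of the coefficient matrix; the bump alone (\<open>None\<close>) absorbs the gradient
  of the bump.\<close>

definition \<beta> :: "nat => 'n option => real^'n => real" where
  "\<beta> k q x = bump (P k) (Q k) x * (case q of None => 1 | Some i => x $ i)"

lemma \<beta>_test: "\<beta> k q \<in> C1c \<Omega>"
proof -
  have "(\<lambda>x. case q of None => 1 | Some i => x $ i) \<in> smooth_algebra"
    by (cases q) (simp_all add: smooth_algebra.const smooth_algebra.coord)
  from smooth_algebra_bump_test_function[OF this boxes(1)] have "\<beta> k q \<in> test_functions \<Omega>" by (simp add: \<beta>_def[abs_def])
  then show ?thesis using test_functions_subset_C1c by blast
qed

lemma bump_differentiable: "bump a b differentiable (at x)"
  using smooth_algebra_step[OF bump_smooth_algebra] by blast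

lemma coord_differentiable: "(\<lambda>x::real^'n. x $ i) differentiable (at x)"
  by (intro bounded_linear_imp_differentiable bounded_linear_vec_nth)

lemma X_classical_\<beta>:
  "X_classical X (\<beta> k None) x = X_classical X (bump (P k) (Q k)) x"
  "X_classical X (\<beta> k (Some i)) x = x $ i *\<^sub>R X_classical X (bump (P k) (Q k)) x + bump (P k) (Q k) x *\<^sub>R (\<chi> j. X j x $ i)"
proof -
  show "X_classical X (\<beta> k None) x = X_classical X (bump (P k) (Q k)) x"
    by (simp add: \<beta>_def[abs_def])
  show "X_classical X (\<beta> k (Some i)) x = x $ i *\<^sub>R X_classical X (bump (P k) (Q k)) x + bump (P k) (Q k) x *\<^sub>R (\<chi> j. X j x $ i)"
    by (simp add: \<beta>_def[abs_def] X_classical_coord X_classical_mult[OF bump_differentiable coord_differentiable])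
qed

text \<open>Coefficients producing \<eta> from the gradients of the \<open>\<beta>\<close>: with
  \<mu> a preimage of \<eta> under the coefficient matrix, \<mu>_i / b on the coordinates gives
  \<eta> plus a multiple of the gradient of the bump b, which the \<open>None\<close> coefficient
  cancels.\<close>

definition lam :: "nat => real^'n => real^'m => 'n option => real" where
  "lam k x \<eta> q = (case q of None => - (\<Sum>i\<in>UNIV. right_solution X x \<eta> $ i * x $ i) | Some i => right_solution X x \<eta> $ i) / bump (P k) (Q k) x"

lemma lam_solves:
  assumes d: "det (gram X x) \<noteq> 0" and x: "x \<in> box (P k) (Q k)"
  shows "(\<Sum>q\<in>UNIV. lam k x \<eta> q *\<^sub>R X_classical X (\<beta> k q) x) = \<eta>"
proof -
  let ?b = "bump (P k) (Q k) x" and ?\<mu> = "right_solution X x \<eta>" and ?g = "X_classical X (bump (P k) (Q k)) x"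
  have b: "?b \<noteq> 0" using bump_pos_iff[of "P k" "Q k" x] x by simp
  have "(\<Sum>q\<in>UNIV. lam k x \<eta> q *\<^sub>R X_classical X (\<beta> k q) x)
      = - ((\<Sum>i\<in>UNIV. (?\<mu> $ i * x $ i) / ?b) *\<^sub>R ?g) + (\<Sum>i\<in>UNIV. (?\<mu> $ i * x $ i / ?b) *\<^sub>R ?g + ?\<mu> $ i *\<^sub>R (\<chi> j. X j x $ i))"
    using b by (simp add: sum_option_UNIV lam_def X_classical_\<beta> sum_divide_distrib scaleR_add_right)
  also have "\<dots> = (\<Sum>i\<in>UNIV. ?\<mu> $ i *\<^sub>R (\<chi> j. X j x $ i))"
    by (simp add: sum.distrib scaleR_sum_left)
  finally show ?thesis using right_solution[OF d] by simp
qed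

text \<open>Assembled from the basis vectors, so linearity in \<eta> is visible; \<open>lam\<close>
  contains determinants of \<eta>.\<close>

definition lin :: "nat => real^'n => real^'m => real^('n option)" where
  "lin k x \<eta> = (\<chi> q. \<Sum>j\<in>UNIV. \<eta> $ j * lam k x (axis j 1) q)"

lemma lin_solves:
  assumes d: "det (gram X x) \<noteq> 0" and x: "x \<in> box (P k) (Q k)"
  shows "(\<Sum>q\<in>UNIV. lin k x \<eta> $ q *\<^sub>R X_classical X (\<beta> k q) x) = \<eta>"
proof -
  have "(\<Sum>q\<in>UNIV. lin k x \<eta> $ q *\<^sub>R X_classical X (\<beta> k q) x)
      = (\<Sum>j\<in>UNIV. \<eta> $ j *\<^sub>R (\<Sum>q\<in>UNIV. lam k x (axis j 1) q *\<^sub>R X_classical X (\<beta> k q) x))"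
    unfolding lin_def by (simp add: scaleR_sum_left scaleR_sum_right) (rule sum.swap)
  also have "\<dots> = (\<Sum>j\<in>UNIV. \<eta> $ j *\<^sub>R axis j 1)" by (simp only: lam_solves[OF d x])
  also have "\<dots> = \<eta>" by (simp add: vec_eq_iff axis_def if_distrib sum.delta cong: if_cong)
  finally show ?thesis .
qed

text \<open>A measurable choice of a box containing \<open>x\<close>; inside its box the bump is
  positive and may be divided by.\<close>

definition kk :: "real^'n => nat" where "kk x = (LEAST k. x \<in> box (P k) (Q k))"

lemma kk: "x \<in> \<Omega> ==> x \<in> box (P (kk x)) (Q (kk x))"
proof -
  assume "x \<in> \<Omega>"
  then obtain k where "x \<in> box (P k) (Q k)" using boxes(2) by blast
  then show ?thesis unfolding kk_def by (rule LeastI)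
qed

text \<open>Column \<open>j\<close> is the combination of limit fluxes with the coefficients that
  represent the \<open>j\<close>-th basis vector as a gradient.\<close>

definition amat :: "(nat => 'n option => ('n, 'm) l2_pair) => real^'n => real^'m^'m" where
  "amat \<tau> x = (\<chi> i j. \<Sum>q\<in>UNIV. lam (kk x) x (axis j 1) q * snd (fn (\<tau> (kk x) q) x) $ i)"

lemma amat_mult: "amat \<tau> x *v \<eta> = (\<Sum>q\<in>UNIV. lin (kk x) x \<eta> $ q *\<^sub>R snd (fn (\<tau> (kk x) q) x))"
  unfolding vec_eq_iff
proof
  fix i
  have "(amat \<tau> x *v \<eta>) $ i = (\<Sum>j\<in>UNIV. \<Sum>q\<in>UNIV. lam (kk x) x (axis j 1) q * snd (fn (\<tau> (kk x) q) x) $ i * \<eta> $ j)"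
    by (simp add: matrix_vector_mult_def amat_def sum_distrib_right)
  also have "\<dots> = (\<Sum>q\<in>UNIV. \<Sum>j\<in>UNIV. lam (kk x) x (axis j 1) q * snd (fn (\<tau> (kk x) q) x) $ i * \<eta> $ j)" by (rule sum.swap)
  also have "\<dots> = (\<Sum>q\<in>UNIV. lin (kk x) x \<eta> $ q *\<^sub>R snd (fn (\<tau> (kk x) q) x)) $ i"
    by (simp add: lin_def sum_distrib_right sum_distrib_left ac_simps)
  finally show "(amat \<tau> x *v \<eta>) $ i = (\<Sum>q\<in>UNIV. lin (kk x) x \<eta> $ q *\<^sub>R snd (fn (\<tau> (kk x) q) x)) $ i" .
qed

lemma gram_nz_AE: "AE x in lebesgue. x \<in> \<Omega> \<longrightarrow> det (gram X x) \<noteq> 0"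
proof -
  obtain N where N: "N \<in> null_sets lebesgue" "\<forall>x\<in>\<Omega> - N. inj (\<lambda>j. X j x) \<and> independent (range (\<lambda>j. X j x))"
    using LIC by (auto simp: LIC_def)
  from AE_not_in[OF N(1)] show ?thesis
  proof eventually_elim
    case (elim x)
    then show ?case using N(2) gram_det_nz[of X x] by blast
  qed
qed

lemma fn_pr_\<beta>: "AE x in lebesgue. \<forall>k q. snd (fn (pr (\<beta> k q)) x) = X_classical X (\<beta> k q) x"
proof -
  have "AE x in lebesgue. \<forall>q\<in>UNIV. snd (fn (pr (\<beta> k q)) x) = X_classical X (\<beta> k q) x" for k
  proof (rule AE_finite_allI)
    show "AE x in lebesgue. snd (fn (pr (\<beta> k q)) x) = X_classical X (\<beta> k q) x" for q
      using fn_pr[OF \<beta>_test[of k q]] by eventually_elim simp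
  qed simp
  then have "AE x in lebesgue. \<forall>k. \<forall>q\<in>UNIV. snd (fn (pr (\<beta> k q)) x) = X_classical X (\<beta> k q) x"
    unfolding AE_all_countable by (rule allI)
  then show ?thesis by simp
qed

text \<open>At almost every point, subtract from the given pair the combination of correctors with
  the same gradient there. The quadratic inequality then bounds the difference of fluxes by zero.
  The coefficients depend on the point, which \<open>adm_quadratic\<close> permits.\<close>

lemma identify_flux:
  assumes \<tau>: "\<And>k q. adm s (pr (\<beta> k q)) (\<tau> k q)" and z: "adm s z D"
  shows "AE x in lebesgue. fn D x = Kmat (amat \<tau>) x (fn z x)"
proof -
  define Z where "Z k q = (case q of None => z | Some q' => pr (\<beta> k q'))" for k and q :: "'n option option"
  define E where "E k q = (case q of None => D | Some q' => \<tau> k q')" for k and q :: "'n option option"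
  have "adm s (Z k q) (E k q)" for k q by (cases q) (simp_all add: Z_def E_def z \<tau>)
  note quad = adm_quadratic[of s "Z k" "E k" for k, OF this]
  have "AE x in lebesgue. \<forall>k. x \<in> \<Omega> \<longrightarrow> (\<forall>cf::real^'n option option.
    (norm (\<Sum>q\<in>UNIV. cf $ q *\<^sub>R snd (fn (E k q) x)))\<^sup>2 \<le> c1 * ((\<Sum>q\<in>UNIV. cf $ q *\<^sub>R snd (fn (E k q) x)) \<bullet> (\<Sum>q\<in>UNIV. cf $ q *\<^sub>R snd (fn (Z k q) x))))"
    (is "AE x in lebesgue. \<forall>k. ?F k x")
    unfolding AE_all_countable
  proof
    fix k
    from quad[of k] show "AE x in lebesgue. ?F k x"
      by eventually_elim blast
  qed
  then show ?thesis using gram_nz_AE fn_pr_\<beta> adm_range[OF z]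
  proof eventually_elim
    case (elim x)
    show ?case
    proof (cases "x \<in> \<Omega>")
      case True
      let ?k = "kk x" and ?\<eta> = "snd (fn z x)"
      have d: "det (gram X x) \<noteq> 0" using elim(2) True by blast
      \<comment> \<open>Coefficient 1 for the given pair, minus the representation of its gradient
        at \<open>x\<close> for the correctors.\<close>
      define cf :: "real^('n option option)" where "cf = (\<chi> q. case q of None => 1 | Some q' => - (lin ?k x ?\<eta> $ q'))"
      let ?e = "\<Sum>q\<in>UNIV. cf $ q *\<^sub>R snd (fn (E ?k q) x)"
        and ?w = "\<Sum>q\<in>UNIV. cf $ q *\<^sub>R snd (fn (Z ?k q) x)"
      have "?w = ?\<eta> - (\<Sum>q\<in>UNIV. lin ?k x ?\<eta> $ q *\<^sub>R X_classical X (\<beta> ?k q) x)"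
        unfolding sum_option_UNIV[of "\<lambda>q. cf $ q *\<^sub>R snd (fn (Z ?k q) x)"] using elim(3) by (simp add: cf_def Z_def sum_negf)
      also have "\<dots> = 0" by (simp only: lin_solves[OF d kk[OF True]]) simp
      finally have z0: "?w = 0" .
      have "(norm ?e)\<^sup>2 \<le> c1 * (?e \<bullet> ?w)"
        using elim(1) True by blast
      then have e0: "?e = 0" unfolding z0 by simp
      have "?e = snd (fn D x) - amat \<tau> x *v ?\<eta>"
        unfolding sum_option_UNIV[of "\<lambda>q. cf $ q *\<^sub>R snd (fn (E ?k q) x)"] amat_mult by (simp add: cf_def E_def sum_negf)
      with e0 have "snd (fn D x) = amat \<tau> x *v ?\<eta>" by simp
      then show ?thesis using elim(4) True by (simp add: Kmat_def prod_eq_iff)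
    qed (use elim(4) in \<open>simp add: Kmat_def prod_eq_iff\<close>)
  qed
qed

lemma amat_measurable: "(\<lambda>x. amat \<tau> x $ i $ j) \<in> borel_measurable lebesgue"
proof -
  have X: "(\<lambda>x. X j x $ i) \<in> borel_measurable lebesgue" for j i
    by (rule continuous_imp_lebesgue_measurable(2)) (intro continuous_intros X_continuous)
  have b: "bump (P k) (Q k) \<in> borel_measurable lebesgue" for k
  proof (rule continuous_imp_lebesgue_measurable(2))
    have "isCont (bump (P k) (Q k)) x" for x by (rule differentiable_imp_continuous_within[OF bump_differentiable])
    then show "continuous_on UNIV (bump (P k) (Q k))" by (simp add: continuous_at_imp_continuous_on)
  qed
  have c: "(\<lambda>x::real^'n. x $ i) \<in> borel_measurable lebesgue" for i
    by (rule continuous_imp_lebesgue_measurable(2)) (intro continuous_intros)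
  have lam: "(\<lambda>x. lam k x \<eta> q) \<in> borel_measurable lebesgue" for k \<eta> q
    unfolding lam_def
    by (cases q) (auto intro!: borel_measurable_divide borel_measurable_uminus borel_measurable_sum borel_measurable_times b c borel_measurable_right_solution X)
  have f: "(\<lambda>x. snd (fn (\<tau> k q) x) $ i) \<in> borel_measurable lebesgue" for k q
    by (rule borel_measurable_continuous_on[OF _ measurable_fn]) (intro continuous_intros)
  have kkm: "kk \<in> measurable lebesgue (count_space UNIV)"
    unfolding kk_def
  proof (rule measurable_Least)
    show "Measurable.pred lebesgue (\<lambda>x. x \<in> box (P k) (Q k))" for k by (simp add: pred_def)
  qed
  have "(\<lambda>x. \<Sum>q\<in>UNIV. lam (kk x) x (axis j 1) q * snd (fn (\<tau> (kk x) q) x) $ i) \<in> borel_measurable lebesgue"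
    by (rule measurable_compose_countable[where f = "\<lambda>k x. \<Sum>q\<in>UNIV. lam k x (axis j 1) q * snd (fn (\<tau> k q) x) $ i", OF _ kkm])
      (intro borel_measurable_sum borel_measurable_times lam f)
  then show ?thesis by (simp add: amat_def)
qed

text \<open>Every vector \<eta> is the gradient at \<open>x\<close> of a combination of correctors
  whose flux is the matrix applied to \<eta>, so the inequalities for fluxes are those for the
  matrix; symmetry comes from the pairwise symmetry of correctors.\<close>

lemma amat_elliptic:
  assumes \<tau>: "\<And>k q. adm s (pr (\<beta> k q)) (\<tau> k q)"
  shows "elliptic_matrix \<Omega> c0 c1 (amat \<tau>)"
proof -
  have quad: "AE x in lebesgue. \<forall>k. x \<in> \<Omega> \<longrightarrow> (\<forall>cf::real^'n option.
    c0 * (norm (\<Sum>q\<in>UNIV. cf $ q *\<^sub>R snd (fn (pr (\<beta> k q)) x)))\<^sup>2 \<le> (\<Sum>q\<in>UNIV. cf $ q *\<^sub>R snd (fn (\<tau> k q) x)) \<bullet> (\<Sum>q\<in>UNIV. cf $ q *\<^sub>R snd (fn (pr (\<beta> k q)) x)) \<and>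
    (norm (\<Sum>q\<in>UNIV. cf $ q *\<^sub>R snd (fn (\<tau> k q) x)))\<^sup>2 \<le> c1 * ((\<Sum>q\<in>UNIV. cf $ q *\<^sub>R snd (fn (\<tau> k q) x)) \<bullet> (\<Sum>q\<in>UNIV. cf $ q *\<^sub>R snd (fn (pr (\<beta> k q)) x))))"
    unfolding AE_all_countable by (intro allI) (rule adm_quadratic, rule \<tau>)
  have sym: "AE x in lebesgue. \<forall>k. \<forall>q\<in>UNIV. \<forall>q'\<in>UNIV. x \<in> \<Omega> \<longrightarrow> snd (fn (\<tau> k q) x) \<bullet> snd (fn (pr (\<beta> k q')) x) \<le> snd (fn (\<tau> k q') x) \<bullet> snd (fn (pr (\<beta> k q)) x)"
    unfolding AE_all_countable
  proof (intro allI AE_finite_allI)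
    fix k q q'
    show "AE x in lebesgue. x \<in> \<Omega> \<longrightarrow> snd (fn (\<tau> k q) x) \<bullet> snd (fn (pr (\<beta> k q')) x) \<le> snd (fn (\<tau> k q') x) \<bullet> snd (fn (pr (\<beta> k q)) x)"
      using adm_symmetric[OF \<tau>[of k q] \<tau>[of k q']] adm_range[OF \<tau>[of k q]] adm_range[OF \<tau>[of k q']]
      by eventually_elim (simp add: inner_prod_def)
  qed simp_all
  have main: "AE x in lebesgue. x \<in> \<Omega> \<longrightarrow> transpose (amat \<tau> x) = amat \<tau> x \<and>
      (\<forall>\<eta>. c0 * (norm \<eta>)\<^sup>2 \<le> (amat \<tau> x *v \<eta>) \<bullet> \<eta> \<and> (norm (amat \<tau> x *v \<eta>))\<^sup>2 \<le> c1 * ((amat \<tau> x *v \<eta>) \<bullet> \<eta>))"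
    using quad sym gram_nz_AE fn_pr_\<beta>
  proof eventually_elim
    case (elim x)
    show ?case
    proof (intro impI conjI allI)
      assume x: "x \<in> \<Omega>"
      let ?k = "kk x"
      have d: "det (gram X x) \<noteq> 0" using elim(3) x by blast
      have ls: "(\<Sum>q\<in>UNIV. lin ?k x \<eta> $ q *\<^sub>R snd (fn (pr (\<beta> ?k q)) x)) = \<eta>" for \<eta>
        using lin_solves[OF d kk[OF x]] elim(4) by simp
      show "c0 * (norm \<eta>)\<^sup>2 \<le> (amat \<tau> x *v \<eta>) \<bullet> \<eta>" "(norm (amat \<tau> x *v \<eta>))\<^sup>2 \<le> c1 * ((amat \<tau> x *v \<eta>) \<bullet> \<eta>)" for \<eta>
        using elim(1)[THEN spec[of _ ?k], THEN mp, OF x, THEN spec[of _ "lin ?k x \<eta>"]] unfolding ls amat_mult[symmetric] by blast+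
      have s: "snd (fn (\<tau> ?k q) x) \<bullet> snd (fn (pr (\<beta> ?k q')) x) = snd (fn (\<tau> ?k q') x) \<bullet> snd (fn (pr (\<beta> ?k q)) x)" for q q'
        using elim(2) x by (meson UNIV_I order.antisym)
      have e: "(amat \<tau> x *v \<eta>) \<bullet> \<zeta> = (\<Sum>q\<in>UNIV. \<Sum>q'\<in>UNIV. lin ?k x \<eta> $ q * (lin ?k x \<zeta> $ q' * (snd (fn (\<tau> ?k q) x) \<bullet> snd (fn (pr (\<beta> ?k q')) x))))" for \<eta> \<zeta>
      proof -
        have "(amat \<tau> x *v \<eta>) \<bullet> \<zeta> = (\<Sum>q\<in>UNIV. lin ?k x \<eta> $ q *\<^sub>R snd (fn (\<tau> ?k q) x)) \<bullet> (\<Sum>q'\<in>UNIV. lin ?k x \<zeta> $ q' *\<^sub>R snd (fn (pr (\<beta> ?k q')) x))"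
          unfolding ls amat_mult ..
        then show ?thesis
          by (simp add: inner_sum_left inner_sum_right sum_distrib_left) (rule trans[OF sum.swap], simp add: mult.left_commute)
      qed
      have "(amat \<tau> x *v \<eta>) \<bullet> \<zeta> = (amat \<tau> x *v \<zeta>) \<bullet> \<eta>" for \<eta> \<zeta>
      proof -
        have "(amat \<tau> x *v \<eta>) \<bullet> \<zeta> = (\<Sum>q'\<in>UNIV. \<Sum>q\<in>UNIV. lin ?k x \<eta> $ q * (lin ?k x \<zeta> $ q' * (snd (fn (\<tau> ?k q) x) \<bullet> snd (fn (pr (\<beta> ?k q')) x))))"
          unfolding e by (rule sum.swap)
        also have "\<dots> = (amat \<tau> x *v \<zeta>) \<bullet> \<eta>"
          unfolding e by (intro sum.cong refl) (subst s, simp)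
        finally show ?thesis .
      qed
      from this[of "axis j 1" "axis i 1" for i j] show "transpose (amat \<tau> x) = amat \<tau> x"
        by (simp add: vec_eq_iff transpose_def inner_axis matrix_vector_mult_basis column_def)
    qed
  qed
  have c1: "0 < c1" using c0 c01 by linarith
  \<comment> \<open>Cauchy-Schwarz in |a \<eta>|^2 <= c1 a \<eta> . \<eta> and cancellation; this
    yields both the entry bound and the upper ellipticity constant.\<close>
  have bd: "AE x in lebesgue. x \<in> \<Omega> \<longrightarrow> (\<forall>\<eta>. norm (amat \<tau> x *v \<eta>) \<le> c1 * norm \<eta>)"
    using main
  proof eventually_elim
    case (elim x)
    show ?case
    proof (intro impI allI)
      fix \<eta> assume "x \<in> \<Omega>"
      then have "(norm (amat \<tau> x *v \<eta>))\<^sup>2 \<le> c1 * ((amat \<tau> x *v \<eta>) \<bullet> \<eta>)" using elim by blast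
      also have "\<dots> \<le> c1 * (norm (amat \<tau> x *v \<eta>) * norm \<eta>)" using c1 norm_cauchy_schwarz by (intro mult_left_mono) auto
      finally have "norm (amat \<tau> x *v \<eta>) * norm (amat \<tau> x *v \<eta>) \<le> norm (amat \<tau> x *v \<eta>) * (c1 * norm \<eta>)"
        by (simp add: power2_eq_square ac_simps)
      then show "norm (amat \<tau> x *v \<eta>) \<le> c1 * norm \<eta>"
        using c1 by (cases "norm (amat \<tau> x *v \<eta>) = 0") (auto simp: mult_le_cancel_left)
    qed
  qed
  show ?thesis
    unfolding elliptic_matrix_def AE_lebesgue_on_iff[OF \<Omega>_sets]
  proof (intro conjI allI)
    fix i j
    show "(\<lambda>x. amat \<tau> x $ i $ j) \<in> borel_measurable (lebesgue_on \<Omega>)" by (intro measurable_restrict_space1 amat_measurable)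
    show "\<exists>M. AE x in lebesgue. x \<in> \<Omega> \<longrightarrow> \<bar>amat \<tau> x $ i $ j\<bar> \<le> M"
    proof (intro exI[of _ c1])
      from bd show "AE x in lebesgue. x \<in> \<Omega> \<longrightarrow> \<bar>amat \<tau> x $ i $ j\<bar> \<le> c1"
      proof eventually_elim
        case (elim x)
        show ?case
        proof
          assume "x \<in> \<Omega>"
          then have "norm (amat \<tau> x *v axis j 1) \<le> c1 * norm (axis j (1::real) :: real^'m)" using elim by blast
          then have "norm (amat \<tau> x *v axis j 1) \<le> c1" by (simp add: norm_axis_1)
          then show "\<bar>amat \<tau> x $ i $ j\<bar> \<le> c1"
            using component_le_norm_cart[of "amat \<tau> x *v axis j 1" i] by (simp add: matrix_vector_mult_basis column_def)
        qed
      qed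
    qed
  next
    from main show "AE x in lebesgue. x \<in> \<Omega> \<longrightarrow> transpose (amat \<tau> x) = amat \<tau> x" by eventually_elim blast
    from main bd show "AE x in lebesgue. x \<in> \<Omega> \<longrightarrow> (\<forall>\<eta>. c0 * (norm \<eta>)\<^sup>2 \<le> (amat \<tau> x *v \<eta>) \<bullet> \<eta> \<and> (amat \<tau> x *v \<eta>) \<bullet> \<eta> \<le> c1 * (norm \<eta>)\<^sup>2)"
    proof eventually_elim
      case (elim x)
      show ?case
      proof (intro impI allI conjI)
        fix \<eta> assume x: "x \<in> \<Omega>"
        then show "c0 * (norm \<eta>)\<^sup>2 \<le> (amat \<tau> x *v \<eta>) \<bullet> \<eta>" using elim(1) by blast
        have "(amat \<tau> x *v \<eta>) \<bullet> \<eta> \<le> norm (amat \<tau> x *v \<eta>) * norm \<eta>" by (rule norm_cauchy_schwarz)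
        also have "\<dots> \<le> (c1 * norm \<eta>) * norm \<eta>" using elim(2) x by (intro mult_right_mono) auto
        finally show "(amat \<tau> x *v \<eta>) \<bullet> \<eta> \<le> c1 * (norm \<eta>)\<^sup>2" by (simp add: power2_eq_square)
      qed
    qed
  qed
qed

text \<open>The identification is stated for all further subsequences: admissibility of the
  correctors passes to them, so the same matrix identifies limits extracted later.\<close>

lemma h_limit:
  obtains a and s :: "nat => nat" where "elliptic_matrix \<Omega> c0 c1 a" "strict_mono s"
    "\<And>(r :: nat => nat) z D. strict_mono r ==> adm (\<lambda>h. s (r h)) z D ==> D = opr a z"
proof -
  obtain \<alpha> where \<alpha>: "0 < \<alpha>" "\<And>(a :: real^'n => real^'m^'m) z. elliptic_matrix \<Omega> c0 c1 a ==> z \<in> V ==> \<alpha> * (norm z)\<^sup>2 \<le> opr a z \<bullet> z"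
    by (rule opr_coercive[OF c0 c01]) (rule that)
  obtain e :: "nat => ('n, 'm) l2_pair" where e: "\<forall>v. (\<forall>k. v \<bullet> e k = 0) \<longrightarrow> v = 0"
    by (rule countable_total_l2) blast
  \<comment> \<open>The countably many pairs of box and factor are enumerated as one
    sequence.\<close>
  define w where "w n = (case from_nat n of (k, q) => pr (\<beta> k q))" for n
  have "\<exists>s f z D. strict_mono s \<and> (\<forall>k h. z k h \<in> V) \<and> (\<forall>k h. \<forall>v\<in>V. opr (A (s h)) (z k h) \<bullet> v = f k \<bullet> v) \<and>
      (\<forall>k. weakly_tendsto (z k) (w k)) \<and> (\<forall>k. weakly_tendsto (\<lambda>h. opr (A (s h)) (z k h)) (D k))"
  proof (rule coercive_correctors[where A = "\<lambda>h. opr (A h)" and V = V and w = w and e = e and C = c1 and c = \<alpha>])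
    show "subspace V" "closed V" by (rule subspace_V closed_V)+
    show "bounded_linear (opr (A h))" for h by (rule bounded_linear_opr[OF elliptic c0 c01])
    show "norm (opr (A h) x) \<le> c1 * norm x" for h x by (rule norm_opr[OF elliptic c0 c01])
    show "0 < \<alpha>" by (rule \<alpha>(1))
    show "\<alpha> * (norm x)\<^sup>2 \<le> opr (A h) x \<bullet> x" if "x \<in> V" for h x by (rule \<alpha>(2)[OF elliptic that])
    show "v = 0" if "\<And>k. v \<bullet> e k = 0" for v using e that by blast
    show "w k \<in> V" for k by (simp add: w_def pr_in_V[OF \<beta>_test] split: prod.split)
  next
    fix s f z D
    assume "strict_mono s" "\<And>k h. z k h \<in> V" "\<And>k h v. v \<in> V ==> opr (A (s h)) (z k h) \<bullet> v = f k \<bullet> v"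
      "\<And>k. weakly_tendsto (z k) (w k)" "\<And>k. weakly_tendsto (\<lambda>h. opr (A (s h)) (z k h)) (D k)"
    then show ?thesis by (intro exI[of _ s] exI[of _ f] exI[of _ z] exI[of _ D]) simp
  qed
  then obtain s f z D where s: "strict_mono s" and zV: "\<forall>k h. z k h \<in> V"
    and eq: "\<forall>k h. \<forall>v\<in>V. opr (A (s h)) (z k h) \<bullet> v = f k \<bullet> v"
    and wz: "\<forall>k. weakly_tendsto (z k) (w k)" and wD: "\<forall>k. weakly_tendsto (\<lambda>h. opr (A (s h)) (z k h)) (D k)"
    by (elim exE conjE)
  have adm: "adm s (w n) (D n)" for n
    by (rule admI[OF zV[rule_format] wz[rule_format] wD[rule_format] tendsto_const eq[rule_format]])
  define \<tau> where "\<tau> k q = D (to_nat (k, q))" for k :: nat and q :: "'n option"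
  have \<tau>: "adm s (pr (\<beta> k q)) (\<tau> k q)" for k q
    using adm[of "to_nat (k, q)"] by (simp add: w_def \<tau>_def)
  have ell: "elliptic_matrix \<Omega> c0 c1 (amat \<tau>)" by (rule amat_elliptic[OF \<tau>])
  show thesis
  proof (rule that[OF ell s])
    fix r z D assume r: "strict_mono r" and zD: "adm (\<lambda>h. s (r h)) z D"
    show "D = opr (amat \<tau>) z"
    proof (rule l2_eqI)
      show "AE x in lebesgue. fn D x = fn (opr (amat \<tau>) z) x"
        using identify_flux[OF adm_subseq[OF \<tau> r] zD] fn_opr[OF ell c0 c01, of z] by eventually_elim simp
    qed
  qed
qed

end

section \<open>Convergence of solutions\<close>

context h_convergence
begin

lemma Pfst_inner_nonneg: "0 \<le> Pfst z \<bullet> z"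
  unfolding Pfst_def inner_ptw[OF ptw_fst] by (rule Bochner_Integration.integral_nonneg) (simp add: inner_prod_def)

text \<open>The solutions are bounded by coercivity. Along any weakly convergent subsequence the
  right-hand sides \<open>G - \<mu> Pfst y\<close> converge strongly by Rellich, so the limit pair
  is admissible and solves the limit equation. Uniqueness gives convergence without further
  extraction.\<close>

lemma solution_convergence:
  assumes a: "elliptic_matrix \<Omega> c0 c1 a"
    and lim: "\<And>(r :: nat => nat) z D. strict_mono r ==> adm (\<lambda>h. s (r h)) z D ==> D = opr a z"
    and \<mu>: "0 \<le> \<mu>" and y: "\<And>h. y h \<in> V" "\<And>h v. v \<in> V ==> opr (A (s h)) (y h) \<bullet> v = (G - \<mu> *\<^sub>R Pfst (y h)) \<bullet> v"
    and y0: "y0 \<in> V" "\<And>v. v \<in> V ==> opr a y0 \<bullet> v = (G - \<mu> *\<^sub>R Pfst y0) \<bullet> v"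
  shows "weakly_tendsto y y0" "weakly_tendsto (\<lambda>h. opr (A (s h)) (y h)) (opr a y0)"
proof -
  interpret Pfst: bounded_linear Pfst by (rule bounded_linear_Pfst)
  obtain \<alpha> where \<alpha>: "0 < \<alpha>" "\<And>(a :: real^'n => real^'m^'m) z. elliptic_matrix \<Omega> c0 c1 a ==> z \<in> V ==> \<alpha> * (norm z)\<^sup>2 \<le> opr a z \<bullet> z"
    by (rule opr_coercive[OF c0 c01]) (rule that)
  have c1: "0 < c1" using c0 c01 by linarith
  \<comment> \<open>The zero-order term has the favourable sign because \<open>\<mu>\<close> is
    nonnegative.\<close>
  have bd: "norm (y h) \<le> norm G / \<alpha>" for h
  proof -
    have "\<alpha> * (norm (y h))\<^sup>2 \<le> G \<bullet> y h - \<mu> * (Pfst (y h) \<bullet> y h)"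
      using \<alpha>(2)[OF elliptic y(1), of h "s h"] y(2)[OF y(1), of h h] by (simp add: inner_diff_left)
    also have "\<dots> \<le> norm G * norm (y h)"
      using norm_cauchy_schwarz[of G "y h"] mult_nonneg_nonneg[OF \<mu> Pfst_inner_nonneg[of "y h"]] by linarith
    finally have "norm (y h) * (\<alpha> * norm (y h)) \<le> norm (y h) * norm G" by (simp add: power2_eq_square ac_simps)
    then have "\<alpha> * norm (y h) \<le> norm G" by (cases "norm (y h) = 0") (auto simp: mult_le_cancel_left)
    then show ?thesis using \<alpha>(1) by (simp add: field_simps)
  qed
  have bdA: "norm (opr (A (s h)) (y h)) \<le> c1 * (norm G / \<alpha>)" for h
    using norm_opr[OF elliptic c0 c01, of "s h" "y h"] mult_left_mono[OF bd[of h], of c1] c1 by linarith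
  have key: "l = y0 \<and> D = opr a y0"
    if r: "strict_mono r" and l: "weakly_tendsto (\<lambda>h. y (r h)) l" and D: "weakly_tendsto (\<lambda>h. opr (A (s (r h))) (y (r h))) D" for r l D
  proof -
    have lV: "l \<in> V" by (rule weakly_tendsto_closed_subspace[OF subspace_V closed_V l y(1)])
    have fl: "(\<lambda>h. G - \<mu> *\<^sub>R Pfst (y (r h))) \<longlonglongrightarrow> G - \<mu> *\<^sub>R Pfst l"
      by (intro tendsto_intros rellich[OF y(1) l])
    have "adm (\<lambda>h. s (r h)) l D" by (rule admI[OF y(1) l D fl y(2)])
    then have Da: "D = opr a l" by (rule lim[OF r])
    have eq: "opr a l \<bullet> v = (G - \<mu> *\<^sub>R Pfst l) \<bullet> v" if v: "v \<in> V" for v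
    proof (rule LIMSEQ_unique)
      show "(\<lambda>h. opr (A (s (r h))) (y (r h)) \<bullet> v) \<longlonglongrightarrow> opr a l \<bullet> v" using weakly_tendstoD[OF D] by (simp add: Da)
      show "(\<lambda>h. opr (A (s (r h))) (y (r h)) \<bullet> v) \<longlonglongrightarrow> (G - \<mu> *\<^sub>R Pfst l) \<bullet> v"
        unfolding y(2)[OF v] by (intro tendsto_inner fl tendsto_const)
    qed
    have dV: "l - y0 \<in> V" by (rule subspace_diff[OF subspace_V lV y0(1)])
    have lin: "linear (opr a)" by (rule bounded_linear.linear[OF bounded_linear_opr[OF a c0 c01]])
    \<comment> \<open>Uniqueness for the limit equation: coercivity applied to the difference of two
      solutions.\<close>
    have "\<alpha> * (norm (l - y0))\<^sup>2 \<le> opr a (l - y0) \<bullet> (l - y0)" by (rule \<alpha>(2)[OF a dV])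
    also have "\<dots> = - (\<mu> * (Pfst (l - y0) \<bullet> (l - y0)))"
      unfolding linear_diff[OF lin] inner_diff_left[of "opr a l"] eq[OF dV] y0(2)[OF dV] Pfst.diff
      by (simp add: inner_diff_left algebra_simps)
    also have "\<dots> \<le> 0" using mult_nonneg_nonneg[OF \<mu> Pfst_inner_nonneg[of "l - y0"]] by linarith
    finally have "(norm (l - y0))\<^sup>2 \<le> 0" using \<alpha>(1) by (simp add: mult_le_0_iff)
    then have "l = y0" by simp
    then show ?thesis using Da by simp
  qed
  show w: "weakly_tendsto y y0"
  proof (rule weakly_tendsto_from_subsequences[OF bd])
    fix r l assume r: "strict_mono r" and l: "weakly_tendsto (\<lambda>h. y (r h)) l"
    obtain r' D where r': "strict_mono r'" and D: "weakly_tendsto (\<lambda>h. opr (A (s (r (r' h)))) (y (r (r' h)))) D"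
      by (rule weak_compactness[of "\<lambda>h. opr (A (s (r h))) (y (r h))", OF bdA]) (rule that)
    have rr: "strict_mono (\<lambda>h. r (r' h))" using strict_mono_o[OF r r'] by (simp add: o_def)
    from key[OF rr weakly_tendsto_subseq[OF l r'] D] show "l = y0" by simp
  qed
  show "weakly_tendsto (\<lambda>h. opr (A (s h)) (y h)) (opr a y0)"
  proof (rule weakly_tendsto_from_subsequences[OF bdA])
    fix r D assume r: "strict_mono r" and D: "weakly_tendsto (\<lambda>h. opr (A (s (r h))) (y (r h))) D"
    from key[OF r weakly_tendsto_subseq[OF w r] D] show "D = opr a y0" by simp
  qed
qed

end

context cc_space
begin

section \<open>From integrals on the domain to the Hilbert space and back\<close>

lemma flux_sq_int:
  assumes a: "elliptic_matrix \<Omega> c0 c1 a" and c: "0 < c0" "c0 \<le> c1" and u: "u \<in> W12 X \<Omega>"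
  shows "sq_int (\<lambda>x. indicator \<Omega> x *\<^sub>R (a x *v Xgrad X \<Omega> u x))"
proof -
  have e: "snd (Kmat a x (indicator \<Omega> x *\<^sub>R (u x, Xgrad X \<Omega> u x))) = indicator \<Omega> x *\<^sub>R (a x *v Xgrad X \<Omega> u x)" for x
    by (simp add: Kmat_def indicator_def)
  from sq_int_linear_image[OF sq_int_ptw[OF ptw_Kmat[OF a c] sq_int_emb[OF u]] bounded_linear_snd] show ?thesis
    unfolding e .
qed

lemma opr_emb_inner:
  assumes a: "elliptic_matrix \<Omega> c0 c1 a" and c: "0 < c0" "c0 \<le> c1" and u: "u \<in> W12 X \<Omega>"
    and \<Phi>: "sq_int (\<lambda>x. indicator \<Omega> x *\<^sub>R (\<psi> x, \<Phi> x))"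
  shows "opr a (emb u) \<bullet> l2_of (\<lambda>x. indicator \<Omega> x *\<^sub>R (\<psi> x, \<Phi> x)) = (\<integral>x. (a x *v Xgrad X \<Omega> u x) \<bullet> \<Phi> x \<partial>lebesgue_on \<Omega>)"
proof -
  have "opr a (emb u) = l2_of (\<lambda>x. Kmat a x (indicator \<Omega> x *\<^sub>R (u x, Xgrad X \<Omega> u x)))"
    unfolding opr_def emb_def by (rule ptw_l2_of[OF ptw_Kmat[OF a c] sq_int_emb[OF u]])
  then have "opr a (emb u) \<bullet> l2_of (\<lambda>x. indicator \<Omega> x *\<^sub>R (\<psi> x, \<Phi> x))
      = (\<integral>x. Kmat a x (indicator \<Omega> x *\<^sub>R (u x, Xgrad X \<Omega> u x)) \<bullet> (indicator \<Omega> x *\<^sub>R (\<psi> x, \<Phi> x)) \<partial>lebesgue)"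
    by (simp only: inner_l2_of[OF sq_int_ptw[OF ptw_Kmat[OF a c] sq_int_emb[OF u]] \<Phi>])
  also have "\<dots> = (\<integral>x. indicator \<Omega> x *\<^sub>R ((a x *v Xgrad X \<Omega> u x) \<bullet> \<Phi> x) \<partial>lebesgue)"
    by (rule Bochner_Integration.integral_cong) (auto simp: Kmat_def indicator_def inner_prod_def)
  also have "\<dots> = (\<integral>x. (a x *v Xgrad X \<Omega> u x) \<bullet> \<Phi> x \<partial>lebesgue_on \<Omega>)"
    by (rule integral_restrict_space[symmetric]) simp
  finally show ?thesis .
qed

text \<open>The index order in \<open>div_X\<close> pairs the gradient of \<open>u\<close> with the
  matrix applied to the gradient of \<open>v\<close>; symmetry identifies this with the flux of
  \<open>u\<close> tested by \<open>v\<close>.\<close>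

lemma div_X_eq_opr:
  assumes a: "elliptic_matrix \<Omega> c0 c1 a" and c: "0 < c0" "c0 \<le> c1" and u: "u \<in> W12 X \<Omega>" and v: "v \<in> W12 X \<Omega>"
  shows "div_X X \<Omega> a u v = opr a (emb u) \<bullet> emb v"
proof -
  let ?U = "Xgrad X \<Omega> u" and ?W = "Xgrad X \<Omega> v"
  let ?s = "\<lambda>x. \<Sum>i\<in>UNIV. \<Sum>j\<in>UNIV. a x $ i $ j * ?U x $ i * ?W x $ j"
    and ?a = "\<lambda>i j x. indicator \<Omega> x *\<^sub>R (a x $ i $ j)"
  have int: "integrable (lebesgue_on \<Omega>) (\<lambda>x. a x $ i $ j * ?U x $ i * ?W x $ j)" for i j
  proof -
    have Wj: "sq_int (\<lambda>x. indicator \<Omega> x * ?W x $ j)"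
      using sq_int_linear_image[OF W12_Xgrad(2)[OF v] bounded_linear_vec_nth[of j]] by simp
    have Ui: "sq_int (\<lambda>x. indicator \<Omega> x * ?U x $ i)"
      using sq_int_linear_image[OF W12_Xgrad(2)[OF u] bounded_linear_vec_nth[of i]] by simp
    obtain M where M: "AE x in lebesgue. x \<in> \<Omega> \<longrightarrow> \<bar>a x $ i $ j\<bar> \<le> M"
      using a unfolding elliptic_matrix_def AE_lebesgue_on_iff[OF \<Omega>_sets] by blast
    have am: "(\<lambda>x. indicator \<Omega> x *\<^sub>R (a x $ i $ j)) \<in> borel_measurable lebesgue"
      using a by (simp add: elliptic_matrix_def borel_measurable_restrict_space_iff)
    have aU: "sq_int (\<lambda>x. ?a i j x * (indicator \<Omega> x * ?U x $ i))"
    proof (rule sq_int_bound[OF Ui, of _ M])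
      show "(\<lambda>x. ?a i j x * (indicator \<Omega> x * ?U x $ i)) \<in> borel_measurable lebesgue"
        by (rule borel_measurable_times[OF am sq_intD(1)[OF Ui]])
      from M show "AE x in lebesgue. norm (?a i j x * (indicator \<Omega> x * ?U x $ i)) \<le> M * norm (indicator \<Omega> x * ?U x $ i)"
      proof eventually_elim
        case (elim x)
        then show ?case by (cases "x \<in> \<Omega>") (auto simp: abs_mult intro: mult_right_mono)
      qed
    qed
    have e: "(\<lambda>x. (?a i j x * (indicator \<Omega> x * ?U x $ i)) \<bullet> (indicator \<Omega> x * ?W x $ j))
        = (\<lambda>x. indicator \<Omega> x *\<^sub>R (a x $ i $ j * ?U x $ i * ?W x $ j))" by (auto simp: indicator_def)
    from integrable_inner_sq_int[OF aU Wj] show ?thesis unfolding e by (simp add: integrable_restrict_space)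
  qed
  have "div_X X \<Omega> a u v = (\<Sum>i\<in>UNIV. \<Sum>j\<in>UNIV. \<integral>x. a x $ i $ j * ?U x $ i * ?W x $ j \<partial>lebesgue_on \<Omega>)"
    by (simp add: div_X_def X_transpose_def)
  also have "\<dots> = (\<integral>x. ?s x \<partial>lebesgue_on \<Omega>)"
    by (subst Bochner_Integration.integral_sum; (intro Bochner_Integration.integrable_sum int)?)
      (intro sum.cong refl Bochner_Integration.integral_sum[symmetric] int)
  also have "\<dots> = (\<integral>x. (a x *v ?U x) \<bullet> ?W x \<partial>lebesgue_on \<Omega>)"
  proof (rule integral_cong_AE)
    show "(\<lambda>x. \<Sum>i\<in>UNIV. \<Sum>j\<in>UNIV. a x $ i $ j * ?U x $ i * ?W x $ j) \<in> borel_measurable (lebesgue_on \<Omega>)"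
      by (intro borel_measurable_sum borel_measurable_integrable int)
    have "integrable lebesgue (\<lambda>x. (indicator \<Omega> x *\<^sub>R (a x *v ?U x)) \<bullet> (indicator \<Omega> x *\<^sub>R ?W x))"
      by (rule integrable_inner_sq_int[OF flux_sq_int[OF a c u] W12_Xgrad(2)[OF v]])
    moreover have "(\<lambda>x. (indicator \<Omega> x *\<^sub>R (a x *v ?U x)) \<bullet> (indicator \<Omega> x *\<^sub>R ?W x)) = (\<lambda>x. indicator \<Omega> x *\<^sub>R ((a x *v ?U x) \<bullet> ?W x))"
      by (auto simp: indicator_def)
    ultimately show "(\<lambda>x. (a x *v ?U x) \<bullet> ?W x) \<in> borel_measurable (lebesgue_on \<Omega>)"
      by (intro borel_measurable_integrable) (simp add: integrable_restrict_space)
    show "AE x in lebesgue_on \<Omega>. ?s x = (a x *v ?U x) \<bullet> ?W x"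
      unfolding AE_lebesgue_on_iff[OF \<Omega>_sets] using elliptic_AE[OF a c]
    proof eventually_elim
      case (elim x)
      show ?case
      proof
        assume "x \<in> \<Omega>"
        then have "transpose (a x) = a x" using elim by blast
        then have "(a x *v ?U x) \<bullet> ?W x = ?U x \<bullet> (a x *v ?W x)" by (rule symmetric_matrix_inner)
        then show "?s x = (a x *v ?U x) \<bullet> ?W x"
          by (simp add: inner_vec_def matrix_vector_mult_def sum_distrib_left ac_simps)
      qed
    qed
  qed
  also have "\<dots> = opr a (emb u) \<bullet> emb v"
    unfolding emb_def[of v] by (rule opr_emb_inner[OF a c u sq_int_emb[OF v], symmetric])
  finally show ?thesis .
qed

definition rhs :: "(real^'n => real) => ('n, 'm) l2_pair" where
  "rhs g = l2_of (\<lambda>x. indicator \<Omega> x *\<^sub>R (g x, 0))"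

lemma rhs_inner_emb:
  assumes g: "g \<in> L2 \<Omega>" and v: "v \<in> W12 X \<Omega>"
  shows "rhs g \<bullet> emb v = (\<integral>x. g x * v x \<partial>lebesgue_on \<Omega>)"
proof -
  have "sq_int (\<lambda>x. (indicator \<Omega> x *\<^sub>R g x, 0 :: real^'m))" using g by (intro sq_int_Pair) (simp_all add: L2_iff_sq_int)
  then have sq: "sq_int (\<lambda>x. indicator \<Omega> x *\<^sub>R (g x, 0 :: real^'m))" by (simp add: scaleR_Pair)
  have "rhs g \<bullet> emb v = (\<integral>x. indicator \<Omega> x *\<^sub>R (g x * v x) \<partial>lebesgue)"
    unfolding rhs_def emb_def inner_l2_of[OF sq sq_int_emb[OF v]]
    by (rule Bochner_Integration.integral_cong) (auto simp: indicator_def inner_prod_def)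
  also have "\<dots> = (\<integral>x. g x * v x \<partial>lebesgue_on \<Omega>)" by (rule integral_restrict_space[symmetric]) simp
  finally show ?thesis .
qed

lemma Pfst_emb: "u \<in> W12 X \<Omega> ==> Pfst (emb u) = rhs u"
  unfolding Pfst_def emb_def rhs_def by (subst ptw_l2_of[OF ptw_fst sq_int_emb]) (simp_all add: scaleR_Pair)

text \<open>The equation is used with C^1 test functions only, where \<open>emb\<close> and
  \<open>pr\<close> agree, and extends to \<open>V\<close> because both sides are continuous in the
  test vector.\<close>

lemma solves_weak:
  assumes a: "elliptic_matrix \<Omega> c0 c1 a" and c: "0 < c0" "c0 \<le> c1" and g: "g \<in> L2 \<Omega>"
    and sol: "solves X \<Omega> \<mu> (div_X X \<Omega> a) g u"
  shows "u \<in> W12 X \<Omega>" "emb u \<in> V" "\<And>v. v \<in> V ==> opr a (emb u) \<bullet> v = (rhs g - \<mu> *\<^sub>R Pfst (emb u)) \<bullet> v"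
proof -
  have uH: "u \<in> H10 X \<Omega>" using sol by (simp add: solves_def)
  show uW: "u \<in> W12 X \<Omega>" using uH by (simp add: H10_def)
  then have uL: "u \<in> L2 \<Omega>" by (simp add: W12_def)
  show "emb u \<in> V" by (rule emb_in_V[OF uH])
  fix v assume v: "v \<in> V"
  let ?d = "opr a (emb u) - (rhs g - \<mu> *\<^sub>R Pfst (emb u))"
  have "?d \<bullet> pr \<phi> = 0" if \<phi>: "\<phi> \<in> C1c \<Omega>" for \<phi>
  proof -
    note \<phi>W = C1c_W12[OF \<phi>]
    have "\<mu> * (\<integral>x. u x * \<phi> x \<partial>lebesgue_on \<Omega>) + div_X X \<Omega> a u \<phi> = (\<integral>x. g x * \<phi> x \<partial>lebesgue_on \<Omega>)"
      using sol C1c_H10[OF \<phi>] by (simp add: solves_def)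
    then show ?thesis
      unfolding div_X_eq_opr[OF a c uW \<phi>W] rhs_inner_emb[OF g \<phi>W, symmetric] rhs_inner_emb[OF uL \<phi>W, symmetric] Pfst_emb[OF uW, symmetric] emb_C1c[OF \<phi>]
      by (simp add: inner_diff_left)
  qed
  then have "pr ` C1c \<Omega> \<subseteq> {v. ?d \<bullet> v = 0}" by blast
  moreover have "closed {v. ?d \<bullet> v = 0}" by (intro closed_Collect_eq continuous_intros)
  ultimately have "V \<subseteq> {v. ?d \<bullet> v = 0}" unfolding V_def by (intro closure_minimal)
  then have "?d \<bullet> v = 0" using v by blast
  then show "opr a (emb u) \<bullet> v = (rhs g - \<mu> *\<^sub>R Pfst (emb u)) \<bullet> v" by (simp add: inner_diff_left)
qed

lemma L2_tendstoI:
  assumes u: "\<And>k. u k \<in> W12 X \<Omega>" "v \<in> W12 X \<Omega>" and lim: "(\<lambda>k. Pfst (emb (u k))) \<longlonglongrightarrow> Pfst (emb v)"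
  shows "L2_tendsto \<Omega> u v"
proof -
  have L2: "u k \<in> L2 \<Omega>" "v \<in> L2 \<Omega>" for k using u by (simp_all add: W12_def)
  have sq: "sq_int (\<lambda>x. indicator \<Omega> x *\<^sub>R (w x, 0 :: real^'m))" if "w \<in> L2 \<Omega>" for w
  proof -
    have "sq_int (\<lambda>x. (indicator \<Omega> x *\<^sub>R w x, 0 :: real^'m))" using that by (intro sq_int_Pair) (simp_all add: L2_iff_sq_int)
    then show ?thesis by (simp add: scaleR_Pair)
  qed
  have eq: "sqrt (\<integral>x. (norm (u k x - v x))\<^sup>2 \<partial>lebesgue_on \<Omega>) = norm (Pfst (emb (u k)) - Pfst (emb v))" for k
  proof -
    have "(\<integral>x. (norm (u k x - v x))\<^sup>2 \<partial>lebesgue_on \<Omega>) = (\<integral>x. indicator \<Omega> x *\<^sub>R (norm (u k x - v x))\<^sup>2 \<partial>lebesgue)"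
      by (rule integral_restrict_space) simp
    also have "\<dots> = (\<integral>x. (norm (fn (rhs (u k) - rhs v) x))\<^sup>2 \<partial>lebesgue)"
    proof (rule integral_cong_AE)
      show AE: "AE x in lebesgue. indicator \<Omega> x *\<^sub>R (norm (u k x - v x))\<^sup>2 = (norm (fn (rhs (u k) - rhs v) x))\<^sup>2"
        using fn_diff[of "rhs (u k)" "rhs v"] fn_l2_of[OF sq[OF L2(1)[of k]], folded rhs_def] fn_l2_of[OF sq[OF L2(2)], folded rhs_def]
      proof eventually_elim
        case (elim x)
        show ?case unfolding elim by (cases "x \<in> \<Omega>") (auto simp: norm_Pair)
      qed
      show "(\<lambda>x. (norm (fn (rhs (u k) - rhs v) x))\<^sup>2) \<in> borel_measurable lebesgue"
        by (rule borel_measurable_integrable[OF sq_intD(2)[OF sq_int_fn]])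
      then show "(\<lambda>x. indicator \<Omega> x *\<^sub>R (norm (u k x - v x))\<^sup>2) \<in> borel_measurable lebesgue"
        by (rule measurable_lebesgue_cong_AE) (use AE in eventually_elim, simp)
    qed
    also have "\<dots> = (norm (rhs (u k) - rhs v))\<^sup>2" by (rule power2_norm_l2[symmetric])
    finally show ?thesis by (simp add: Pfst_emb u)
  qed
  have "(\<lambda>k. norm (Pfst (emb (u k)) - Pfst (emb v))) \<longlonglongrightarrow> 0"
    using tendsto_norm_zero[OF LIM_zero[OF lim]] .
  then show ?thesis unfolding L2_tendsto_def eq using L2 by blast
qed

lemma L2_weakly_tendstoI:
  assumes a: "\<And>k. elliptic_matrix \<Omega> c0 c1 (a k)" "elliptic_matrix \<Omega> c0 c1 b" and c: "0 < c0" "c0 \<le> c1"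
    and u: "\<And>k. u k \<in> W12 X \<Omega>" "v \<in> W12 X \<Omega>" and lim: "weakly_tendsto (\<lambda>k. opr (a k) (emb (u k))) (opr b (emb v))"
  shows "L2_weakly_tendsto \<Omega> (\<lambda>k x. a k x *v Xgrad X \<Omega> (u k) x) (\<lambda>x. b x *v Xgrad X \<Omega> v x)"
  unfolding L2_weakly_tendsto_def
proof (intro conjI allI ballI)
  show "(\<lambda>x. a k x *v Xgrad X \<Omega> (u k) x) \<in> L2 \<Omega>" for k
    unfolding L2_iff_sq_int[OF \<Omega>_sets] by (rule flux_sq_int[OF a(1) c u(1)])
  show "(\<lambda>x. b x *v Xgrad X \<Omega> v x) \<in> L2 \<Omega>"
    unfolding L2_iff_sq_int[OF \<Omega>_sets] by (rule flux_sq_int[OF a(2) c u(2)])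
  fix \<Phi> :: "real^'n => real^'m" assume "\<Phi> \<in> L2 \<Omega>"
  then have "sq_int (\<lambda>x. indicator \<Omega> x *\<^sub>R (0 :: real, \<Phi> x))"
    using sq_int_Pair[OF sq_int_0, of "\<lambda>x. indicator \<Omega> x *\<^sub>R \<Phi> x"] by (simp add: scaleR_Pair L2_iff_sq_int)
  from weakly_tendstoD[OF lim, of "l2_of (\<lambda>x. indicator \<Omega> x *\<^sub>R (0 :: real, \<Phi> x))"]
  show "(\<lambda>k. \<integral>x. (a k x *v Xgrad X \<Omega> (u k) x) \<bullet> \<Phi> x \<partial>lebesgue_on \<Omega>) \<longlonglongrightarrow> (\<integral>x. (b x *v Xgrad X \<Omega> v x) \<bullet> \<Phi> x \<partial>lebesgue_on \<Omega>)"
    unfolding opr_emb_inner[OF a(1) c u(1) \<open>sq_int _\<close>] opr_emb_inner[OF a(2) c u(2) \<open>sq_int _\<close>] .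
qed

end

theorem theorem6p2:
  fixes X :: "'m::finite \<Rightarrow> real^'n \<Rightarrow> real^'n"
    and \<Omega> \<Omega>0 :: "(real^'n) set"
    and c0 c1 :: real
    and L :: "nat \<Rightarrow> (real^'n \<Rightarrow> real) \<Rightarrow> (real^'n \<Rightarrow> real) \<Rightarrow> real"
    and A :: "nat \<Rightarrow> real^'n \<Rightarrow> real^'m^'m"
  assumes "open \<Omega>" and "bounded \<Omega>"
    and "open \<Omega>0" and "closure \<Omega> \<subseteq> \<Omega>0"
    and "lipschitz_fields X \<Omega>0"
    and "LIC X \<Omega>"
    and "cond_H1 X \<Omega>0" and "cond_H2 X \<Omega>0" and "cond_H3 X \<Omega>0"
    and "0 < c0" and "c0 \<le> c1"
    and "\<And>h. L h \<in> operator_class X \<Omega> c0 c1"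
    and "\<And>h. elliptic_matrix \<Omega> c0 c1 (A h)"
    and "\<And>h. L h = div_X X \<Omega> (A h)"
  shows "\<exists>(a :: real^'n \<Rightarrow> real^'m^'m) Linf.
    elliptic_matrix \<Omega> c0 c1 a \<and> Linf = div_X X \<Omega> a \<and> Linf \<in> operator_class X \<Omega> c0 c1 \<and>
    (\<exists>s :: nat \<Rightarrow> nat. strict_mono s \<and>
      (\<forall>g\<in>L2 \<Omega>. \<forall>\<mu>\<ge>0. \<forall>u uinf.
        (\<forall>h. solves X \<Omega> \<mu> (L h) g (u h)) \<and> solves X \<Omega> \<mu> Linf g uinf \<longrightarrow>
        L2_tendsto \<Omega> (\<lambda>k. u (s k)) uinf \<and>
        L2_weakly_tendsto \<Omega>
          (\<lambda>k x. A (s k) x *v Xgrad X \<Omega> (u (s k)) x)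
          (\<lambda>x. a x *v Xgrad X \<Omega> uinf x)))"
proof -
  interpret h_convergence X \<Omega> \<Omega>0 c0 c1 A
    by unfold_locales (use assms in auto)
  obtain P Q :: "nat => real^'n" where PQ: "(\<forall>k. cbox (P k) (Q k) \<subseteq> \<Omega>) \<and> (\<Union>k. box (P k) (Q k)) = \<Omega>"
    using open_box_exhaustion[OF assms(1)] by (elim exE)
  interpret h_correctors X \<Omega> \<Omega>0 c0 c1 A P Q
    by unfold_locales (use assms(6) PQ in auto)
  obtain a and s :: "nat => nat" where a: "elliptic_matrix \<Omega> c0 c1 a" and s: "strict_mono s"
    and lim: "\<And>(r :: nat => nat) z D. strict_mono r ==> adm (\<lambda>h. s (r h)) z D ==> D = opr a z"
    by (rule h_limit) (rule that)
  show ?thesis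
  proof (rule exI[of _ a], rule exI[of _ "div_X X \<Omega> a"], intro conjI)
    show "elliptic_matrix \<Omega> c0 c1 a" by (rule a)
    show "div_X X \<Omega> a \<in> operator_class X \<Omega> c0 c1" using a by (auto simp: operator_class_def)
    show "\<exists>s. strict_mono s \<and>
      (\<forall>g\<in>L2 \<Omega>. \<forall>\<mu>\<ge>0. \<forall>u uinf.
        (\<forall>h. solves X \<Omega> \<mu> (L h) g (u h)) \<and> solves X \<Omega> \<mu> (div_X X \<Omega> a) g uinf \<longrightarrow>
        L2_tendsto \<Omega> (\<lambda>k. u (s k)) uinf \<and>
        L2_weakly_tendsto \<Omega> (\<lambda>k x. A (s k) x *v Xgrad X \<Omega> (u (s k)) x) (\<lambda>x. a x *v Xgrad X \<Omega> uinf x))"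
    \<comment> \<open>The subsequence was fixed by the correctors, before \<open>g\<close>,
      \<open>\<mu>\<close> and the solutions are given.\<close>
    proof (rule exI[of _ s], intro conjI s ballI allI impI)
      fix g \<mu> u uinf
      assume g: "g \<in> L2 \<Omega>" and \<mu>: "(0::real) \<le> \<mu>"
        and sol: "(\<forall>h. solves X \<Omega> \<mu> (L h) g (u h)) \<and> solves X \<Omega> \<mu> (div_X X \<Omega> a) g uinf"
      have u: "solves X \<Omega> \<mu> (div_X X \<Omega> (A h)) g (u h)" for h
        using conjunct1[OF sol, THEN spec, of h] unfolding assms(14) .
      note U = solves_weak[OF elliptic c0 c01 g u] and UI = solves_weak[OF a c0 c01 g conjunct2[OF sol]]
      note conv = solution_convergence[OF a lim \<mu> U(2,3) UI(2,3)]
      have w: "weakly_tendsto (\<lambda>h. emb (u (s h))) (emb uinf)" by (rule conv(1))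
      have wA: "weakly_tendsto (\<lambda>h. opr (A (s h)) (emb (u (s h)))) (opr a (emb uinf))" by (rule conv(2))
      show "L2_tendsto \<Omega> (\<lambda>k. u (s k)) uinf" by (rule L2_tendstoI[OF U(1) UI(1) rellich[OF U(2) w]])
      show "L2_weakly_tendsto \<Omega> (\<lambda>k x. A (s k) x *v Xgrad X \<Omega> (u (s k)) x) (\<lambda>x. a x *v Xgrad X \<Omega> uinf x)"
        by (rule L2_weakly_tendstoI[OF elliptic a c0 c01 U(1) UI(1) wA])
    qed
  qed simp
qed

end
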